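(* Let $p:C_*(\underline W)\to C_*(\underline K)$ be the morphism of graded operads defined in the context. For every oriented fully metric tree $(T,\omega_T)$ (here $\omega_T$ is any orientation of the internal edges of $T$), $$p(\partial_W(T,\omega_T))=\partial_K\,p(T,\omega_T).$$ Since $p$ is an operad morphism, this implies that $p$ commutes with the differential on $C_*(\underline W)$, and therefore $p$ is a morphism of operads in the category of chain complexes.
   Context: $\mathbf k$ is the ground field. "Operad" means a non-$\Sigma$ pseudo-operad $\mathcal P$ with $\mathcal P(0)=\mathcal P(1)=0$ (operations $\circ_i$ satisfying the usual axioms with Koszul signs, no units). Trees. Trees are planar rooted trees all of whose vertices have at least two inputs; leaves are numbered from left to right; an internal edge joins two vertices. $T/e$ is $T$ with internal edge $e$ collapsed; $T\circ_iT'$ is the tree obtained by grafting the root of $T'$ to the $i$-th leaf of $T$ (creating one new internal edge); $c(n)$ is the corolla with $n$ leaves. An orientation of a finite set of edges $\{e_1,\dots,e_m\}$ is a symbol $\pm e_{1}\wedge\cdots\wedge e_{m}$, antisymmetric in the edges; for the empty set it is $\pm1$. The operad $C_*(\underline K)$ (cellular chains of the associahedra). $C_k(K_n)$, $n\ge2$, is the vector space spanned by pairs $(T,\omega)$, $T$ a tree with $n$ leaves and $n-k-2$ internal edges, $\omega$ an orientation of all its internal edges, modulo $(T,-\omega)=-(T,\omega)$. For $(T,\omega)\in C_k(K_r)$, $(T',\omega')\in C_l(K_s)$, $$(T,\omega)\circ_i(T',\omega')=(-1)^{rl+i(s+1)}(T\circ_iT',\omega\wedge\omega'\wedge e),$$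 $e$ being the new edge. The differential is $\partial_K(T,e_1\wedge\cdots\wedge e_m)=\sum(T',e'\wedge e_1\wedge\cdots\wedge e_m)$, over all trees $T'$ with an internal edge $e'$ such that $T'/e'=T$. The operad $C_*(\underline W)$ (cubical chains of the $W$-construction). A metric tree is a tree each of whose internal edges is labeled "metric" or "non-metric"; it is fully metric if all internal edges are metric. $C_k(W_n)$ is the vector space spanned by pairs $(T,\omega)$, $T$ a metric tree with $n$ leaves and exactly $k$ metric edges, $\omega$ an orientation of the metric edges, modulo $(T,-\omega)=-(T,\omega)$. $(T,\omega)\circ_i(T',\omega')=(T\circ_iT',\omega\wedge\omega')$, the new edge being non-metric. The differential is $$\partial_W(T,e_1\wedge\cdots\wedge e_k)=\sum_{1\le i\le k}(-1)^i\big[(T/e_i,e_1\wedge\cdots\widehat{e_i}\cdots\wedge e_k)-(T_i,e_1\wedge\cdots\widehat{e_i}\cdots\wedge e_k)\big],$$ where $T_i$ is $T$ with $e_i$ changed to non-metric. As a graded operad $C_*(\underline W)$ is free, generated by the (oriented) fully metric trees. Binary trees. In a binary tree an internal edge is left-leaning if it joins a vertex to its right child and right-leaning if it joins a vertex to its left child. $\min(r)$ is the binary $r$-tree with all internal edges right-leaning. An elementary downward move $T\rightsquigarrow T'$ is the replacement, at a vertex $v$ of $T$ whose right child is a vertex $u$, of the configuration $A(BC)$ ($A$ the left subtree of $v$; $B,C$ the subtrees of $u$) by $(AB)C$; the edge $vu$ is replaced by a new edge joining $v$ to the new left child $u'$ carrying $A,B$; all other edges (including the outgoing edge of $v$ and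 the outgoing edges of $A,B,C$) are identified with those of $T$. The partial order on binary $n$-trees is generated by $T'<T$ for such moves. Standard orientation $\xi_S$ of a binary tree $S$ as a $0$-cell of $K_n$: $\xi_{c(2)}=1$ and $(S,\xi_S)\circ_i(S',\xi_{S'})=(S\circ_iS',\xi_{S\circ_iS'})$ in $C_*(\underline K)$ (this is unambiguous). The map $p$. For a fully metric tree $T$, $T_{\min}$ is the binary tree obtained by replacing each vertex with $r\ge3$ inputs by $\min(r)$ (so all new edges are right-leaning); the internal edges $e_1,\dots,e_k$ of $T$ are regarded as edges of $T_{\min}$. On $(T,e_1\wedge\cdots\wedge e_k)$, with $T$ fully metric with $n$ leaves and $k$ internal edges, $$p(T,e_1\wedge\cdots\wedge e_k)=\sum_S\big(S/\{e_1,\dots,e_k\},\ e_1\wedge\cdots\wedge e_k\lrcorner\,\xi_S\big),$$ the sum over binary trees $S\le T_{\min}$ having exactly $k$ left-leaning edges (the sum is empty, $p=0$, if $T_{\min}$ has fewer than $k$ left-leaning edges). The left-leaning edges of such $S$ are labeled $e_1,\dots,e_k$ as follows: those of $T_{\min}$ are the original edges $e_1,\dots,e_k$; along a downward move $A(BC)\rightsquigarrow(AB)C$ with $B$ not a single leaf, the label of the left-leaning edge $vu$ is transferred to the outgoing edge of $B$ (which becomes left-leaning), and other left-leaning edges keep their labels; $S$ is reached from $T_{\min}$ by a sequence of such moves and the labeling does not depend on the sequence. $S/\{e_1,\dots,e_k\}$ is $S$ with these edges collapsed, and if $\xi_S=\eta\, e_1\wedge\cdots\wedge e_k\wedge f_1\wedge\cdots\wedge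 f_{n-k-2}$, $\eta=\pm1$, then $e_1\wedge\cdots\wedge e_k\lrcorner\,\xi_S=\eta(-1)^{k(k-1)/2}f_1\wedge\cdots\wedge f_{n-k-2}$. $p$ is extended to all of $C_*(\underline W)$ as the unique morphism of operads in graded vector spaces with these values on fully metric trees. *)

theory Defs
  imports Main "HOL-Library.Poly_Mapping" "HOL-Library.Product_Lexorder"
begin

section \<open>Planar rooted trees\<close>

datatype tree = Leaf | Node "tree list"

fun wf_tree :: "tree \<Rightarrow> bool" where
  "wf_tree Leaf = True"
| "wf_tree (Node ts) = (2 \<le> length ts \<and> (\<forall>t\<in>set ts. wf_tree t))"

fun leaves :: "tree \<Rightarrow> nat" where
  "leaves Leaf = 1"
| "leaves (Node ts) = sum_list (map leaves ts)"

lemma leaves_pos: "wf_tree T \<Longrightarrow> 0 < leaves T"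
proof (induction T)
  case (Node ts)
  then show ?case by (cases ts) auto
qed simp

text \<open>
  A vertex is named by the pair (number of the first leaf, number of the last leaf) above it;
  since all vertices have at least two inputs, different vertices have different names. An
  internal edge is named by its upper vertex, so the internal edges are the vertices other than
  the root. The edges of a tree that survive a collapse, or a downward move, keep their names, so
  the usual identifications of edges of different trees become equalities. The argument
  \<open>a\<close> of the recursive functions is the number of the first leaf of the subtree at hand.
\<close>

type_synonym edge = "nat \<times> nat"

fun vertices_from :: "nat \<Rightarrow> tree \<Rightarrow> edge set"
  and vertices_from_list :: "nat \<Rightarrow> tree list \<Rightarrow> edge set" where
  "vertices_from a Leaf = {}"
| "vertices_from a (Node ts) =
     insert (a, a + leaves (Node ts) - 1) (vertices_from_list a ts)"
| "vertices_from_list a [] = {}"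
| "vertices_from_list a (t # ts) = vertices_from a t \<union> vertices_from_list (a + leaves t) ts"

definition edges :: "tree \<Rightarrow> edge set" where
  "edges T = vertices_from 1 T - {(1, leaves T)}"

lemma finite_vertices_from:
  "finite (vertices_from a T)" "finite (vertices_from_list a ts)"
  by (induction a T and a ts rule: vertices_from_vertices_from_list.induct) auto

lemma finite_edges [simp]: "finite (edges T)"
  by (simp add: edges_def finite_vertices_from)

text \<open>Collapse of all the internal edges of a tree that belong to a given set.\<close>

fun collapse_from :: "edge set \<Rightarrow> nat \<Rightarrow> tree \<Rightarrow> tree"
  and collapse_from_list :: "edge set \<Rightarrow> nat \<Rightarrow> tree list \<Rightarrow> tree list" where
  "collapse_from E a Leaf = Leaf"
| "collapse_from E a (Node ts) = Node (collapse_from_list E a ts)"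
| "collapse_from_list E a [] = []"
| "collapse_from_list E a (t # ts) =
     (case collapse_from E a t of
        Leaf \<Rightarrow> [Leaf]
      | Node us \<Rightarrow> if (a, a + leaves t - 1) \<in> E then us else [Node us])
     @ collapse_from_list E (a + leaves t) ts"

definition collapse :: "edge set \<Rightarrow> tree \<Rightarrow> tree" where
  "collapse E T = collapse_from E 1 T"

text \<open>\<open>graft T i T'\<close> grafts the root of \<open>T'\<close> to the \<open>i\<close>-th leaf of \<open>T\<close> (\<open>1 \<le> i \<le> leaves T\<close>).\<close>

fun graft :: "tree \<Rightarrow> nat \<Rightarrow> tree \<Rightarrow> tree"
  and graft_list :: "tree list \<Rightarrow> nat \<Rightarrow> tree \<Rightarrow> tree list" where
  "graft Leaf i S = S"
| "graft (Node ts) i S = Node (graft_list ts i S)"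
| "graft_list [] i S = []"
| "graft_list (t # ts) i S =
     (if i \<le> leaves t then graft t i S # ts else t # graft_list ts (i - leaves t) S)"

text \<open>
  The names, in \<open>graft T i T'\<close> with \<open>s = leaves T'\<close>, of an edge of \<open>T\<close> (whose leaf \<open>i\<close> is
  replaced by the leaves \<open>i, \<dots>, i + s - 1\<close>), of an edge of \<open>T'\<close>, and of the new edge.
\<close>

definition outer_edge :: "nat \<Rightarrow> nat \<Rightarrow> edge \<Rightarrow> edge" where
  "outer_edge i s e =
     (if fst e \<le> i then fst e else fst e + s - 1, if snd e < i then snd e else snd e + s - 1)"

definition inner_edge :: "nat \<Rightarrow> edge \<Rightarrow> edge" where
  "inner_edge i e = (fst e + i - 1, snd e + i - 1)"

definition new_edge :: "nat \<Rightarrow> nat \<Rightarrow> edge" where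
  "new_edge i s = (i, i + s - 1)"

lemma outer_edge_less: "0 < s \<Longrightarrow> outer_edge i s e < outer_edge i s e' \<longleftrightarrow> e < e'"
  by (auto simp: outer_edge_def less_prod_def prod_eq_iff)

lemma inj_outer_edge: "0 < s \<Longrightarrow> inj (outer_edge i s)"
  by (intro injI) (metis outer_edge_less neq_iff)

lemma inner_edge_less: "0 < i \<Longrightarrow> inner_edge i e < inner_edge i e' \<longleftrightarrow> e < e'"
  by (auto simp: inner_edge_def less_prod_def prod_eq_iff)

lemma inj_inner_edge: "0 < i \<Longrightarrow> inj (inner_edge i)"
  by (intro injI) (metis inner_edge_less neq_iff)


section \<open>Orientations and chains\<close>

text \<open>\<open>(\<eta>, [e\<^sub>1, \<dots>, e\<^sub>m])\<close> stands for the symbol \<open>\<eta> e\<^sub>1 \<and> \<dots> \<and> e\<^sub>m\<close> with \<open>\<eta> = \<plusminus>1\<close>.\<close>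

type_synonym orientation = "int \<times> edge list"

definition orients :: "orientation \<Rightarrow> edge set \<Rightarrow> bool" where
  "orients \<omega> E \<longleftrightarrow> fst \<omega> \<in> {1, -1} \<and> distinct (snd \<omega>) \<and> set (snd \<omega>) = E"

text \<open>
  The sign of the permutation that sorts the list (for the lexicographic order of names).
  Two symbols for the same set of edges are equal as orientations iff they have the same
  \<open>orientation_sign\<close>.
\<close>

fun list_sign :: "edge list \<Rightarrow> int" where
  "list_sign [] = 1"
| "list_sign (e # es) = (\<Prod>x\<leftarrow>es. if e < x then 1 else -1) * list_sign es"

definition orientation_sign :: "orientation \<Rightarrow> int" where
  "orientation_sign \<omega> = fst \<omega> * list_sign (snd \<omega>)"

lemma list_sign_swap:
  "x \<noteq> y \<Longrightarrow> list_sign (us @ x # y # vs) = - list_sign (us @ y # x # vs)"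
  by (induction us) (auto simp: not_less)

lemma list_sign_mult_self [simp]: "list_sign es * list_sign es = 1"
proof (induction es)
  case (Cons e es)
  have "(\<Prod>x\<leftarrow>es. if e < x then 1 else -1) * (\<Prod>x\<leftarrow>es. if e < x then 1 else -1::int) = 1"
    by (induction es) auto
  then show ?case
    using Cons by (simp add: ac_simps)
qed simp

lemma list_sign_sorted: "sorted es \<Longrightarrow> distinct es \<Longrightarrow> list_sign es = 1"
proof (induction es)
  case (Cons e es)
  have "(\<Prod>x\<leftarrow>es. if e < x then 1 else -1::int) = (\<Prod>x\<leftarrow>es. 1)"
    using Cons.prems by (intro arg_cong[where f = prod_list] map_cong) (auto simp: order.strict_iff_order)
  moreover have "(\<Prod>x\<leftarrow>es. 1::int) = 1" for es :: "edge list" by (induction es) auto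
  ultimately show ?case using Cons by simp
qed simp

lemma list_sign_std [simp]: "finite E \<Longrightarrow> list_sign (sorted_list_of_set E) = 1"
  by (simp add: list_sign_sorted)

lemma prod_list_sign:
  "distinct es \<Longrightarrow> (\<Prod>x\<leftarrow>es. if e < x then 1 else -1) = (\<Prod>x\<in>set es. if e < x then 1 else (-1::int))"
  by (simp add: prod.distinct_set_conv_list)

lemma list_sign_append:
  "distinct xs \<Longrightarrow> distinct ys \<Longrightarrow> list_sign (xs @ ys) =
     list_sign xs * list_sign ys * (\<Prod>x\<in>set xs. \<Prod>y\<in>set ys. if x < y then 1 else -1)"
  by (induction xs) (auto simp: prod_list_sign)

lemma list_sign_map:
  assumes "\<And>x y. x \<in> set es \<Longrightarrow> y \<in> set es \<Longrightarrow> f x < f y \<longleftrightarrow> x < y"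
  shows "list_sign (map f es) = list_sign es"
  using assms
proof (induction es)
  case (Cons e es)
  have "(\<Prod>x\<leftarrow>es. if f e < f x then 1 else (-1::int)) = (\<Prod>x\<leftarrow>es. if e < x then 1 else -1)"
    using Cons.prems by (intro arg_cong[where f = prod_list] map_cong) auto
  moreover have "list_sign (map f es) = list_sign es"
    by (rule Cons.IH) (use Cons.prems in auto)
  ultimately show ?case by (simp add: o_def)
qed simp

lemma list_sign_move_to_front:
  "e \<notin> set us \<Longrightarrow> list_sign (us @ e # vs) = (-1) ^ length us * list_sign (e # us @ vs)"
proof (induction us arbitrary: vs rule: rev_induct)
  case (snoc u us)
  then show ?case
    using list_sign_swap[of u e us vs] snoc.IH[of "u # vs"] by (cases "e < u") auto
qed simp

lemma list_sign_graft:
  fixes es fs :: "edge list"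
  assumes "distinct es" "distinct fs" "0 < i" "0 < s"
  defines "es' \<equiv> sorted_list_of_set (set es)" and "fs' \<equiv> sorted_list_of_set (set fs)"
  shows "list_sign (map (outer_edge i s) es @ map (inner_edge i) fs) =
      list_sign es * list_sign fs *
      list_sign (map (outer_edge i s) es' @ map (inner_edge i) fs')" (is ?A)
    and "list_sign (map (outer_edge i s) es @ map (inner_edge i) fs @ [z]) =
      list_sign es * list_sign fs *
      list_sign (map (outer_edge i s) es' @ map (inner_edge i) fs' @ [z])" (is ?B)
proof -
  have inj: "inj_on (outer_edge i s) A" "inj_on (inner_edge i) A" for A
    using assms inj_outer_edge inj_inner_edge by (auto intro: inj_on_subset)
  have m: "list_sign (map (outer_edge i s) us) = list_sign us"
    "list_sign (map (inner_edge i) us) = list_sign us" for us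
    using assms by (auto intro!: list_sign_map simp: outer_edge_less inner_edge_less
        simp del: less_prod_simp)
  show A: ?A
    using assms by (simp add: list_sign_append distinct_map inj m)
  have last: "list_sign (us @ [z]) = list_sign us * (\<Prod>x\<leftarrow>us. if x < z then 1 else -1)"
    for us :: "edge list"
    by (induction us) auto
  have p: "prod_list (map h us) = prod_list (map h (sorted_list_of_set (set us)))"
    if "distinct us" for us :: "edge list" and h :: "edge \<Rightarrow> int"
    using that by (simp flip: prod.distinct_set_conv_list)
  show ?B
    using A assms last[of "map (outer_edge i s) es @ map (inner_edge i) fs"]
      last[of "map (outer_edge i s) es' @ map (inner_edge i) fs'"]
    by (simp add: p[of es] p[of fs] o_def)
qed

text \<open>
  The quotient of the span of the pairs \<open>(T, \<omega>)\<close> by \<open>(T, -\<omega>) = -(T, \<omega>)\<close> has as basis the \<open>T\<close>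
  oriented by their increasingly ordered edges. Chains are finitely supported functions on this
  basis, and \<open>cell T \<omega>\<close> is the class of \<open>(T, \<omega>)\<close>. Here \<open>T\<close> is a tree or a metric tree.
\<close>

definition cell :: "'t \<Rightarrow> orientation \<Rightarrow> 't \<Rightarrow>\<^sub>0 'k::field" where
  "cell T \<omega> = Poly_Mapping.single T (of_int (orientation_sign \<omega>))"

lemma cell_uminus: "cell T (- \<eta>, es) = - cell T (\<eta>, es)"
  by (simp add: cell_def orientation_sign_def single_uminus)

lemma cell_swap:
  "x \<noteq> y \<Longrightarrow> cell T (\<eta>, us @ x # y # vs) = - cell T (\<eta>, us @ y # x # vs)"
  by (simp add: cell_def orientation_sign_def single_uminus list_sign_swap[of x y])

definition scale :: "'k::field \<Rightarrow> ('t \<Rightarrow>\<^sub>0 'k) \<Rightarrow> 't \<Rightarrow>\<^sub>0 'k" where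
  "scale c x = Poly_Mapping.map ((*) c) x"

definition lin_ext :: "('s \<Rightarrow> 't \<Rightarrow>\<^sub>0 'k::field) \<Rightarrow> ('s \<Rightarrow>\<^sub>0 'k) \<Rightarrow> 't \<Rightarrow>\<^sub>0 'k" where
  "lin_ext f x = (\<Sum>T\<in>Poly_Mapping.keys x. scale (Poly_Mapping.lookup x T) (f T))"

lemma lookup_scale [simp]: "Poly_Mapping.lookup (scale c x) T = c * Poly_Mapping.lookup x T"
  by (simp add: scale_def Poly_Mapping.map.rep_eq when_def)

lemma scale_add_right: "scale c (x + y) = scale c x + scale c y"
  by (intro poly_mapping_eqI) (simp add: lookup_add algebra_simps)

lemma scale_diff_right: "scale c (x - y) = scale c x - scale c y"
  by (intro poly_mapping_eqI) (simp add: lookup_minus algebra_simps)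

lemma scale_add_left: "scale (c + d) x = scale c x + scale d x"
  by (intro poly_mapping_eqI) (simp add: lookup_add algebra_simps)

lemma scale_scale [simp]: "scale c (scale d x) = scale (c * d) x"
  by (intro poly_mapping_eqI) (simp add: algebra_simps)

lemma scale_0 [simp]: "scale 0 x = 0" "scale c 0 = 0"
  by (intro poly_mapping_eqI; simp)+

lemma scale_1 [simp]: "scale 1 x = x"
  by (intro poly_mapping_eqI) simp

lemma scale_sum: "scale c (sum f A) = (\<Sum>a\<in>A. scale c (f a))"
  by (induction A rule: infinite_finite_induct) (simp_all add: scale_add_right)

lemma lin_ext_superset:
  assumes "finite A" "Poly_Mapping.keys x \<subseteq> A"
  shows "lin_ext f x = (\<Sum>T\<in>A. scale (Poly_Mapping.lookup x T) (f T))"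
  unfolding lin_ext_def using assms by (intro sum.mono_neutral_left) (auto simp: in_keys_iff)

lemma lin_ext_single [simp]: "lin_ext f (Poly_Mapping.single T c) = scale c (f T)"
  by (subst lin_ext_superset[of "{T}"]) auto

lemma lin_ext_add: "lin_ext f (x + y) = lin_ext f x + lin_ext f y"
proof -
  let ?A = "Poly_Mapping.keys x \<union> Poly_Mapping.keys y"
  have "lin_ext f (x + y) = (\<Sum>T\<in>?A. scale (Poly_Mapping.lookup (x + y) T) (f T))"
    using keys_add[of x y] by (intro lin_ext_superset) auto
  moreover have "lin_ext f x = (\<Sum>T\<in>?A. scale (Poly_Mapping.lookup x T) (f T))"
    by (intro lin_ext_superset) auto
  moreover have "lin_ext f y = (\<Sum>T\<in>?A. scale (Poly_Mapping.lookup y T) (f T))"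
    by (intro lin_ext_superset) auto
  ultimately show ?thesis by (simp add: lookup_add scale_add_left sum.distrib)
qed

lemma lin_ext_scale: "lin_ext f (scale c x) = scale c (lin_ext f x)"
proof -
  have "Poly_Mapping.keys (scale c x) \<subseteq> Poly_Mapping.keys x"
    by (auto simp: in_keys_iff)
  then have "lin_ext f (scale c x) =
      (\<Sum>T\<in>Poly_Mapping.keys x. scale (Poly_Mapping.lookup (scale c x) T) (f T))"
    by (intro lin_ext_superset) auto
  then show ?thesis by (simp add: lin_ext_def scale_sum)
qed

lemma scale_cell: "scale c (cell T \<omega>) = Poly_Mapping.single T (c * of_int (orientation_sign \<omega>))"
  by (intro poly_mapping_eqI) (simp add: cell_def lookup_single when_def)

lemma lin_ext_cell: "lin_ext f (cell T \<omega>) = scale (of_int (orientation_sign \<omega>)) (f T)"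
  by (simp add: cell_def)

lemma scale_cell_eq:
  assumes "c * orientation_sign \<omega> = orientation_sign \<omega>'"
  shows "scale (of_int c) (cell T \<omega>) = cell T \<omega>'"
  unfolding scale_cell by (simp add: cell_def flip: assms)

definition std_order :: "edge set \<Rightarrow> orientation" where
  "std_order E = (1, sorted_list_of_set E)"

record 'c chain_operad =
  chains :: "nat \<Rightarrow> nat \<Rightarrow> 'c set"  \<comment> \<open>arity, then degree\<close>
  comp :: "'c \<Rightarrow> nat \<Rightarrow> 'c \<Rightarrow> 'c"
  bdry :: "'c \<Rightarrow> 'c"

definition graded_operad_morphism ::
  "('s \<Rightarrow>\<^sub>0 'k::field) chain_operad \<Rightarrow> ('t \<Rightarrow>\<^sub>0 'k) chain_operad \<Rightarrow>
   (('s \<Rightarrow>\<^sub>0 'k) \<Rightarrow> ('t \<Rightarrow>\<^sub>0 'k)) \<Rightarrow> bool" where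
  "graded_operad_morphism A B p \<longleftrightarrow>
     (\<forall>n k. \<forall>x\<in>chains A n k. p x \<in> chains B n k) \<and>
     (\<forall>n k. \<forall>x\<in>chains A n k. \<forall>y\<in>chains A n k. p (x + y) = p x + p y) \<and>
     (\<forall>n k c. \<forall>x\<in>chains A n k. p (scale c x) = scale c (p x)) \<and>
     (\<forall>r s k l i. \<forall>x\<in>chains A r k. \<forall>y\<in>chains A s l.
        1 \<le> i \<and> i \<le> r \<longrightarrow> p (comp A x i y) = comp B (p x) i (p y))"

definition dg_operad_morphism ::
  "('s \<Rightarrow>\<^sub>0 'k::field) chain_operad \<Rightarrow> ('t \<Rightarrow>\<^sub>0 'k) chain_operad \<Rightarrow>
   (('s \<Rightarrow>\<^sub>0 'k) \<Rightarrow> ('t \<Rightarrow>\<^sub>0 'k)) \<Rightarrow> bool" where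
  "dg_operad_morphism A B p \<longleftrightarrow>
     graded_operad_morphism A B p \<and>
     (\<forall>n k. \<forall>x\<in>chains A n k. p (bdry A x) = bdry B (p x))"


section \<open>The operad of cellular chains of the associahedra\<close>

definition K_chains :: "nat \<Rightarrow> nat \<Rightarrow> (tree \<Rightarrow>\<^sub>0 'k::field) set" where
  "K_chains n k =
     {x. \<forall>T\<in>Poly_Mapping.keys x.
           wf_tree T \<and> leaves T = n \<and> 2 \<le> n \<and> card (edges T) + k + 2 = n}"

text \<open>The degree of the cell of \<open>T'\<close> is \<open>leaves T' - 2 - card (edges T')\<close>.\<close>

definition K_graft_orientation ::
  "tree \<Rightarrow> orientation \<Rightarrow> nat \<Rightarrow> tree \<Rightarrow> orientation \<Rightarrow> orientation" where
  "K_graft_orientation T \<omega> i T' \<omega>' =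
     (let r = leaves T; s = leaves T'; l = s - 2 - card (edges T') in
      ((-1) ^ (r * l + i * (s + 1)) * fst \<omega> * fst \<omega>',
       map (outer_edge i s) (snd \<omega>) @ map (inner_edge i) (snd \<omega>') @ [new_edge i s]))"

definition K_comp :: "(tree \<Rightarrow>\<^sub>0 'k::field) \<Rightarrow> nat \<Rightarrow> (tree \<Rightarrow>\<^sub>0 'k) \<Rightarrow> (tree \<Rightarrow>\<^sub>0 'k)" where
  "K_comp x i y =
     lin_ext (\<lambda>T. lin_ext (\<lambda>T'. cell (graft T i T')
       (K_graft_orientation T (std_order (edges T)) i T' (std_order (edges T')))) y) x"

lemma K_comp_cell:
  assumes "orients \<omega> (edges T)" "orients \<omega>' (edges T')" "wf_tree T'" "1 \<le> i"
  shows "K_comp (cell T \<omega>) i (cell T' \<omega>') =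
    cell (graft T i T') (K_graft_orientation T \<omega> i T' \<omega>')"
proof -
  have *: "list_sign (map (outer_edge i (leaves T')) (snd \<omega>) @ map (inner_edge i) (snd \<omega>') @ [z]) =
      list_sign (snd \<omega>) * list_sign (snd \<omega>') *
      list_sign (map (outer_edge i (leaves T')) (sorted_list_of_set (edges T)) @
        map (inner_edge i) (sorted_list_of_set (edges T')) @ [z])" for z
    using list_sign_graft(2)[of "snd \<omega>" "snd \<omega>'" i "leaves T'" z] assms leaves_pos[of T']
    by (simp add: orients_def)
  have "(orientation_sign \<omega> * orientation_sign \<omega>') * orientation_sign
      (K_graft_orientation T (std_order (edges T)) i T' (std_order (edges T'))) =
      orientation_sign (K_graft_orientation T \<omega> i T' \<omega>')"
    by (simp add: orientation_sign_def K_graft_orientation_def std_order_def Let_def *)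
  then show ?thesis
    by (simp add: K_comp_def lin_ext_cell scale_cell_eq flip: of_int_mult)
qed

definition expansions :: "tree \<Rightarrow> (tree \<times> edge) set" where
  "expansions T =
     {(T', e'). wf_tree T' \<and> leaves T' = leaves T \<and> e' \<in> edges T' \<and> collapse {e'} T' = T}"

definition prepend :: "edge \<Rightarrow> orientation \<Rightarrow> orientation" where
  "prepend e \<omega> = (fst \<omega>, e # snd \<omega>)"

definition K_bdry :: "(tree \<Rightarrow>\<^sub>0 'k::field) \<Rightarrow> (tree \<Rightarrow>\<^sub>0 'k)" where
  "K_bdry = lin_ext (\<lambda>T. \<Sum>(T', e')\<in>expansions T. cell T' (prepend e' (std_order (edges T))))"

lemma K_bdry_cell:
  assumes "orients \<omega> (edges T)"
  shows "K_bdry (cell T \<omega>) = (\<Sum>(T', e')\<in>expansions T. cell T' (prepend e' \<omega>))"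
proof -
  have "orientation_sign \<omega> * orientation_sign (prepend e' (std_order (edges T))) =
      orientation_sign (prepend e' \<omega>)" for e'
    using assms by (simp add: orientation_sign_def prepend_def std_order_def
        orients_def prod_list_sign)
  then show ?thesis
    by (simp add: K_bdry_def lin_ext_cell scale_sum split_def scale_cell_eq)
qed

definition K_operad :: "(tree \<Rightarrow>\<^sub>0 'k::field) chain_operad" where
  "K_operad = \<lparr>chains = K_chains, comp = K_comp, bdry = K_bdry\<rparr>"


section \<open>The operad of cubical chains of the W-construction\<close>

text \<open>A metric tree is a tree together with the set of its metric internal edges.\<close>

type_synonym mtree = "tree \<times> edge set"

definition W_chains :: "nat \<Rightarrow> nat \<Rightarrow> (mtree \<Rightarrow>\<^sub>0 'k::field) set" where
  "W_chains n k =
     {x. \<forall>(T, M)\<in>Poly_Mapping.keys x.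
           wf_tree T \<and> leaves T = n \<and> 2 \<le> n \<and> M \<subseteq> edges T \<and> card M = k}"

definition W_graft :: "mtree \<Rightarrow> nat \<Rightarrow> mtree \<Rightarrow> mtree" where
  "W_graft X i Y =
     (graft (fst X) i (fst Y),
      outer_edge i (leaves (fst Y)) ` snd X \<union> inner_edge i ` snd Y)"

definition W_graft_orientation ::
  "mtree \<Rightarrow> orientation \<Rightarrow> nat \<Rightarrow> mtree \<Rightarrow> orientation \<Rightarrow> orientation" where
  "W_graft_orientation X \<omega> i Y \<omega>' =
     (fst \<omega> * fst \<omega>',
      map (outer_edge i (leaves (fst Y))) (snd \<omega>) @ map (inner_edge i) (snd \<omega>'))"

definition W_comp :: "(mtree \<Rightarrow>\<^sub>0 'k::field) \<Rightarrow> nat \<Rightarrow> (mtree \<Rightarrow>\<^sub>0 'k) \<Rightarrow> (mtree \<Rightarrow>\<^sub>0 'k)" where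
  "W_comp x i y =
     lin_ext (\<lambda>X. lin_ext (\<lambda>Y. cell (W_graft X i Y)
       (W_graft_orientation X (std_order (snd X)) i Y (std_order (snd Y)))) y) x"

lemma W_comp_cell:
  assumes "orients \<omega> (snd X)" "orients \<omega>' (snd Y)" "wf_tree (fst Y)" "1 \<le> i"
  shows "W_comp (cell X \<omega>) i (cell Y \<omega>') = cell (W_graft X i Y) (W_graft_orientation X \<omega> i Y \<omega>')"
proof -
  have "(orientation_sign \<omega> * orientation_sign \<omega>') * orientation_sign
      (W_graft_orientation X (std_order (snd X)) i Y (std_order (snd Y))) =
      orientation_sign (W_graft_orientation X \<omega> i Y \<omega>')"
    using list_sign_graft(1)[of "snd \<omega>" "snd \<omega>'" i "leaves (fst Y)"] assms leaves_pos[of "fst Y"]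
    by (simp add: orientation_sign_def W_graft_orientation_def std_order_def orients_def)
  then show ?thesis
    by (simp add: W_comp_def lin_ext_cell scale_cell_eq flip: of_int_mult)
qed

definition omit_nth :: "nat \<Rightarrow> orientation \<Rightarrow> orientation" where
  "omit_nth i \<omega> = (fst \<omega>, take i (snd \<omega>) @ drop (Suc i) (snd \<omega>))"

text \<open>The index \<open>i\<close> counts from 0, hence the exponent \<open>i + 1\<close>.\<close>

definition W_bdry_cell :: "mtree \<Rightarrow> orientation \<Rightarrow> (mtree \<Rightarrow>\<^sub>0 'k::field)" where
  "W_bdry_cell X \<omega> =
     (\<Sum>i<length (snd \<omega>). scale ((-1) ^ (i + 1))
        (let e = snd \<omega> ! i in
           cell (collapse {e} (fst X), snd X - {e}) (omit_nth i \<omega>)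
         - cell (fst X, snd X - {e}) (omit_nth i \<omega>)))"

definition W_bdry :: "(mtree \<Rightarrow>\<^sub>0 'k::field) \<Rightarrow> (mtree \<Rightarrow>\<^sub>0 'k)" where
  "W_bdry = lin_ext (\<lambda>X. W_bdry_cell X (std_order (snd X)))"

lemma W_bdry_cell_sum:
  assumes "orients \<omega> (snd X)"
  shows "(W_bdry_cell X \<omega> :: mtree \<Rightarrow>\<^sub>0 'a::field) = scale (of_int (orientation_sign \<omega>))
    (\<Sum>e\<in>snd X. scale (of_int (\<Prod>x\<in>snd X - {e}. if e < x then 1 else -1))
      (Poly_Mapping.single (fst X, snd X - {e}) 1 -
       Poly_Mapping.single (collapse {e} (fst X), snd X - {e}) 1))"
proof -
  obtain \<eta> es where \<omega>: "\<omega> = (\<eta>, es)" by fastforce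
  define g where "g e = (\<Prod>x\<in>snd X - {e}. if e < x then 1 else (-1::int))" for e :: edge
  have es: "distinct es" "set es = snd X" using assms by (auto simp: orients_def \<omega>)
  have sgn: "(-1) ^ i * orientation_sign (omit_nth i \<omega>) = orientation_sign \<omega> * g (es ! i)"
    if "i < length es" for i
  proof -
    let ?us = "take i es" and ?e = "es ! i" and ?vs = "drop (Suc i) es"
    have dec: "es = ?us @ ?e # ?vs" using that by (rule id_take_nth_drop)
    then have d: "distinct (?us @ ?e # ?vs)" using es by metis
    then have "set (?us @ ?vs) = set (?us @ ?e # ?vs) - {?e}" by auto
    also have "\<dots> = snd X - {?e}" using dec es by metis
    finally have 1: "set (?us @ ?vs) = snd X - {?e}" .
    have "?e \<notin> set ?us" using d by auto
    then have "list_sign es = (-1) ^ i * list_sign (?e # ?us @ ?vs)"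
      using list_sign_move_to_front[of ?e ?us ?vs] d that
      by (simp flip: dec del: list_sign.simps)
    also have "list_sign (?e # ?us @ ?vs) = g ?e * list_sign (?us @ ?vs)"
      using d prod_list_sign[of "?us @ ?vs" ?e] unfolding g_def 1[symmetric] by simp
    finally have "list_sign es = (-1) ^ i * g ?e * list_sign (?us @ ?vs)" by simp
    moreover have "g ?e * g ?e = 1"
      unfolding g_def prod.distrib[symmetric] by (intro prod.neutral) simp
    ultimately show ?thesis
      by (simp add: orientation_sign_def omit_nth_def \<omega>)
  qed
  have gen: "scale ((-1) ^ (i + 1)) (scale c P - scale c Q) = scale a (scale b (Q - P))"
    if "(-1) ^ i * c = a * b" for i and a b c :: 'a and P Q :: "mtree \<Rightarrow>\<^sub>0 'a"
  proof (intro poly_mapping_eqI)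
    fix Y
    have "(-1) ^ (i + 1) * (c * p - c * q) = ((-1) ^ i * c) * (q - p)" for p q
      by (simp add: algebra_simps)
    then show "Poly_Mapping.lookup (scale ((-1) ^ (i + 1)) (scale c P - scale c Q)) Y =
        Poly_Mapping.lookup (scale a (scale b (Q - P))) Y"
      by (simp add: lookup_minus that mult.assoc)
  qed
  have cell_one: "cell Y \<omega>' = scale (of_int (orientation_sign \<omega>')) (Poly_Mapping.single Y (1::'a))"
    for Y :: mtree and \<omega>'
    by (intro poly_mapping_eqI) (simp add: cell_def lookup_single when_def)
  have "(W_bdry_cell X \<omega> :: mtree \<Rightarrow>\<^sub>0 'a) = (\<Sum>i<length es. scale (of_int (orientation_sign \<omega>))
      (scale (of_int (g (es ! i)))
      (Poly_Mapping.single (fst X, snd X - {es ! i}) 1 -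
       Poly_Mapping.single (collapse {es ! i} (fst X), snd X - {es ! i}) 1)))"
    unfolding W_bdry_cell_def \<omega> snd_conv
  proof (intro sum.cong refl)
    fix i assume "i \<in> {..<length es}"
    then have "of_int ((-1) ^ i * orientation_sign (omit_nth i \<omega>)) =
        (of_int (orientation_sign \<omega> * g (es ! i)) :: 'a)"
      by (subst sgn) auto
    then have s: "(-1) ^ i * of_int (orientation_sign (omit_nth i \<omega>)) =
        (of_int (orientation_sign \<omega>) * of_int (g (es ! i)) :: 'a)"
      by simp
    show "scale ((-1) ^ (i + 1))
        (let e = es ! i in cell (collapse {e} (fst X), snd X - {e}) (omit_nth i (\<eta>, es))
          - cell (fst X, snd X - {e}) (omit_nth i (\<eta>, es))) =
      scale (of_int (orientation_sign (\<eta>, es))) (scale (of_int (g (es ! i)))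
        (Poly_Mapping.single (fst X, snd X - {es ! i}) 1 -
         Poly_Mapping.single (collapse {es ! i} (fst X), snd X - {es ! i}) (1::'a)))"
      using gen[OF s] by (simp add: cell_one \<omega> Let_def)
  qed
  also have "\<dots> = (\<Sum>e\<in>snd X. scale (of_int (orientation_sign \<omega>))
      (scale (of_int (g e))
      (Poly_Mapping.single (fst X, snd X - {e}) 1 -
       Poly_Mapping.single (collapse {e} (fst X), snd X - {e}) 1)))"
    by (rule sum.reindex_bij_betw[OF bij_betw_nth[of es "{..<length es}" "snd X"]])
      (use es in auto)
  finally show ?thesis by (simp only: scale_sum g_def)
qed

lemma W_bdry_cell:
  assumes "orients \<omega> (snd X)"
  shows "W_bdry (cell X \<omega>) = W_bdry_cell X \<omega>"
proof -
  have "finite (snd X)" using assms unfolding orients_def by (metis List.finite_set)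
  then have "orients (std_order (snd X)) (snd X)" "orientation_sign (std_order (snd X)) = 1"
    by (simp_all add: orients_def std_order_def orientation_sign_def)
  then show ?thesis
    using assms by (simp add: W_bdry_def lin_ext_cell W_bdry_cell_sum)
qed

definition W_operad :: "(mtree \<Rightarrow>\<^sub>0 'k::field) chain_operad" where
  "W_operad = \<lparr>chains = W_chains, comp = W_comp, bdry = W_bdry\<rparr>"

definition fully_metric :: "tree \<Rightarrow> mtree" where
  "fully_metric T = (T, edges T)"


section \<open>Binary trees\<close>

fun binary :: "tree \<Rightarrow> bool" where
  "binary Leaf = True"
| "binary (Node ts) = (length ts = 2 \<and> (\<forall>t\<in>set ts. binary t))"

fun left_leaning_from :: "nat \<Rightarrow> tree \<Rightarrow> edge set" where
  "left_leaning_from a (Node [L, R]) =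
     left_leaning_from a L \<union> left_leaning_from (a + leaves L) R \<union>
     (if R = Leaf then {} else {(a + leaves L, a + leaves L + leaves R - 1)})"
| "left_leaning_from a _ = {}"

definition left_leaning :: "tree \<Rightarrow> edge set" where
  "left_leaning S = left_leaning_from 1 S"

text \<open>
  \<open>down_move a T T' e f\<close>: \<open>T'\<close> arises from \<open>T\<close> by replacing some \<open>A(BC)\<close> by \<open>(AB)C\<close>, where \<open>e\<close> is
  the name of the edge \<open>vu\<close> and \<open>f\<close> is the name of the outgoing edge of \<open>B\<close>. If \<open>B\<close> is a
  leaf then \<open>f = (j, j)\<close> for some \<open>j\<close>, which is not an internal edge.
\<close>

inductive down_move :: "nat \<Rightarrow> tree \<Rightarrow> tree \<Rightarrow> edge \<Rightarrow> edge \<Rightarrow> bool" where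
  here: "down_move a (Node [A, Node [B, C]]) (Node [Node [A, B], C])
           (a + leaves A, a + leaves A + leaves B + leaves C - 1)
           (a + leaves A, a + leaves A + leaves B - 1)"
| left: "down_move a L L' e f \<Longrightarrow> down_move a (Node [L, R]) (Node [L', R]) e f"
| right: "down_move (a + leaves L) R R' e f \<Longrightarrow> down_move a (Node [L, R]) (Node [L, R']) e f"

definition down_step :: "tree \<Rightarrow> tree \<Rightarrow> bool" where
  "down_step T T' \<longleftrightarrow> (\<exists>e f. down_move 1 T T' e f)"

definition tree_le :: "tree \<Rightarrow> tree \<Rightarrow> bool" where
  "tree_le S T \<longleftrightarrow> down_step\<^sup>*\<^sup>* T S"

inductive std_orientation :: "tree \<Rightarrow> orientation \<Rightarrow> bool" where
  corolla: "std_orientation (Node [Leaf, Leaf]) (1, [])"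
| graft: "std_orientation S \<omega> \<Longrightarrow> std_orientation S' \<omega>' \<Longrightarrow> 1 \<le> i \<Longrightarrow> i \<le> leaves S \<Longrightarrow>
    std_orientation (graft S i S') (K_graft_orientation S \<omega> i S' \<omega>')"

text \<open>All symbols related to \<open>S\<close> by \<open>std_orientation\<close> are equal as orientations.\<close>

definition xi :: "tree \<Rightarrow> orientation" where
  "xi S = (SOME \<omega>. std_orientation S \<omega>)"


section \<open>The map on fully metric trees\<close>

text \<open>In \<open>T_min\<close> a vertex with inputs \<open>t\<^sub>1, \<dots>, t\<^sub>r\<close> becomes \<open>((t\<^sub>1 t\<^sub>2) t\<^sub>3) \<dots> t\<^sub>r\<close>.\<close>

fun left_comb :: "tree list \<Rightarrow> tree" where
  "left_comb [] = Leaf"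
| "left_comb (t # ts) = foldl (\<lambda>x y. Node [x, y]) t ts"

fun T_min :: "tree \<Rightarrow> tree" where
  "T_min Leaf = Leaf"
| "T_min (Node ts) = left_comb (map T_min ts)"

text \<open>
  \<open>label_path T es S ls\<close>: a sequence of moves from \<open>T_min T\<close> to \<open>S\<close> transfers the label of the edge
  \<open>es ! j\<close> of \<open>T\<close> to the edge \<open>ls ! j\<close> of \<open>S\<close>. Only moves with \<open>B\<close> not a leaf occur, since the others
  lower the number of left-leaning edges and no move raises it.
\<close>

inductive label_path :: "tree \<Rightarrow> edge list \<Rightarrow> tree \<Rightarrow> edge list \<Rightarrow> bool" for T es where
  start: "label_path T es (T_min T) es"
| move: "label_path T es S ls \<Longrightarrow> down_move 1 S S' e f \<Longrightarrow> f \<in> edges S \<Longrightarrow>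
    label_path T es S' (map (\<lambda>x. if x = e then f else x) ls)"

definition labelling :: "tree \<Rightarrow> edge list \<Rightarrow> tree \<Rightarrow> edge list" where
  "labelling T es S = (THE ls. label_path T es S ls)"

text \<open>
  \<open>interior [e\<^sub>1, \<dots>, e\<^sub>k] \<omega>\<close> is the contraction of \<open>\<omega>\<close> by \<open>e\<^sub>1 \<and> \<dots> \<and> e\<^sub>k\<close>, computed with the \<open>f\<^sub>j\<close> in
  increasing order; lemma \<open>interior_eq\<close> below gives the value for any order of the \<open>f\<^sub>j\<close>.
\<close>

definition interior :: "edge list \<Rightarrow> orientation \<Rightarrow> orientation" where
  "interior es \<omega> =
     (let k = length es;
          fs = sorted_list_of_set (set (snd \<omega>) - set es);
          \<eta> = orientation_sign \<omega> * list_sign (es @ fs)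
      in (\<eta> * (-1) ^ (k * (k - 1) div 2), fs))"

lemma interior_eq:
  assumes "orients \<omega> (set (es @ fs))" "distinct (es @ fs)"
    and "orientation_sign \<omega> = orientation_sign (\<eta>, es @ fs)"
  shows "set (snd (interior es \<omega>)) = set fs"
    and "orientation_sign (interior es \<omega>) =
      orientation_sign (\<eta> * (-1) ^ (length es * (length es - 1) div 2), fs)"
proof -
  have fs: "set (snd \<omega>) - set es = set fs" using assms by (auto simp: orients_def)
  then show "set (snd (interior es \<omega>)) = set fs" by (simp add: interior_def Let_def)
  have a: "list_sign (es @ fs) = list_sign fs * list_sign (es @ sorted_list_of_set (set fs))"
    using assms(2) by (simp add: list_sign_append)
  have "orientation_sign \<omega> * list_sign (es @ sorted_list_of_set (set fs)) = \<eta> * list_sign fs"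
    by (subst assms(3)) (simp add: orientation_sign_def a)
  then show "orientation_sign (interior es \<omega>) =
      orientation_sign (\<eta> * (-1) ^ (length es * (length es - 1) div 2), fs)"
    by (simp add: interior_def orientation_sign_def Let_def fs)
qed

definition p_value :: "tree \<Rightarrow> edge list \<Rightarrow> (tree \<Rightarrow>\<^sub>0 'k::field)" where
  "p_value T es =
     (\<Sum>S | binary S \<and> tree_le S (T_min T) \<and> card (left_leaning S) = length es.
        let ls = labelling T es S in cell (collapse (set ls) S) (interior ls (xi S)))"

text \<open>
  The condition determines \<open>p\<close> on all \<open>W_chains n k\<close>, because the operad \<open>W_operad\<close> is freely
  generated by the fully metric trees.
\<close>

definition is_p :: "((mtree \<Rightarrow>\<^sub>0 'k::field) \<Rightarrow> (tree \<Rightarrow>\<^sub>0 'k)) \<Rightarrow> bool" where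
  "is_p p \<longleftrightarrow>
     graded_operad_morphism W_operad K_operad p \<and>
     (\<forall>T es. wf_tree T \<and> 2 \<le> leaves T \<and> distinct es \<and> set es = edges T \<longrightarrow>
        p (cell (fully_metric T) (1, es)) = p_value T es)"

end

theory Submission
  imports Defs
begin

text \<open>
  An edge is the interval of leaves above it, so a tree with \<open>n\<close> leaves is a set of nested or
  disjoint intervals (\<open>edges_inj\<close>). Collapse removes intervals, and grafting unites two
  renumbered sets with one new interval.

  In a binary tree every leaf \<open>p\<close> with \<open>2 \<le> p < n\<close> is either a left child, and then it is the
  first leaf of exactly one left-leaning edge, or a right child, and then it is the last leaf of
  exactly one right-leaning edge. This numbers the edges by \<open>2, \<dots>, n - 1\<close>
  (\<open>leaning_names\<close>), and \<open>\<xi>\<^sub>S\<close> is, up to an explicit sign, the wedge of the edges in the order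
  of their numbers (\<open>xi_sign\<close>). A downward move that transfers a label keeps all the numbers:
  the label of an edge of \<open>T\<close> sits at the left-leaning edge of \<open>S\<close> with the same first leaf
  (\<open>labelling_props\<close>). Moreover \<open>S \<le> S'\<close> iff every left-leaning edge of \<open>S\<close> is contained
  in a left-leaning edge of \<open>S'\<close> with the same first leaf (\<open>tree_le_iff\<close>).

  A binary tree \<open>S\<close> can be recovered from its right-leaning edges, that is, from the tree \<open>V\<close>
  obtained by collapsing the left-leaning ones; the trees \<open>V\<close> that arise are those whose edges
  end at different leaves, none at \<open>n\<close>. Dually, \<open>T_min\<close> has enough left-leaning edges iff the
  edges of \<open>T\<close> start at different leaves, none at \<open>1\<close>. So the value of \<open>p\<close> at \<open>T\<close> with edges
  \<open>F\<close> is a sum over the trees with edges \<open>G\<close> for which \<open>matching n F G\<close> holds, and the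
  coefficient is the sign of the permutation that lists the first leaves of \<open>F\<close> and then the
  last leaves of \<open>G\<close> (\<open>lookup_p_value\<close>, \<open>p_sign\<close>).

  For the chain map property at a fully metric tree with edges \<open>F\<close> compare the coefficients of a
  tree with edges \<open>G\<close>, where \<open>card F + card G = n - 1\<close>. The boundary of \<open>p\<close> contributes the
  \<open>g \<in> G\<close> such that \<open>F\<close> matches \<open>G - {g}\<close>; the collapse of \<open>f \<in> F\<close> contributes if \<open>F - {f}\<close>
  matches \<open>G\<close>; making \<open>f\<close> non-metric contributes if \<open>f \<in> G\<close> and the parts of \<open>F\<close> and \<open>G\<close>
  inside and outside \<open>f\<close> match separately. There is one leaf number too many, and this leaves
  at most three terms. If the first leaves of \<open>F\<close> and the last leaves of \<open>G\<close> are distinct in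
  themselves, then some \<open>f\<close> starts where some \<open>g\<close> ends, and these two terms are equal
  (\<open>one_shared_leaf\<close>). If two members of \<open>G\<close> end at the same leaf, their terms cancel except
  when the smaller one belongs to \<open>F\<close>, and then the third kind of term compensates
  (\<open>common_end\<close>). The case of two members of \<open>F\<close> that start at the same leaf is similar
  (\<open>common_start\<close>). The signs are collected in \<open>boundary_identity\<close>.

  Finally, both boundaries are derivations for the compositions (\<open>K_Leibniz\<close>, \<open>W_Leibniz\<close>), and a
  metric tree with a non-metric edge is a composite of trees with fewer non-metric edges. So the
  chain map property spreads from fully metric trees to all chains (\<open>p_chain_map\<close>).
\<close>

section \<open>Trees as nested families of intervals\<close>

lemma vertices_bounds:
  "wf_tree T \<Longrightarrow> (p, q) \<in> vertices_from a T \<Longrightarrow> a \<le> p \<and> p < q \<and> q < a + leaves T"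
  "(\<forall>t\<in>set ts. wf_tree t) \<Longrightarrow> (p, q) \<in> vertices_from_list a ts \<Longrightarrow>
     a \<le> p \<and> p < q \<and> q < a + sum_list (map leaves ts)"
proof (induction a T and a ts rule: vertices_from_vertices_from_list.induct)
  case (2 a ts)
  from \<open>wf_tree (Node ts)\<close> obtain u v us where ts: "ts = u # v # us"
    by (cases ts; cases "tl ts") auto
  have "0 < leaves u" "0 < leaves v" using 2(2) by (auto simp: ts leaves_pos)
  then show ?case using 2 by (auto simp: ts)
next
  case (4 a t ts)
  then show ?case using leaves_pos[of t] by fastforce
qed auto

lemma root_notin_children:
  assumes "wf_tree (Node ts)"
  shows "(a, a + leaves (Node ts) - 1) \<notin> vertices_from_list a ts"
proof
  assume *: "(a, a + leaves (Node ts) - 1) \<in> vertices_from_list a ts"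
  from assms obtain u v us where ts: "ts = u # v # us"
    by (cases ts; cases "tl ts") auto
  have "0 < leaves u" "0 < leaves v" using assms by (auto simp: ts leaves_pos)
  then show False
    using * vertices_bounds(1)[of u a "a + leaves (Node ts) - 1" a] vertices_bounds(2)[of "v # us" a "a +
        leaves (Node ts) - 1" "a + leaves u"] assms
    by (auto simp: ts)
qed

definition laminar :: "edge set \<Rightarrow> bool" where
  "laminar F \<longleftrightarrow> (\<forall>x\<in>F. \<forall>y\<in>F. fst x < fst y \<longrightarrow> fst y \<le> snd x \<longrightarrow> snd y \<le> snd x)"

lemma laminarD: "laminar F \<Longrightarrow> (a, b) \<in> F \<Longrightarrow> (c, d) \<in> F \<Longrightarrow> a < c \<Longrightarrow> c \<le> b \<Longrightarrow> d \<le> b"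
  unfolding laminar_def by (metis fst_conv snd_conv)

lemma laminar_subset: "laminar F \<Longrightarrow> G \<subseteq> F \<Longrightarrow> laminar G"
  unfolding laminar_def by blast

lemma laminar_insert:
  assumes "laminar F" "\<And>v. v \<in> F \<Longrightarrow> fst r \<le> fst v \<and> snd v \<le> snd r"
  shows "laminar (insert r F)"
  unfolding laminar_def
proof (intro ballI impI)
  fix x y assume xy: "x \<in> insert r F" "y \<in> insert r F" "fst x < fst y" "fst y \<le> snd x"
  show "snd y \<le> snd x"
  proof (cases "x = r")
    case True
    then show ?thesis using assms(2)[of y] xy by auto
  next
    case False
    then have "y \<noteq> r" using assms(2)[of x] xy by auto
    then show ?thesis using False xy assms(1) unfolding laminar_def by blast
  qed
qed

lemma laminar_Un:
  assumes "laminar F" "laminar G" "\<And>v w. v \<in> F \<Longrightarrow> w \<in> G \<Longrightarrow> snd v < fst w" "\<And>w. w \<in> G \<Longrightarrow> fst w \<le> snd w"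
    "\<And>w. w \<in> F \<Longrightarrow> fst w \<le> snd w"
  shows "laminar (F \<union> G)"
  unfolding laminar_def
proof (intro ballI impI)
  fix x y assume xy: "x \<in> F \<union> G" "y \<in> F \<union> G" "fst x < fst y" "fst y \<le> snd x"
  consider "x \<in> F" "y \<in> F" | "x \<in> G" "y \<in> G" | "x \<in> F" "y \<in> G" | "x \<in> G" "y \<in> F" using xy by blast
  then show "snd y \<le> snd x"
  proof cases
    case 1 then show ?thesis using assms(1) xy unfolding laminar_def by blast
  next
    case 2 then show ?thesis using assms(2) xy unfolding laminar_def by blast
  next
    case 3 then show ?thesis using assms(3)[of x y] xy by simp
  next
    case 4 then show ?thesis using assms(3)[of y x] assms(4)[of x] assms(5)[of y] xy by linarith
  qed
qed

lemma laminar_vertices: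
  "wf_tree T \<Longrightarrow> laminar (vertices_from a T)"
  "(\<forall>t\<in>set ts. wf_tree t) \<Longrightarrow> laminar (vertices_from_list a ts)"
proof (induction a T and a ts rule: vertices_from_vertices_from_list.induct)
  case (2 a ts)
  have "a \<le> fst v \<and> snd v \<le> a + leaves (Node ts) - 1" if "v \<in> vertices_from_list a ts" for v
    using vertices_bounds(2)[of ts "fst v" "snd v" a] that 2(2) by auto
  moreover have "laminar (vertices_from_list a ts)" using 2 by simp
  ultimately show ?case unfolding vertices_from.simps by (intro laminar_insert) auto
next
  case (4 a t ts)
  have A: "a \<le> fst v \<and> fst v < snd v \<and> snd v < a + leaves t" if "v \<in> vertices_from a t" for v
    using vertices_bounds(1)[of t "fst v" "snd v" a] that 4 by auto
  have B: "a + leaves t \<le> fst v \<and> fst v < snd v" if "v \<in> vertices_from_list (a + leaves t) ts" for v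
    using vertices_bounds(2)[of ts "fst v" "snd v" "a + leaves t"] that 4 by auto
  show ?case unfolding vertices_from_list.simps
    by (rule laminar_Un) (use 4 A B in \<open>auto dest!: A B\<close>)
qed (auto simp: laminar_def)

text \<open>
  The number of leaves of the first tree in a list is visible in the names of the vertices, as
  the longest interval that starts at \<open>a\<close> belongs to its root. This lets a list of trees be
  reconstructed from left to right.
\<close>

lemma first_child_vertices:
  assumes "\<forall>t\<in>set (t # ts). wf_tree t"
  shows "vertices_from a t = {v \<in> vertices_from_list a (t # ts). snd v < a + leaves t}"
    and "vertices_from_list (a + leaves t) ts = {v \<in> vertices_from_list a (t # ts). a + leaves t \<le> fst v}"
    and "leaves t = (if \<exists>q. (a, q) \<in> vertices_from_list a (t # ts)
           then Suc (Max {q. (a, q) \<in> vertices_from_list a (t # ts)}) - a else 1)"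
proof -
  have 1: "a \<le> p \<and> p < q \<and> q < a + leaves t" if "(p, q) \<in> vertices_from a t" for p q
    using vertices_bounds(1)[of t p q a] that assms by auto
  have 2: "a + leaves t \<le> p \<and> p < q" if "(p, q) \<in> vertices_from_list (a + leaves t) ts" for p q
    using vertices_bounds(2)[of ts p q "a + leaves t"] that assms by auto
  show "vertices_from a t = {v \<in> vertices_from_list a (t # ts). snd v < a + leaves t}"
    by (auto dest: 1 2)
  show "vertices_from_list (a + leaves t) ts = {v \<in> vertices_from_list a (t # ts). a + leaves t \<le> fst v}"
    by (auto dest: 1 2)
  have pos: "0 < leaves t" using assms leaves_pos by auto
  show "leaves t = (if \<exists>q. (a, q) \<in> vertices_from_list a (t # ts)
           then Suc (Max {q. (a, q) \<in> vertices_from_list a (t # ts)}) - a else 1)"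
  proof (cases t)
    case Leaf
    then have "\<not> (\<exists>q. (a, q) \<in> vertices_from_list a (t # ts))" using 2[of a] by auto
    then show ?thesis using Leaf by simp
  next
    case (Node us)
    have "(a, a + leaves t - 1) \<in> vertices_from_list a (t # ts)" by (simp add: Node)
    moreover have "q \<le> a + leaves t - 1" if "(a, q) \<in> vertices_from_list a (t # ts)" for q
      using that 1[of a q] 2[of a q] pos by auto
    ultimately have "Max {q. (a, q) \<in> vertices_from_list a (t # ts)} = a + leaves t - 1"
      by (intro Max_eqI) (auto intro: finite_subset[of _ "{..a + leaves t - 1}"])
    then show ?thesis using \<open>(a, a + leaves t - 1) \<in> _\<close> pos by auto
  qed
qed

text \<open>
  The root of a tree is the only vertex that spans all its leaves, so the vertices above the
  children are known too, and the children can be split off one by one.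
\<close>

lemma tree_eqI:
  "wf_tree T \<Longrightarrow> wf_tree T' \<Longrightarrow> leaves T = leaves T' \<Longrightarrow> vertices_from a T = vertices_from a T' \<Longrightarrow> T = T'"
  "(\<forall>t\<in>set ts. wf_tree t) \<Longrightarrow> (\<forall>t\<in>set ts'. wf_tree t) \<Longrightarrow>
     sum_list (map leaves ts) = sum_list (map leaves ts') \<Longrightarrow>
     vertices_from_list a ts = vertices_from_list a ts' \<Longrightarrow> ts = ts'"
proof (induction a T and a ts arbitrary: T' and ts' rule: vertices_from_vertices_from_list.induct)
  case (1 a)
  then show ?case by (cases T') auto
next
  case (2 a ts)
  then obtain ts' where T': "T' = Node ts'" by (cases T') auto
  have "vertices_from_list a ts = vertices_from_list a ts'"
    using 2(5) root_notin_children[OF 2(2), of a] root_notin_children[of ts' a] 2(3,4)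
    unfolding T' by (simp add: insert_ident)
  then show ?case using 2 by (auto simp: T')
next
  case (3 a)
  then show ?case using leaves_pos[of "hd ts'"] by (cases ts') auto
next
  case (4 a t ts)
  then obtain t' us where ts': "ts' = t' # us" using leaves_pos[of t] by (cases ts') auto
  have l: "leaves t = leaves t'"
    using first_child_vertices(3)[OF 4(3), of a] first_child_vertices(3)[OF 4(4)[unfolded ts'], of a] 4(6)
        by (simp only: ts')
  have v1: "vertices_from a t = vertices_from a t'"
    using first_child_vertices(1)[OF 4(3)] first_child_vertices(1)[OF 4(4)[unfolded ts']] 4(6)
        by (simp only: ts' l)
  have v2: "vertices_from_list (a + leaves t) ts = vertices_from_list (a + leaves t) us"
    using first_child_vertices(2)[OF 4(3)] first_child_vertices(2)[OF 4(4)[unfolded ts']] 4(6)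
        by (simp only: ts' l)
  have "t = t'" by (rule 4(1)) (use 4(3,4) l v1 in \<open>simp_all add: ts'\<close>)
  moreover have "ts = us" by (rule 4(2)) (use 4(3-5) l v2 in \<open>simp_all add: ts'\<close>)
  ultimately show ?case by (simp add: ts')
qed

lemma vertices_edges:
  assumes "wf_tree T" "2 \<le> leaves T"
  shows "vertices_from 1 T = insert (1, leaves T) (edges T)" "(1, leaves T) \<notin> edges T"
  using assms by (cases T; auto simp: edges_def)+

lemma edges_bounds:
  assumes "wf_tree T" "(p, q) \<in> edges T"
  shows "1 \<le> p" "p < q" "q \<le> leaves T" "(p, q) \<noteq> (1, leaves T)"
  using assms vertices_bounds(1)[of T p q 1] by (auto simp: edges_def)

lemma laminar_edges: "wf_tree T \<Longrightarrow> laminar (insert (1, leaves T) (edges T))"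
proof -
  assume T: "wf_tree T"
  show ?thesis
  proof (cases T)
    case Leaf then show ?thesis by (auto simp: laminar_def edges_def)
  next
    case (Node ts)
    then have "insert (1, leaves T) (edges T) = vertices_from 1 T" by (auto simp: edges_def)
    then show ?thesis using laminar_vertices(1)[OF T] by simp
  qed
qed

lemma edges_inj:
  assumes "wf_tree T" "wf_tree T'" "leaves T = leaves T'" "edges T = edges T'" "2 \<le> leaves T"
  shows "T = T'"
  using tree_eqI(1)[of T T' 1] vertices_edges(1)[of T] vertices_edges(1)[of T'] assms by simp

lemma finite_trees: "finite {T. wf_tree T \<and> leaves T = n}"
proof (cases "2 \<le> n")
  case True
  have "inj_on edges {T. wf_tree T \<and> leaves T = n}"
    using True by (intro inj_onI) (auto intro: edges_inj)
  moreover have "edges ` {T. wf_tree T \<and> leaves T = n} \<subseteq> Pow ({..n} \<times> {..n})"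
    using edges_bounds by (fastforce dest: edges_bounds)
  ultimately show ?thesis by (meson finite_Pow_iff finite_SigmaI finite_atMost finite_imageD finite_subset)
next
  case False
  have "T = Leaf" if "wf_tree T" "leaves T = n" for T
  proof (cases T)
    case (Node ts)
    have "2 \<le> length ts" using that by (simp add: Node)
    then obtain u v us where ts: "ts = u # v # us" by (cases ts; cases "tl ts") auto
    have "0 < leaves u" "0 < leaves v" using that by (auto simp: ts Node leaves_pos)
    then show ?thesis using that False by (auto simp: Node ts)
  qed simp
  then have "{T. wf_tree T \<and> leaves T = n} \<subseteq> {Leaf}" by blast
  then show ?thesis by (rule finite_subset) simp
qed

text \<open>
  The recursion decides about an edge at the parent of its upper vertex, so the root of the tree
  at hand stays even if its name belongs to \<open>E\<close>.
\<close>

lemma collapse_from_props: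
  "wf_tree T \<Longrightarrow> leaves (collapse_from E a T) = leaves T \<and> wf_tree (collapse_from E a T) \<and>
     (collapse_from E a T = Leaf \<longleftrightarrow> T = Leaf) \<and>
     vertices_from a (collapse_from E a T) = vertices_from a T - (E - {(a, a + leaves T - 1)})"
  "(\<forall>t\<in>set ts. wf_tree t) \<Longrightarrow>
     sum_list (map leaves (collapse_from_list E a ts)) = sum_list (map leaves ts) \<and>
     (\<forall>t\<in>set (collapse_from_list E a ts). wf_tree t) \<and> length ts \<le> length (collapse_from_list E a ts) \<and>
     vertices_from_list a (collapse_from_list E a ts) = vertices_from_list a ts - E"
proof (induction E a T and E a ts rule: collapse_from_collapse_from_list.induct)
  case (2 E a ts)
  then show ?case using root_notin_children[OF 2(2)] by auto
next
  case (4 E a t ts)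
  have app: "vertices_from_list a (us @ vs) =
      vertices_from_list a us \<union> vertices_from_list (a + sum_list (map leaves us)) vs" for a us vs
    by (induction us arbitrary: a) (auto simp: add.assoc)
  note IH = 4(1)[of] 4(2)
  show ?case
  proof (cases "collapse_from E a t")
    case Leaf
    then show ?thesis using 4 by (auto simp: app)
  next
    case (Node us)
    then obtain vs where t: "t = Node vs" using 4 by (cases t) auto
    have w: "wf_tree t" using 4 by auto
    have IH1: "leaves (Node us) = leaves t" "wf_tree (Node us)"
      "vertices_from a (Node us) = vertices_from a t - (E - {(a, a + leaves t - 1)})"
      using 4(1)[OF w] unfolding Node by blast+
    have IH2: "sum_list (map leaves (collapse_from_list E (a + leaves t) ts)) = sum_list (map leaves ts)"
     "(\<forall>t\<in>set (collapse_from_list E (a + leaves t) ts). wf_tree t)" "length ts \<le> length (collapse_from_list E (a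
         + leaves t) ts)"
     "vertices_from_list (a + leaves t) (collapse_from_list E (a + leaves t) ts) =
         vertices_from_list (a + leaves t) ts - E"
      using 4 by auto
    have b: "(a, a + leaves t - 1) \<notin> vertices_from_list (a + leaves t) ts"
      using vertices_bounds(2)[of ts a "a + leaves t - 1" "a + leaves t"] 4(3) leaves_pos[OF w] by auto
    show ?thesis
    proof (cases "(a, a + leaves t - 1) \<in> E")
      case True
      have "vertices_from_list a us = vertices_from a (Node us) - {(a, a + leaves t - 1)}"
        using root_notin_children[OF IH1(2), of a] IH1(1) by auto
      also have "\<dots> = vertices_from a t - E" unfolding IH1(3) using True by blast
      finally have 1: "vertices_from_list a us = vertices_from a t - E" .
      have "vertices_from_list (a + leaves t) ts - E =
          vertices_from_list (a + leaves t) (collapse_from_list E (a + leaves t) ts)" using IH2 by simp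
      then show ?thesis using Node True IH1(1,2) IH2(1-3) b 1 by (auto simp: app Un_Diff)
    next
      case False
      then show ?thesis using Node IH1 IH2 b by auto
    qed
  qed
qed auto

lemma collapse_props:
  assumes "wf_tree T"
  shows "leaves (collapse E T) = leaves T" "wf_tree (collapse E T)" "edges (collapse E T) = edges T - E"
  using collapse_from_props(1)[OF assms, of E 1] by (auto simp: collapse_def edges_def)

lemma leaves_graft:
  "wf_tree T \<Longrightarrow> wf_tree S \<Longrightarrow> 1 \<le> i \<Longrightarrow> i \<le> leaves T \<Longrightarrow>
      leaves (graft T i S) = leaves T + leaves S - 1 \<and> wf_tree (graft T i S)"
  "(\<forall>t\<in>set ts. wf_tree t) \<Longrightarrow> wf_tree S \<Longrightarrow> 1 \<le> i \<Longrightarrow> i \<le> sum_list (map leaves ts) \<Longrightarrow>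
     sum_list (map leaves (graft_list ts i S)) = sum_list (map leaves ts) + leaves S - 1 \<and>
     length (graft_list ts i S) = length ts \<and> (\<forall>t\<in>set (graft_list ts i S). wf_tree t)"
proof (induction T i S and ts i S rule: graft_graft_list.induct)
  case (4 t ts i S)
  then show ?case using leaves_pos[of S] leaves_pos[of t] by auto
qed auto

lemma vertices_shift:
  "wf_tree T \<Longrightarrow> vertices_from (a + d) T = (\<lambda>(p, q). (p + d, q + d)) ` vertices_from a T"
  "\<forall>t\<in>set ts. wf_tree t \<Longrightarrow>
     vertices_from_list (a + d) ts = (\<lambda>(p, q). (p + d, q + d)) ` vertices_from_list a ts"
proof (induction a T and a ts rule: vertices_from_vertices_from_list.induct)
  case (2 a ts)
  then show ?case using leaves_pos[of "Node ts"] by (auto simp: ac_simps)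
next
  case (4 a t ts)
  have e: "a + d + leaves t = a + leaves t + d" by simp
  show ?case using 4 unfolding vertices_from_list.simps e by (simp add: image_Un)
qed auto

text \<open>
  With the numbering of leaves starting at \<open>a\<close>, the grafting happens at leaf \<open>a + i - 1\<close>.
\<close>

lemma vertices_graft:
  "wf_tree T \<Longrightarrow> wf_tree S \<Longrightarrow> 1 \<le> i \<Longrightarrow> i \<le> leaves T \<Longrightarrow> 1 \<le> a \<Longrightarrow>
     vertices_from a (graft T i S) =
       outer_edge (a + i - 1) (leaves S) ` vertices_from a T \<union> vertices_from (a + i - 1) S"
  "(\<forall>t\<in>set ts. wf_tree t) \<Longrightarrow> wf_tree S \<Longrightarrow> 1 \<le> i \<Longrightarrow> i \<le> sum_list (map leaves ts) \<Longrightarrow> 1 \<le> a \<Longrightarrow>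
     vertices_from_list a (graft_list ts i S) =
       outer_edge (a + i - 1) (leaves S) ` vertices_from_list a ts \<union> vertices_from (a + i - 1) S"
proof (induction T i S and ts i S arbitrary: a and a rule: graft_graft_list.induct)
  case (1 i S)
  then show ?case by simp
next
  case (2 ts i S)
  have "outer_edge (a + i - 1) (leaves S) (a, a + leaves (Node ts) - 1) =
      (a, a + leaves (graft (Node ts) i S) - 1)"
    using 2(3-6) leaves_graft(1)[OF 2(2) 2(3,4,5)] leaves_pos[of S] by (auto simp: outer_edge_def)
  moreover have "vertices_from_list a (graft_list ts i S) =
      outer_edge (a + i - 1) (leaves S) ` vertices_from_list a ts \<union> vertices_from (a + i - 1) S"
    using 2 by simp
  ultimately show ?case by (simp only: graft.simps vertices_from.simps image_insert Un_insert_left)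
next
  case (4 t ts i S)
  have S: "0 < leaves S" and t: "wf_tree t" "0 < leaves t" using 4 leaves_pos by auto
  show ?case
  proof (cases "i \<le> leaves t")
    case True
    have "outer_edge (a + i - 1) (leaves S) (p, q) = (p + (leaves S - 1), q + (leaves S - 1))"
      if "(p, q) \<in> vertices_from_list (a + leaves t) ts" for p q
      using vertices_bounds(2)[of ts p q "a + leaves t"] that True 4 S t by (auto simp: outer_edge_def)
    then have "outer_edge (a + i - 1) (leaves S) ` vertices_from_list (a + leaves t) ts =
        (\<lambda>(p, q). (p + (leaves S - 1), q + (leaves S - 1))) ` vertices_from_list (a + leaves t) ts"
      by (intro image_cong) auto
    also have "\<dots> = vertices_from_list (a + leaves t + (leaves S - 1)) ts"
      using vertices_shift(2)[of ts] 4 by auto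
    also have "a + leaves t + (leaves S - 1) = a + leaves (graft t i S)"
      using leaves_graft(1)[of t S i] 4 True t S by auto
    finally show ?thesis using 4 True t by (auto simp: image_Un)
  next
    case False
    have "outer_edge (a + i - 1) (leaves S) (p, q) = (p, q)"
      if "(p, q) \<in> vertices_from a t" for p q
      using vertices_bounds(1)[of t p q a] that False 4 S t by (auto simp: outer_edge_def)
    then have "outer_edge (a + i - 1) (leaves S) ` vertices_from a t = id ` vertices_from a t"
      by (intro image_cong) auto
    then have 1: "outer_edge (a + i - 1) (leaves S) ` vertices_from a t = vertices_from a t" by simp
    have 2: "a + leaves t + (i - leaves t) - 1 = a + i - 1" using False by auto
    have "vertices_from_list (a + leaves t) (graft_list ts (i - leaves t) S) =
        outer_edge (a + i - 1) (leaves S) ` vertices_from_list (a + leaves t) ts \<union> vertices_from (a + i - 1) S"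
      unfolding 2[symmetric] by (rule 4(2)[OF False]) (use 4(3-7) False t in auto)
    then show ?thesis using False by (simp only: graft_list.simps if_False vertices_from_list.simps image_Un 1
        Un_assoc)
  qed
qed auto

text \<open>
  No edge of the outer tree lies within the block of leaves that replaces leaf \<open>i\<close>, whereas the
  edges of the inner tree and the new edge do. This separates the three kinds of edges.
\<close>

lemma edges_graft:
  assumes "wf_tree T" "wf_tree S" "1 \<le> i" "i \<le> leaves T" "2 \<le> leaves T" "2 \<le> leaves S"
  shows "edges (graft T i S) = outer_edge i (leaves S) ` edges T \<union> inner_edge i ` edges S \<union> {new_edge i (leaves
      S)}"
    and "outer_edge i (leaves S) ` edges T \<inter> inner_edge i ` edges S = {}"
    and "new_edge i (leaves S) \<notin> outer_edge i (leaves S) ` edges T"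
    and "new_edge i (leaves S) \<notin> inner_edge i ` edges S"
proof -
  let ?o = "outer_edge i (leaves S)"
  have inn: "vertices_from i S = inner_edge i ` vertices_from 1 S"
    using vertices_shift(1)[OF assms(2), of 1 "i - 1"] assms(3)
    by (auto simp: inner_edge_def split_def intro!: image_cong)
  then have vS: "vertices_from i S = insert (new_edge i (leaves S)) (inner_edge i ` edges S)"
    using vertices_edges[OF assms(2,6)] by (auto simp: inner_edge_def new_edge_def add.commute)
  have 1: "vertices_from 1 (graft T i S) = ?o ` insert (1, leaves T) (edges T) \<union> vertices_from i S"
    using vertices_graft(1)[OF assms(1-4), of 1] vertices_edges[OF assms(1,5)] by simp
  have r: "?o (1, leaves T) = (1, leaves (graft T i S))"
    using leaves_graft(1)[OF assms(1-4)] assms by (auto simp: outer_edge_def)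
  have "inj ?o" using inj_outer_edge assms by auto
  then have ro: "(1, leaves (graft T i S)) \<notin> ?o ` edges T"
    using vertices_edges(2)[OF assms(1,5)] r by (metis inj_image_mem_iff)
  have ri: "(1, leaves (graft T i S)) \<notin> vertices_from i S"
    using vertices_bounds(1)[OF assms(2), of 1 "leaves (graft T i S)" i] leaves_graft(1)[OF assms(1-4)] assms
        by auto
  show "edges (graft T i S) = ?o ` edges T \<union> inner_edge i ` edges S \<union> {new_edge i (leaves S)}"
    using 1 r ro ri unfolding edges_def[of "graft T i S"] vS by auto
  have sub: "i \<le> fst v \<and> snd v \<le> i + leaves S - 1" if "v \<in> vertices_from i S" for v
    using vertices_bounds(1)[OF assms(2), of "fst v" "snd v" i] that by auto
  have nin: "\<not> (i \<le> fst (?o v) \<and> snd (?o v) \<le> i + leaves S - 1)" if "v \<in> edges T" for v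
    using edges_bounds(2)[OF assms(1), of "fst v" "snd v"] that assms
    by (auto simp: outer_edge_def split: if_splits)
  have disj: "x \<notin> vertices_from i S" if xo: "x \<in> ?o ` edges T" for x
  proof
    assume x: "x \<in> vertices_from i S"
    obtain v where "v \<in> edges T" "x = ?o v" using xo by blast
    then show False using nin[of v] sub[OF x] by simp
  qed
  show "?o ` edges T \<inter> inner_edge i ` edges S = {}"
    using disj unfolding vS by (meson disjoint_iff insertI2)
  show "new_edge i (leaves S) \<notin> ?o ` edges T"
    using disj unfolding vS by (meson insertI1)
  show "new_edge i (leaves S) \<notin> inner_edge i ` edges S"
  proof
    assume "new_edge i (leaves S) \<in> inner_edge i ` edges S"
    then obtain a b where ab: "(a, b) \<in> edges S" "i = a + i - 1" "i + leaves S - 1 = b + i - 1"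
      by (auto simp: new_edge_def inner_edge_def)
    then have "a = 1" "b = leaves S" using edges_bounds[OF assms(2) ab(1)] assms by linarith+
    then show False using ab(1) vertices_edges(2)[OF assms(2,6)] by simp
  qed
qed

lemma decompose_from:
  "wf_tree U \<Longrightarrow> (j, m) \<in> vertices_from a U \<Longrightarrow>
     \<exists>U' U''. wf_tree U' \<and> wf_tree U'' \<and> a \<le> j \<and> j - a < leaves U' \<and> leaves U'' = Suc m - j \<and>
       U = graft U' (Suc j - a) U''"
  "(\<forall>t\<in>set ts. wf_tree t) \<Longrightarrow> (j, m) \<in> vertices_from_list a ts \<Longrightarrow>
     \<exists>ts' U''. (\<forall>t\<in>set ts'. wf_tree t) \<and> wf_tree U'' \<and> a \<le> j \<and> j - a < sum_list (map leaves ts') \<and>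
       leaves U'' = Suc m - j \<and> length ts' = length ts \<and> ts = graft_list ts' (Suc j - a) U''"
proof (induction a U and a ts rule: vertices_from_vertices_from_list.induct)
  case (2 a ts)
  show ?case
  proof (cases "(j, m) = (a, a + leaves (Node ts) - 1)")
    case True
    then show ?thesis
      using 2(2) leaves_pos[OF 2(2)] by (intro exI[of _ Leaf] exI[of _ "Node ts"]) auto
  next
    case False
    then obtain ts' U'' where "\<forall>t\<in>set ts'. wf_tree t" "wf_tree U''" "a \<le> j" "j - a < sum_list (map leaves ts')"
       "leaves U'' = Suc m - j" "length ts' = length ts" "ts = graft_list ts' (Suc j - a) U''"
      using 2 by auto
    then show ?thesis using 2(2)
      by (intro exI[of _ "Node ts'"] exI[of _ U'']) auto
  qed
next
  case (4 a t ts)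
  show ?case
  proof (cases "(j, m) \<in> vertices_from a t")
    case True
    then obtain U' U'' where "wf_tree U'" "wf_tree U''" "a \<le> j" "j - a < leaves U'" "leaves U'' = Suc m - j"
       "t = graft U' (Suc j - a) U''"
      using 4 by auto
    then show ?thesis using 4
      by (intro exI[of _ "U' # ts"] exI[of _ U'']) auto
  next
    case False
    then obtain ts' U'' where "\<forall>t\<in>set ts'. wf_tree t" "wf_tree U''" "a + leaves t \<le> j"
      "j - (a + leaves t) < sum_list (map leaves ts')"
       "leaves U'' = Suc m - j" "length ts' = length ts" "ts = graft_list ts' (Suc j - (a + leaves t)) U''"
      using 4 by auto
    then show ?thesis using 4
      by (intro exI[of _ "t # ts'"] exI[of _ U'']) (auto simp: Suc_diff_le)
  qed
qed auto

text \<open>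
  Every internal edge is the new edge of a graft. This is used for non-metric edges, and for an
  edge that a tree in the source shares with a tree in the target.
\<close>

lemma decompose:
  assumes "wf_tree U" "(j, m) \<in> edges U"
  obtains U' U'' where "wf_tree U'" "wf_tree U''" "1 \<le> j" "j \<le> leaves U'" "2 \<le> leaves U'" "2 \<le> leaves U''"
    "m = j + leaves U'' - 1" "U = graft U' j U''" "leaves U = leaves U' + leaves U'' - 1"
proof -
  have jm: "1 \<le> j" "j < m" "m \<le> leaves U" "(j, m) \<noteq> (1, leaves U)" using edges_bounds[OF assms] by auto
  obtain U' U'' where U: "wf_tree U'" "wf_tree U''" "j - 1 < leaves U'" "leaves U'' = Suc m - j" "U =
      graft U' j U''"
    using decompose_from(1)[OF assms(1), of j m 1] assms(2) by (auto simp: edges_def)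
  have "leaves U = leaves U' + leaves U'' - 1"
    using leaves_graft(1)[of U' U'' j] U jm by auto
  then show ?thesis using U jm by (intro that[of U' U'']) auto
qed

section \<open>Signs of permutations\<close>

text \<open>
  Signs of lists of edges have to be compared with signs of lists of leaf numbers, hence the
  generalization of \<open>list_sign\<close> to an arbitrary linear order.
\<close>

fun perm_sign :: "'a::linorder list \<Rightarrow> int" where
  "perm_sign [] = 1"
| "perm_sign (x # xs) = (\<Prod>y\<leftarrow>xs. if x < y then 1 else -1) * perm_sign xs"

definition cross_sign :: "'a::linorder list \<Rightarrow> 'a list \<Rightarrow> int" where
  "cross_sign xs ys = (\<Prod>x\<leftarrow>xs. \<Prod>y\<leftarrow>ys. if x < y then 1 else -1)"

lemma list_sign_perm_sign: "list_sign es = perm_sign es"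
  by (induction es) auto

lemma perm_sign_append: "perm_sign (xs @ ys) = perm_sign xs * perm_sign ys * cross_sign xs ys"
  by (induction xs) (auto simp: cross_sign_def)

lemma perm_sign_mult_self [simp]: "perm_sign xs * perm_sign xs = 1"
proof (induction xs)
  case (Cons e es)
  have "(\<Prod>x\<leftarrow>es. if e < x then 1 else -1) * (\<Prod>x\<leftarrow>es. if e < x then 1 else -1::int) = 1"
    by (induction es) auto
  then show ?case
    using Cons by (simp add: ac_simps)
qed simp

lemma perm_sign_map:
  assumes "\<And>x y. x \<in> set xs \<Longrightarrow> y \<in> set xs \<Longrightarrow> f x < f y \<longleftrightarrow> x < y"
  shows "perm_sign (map f xs) = perm_sign xs"
  using assms
proof (induction xs)
  case (Cons e es)
  have "(\<Prod>x\<leftarrow>es. if f e < f x then 1 else (-1::int)) = (\<Prod>x\<leftarrow>es. if e < x then 1 else -1)"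
    using Cons.prems by (intro arg_cong[where f = prod_list] map_cong) auto
  moreover have "perm_sign (map f es) = perm_sign es"
    by (rule Cons.IH) (use Cons.prems in auto)
  ultimately show ?case by (simp add: o_def)
qed simp

lemma cross_sign_swap:
  fixes xs ys :: "'a::linorder list"
  assumes "set xs \<inter> set ys = {}"
  shows "cross_sign xs ys = (-1) ^ (length xs * length ys) * cross_sign ys xs"
proof -
  have 1: "(\<Prod>y\<leftarrow>ys. if x < y then 1 else (-1::int)) =
      (-1) ^ length ys * (\<Prod>y\<leftarrow>ys. if y < x then 1 else -1)" if "x \<notin> set ys" for x :: 'a and ys
    using that
  proof (induction ys)
    case (Cons y ys)
    then show ?case by (cases x y rule: linorder_cases) auto
  qed simp
  have 2: "cross_sign ys (x # xs) = (\<Prod>y\<leftarrow>ys. if y < x then 1 else -1) * cross_sign ys xs" for x xs ys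
    by (induction ys) (auto simp: cross_sign_def)
  have 3: "cross_sign ys [] = 1" for ys by (induction ys) (auto simp: cross_sign_def)
  show ?thesis using assms
  proof (induction xs)
    case Nil
    then show ?case by (simp add: 3) (simp add: cross_sign_def)
  next
    case (Cons x xs)
    have "cross_sign (x # xs) ys = (\<Prod>y\<leftarrow>ys. if x < y then 1 else (-1::int)) * cross_sign xs ys"
      by (simp add: cross_sign_def)
    then show ?case using Cons 1[of x ys] by (simp add: 2 power_add mult.assoc)
  qed
qed

lemma cross_sign_append_left: "cross_sign (xs @ ys) zs = cross_sign xs zs * cross_sign ys zs"
  by (simp add: cross_sign_def)

lemma cross_sign_append_right: "cross_sign xs (ys @ zs) = cross_sign xs ys * cross_sign xs zs"
  by (induction xs) (auto simp: cross_sign_def)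

lemma perm_sign_swap_middle:
  assumes "set ys \<inter> set zs = {}"
  shows "perm_sign (xs @ ys @ zs @ ws) = (-1) ^ (length ys * length zs) * perm_sign (xs @ zs @ ys @ ws)"
  by (simp add: perm_sign_append cross_sign_append_left cross_sign_append_right cross_sign_swap[OF assms])

text \<open>
  Used when the entries of \<open>ys\<close> form a block of consecutive numbers, none of which occurs in \<open>xs\<close>.
\<close>

lemma cross_sign_block:
  assumes "\<And>x y. x \<in> set xs \<Longrightarrow> y \<in> set ys \<Longrightarrow> x < y \<longleftrightarrow> P x"
  shows "cross_sign xs ys = (-1) ^ (length (filter (\<lambda>x. \<not> P x) xs) * length ys)"
  using assms
proof (induction xs)
  case Nil
  then show ?case by (simp add: cross_sign_def)
next
  case (Cons x xs)
  have "(\<Prod>y\<leftarrow>ys. if x < y then 1 else (-1::int)) = (\<Prod>y\<leftarrow>ys. if P x then 1 else -1)"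
    using Cons.prems by (intro arg_cong[where f = prod_list] map_cong) auto
  also have "\<dots> = (if P x then 1 else (-1) ^ length ys)" by (induction ys) auto
  moreover have "cross_sign (x # xs) ys = (\<Prod>y\<leftarrow>ys. if x < y then 1 else (-1::int)) * cross_sign xs ys"
      by (simp add: cross_sign_def)
  ultimately show ?case using Cons by (simp add: power_add)
qed

lemma perm_sign_block:
  assumes "\<And>x y. x \<in> set xs \<Longrightarrow> y \<in> set ys \<Longrightarrow> x < y \<longleftrightarrow> P x" "distinct xs"
  shows "perm_sign (xs @ ys) = perm_sign xs * perm_sign ys * (-1) ^ (card {x \<in> set xs. \<not> P x} * length ys)"
  using assms cross_sign_block[of xs ys P] distinct_card[of "filter (\<lambda>x. \<not> P x) xs"]
  by (simp add: perm_sign_append)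

text \<open>
  The contributions of a pair to the two signs combine to a factor that is symmetric in the pair,
  so their product depends on the set of entries only. Hence a renaming of the entries changes
  the signs of all orderings of a set by the same factor.
\<close>

lemma perm_sign_relative:
  fixes f :: "'a::linorder \<Rightarrow> 'b::linorder"
  assumes "distinct xs" "inj_on f (set xs)"
  shows "perm_sign (map f xs) * perm_sign xs =
    (\<Prod>x\<in>set xs. \<Prod>y\<in>{y \<in> set xs. x < y}. if f x < f y then 1 else -1)"
  using assms
proof (induction xs)
  case Nil
  then show ?case by simp
next
  case (Cons a xs)
  let ?A = "set xs"
  define \<phi> where "\<phi> x y = (if f x < f y then 1 else (-1::int))" for x y
  have ne: "a \<noteq> y" "f a \<noteq> f y" if "y \<in> ?A" for y using Cons.prems that by (auto simp: inj_on_def)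
  have dist: "distinct xs" "a \<notin> ?A" using Cons.prems by auto
  have "perm_sign (map f (a # xs)) * perm_sign (a # xs) =
      ((\<Prod>y\<leftarrow>xs. if f a < f y then 1 else -1) * (\<Prod>y\<leftarrow>xs. if a < y then 1 else -1)) *
      (perm_sign (map f xs) * perm_sign xs)" by (simp add: o_def)
  also have "(\<Prod>y\<leftarrow>xs. if f a < f y then 1 else -1) * (\<Prod>y\<leftarrow>xs. if a < y then 1 else (-1::int)) =
      (\<Prod>y\<in>?A. \<phi> a y * (if a < y then 1 else -1))"
    using dist by (simp add: prod.distinct_set_conv_list[symmetric] prod.distrib \<phi>_def)
  also have "\<dots> = (\<Prod>y\<in>?A. (if a < y then \<phi> a y else 1) * (if y < a then \<phi> y a else 1))"
  proof (intro prod.cong refl)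
    fix y assume "y \<in> ?A"
    then show "\<phi> a y * (if a < y then 1 else -1) = (if a < y then \<phi> a y else 1) * (if y < a then \<phi> y a else 1)"
      using ne[of y] by (auto simp: \<phi>_def)
  qed
  also have "\<dots> = (\<Prod>y\<in>{y\<in>?A. a < y}. \<phi> a y) * (\<Prod>y\<in>?A. if y < a then \<phi> y a else 1)"
    by (simp add: prod.distrib prod.inter_filter[symmetric])
  also have "perm_sign (map f xs) * perm_sign xs = (\<Prod>x\<in>?A. \<Prod>y\<in>{y \<in> ?A. x < y}. \<phi> x y)"
    using Cons by (simp add: \<phi>_def)
  also have "(\<Prod>y\<in>{y\<in>?A. a < y}. \<phi> a y) * (\<Prod>y\<in>?A.
      if y < a then \<phi> y a else 1) * (\<Prod>x\<in>?A. \<Prod>y\<in>{y \<in> ?A. x < y}. \<phi> x y) =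
     (\<Prod>y\<in>{y\<in>?A. a < y}. \<phi> a y) * (\<Prod>x\<in>?A. (if x < a then \<phi> x a else 1) * (\<Prod>y\<in>{y \<in> ?A. x < y}. \<phi> x y))"
    by (simp add: prod.distrib mult.assoc)
  also have "(\<Prod>x\<in>?A. (if x < a then \<phi> x a else 1) * (\<Prod>y\<in>{y \<in> ?A. x < y}. \<phi> x y)) =
     (\<Prod>x\<in>?A. \<Prod>y\<in>{y \<in> set (a # xs). x < y}. \<phi> x y)"
  proof (intro prod.cong refl)
    fix x assume "x \<in> ?A"
    have "{y \<in> set (a # xs). x < y} = (if x < a then insert a {y \<in> ?A. x < y} else {y \<in> ?A. x < y})" by auto
    then show "(if x < a then \<phi> x a else 1) * (\<Prod>y\<in>{y \<in> ?A. x < y}. \<phi> x y) =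
        (\<Prod>y\<in>{y \<in> set (a # xs). x < y}. \<phi> x y)"
      using dist by auto
  qed
  also have "(\<Prod>y\<in>{y\<in>?A. a < y}. \<phi> a y) = (\<Prod>y\<in>{y\<in>set (a # xs). a < y}. \<phi> a y)"
    by (intro prod.cong) auto
  finally show ?case using dist by (simp add: \<phi>_def)
qed

lemma perm_sign_reorder:
  fixes f :: "'a::linorder \<Rightarrow> 'b::linorder"
  assumes "distinct xs" "distinct ys" "set xs = set ys" "inj_on f (set xs)"
  shows "perm_sign (map f xs) * perm_sign xs = perm_sign (map f ys) * perm_sign ys"
  using perm_sign_relative[of xs f] perm_sign_relative[of ys f] assms by simp

lemma cross_sign_set:
  assumes "distinct xs" "distinct xs'" "set xs = set xs'" "distinct ys" "distinct ys'" "set ys = set ys'"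
  shows "cross_sign xs ys = cross_sign xs' ys'"
  using assms by (simp add: cross_sign_def prod.distinct_set_conv_list[symmetric])

text \<open>
  The exponents of the signs are triangular numbers; \<open>tri_add\<close> is what makes them compatible with
  grafting.
\<close>

definition tri :: "nat \<Rightarrow> nat" where "tri n = n * (n - 1) div 2"

lemma tri_Suc: "tri (Suc n) = tri n + n"
  by (cases n) (auto simp: tri_def)

lemma tri_add: "tri (a + b) = tri a + tri b + a * b"
  by (induction b) (auto simp: tri_Suc, simp add: tri_def)

lemma minus_one_power_cong: "even (a + b) \<Longrightarrow> (-1::int) ^ a = (-1) ^ b"
  by (auto simp: minus_one_power_iff)

text \<open>
  The coefficient of a tree with edges \<open>fs\<close> in the value of \<open>p\<close> at a tree with edges \<open>es\<close>. With
  \<open>k\<close> the length of \<open>es\<close>, the contraction contributes the exponent \<open>k(k - 1)/2\<close>, the standard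
  orientation contributes \<open>k + (n - 1)(n - 2)/2\<close>.
\<close>

definition p_sign :: "nat \<Rightarrow> edge list \<Rightarrow> edge list \<Rightarrow> int" where
  "p_sign n es fs = (-1) ^ (tri (length es + 1) + tri (n - 1)) * perm_sign (map fst es @ map snd fs)"

lemma p_sign_reorder:
  assumes "distinct es" "distinct es'" "set es = set es'" "distinct fs" "distinct fs'" "set fs = set fs'"
    "inj_on fst (set es)" "inj_on snd (set fs)"
  shows "p_sign n es fs = list_sign es * list_sign es' * (list_sign fs * list_sign fs') * p_sign n es' fs'"
proof -
  have len: "length es = length es'" using assms by (metis distinct_card)
  have c: "cross_sign (map fst es) (map snd fs) = cross_sign (map fst es') (map snd fs')"
    by (rule cross_sign_set) (use assms in \<open>auto simp: distinct_map\<close>)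
  have r: "x = y * z * w" if "x * y = w * z" "y * y = 1" "z * z = 1" for x y z w :: int
  proof -
    have "x = (x * y) * y" using that(2) by (simp add: mult.assoc)
    then show ?thesis by (simp add: that(1) ac_simps)
  qed
  have 1: "perm_sign (map fst es) = list_sign es * list_sign es' * perm_sign (map fst es')"
    using perm_sign_reorder[OF assms(1,2,3,7)] by (intro r) (auto simp: list_sign_perm_sign)
  have 2: "perm_sign (map snd fs) = list_sign fs * list_sign fs' * perm_sign (map snd fs')"
    using perm_sign_reorder[OF assms(4,5,6,8)] by (intro r) (auto simp: list_sign_perm_sign)
  show ?thesis unfolding p_sign_def perm_sign_append c len 1 2 by (simp add: ac_simps)
qed

text \<open>
  The shared number passes the first leaves of \<open>es\<close>, and the triangular exponent changes by one
  more than their number.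
\<close>

lemma p_sign_move:
  assumes "fst f = snd g" "fst f \<notin> fst ` set es"
  shows "p_sign n (f # es) gs = - p_sign n es (g # gs)"
proof -
  have "perm_sign ([fst f] @ map fst es @ map snd gs) =
      (-1) ^ (length es) * perm_sign (map fst es @ [fst f] @ map snd gs)"
    using perm_sign_swap_middle[of "[fst f]" "map fst es" "[]" "map snd gs"] assms by auto
  then show ?thesis
    using assms by (simp add: p_sign_def tri_Suc power_add del: perm_sign.simps)
qed

lemma outer_edge_simps:
  "fst (outer_edge i s e) = (if fst e \<le> i then fst e else fst e + s - 1)"
  "snd (outer_edge i s e) = (if snd e < i then snd e else snd e + s - 1)"
  by (auto simp: outer_edge_def)

text \<open>
  Leaf \<open>j\<close> is replaced by the block from \<open>j\<close> to \<open>j + s - 1\<close>, so a first leaf \<open>j\<close> keeps its number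
  and a last leaf \<open>j\<close> becomes \<open>j + s - 1\<close>. As long as \<open>j\<close> does not occur in both roles, the
  renumbering preserves the order.
\<close>

lemma outer_names_sign:
  assumes "j \<notin> fst ` set es \<or> j \<notin> snd ` set fs" "1 \<le> s"
  shows "perm_sign (map fst (map (outer_edge j s) es) @ map snd (map (outer_edge j s) fs)) =
    perm_sign (map fst es @ map snd fs)"
proof -
  define h where "h p = (if p < j then p else if p =
      j then (if j \<in> fst ` set es then j else j + s - 1) else p + s - 1)" for p
  have 1: "map fst (map (outer_edge j s) es) @ map snd (map (outer_edge j s) fs) =
      map h (map fst es @ map snd fs)"
    using assms by (auto simp: h_def outer_edge_simps rev_image_eqI)
  have "h x < h y \<longleftrightarrow> x < y" for x y using assms by (auto simp: h_def)
  then show ?thesis unfolding 1 by (intro perm_sign_map) auto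
qed

lemma inner_names_sign:
  assumes "1 \<le> j"
  shows "perm_sign (map fst (map (inner_edge j) es) @ map snd (map (inner_edge j) fs)) =
    perm_sign (map fst es @ map snd fs)"
proof -
  have 1: "map fst (map (inner_edge j) es) @ map snd (map (inner_edge j) fs) =
      map (\<lambda>x. x + j - 1) (map fst es @ map snd fs)"
    by (auto simp: inner_edge_def)
  show ?thesis unfolding 1 using assms by (intro perm_sign_map) auto
qed

text \<open>
  The names of the inner tree fill the interior of the block from \<open>j\<close> to \<open>j + s - 1\<close>. Of the
  two ends of the block one is the new name of \<open>j\<close>, or no name at all if \<open>j\<close> is an
  outermost leaf; the other one is the name of the new edge, as first leaf \<open>j\<close> or as last leaf
  \<open>j + s - 1\<close>. The signs come from gathering the block and moving it to its place among the
  outer names.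
\<close>

lemma p_sign_graft_common:
  assumes d': "distinct (map fst es' @ map snd fs')" "set (map fst es' @ map snd fs') = {2..<r}"
    and d'': "distinct (map fst es'' @ map snd fs'')" "set (map fst es'' @ map snd fs'') = {2..<s}"
    and j: "1 \<le> j" "j \<le> r" and rs: "2 \<le> r" "2 \<le> s"
  defines "oe \<equiv> map (outer_edge j s)" and "ie \<equiv> map (inner_edge j)"
  shows "j \<notin> fst ` set es' \<Longrightarrow> 2 \<le> j \<Longrightarrow> perm_sign (map fst (new_edge j s # oe es' @ ie es'') @ map snd (oe fs' @ ie
      fs'')) =
      (-1) ^ (length es'' * length fs' + r + (r - j) * (s - 1)) *
      perm_sign (map fst es' @ map snd fs') * perm_sign (map fst es'' @ map snd fs'')" (is "_ \<Longrightarrow> _ \<Longrightarrow> ?A")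
    and "j \<notin> snd ` set fs' \<Longrightarrow> j < r \<Longrightarrow> perm_sign (map fst (oe es' @ ie es'') @ map snd (oe fs' @ ie fs'' @
        [new_edge j s])) =
      (-1) ^ (length es'' * length fs' + (r - 1 - j) * (s - 1)) *
      perm_sign (map fst es' @ map snd fs') * perm_sign (map fst es'' @ map snd fs'')" (is "_ \<Longrightarrow> _ \<Longrightarrow> ?B")
proof -
  let ?oP = "map fst (oe es')" and ?oQ = "map snd (oe fs')" and ?iP = "map fst (ie es'')" and ?iQ =
      "map snd (ie fs'')"
  have len: "length es' + length fs' = r - 2" "length es'' + length fs'' = s - 2"
    using distinct_card[OF d'(1)] d'(2) distinct_card[OF d''(1)] d''(2) by auto
  have es': "2 \<le> fst x \<and> fst x < r" if "x \<in> set es'" for x using d'(2) that by auto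
  have fs': "2 \<le> snd x \<and> snd x < r" if "x \<in> set fs'" for x using d'(2) that by auto
  have es'': "2 \<le> fst x \<and> fst x < s" if "x \<in> set es''" for x using d''(2) that by auto
  have fs'': "2 \<le> snd x \<and> snd x < s" if "x \<in> set fs''" for x using d''(2) that by auto
  have sets: "set ?oP = (\<lambda>e. if fst e \<le> j then fst e else fst e + s - 1) ` set es'"
    "set ?oQ = (\<lambda>e. if snd e < j then snd e else snd e + s - 1) ` set fs'"
    "set ?iP = (\<lambda>e. fst e + j - 1) ` set es''" "set ?iQ = (\<lambda>e. snd e + j - 1) ` set fs''"
    by (auto simp: oe_def ie_def outer_edge_simps inner_edge_def)
  have in_block: "j < x \<and> x < j + s - 1" if "x \<in> set (?iP @ ?iQ)" for x
  proof -
    have "(\<exists>e\<in>set es''. x = fst e + j - 1) \<or> (\<exists>e\<in>set fs''. x = snd e + j - 1)"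
      using that unfolding set_append sets by blast
    then show ?thesis using es'' fs'' j by force
  qed
  have out_block: "x \<le> j \<or> j + s - 1 \<le> x" if "x \<in> set (?oP @ ?oQ)" for x
    using that rs unfolding set_append sets by (auto split: if_splits)
  have disj: "set ?iP \<inter> set ?oQ = {}" using in_block out_block by fastforce
  have osign: "perm_sign (?oP @ ?oQ) = perm_sign (map fst es' @ map snd fs')"
    using outer_names_sign[of j es' fs' s] rs d'(1) unfolding oe_def by auto
  have isign: "perm_sign (?iP @ ?iQ) = perm_sign (map fst es'' @ map snd fs'')"
    using inner_names_sign[of j es'' fs''] j unfolding ie_def by auto
  have dist: "distinct (?oP @ ?oQ)"
  proof -
    have inj: "x = y" if "(if x \<le> j then x else x + s - 1) = (if y \<le> j then y else y + s - 1)" for x y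
      using that rs by (auto split: if_splits)
    have inj': "x = y" if "(if x < j then x else x + s - 1) = (if y < j then y else y + s - 1)" for x y
      using that rs by (auto split: if_splits)
    have i1: "distinct es'" "inj_on fst (set es')" and i2: "distinct fs'" "inj_on snd (set fs')"
      using d'(1) by (auto simp: distinct_map)
    have "inj_on (\<lambda>e. if fst e \<le> j then fst e else fst e + s - 1) (set es')"
      by (rule inj_onI) (rule inj_onD[OF i1(2)], rule inj, assumption+)
    then have 1: "distinct ?oP" using i1 by (simp add: oe_def distinct_map o_def outer_edge_simps)
    have "inj_on (\<lambda>e. if snd e < j then snd e else snd e + s - 1) (set fs')"
      by (rule inj_onI) (rule inj_onD[OF i2(2)], rule inj', assumption+)
    then have 2: "distinct ?oQ" using i2 by (simp add: oe_def distinct_map o_def outer_edge_simps)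
    moreover have "set ?oP \<inter> set ?oQ = {}"
    proof (intro equals0I)
      fix x assume "x \<in> set ?oP \<inter> set ?oQ"
      then have "x \<in> set ?oP" "x \<in> set ?oQ" by blast+
      then obtain e f where ef: "e \<in> set es'" "f \<in> set fs'"
        "(if fst e \<le> j then fst e else fst e + s - 1) = (if snd f < j then snd f else snd f + s - 1)"
        unfolding sets by auto
      then have "fst e = snd f" using rs by (auto split: if_splits)
      then show False using ef d'(1) by (auto simp: disjoint_iff)
    qed
    ultimately show ?thesis using 1 2 by (simp only: distinct_append simp_thms)
  qed
  have swap: "perm_sign (zs @ ?oP @ ?iP @ ?oQ @ ws) =
      (-1) ^ (length es'' * length fs') * perm_sign (zs @ (?oP @ ?oQ) @ ?iP @ ws)" for zs ws
    using perm_sign_swap_middle[OF disj, of "zs @ ?oP" ws] by (simp add: oe_def ie_def)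
  show ?A if jj: "j \<notin> fst ` set es'" "2 \<le> j"
  proof -
    have jn: "j \<notin> set (?oP @ ?oQ)" using jj rs unfolding set_append sets by (auto split: if_splits)
    \<comment> \<open>The outer numbers behind the block are the renumbered \<open>j, \<dots>, r - 1\<close>.\<close>
    have "card {x \<in> set (?oP @ ?oQ). \<not> x < j} = card {j..<r}"
    proof (rule bij_betw_same_card[symmetric, of "\<lambda>x. x + s - 1"])
      have "x + s - 1 \<in> set (?oP @ ?oQ)" if "x \<in> {j..<r}" for x
      proof -
        have "x \<in> set (map fst es' @ map snd fs')" unfolding d'(2) using that jj by auto
        then consider e where "e \<in> set es'" "x = fst e" | e where "e \<in> set fs'" "x = snd e" by auto
        then show ?thesis
        proof cases
          case 1
          then have "x \<noteq> j" using jj by auto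
          then show ?thesis using 1 that unfolding set_append sets by (intro UnI1 image_eqI[of _ _ e]) auto
        next
          case 2
          then show ?thesis using that unfolding set_append sets by (intro UnI2 image_eqI[of _ _ e]) auto
        qed
      qed
      moreover have "\<exists>x\<in>{j..<r}. y = x + s - 1" if y: "y \<in> set (?oP @ ?oQ)" "\<not> y < j" for y
      proof -
        have "y \<noteq> j" using y jn by blast
        have "y \<in> set ?oP \<or> y \<in> set ?oQ" using y by auto
        then show ?thesis
        proof
          assume "y \<in> set ?oP"
          then obtain e where e: "e \<in> set es'" "y = (if fst e \<le> j then fst e else fst e + s - 1)" unfolding sets
              by auto
          then show ?thesis using y(2) \<open>y \<noteq> j\<close> es'[of e] by (intro bexI[of _ "fst e"]) (auto split: if_splits)
        next
          assume "y \<in> set ?oQ"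
          then obtain e where e: "e \<in> set fs'" "y = (if snd e < j then snd e else snd e + s - 1)" unfolding sets
              by auto
          then show ?thesis using y(2) fs'[of e] by (intro bexI[of _ "snd e"]) (auto split: if_splits)
        qed
      qed
      ultimately show "bij_betw (\<lambda>x. x + s - 1) {j..<r} {x \<in> set (?oP @ ?oQ). \<not> x < j}"
        unfolding bij_betw_def using rs by (intro conjI inj_onI equalityI subsetI) (auto simp del: set_append
            set_map)
    qed
    then have cnt: "card {x \<in> set (?oP @ ?oQ). \<not> x < j} = r - j" by simp
    have bl: "x < y \<longleftrightarrow> x < j" if "x \<in> set (?oP @ ?oQ)" "y \<in> set (j # ?iP @ ?iQ)" for x y
    proof -
      have "x \<noteq> j" using that(1) jn by metis
      moreover have "j < y \<and> y < j + s - 1 \<or> y = j" using that(2) in_block[of y] by auto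
      ultimately show ?thesis using out_block[OF that(1)] rs by auto
    qed
    have "perm_sign (map fst (new_edge j s # oe es' @ ie es'') @ map snd (oe fs' @ ie fs'')) =
        perm_sign ([j] @ ?oP @ ?iP @ ?oQ @ ?iQ)" by (simp add: new_edge_def)
    also have "\<dots> = (-1) ^ (length es'' * length fs') * perm_sign ([j] @ (?oP @ ?oQ) @ ?iP @ ?iQ)"
      by (rule swap)
    also have "perm_sign ([j] @ (?oP @ ?oQ) @ ?iP @ ?iQ) =
        (-1) ^ (r - 2) * perm_sign ((?oP @ ?oQ) @ [j] @ ?iP @ ?iQ)"
      using perm_sign_swap_middle[of "[j]" "?oP @ ?oQ" "[]" "?iP @ ?iQ"] jn len
          by (simp add: oe_def del: perm_sign.simps)
    also have "(-1::int) ^ (r - 2) = (-1) ^ r" using rs by (intro minus_one_power_cong) auto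
    also have "perm_sign ((?oP @ ?oQ) @ [j] @ ?iP @ ?iQ) =
        perm_sign (?oP @ ?oQ) * perm_sign (j # ?iP @ ?iQ) * (-1) ^ ((r - j) * (s - 1))"
    proof -
      have "length (j # ?iP @ ?iQ) = s - 1" using len rs by (simp add: ie_def)
      then show ?thesis
        using perm_sign_block[of "?oP @ ?oQ" "j # ?iP @ ?iQ" "\<lambda>x. x < j", OF bl dist] cnt by simp
    qed
    also have "perm_sign (j # ?iP @ ?iQ) = perm_sign (?iP @ ?iQ)"
    proof -
      have "(\<Prod>y\<leftarrow>?iP @ ?iQ. if j < y then 1 else (-1::int)) = (\<Prod>y\<leftarrow>?iP @ ?iQ. 1)"
        using in_block by (intro arg_cong[where f = prod_list] map_cong) auto
      also have "\<dots> = 1"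
      proof -
        have "(\<Prod>y\<leftarrow>zs. 1::int) = 1" for zs :: "nat list" by (induction zs) auto
        then show ?thesis .
      qed
      finally show ?thesis by simp
    qed
    finally show ?thesis by (simp only: osign isign power_add ac_simps)
  qed
  show ?B if jj: "j \<notin> snd ` set fs'" "j < r"
  proof -
    let ?z = "j + s - 1"
    have ne: "snd e < j \<or> j < snd e" if "e \<in> set fs'" for e
        using jj that by (cases "snd e" j rule: linorder_cases) auto
    have jn: "?z \<notin> set (?oP @ ?oQ)"
    proof
      assume "?z \<in> set (?oP @ ?oQ)"
      then have "?z \<in> set ?oP \<or> ?z \<in> set ?oQ" by simp
      then show False
      proof
        assume "?z \<in> set ?oP"
        then show False unfolding sets using rs by (auto split: if_splits)
      next
        assume "?z \<in> set ?oQ"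
        then obtain e where e: "e \<in> set fs'" "?z = (if snd e < j then snd e else snd e + s - 1)" unfolding sets
            by auto
        then show False using ne[of e] rs by (auto split: if_splits)
      qed
    qed
    \<comment> \<open>Now \<open>j\<close> itself, if it occurs, lies before the block.\<close>
    have "card {x \<in> set (?oP @ ?oQ). \<not> x \<le> j} = card {Suc j..<r}"
    proof (rule bij_betw_same_card[symmetric, of "\<lambda>x. x + s - 1"])
      have "x + s - 1 \<in> set (?oP @ ?oQ)" if "x \<in> {Suc j..<r}" for x
      proof -
        have "x \<in> set (map fst es' @ map snd fs')" unfolding d'(2) using that j by auto
        then consider e where "e \<in> set es'" "x = fst e" | e where "e \<in> set fs'" "x = snd e" by auto
        then show ?thesis
        proof cases
          case 1
          then show ?thesis using that unfolding set_append sets by (intro UnI1 image_eqI[of _ _ e]) auto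
        next
          case 2
          then show ?thesis using that unfolding set_append sets by (intro UnI2 image_eqI[of _ _ e]) auto
        qed
      qed
      moreover have "\<exists>x\<in>{Suc j..<r}. y = x + s - 1" if y: "y \<in> set (?oP @ ?oQ)" "\<not> y \<le> j" for y
      proof -
        have "y \<in> set ?oP \<or> y \<in> set ?oQ" using y by auto
        then show ?thesis
        proof
          assume "y \<in> set ?oP"
          then obtain e where e: "e \<in> set es'" "y = (if fst e \<le> j then fst e else fst e + s - 1)" unfolding sets
              by auto
          then show ?thesis using y(2) es'[of e] by (intro bexI[of _ "fst e"]) (auto split: if_splits)
        next
          assume "y \<in> set ?oQ"
          then obtain e where e: "e \<in> set fs'" "y = (if snd e < j then snd e else snd e + s - 1)" unfolding sets
              by auto
          moreover have "snd e \<noteq> j" using e jj by auto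
          ultimately show ?thesis using y(2) fs'[of e] by (intro bexI[of _ "snd e"]) (auto split: if_splits)
        qed
      qed
      ultimately show "bij_betw (\<lambda>x. x + s - 1) {Suc j..<r} {x \<in> set (?oP @ ?oQ). \<not> x \<le> j}"
        unfolding bij_betw_def using rs by (intro conjI inj_onI equalityI subsetI) (auto simp del: set_append
            set_map)
    qed
    then have cnt: "card {x \<in> set (?oP @ ?oQ). \<not> x \<le> j} = r - 1 - j" by simp
    have bl: "x < y \<longleftrightarrow> x \<le> j" if "x \<in> set (?oP @ ?oQ)" "y \<in> set (?iP @ ?iQ @ [?z])" for x y
    proof (cases "y = ?z")
      case True
      have "x \<noteq> ?z" using that(1) jn by metis
      then show ?thesis using True out_block[OF that(1)] rs by auto
    next
      case False
      then have "j < y \<and> y < j + s - 1" using that(2) in_block[of y] by auto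
      then show ?thesis using out_block[OF that(1)] by auto
    qed
    have "perm_sign (map fst (oe es' @ ie es'') @ map snd (oe fs' @ ie fs'' @ [new_edge j s])) =
        perm_sign ([] @ ?oP @ ?iP @ ?oQ @ ?iQ @ [?z])" by (simp add: new_edge_def)
    also have "\<dots> = (-1) ^ (length es'' * length fs') * perm_sign ([] @ (?oP @ ?oQ) @ ?iP @ ?iQ @ [?z])"
      by (rule swap)
    also have "perm_sign ([] @ (?oP @ ?oQ) @ ?iP @ ?iQ @ [?z]) =
        perm_sign (?oP @ ?oQ) * perm_sign (?iP @ ?iQ @ [?z]) * (-1) ^ ((r - 1 - j) * (s - 1))"
    proof -
      have "length (?iP @ ?iQ @ [?z]) = s - 1" using len rs by (simp add: ie_def)
      then show ?thesis
        using perm_sign_block[of "?oP @ ?oQ" "?iP @ ?iQ @ [?z]" "\<lambda>x. x \<le> j", OF bl dist] cnt by simp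
    qed
    also have "perm_sign (?iP @ ?iQ @ [?z]) = perm_sign (?iP @ ?iQ)"
    proof -
      have "cross_sign (?iP @ ?iQ) [?z] = 1"
        using cross_sign_block[of "?iP @ ?iQ" "[?z]" "\<lambda>_. True"] in_block by auto
      then show ?thesis using perm_sign_append[of "?iP @ ?iQ" "[?z]"] by simp
    qed
    finally show ?thesis by (simp only: osign isign power_add ac_simps)
  qed
qed

text \<open>
  The constant \<open>c\<close> is the coefficient of the composite of two values of \<open>p\<close>: its first factor
  is the sign in the composition of the associahedra, since the degree of the inner cell is
  the length of \<open>es''\<close>.
\<close>

lemma p_sign_graft:
  assumes d': "distinct (map fst es' @ map snd fs')" "set (map fst es' @ map snd fs') = {2..<r}"
    and d'': "distinct (map fst es'' @ map snd fs'')" "set (map fst es'' @ map snd fs'') = {2..<s}"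
    and j: "1 \<le> j" "j \<le> r" and rs: "2 \<le> r" "2 \<le> s"
  defines "oe \<equiv> map (outer_edge j s)" and "ie \<equiv> map (inner_edge j)"
  defines "c \<equiv> (-1) ^ (r * length es'' + j * (s + 1)) * p_sign r es' fs' * p_sign s es'' fs''"
  shows "j \<notin> fst ` set es' \<Longrightarrow> 2 \<le> j \<Longrightarrow>
      p_sign (r + s - 1) (new_edge j s # oe es' @ ie es'') (oe fs' @ ie fs'') =
          (-1) ^ (length fs' + length fs'') * c"
    and "j \<notin> snd ` set fs' \<Longrightarrow> j < r \<Longrightarrow>
      p_sign (r + s - 1) (oe es' @ ie es'') (oe fs' @ ie fs'' @ [new_edge j s]) = c"
proof -
  have len: "length es' + length fs' + 2 = r" "length es'' + length fs'' + 2 = s"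
    using distinct_card[OF d'(1)] d'(2) distinct_card[OF d''(1)] d''(2) rs by auto
  note [simp del] = perm_sign.simps
  have t: "tri (r + s - 1 - 1) = tri (r - 1) + tri (s - 1) + (r - 1) * (s - 1)"
    using tri_add[of "r - 1" "s - 1"] rs by (simp add: numeral_2_eq_2)
  show "p_sign (r + s - 1) (new_edge j s # oe es' @ ie es'') (oe fs' @ ie fs'') =
      (-1) ^ (length fs' + length fs'') * c"
    if jj: "j \<notin> fst ` set es'" "2 \<le> j"
  proof -
    obtain d where d: "r = j + d" using j by (metis le_add_diff_inverse)
    have "(-1::int) ^ (tri (length es' + length es'' + 2) + tri (r + s - 1 - 1) +
          (length es'' * length fs' + r + (r - j) * (s - 1))) =
        (-1) ^ (length fs' + length fs'' + (r * length es'' + j * (s + 1)) +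
          (tri (length es' + 1) + tri (r - 1)) + (tri (length es'' + 1) + tri (s - 1)))"
    proof (rule minus_one_power_cong)
      have t2: "tri (length es' + length es'' + 2) =
          tri (length es' + 1) + tri (length es'' + 1) + (length es' + 1) * (length es'' + 1)"
        using tri_add[of "length es' + 1" "length es'' + 1"] by (simp add: numeral_2_eq_2)
      have 1: "even ((length es' + 1) * (length es'' + 1) + (r - 1) * (s - 1) + (length es'' *
          length fs' + r + (r - j) * (s - 1)) +
          (length fs' + length fs'' + (r * length es'' + j * (s + 1))))"
      proof -
        have "even (r - j) \<longleftrightarrow> (even r \<longleftrightarrow> even j)" "even (r - 1) \<longleftrightarrow> odd r" "even (s - 1) \<longleftrightarrow> odd s"
          "even r \<longleftrightarrow> (even (length es') \<longleftrightarrow> even (length fs'))" "even s \<longleftrightarrow> (even (length es'') \<longleftrightarrow>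
              even (length fs''))"
          using j rs len by presburger+
        then show ?thesis by auto
      qed
      show "even (tri (length es' + length es'' + 2) + tri (r + s - 1 - 1) +
          (length es'' * length fs' + r + (r - j) * (s - 1)) +
          (length fs' + length fs'' + (r * length es'' + j * (s + 1)) +
          (tri (length es' + 1) + tri (r - 1)) + (tri (length es'' + 1) + tri (s - 1))))"
        using 1 unfolding t t2 by presburger
    qed
    then show ?thesis
      using p_sign_graft_common(1)[OF d' d'' j rs jj]
      by (simp add: p_sign_def c_def oe_def ie_def power_add ac_simps)
  qed
  show "p_sign (r + s - 1) (oe es' @ ie es'') (oe fs' @ ie fs'' @ [new_edge j s]) = c"
    if jj: "j \<notin> snd ` set fs'" "j < r"
  proof -
    have "(-1::int) ^ (tri (length es' + length es'' + 1) + tri (r + s - 1 - 1) +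
          (length es'' * length fs' + (r - 1 - j) * (s - 1))) =
        (-1) ^ ((r * length es'' + j * (s + 1)) +
          (tri (length es' + 1) + tri (r - 1)) + (tri (length es'' + 1) + tri (s - 1)))"
    proof (rule minus_one_power_cong)
      have t2: "tri (length es' + length es'' + 1) =
          tri (length es' + 1) + tri (length es'' + 1) + length es' * length es''"
        using tri_add[of "length es' + 1" "length es''"] by (simp add: tri_Suc)
      have 1: "even (length es' * length es'' + (r - 1) * (s - 1) + (length es'' * length fs' + (r - 1 - j) *
          (s - 1)) +
          (r * length es'' + j * (s + 1)))"
      proof -
        have "even (r - 1 - j) \<longleftrightarrow> (odd r \<longleftrightarrow> even j)" "even (r - 1) \<longleftrightarrow> odd r" "even (s - 1) \<longleftrightarrow> odd s"
          "even r \<longleftrightarrow> (even (length es') \<longleftrightarrow> even (length fs'))" "even s \<longleftrightarrow> (even (length es'') \<longleftrightarrow>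
              even (length fs''))"
          using j rs len jj by presburger+
        then show ?thesis by auto
      qed
      show "even (tri (length es' + length es'' + 1) + tri (r + s - 1 - 1) +
          (length es'' * length fs' + (r - 1 - j) * (s - 1)) +
          ((r * length es'' + j * (s + 1)) +
          (tri (length es' + 1) + tri (r - 1)) + (tri (length es'' + 1) + tri (s - 1))))"
        using 1 unfolding t t2 by presburger
    qed
    then show ?thesis
      using p_sign_graft_common(2)[OF d' d'' j rs jj]
      by (simp add: p_sign_def c_def oe_def ie_def power_add ac_simps)
  qed
qed

section \<open>Left-leaning and right-leaning edges\<close>

lemma binary_wf: "binary S \<Longrightarrow> wf_tree S"
  by (induction S) auto

lemma binary_induct [consumes 1, case_names Leaf Node]:
  assumes "binary S" and "P Leaf"
    and "\<And>L R. binary L \<Longrightarrow> binary R \<Longrightarrow> P L \<Longrightarrow> P R \<Longrightarrow> P (Node [L, R])"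
  shows "P S"
  using assms(1)
proof (induction S)
  case Leaf
  show ?case by (rule assms(2))
next
  case (Node ts)
  then obtain L R where "ts = [L, R]" by (auto simp: length_Suc_conv numeral_2_eq_2)
  then show ?case using Node assms(3) by auto
qed

lemma binary_cases:
  assumes "binary S"
  obtains "S = Leaf" | L R where "S = Node [L, R]" "binary L" "binary R"
proof (cases S)
  case (Node ts)
  then obtain L R where "ts = [L, R]" using assms by (auto simp: length_Suc_conv numeral_2_eq_2)
  then show ?thesis using Node assms that by auto
qed

fun right_leaning_from :: "nat \<Rightarrow> tree \<Rightarrow> edge set" where
  "right_leaning_from a (Node [L, R]) =
     right_leaning_from a L \<union> right_leaning_from (a + leaves L) R \<union>
     (if L = Leaf then {} else {(a, a + leaves L - 1)})"
| "right_leaning_from a _ = {}"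

definition right_leaning :: "tree \<Rightarrow> edge set" where
  "right_leaning S = right_leaning_from 1 S"

lemma leaves_binary_pos: "binary S \<Longrightarrow> 0 < leaves S"
  using leaves_pos binary_wf by blast

lemma leaning_vertices:
  "binary S \<Longrightarrow> vertices_from a S =
     (if S = Leaf then {} else {(a, a + leaves S - 1)}) \<union> left_leaning_from a S \<union> right_leaning_from a S"
proof (induction S arbitrary: a rule: binary_induct)
  case (Node L R)
  then show ?case by auto
qed auto

lemma leaning_bounds:
  assumes "binary S"
  shows "(p, q) \<in> left_leaning_from a S \<Longrightarrow> a < p \<and> p < q \<and> q < a + leaves S"
    and "(p, q) \<in> right_leaning_from a S \<Longrightarrow> a \<le> p \<and> p < q \<and> Suc q < a + leaves S"
proof -
  have "((p, q) \<in> left_leaning_from a S \<longrightarrow> a < p) \<and> ((p, q) \<in> right_leaning_from a S \<longrightarrow> Suc q < a + leaves S)"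
    using assms
  proof (induction S arbitrary: a rule: binary_induct)
    case (Node L R)
    show ?case
      using leaves_binary_pos[OF Node.hyps(1)] leaves_binary_pos[OF Node.hyps(2)] Node.IH(1)[of a] Node.IH(2)[of
          "a + leaves L"]
      by (auto split: if_splits)
  qed auto
  moreover have "a \<le> p \<and> p < q \<and> q < a + leaves S" if "(p, q) \<in> left_leaning_from a S \<union> right_leaning_from a S"
    using that leaning_vertices[OF assms] vertices_bounds(1)[OF binary_wf[OF assms]] by blast
  ultimately show "(p, q) \<in> left_leaning_from a S \<Longrightarrow> a < p \<and> p < q \<and> q < a + leaves S"
    "(p, q) \<in> right_leaning_from a S \<Longrightarrow> a \<le> p \<and> p < q \<and> Suc q < a + leaves S" by auto
qed

lemma finite_leaning: "binary S \<Longrightarrow> finite (left_leaning_from a S)" "binary S \<Longrightarrow> finite (right_leaning_from a S)"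
  using leaning_vertices[of S a] finite_vertices_from(1)[of a S] by (metis Un_infinite finite_Un)+

lemma inj_on_Un_disjoint:
  "inj_on f A \<Longrightarrow> inj_on f B \<Longrightarrow> f ` A \<inter> f ` B = {} \<Longrightarrow> inj_on f (A \<union> B)"
  by (auto simp: inj_on_Un)

text \<open>
  Consider the leaf \<open>b - 1\<close> left of the root of \<open>[L, R]\<close> and the leaf \<open>b\<close> right of it. The outgoing
  edge of \<open>L\<close> ends at the former, that of \<open>R\<close> starts at the latter; if \<open>L\<close> or \<open>R\<close> is a leaf,
  then the edge is missing, and the leaf is an outermost one. All other names are names of
  edges of \<open>L\<close> or of \<open>R\<close>.
\<close>

lemma leaning_names:
  "binary S \<Longrightarrow> inj_on fst (left_leaning_from a S) \<and> inj_on snd (right_leaning_from a S) \<and>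
     fst ` left_leaning_from a S \<inter> snd ` right_leaning_from a S = {} \<and>
     fst ` left_leaning_from a S \<union> snd ` right_leaning_from a S = {a<..<a + leaves S - 1}"
proof (induction S arbitrary: a rule: binary_induct)
  case (Node L R)
  let ?b = "a + leaves L" and ?e = "a + leaves L + leaves R"
  let ?l = "fst ` left_leaning_from a L" and ?r = "snd ` right_leaning_from a L"
  let ?l' = "fst ` left_leaning_from ?b R" and ?r' = "snd ` right_leaning_from ?b R"
  have pos: "0 < leaves L" "0 < leaves R" using Node leaves_binary_pos by auto
  have LL: "leaves L = 1 \<longleftrightarrow> L = Leaf" "leaves R = 1 \<longleftrightarrow> R = Leaf"
  proof -
    have "leaves T = 1 \<longleftrightarrow> T = Leaf" if T: "binary T" for T
      using T
    proof (cases T rule: binary_cases)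
      case (2 L R)
      then show ?thesis using leaves_binary_pos[of L] leaves_binary_pos[of R] by simp
    qed simp
    then show "leaves L = 1 \<longleftrightarrow> L = Leaf" "leaves R = 1 \<longleftrightarrow> R = Leaf" using Node by auto
  qed
  have L: "?l \<union> ?r = {a<..<?b - 1}" "?l \<inter> ?r = {}" and R: "?l' \<union> ?r' = {?b<..<?e - 1}" "?l' \<inter> ?r' = {}"
    using Node by auto
  have Lb: "a < x \<and> x < ?b - 1" if "x \<in> ?l \<or> x \<in> ?r" for x
  proof -
    have "x \<in> ?l \<union> ?r" using that by blast
    then show ?thesis unfolding L(1) by simp
  qed
  have Rb: "?b < x \<and> x < ?e - 1" if "x \<in> ?l' \<or> x \<in> ?r'" for x
  proof -
    have "x \<in> ?l' \<union> ?r'" using that by blast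
    then show ?thesis unfolding R(1) by simp
  qed
  define X where "X = (if R = Leaf then {} else {(?b, ?e - 1)})"
  define Y where "Y = (if L = Leaf then {} else {(a, ?b - 1)})"
  have l: "left_leaning_from a (Node [L, R]) = left_leaning_from a L \<union> left_leaning_from ?b R \<union> X"
    and r: "right_leaning_from a (Node [L, R]) = right_leaning_from a L \<union> right_leaning_from ?b R \<union> Y"
    by (simp_all add: X_def Y_def)
  have X: "fst ` X = (if R = Leaf then {} else {?b})" "inj_on fst X" by (auto simp: X_def)
  have Y: "snd ` Y = (if L = Leaf then {} else {?b - 1})" "inj_on snd Y" by (auto simp: Y_def)
  define lL rL lR rR where d: "lL = ?l" "rL = ?r" "lR = ?l'" "rR = ?r'"
  have XD: "x = ?b" if "x \<in> fst ` X" for x using that unfolding X by (auto split: if_splits)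
  have YD: "x = ?b - 1" if "x \<in> snd ` Y" for x using that unfolding Y by (auto split: if_splits)
  have D: "x \<in> lL \<Longrightarrow> a < x \<and> x < ?b - 1" "x \<in> rL \<Longrightarrow> a < x \<and> x < ?b - 1"
    "x \<in> lR \<Longrightarrow> ?b < x \<and> x < ?e - 1" "x \<in> rR \<Longrightarrow> ?b < x \<and> x < ?e - 1"
    "x \<in> fst ` X \<Longrightarrow> ?b - 1 < x \<and> x = ?b" "x \<in> snd ` Y \<Longrightarrow> x = ?b - 1 \<and> x < ?b" for x
    unfolding d by (rule Lb, blast, rule Lb, blast, rule Rb, blast, rule Rb, blast, drule XD, use pos in
        linarith, drule YD, use pos in linarith)
  have dj: "A \<inter> B = {}" if "\<And>x. x \<in> A \<Longrightarrow> x \<in> B \<Longrightarrow> False" for A B :: "nat set" using that by blast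
  have c1: "lL \<inter> lR = {}" "lL \<inter> fst ` X = {}" "lR \<inter> fst ` X = {}"
    by (rule dj, (drule D)+, linarith)+
  have c2: "rL \<inter> rR = {}" "rL \<inter> snd ` Y = {}" "rR \<inter> snd ` Y = {}"
    by (rule dj, (drule D)+, linarith)+
  have c3: "lL \<inter> rR = {}" "lR \<inter> rL = {}" "fst ` X \<inter> rL = {}" "fst ` X \<inter> rR = {}" "fst ` X \<inter> snd ` Y = {}"
    "lL \<inter> snd ` Y = {}" "lR \<inter> snd ` Y = {}"
    by (rule dj, (drule D)+, linarith)+
  have c4: "lL \<inter> rL = {}" "lR \<inter> rR = {}" using L(2) R(2) unfolding d .
  have IH: "inj_on fst (left_leaning_from a L)" "inj_on snd (right_leaning_from a L)"
    "inj_on fst (left_leaning_from ?b R)" "inj_on snd (right_leaning_from ?b R)" using Node.IH by blast+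
  have "inj_on fst (left_leaning_from a (Node [L, R]))"
    unfolding l by (intro inj_on_Un_disjoint IH X) (use c1 in \<open>simp_all add: d image_Un Int_Un_distrib2\<close>)
  moreover have "inj_on snd (right_leaning_from a (Node [L, R]))"
    unfolding r by (intro inj_on_Un_disjoint IH Y) (use c2 in \<open>simp_all add: d image_Un Int_Un_distrib2\<close>)
  moreover have "(lL \<union> lR \<union> fst ` X) \<inter> (rL \<union> rR \<union> snd ` Y) = {}"
    using c3 c4 by (simp add: Int_Un_distrib Int_Un_distrib2)
  moreover have "(lL \<union> lR \<union> fst ` X) \<union> (rL \<union> rR \<union> snd ` Y) = {a<..<?e - 1}"
  proof -
    have "(lL \<union> lR \<union> fst ` X) \<union> (rL \<union> rR \<union> snd ` Y) = (lL \<union> rL) \<union> (lR \<union> rR) \<union> (fst ` X \<union> snd ` Y)"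
      by (simp only: Un_ac)
    also have "\<dots> = {a<..<?b - 1} \<union> {?b<..<?e - 1} \<union> (fst ` X \<union> snd ` Y)"
      using L(1) R(1) by (simp only: d)
    also have "\<dots> = {a<..<?e - 1}"
    proof (cases "L = Leaf"; cases "R = Leaf")
    qed (use pos LL in \<open>auto simp: X Y\<close>)
    finally show ?thesis .
  qed
  ultimately show ?case unfolding l r image_Un d by (simp add: add.assoc)
qed auto

text \<open>
  Climb from a left-leaning edge to its parent until the edge is not left-leaning: the last leaf
  never changes, and the first leaf decreases.
\<close>

lemma left_leaning_parent:
  "binary S \<Longrightarrow> (p, q) \<in> left_leaning_from a S \<Longrightarrow>
     \<exists>p'<p. (p', q) \<in> insert (a, a + leaves S - 1) (right_leaning_from a S)"
proof (induction S arbitrary: a rule: binary_induct)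
  case (Node L R)
  have pos: "0 < leaves L" "0 < leaves R" using Node leaves_binary_pos by auto
  consider "(p, q) \<in> left_leaning_from a L" | "(p, q) \<in> left_leaning_from (a + leaves L) R" |
    "(p, q) = (a + leaves L, a + leaves L + leaves R - 1)" using Node.prems by (auto split: if_splits)
  then show ?case
  proof cases
    case 1
    then have "L \<noteq> Leaf" by auto
    then show ?thesis using Node.IH(1)[OF 1] by auto
  next
    case 2
    then obtain p' where "p' < p" and "(p', q) \<in> insert (a + leaves L, a + leaves L +
        leaves R - 1) (right_leaning_from (a + leaves L) R)"
      using Node.IH(2) by blast
    show ?thesis
    proof (cases "(p', q) \<in> right_leaning_from (a + leaves L) R")
      case True
      then show ?thesis using \<open>p' < p\<close> by (intro exI[of _ p']) simp
    next
      case False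
      then have "q = a + leaves (Node [L, R]) - 1"
        using \<open>(p', q) \<in> insert _ _\<close> by (simp add: add.assoc)
      moreover have "a < p" using leaning_bounds(1)[OF Node.hyps(2) 2] by simp
      ultimately show ?thesis by (intro exI[of _ a]) simp
    qed
  next
    case 3
    then show ?thesis using pos by (intro exI[of _ a]) (auto simp: add.assoc)
  qed
qed auto

lemma left_right_disjoint: "binary S \<Longrightarrow> left_leaning_from a S \<inter> right_leaning_from a S = {}"
proof (intro equals0I)
  fix x assume S: "binary S" and x: "x \<in> left_leaning_from a S \<inter> right_leaning_from a S"
  obtain p q where pq: "x = (p, q)" by fastforce
  obtain p' where p': "p' < p" "(p', q) \<in> insert (a, a + leaves S - 1) (right_leaning_from a S)"
    using left_leaning_parent[OF S] x pq by blast
  have q: "Suc q < a + leaves S" using leaning_bounds(2)[OF S, of p q a] x pq by auto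
  then have "(p', q) \<in> right_leaning_from a S" using p' by auto
  then have "(p', q) = (p, q)"
    using leaning_names[OF S, of a] x pq inj_onD[of snd "right_leaning_from a S" "(p', q)" "(p, q)"] by simp
  then show False using p' by simp
qed

lemma leaning_edges:
  assumes "binary S" "2 \<le> leaves S"
  shows "edges S = left_leaning S \<union> right_leaning S" "left_leaning S \<inter> right_leaning S = {}"
    "finite (left_leaning S)" "finite (right_leaning S)"
    "inj_on fst (left_leaning S)" "inj_on snd (right_leaning S)"
    "fst ` left_leaning S \<inter> snd ` right_leaning S = {}"
    "fst ` left_leaning S \<union> snd ` right_leaning S = {2..<leaves S}"
    "card (left_leaning S) + card (right_leaning S) = leaves S - 2"
proof -
  have S: "S \<noteq> Leaf" using assms by auto
  have "(1, leaves S) \<notin> left_leaning S" "(1, leaves S) \<notin> right_leaning S"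
    using leaning_bounds[OF assms(1), of 1 "leaves S" 1] by (auto simp: left_leaning_def right_leaning_def)
  then show "edges S = left_leaning S \<union> right_leaning S"
    using leaning_vertices[OF assms(1), of 1] S by (auto simp: edges_def left_leaning_def right_leaning_def)
  show "left_leaning S \<inter> right_leaning S = {}"
    using left_right_disjoint[OF assms(1)] by (simp add: left_leaning_def right_leaning_def)
  show 1: "finite (left_leaning S)" "finite (right_leaning S)"
    using finite_leaning[OF assms(1)] by (simp_all add: left_leaning_def right_leaning_def)
  show 2: "inj_on fst (left_leaning S)" "inj_on snd (right_leaning S)"
    "fst ` left_leaning S \<inter> snd ` right_leaning S = {}"
    using leaning_names[OF assms(1), of 1] by (simp_all add: left_leaning_def right_leaning_def)
  have "{1<..<leaves S} = {2..<leaves S}" by auto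
  then show 3: "fst ` left_leaning S \<union> snd ` right_leaning S = {2..<leaves S}"
    using leaning_names[OF assms(1), of 1] by (simp add: left_leaning_def right_leaning_def)
  show "card (left_leaning S) + card (right_leaning S) = leaves S - 2"
    using card_Un_disjoint[OF _ _ 2(3)] 1 3 card_image[OF 2(1)] card_image[OF 2(2)] by simp
qed

text \<open>
  Leaf \<open>i\<close> is the right child of its parent, so that the new edge of a graft at \<open>i\<close> is left-leaning.
\<close>

fun right_leaf :: "tree \<Rightarrow> nat \<Rightarrow> bool" where
  "right_leaf (Node [L, R]) i =
     (if i \<le> leaves L then right_leaf L i else R = Leaf \<or> right_leaf R (i - leaves L))"
| "right_leaf _ i = False"

lemma left_leaning_shift:
  "binary S \<Longrightarrow> left_leaning_from (a + d) S = (\<lambda>(p, q). (p + d, q + d)) ` left_leaning_from a S"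
proof (induction S arbitrary: a rule: binary_induct)
  case (Node L R)
  have e: "a + d + leaves L = a + leaves L + d" by simp
  show ?case using Node leaves_binary_pos[of R]
    unfolding left_leaning_from.simps e by (auto simp: image_Un)
qed auto

lemma graft_binary:
  assumes "binary S" "binary S'" "1 \<le> i" "i \<le> leaves S"
  shows "binary (graft S i S')"
  using assms
proof (induction S arbitrary: i rule: binary_induct)
qed (auto simp: not_le)

lemma left_leaning_graft:
  assumes "binary S" "binary S'" "S' \<noteq> Leaf" "1 \<le> i" "i \<le> leaves S" "1 \<le> a"
  shows "left_leaning_from a (graft S i S') =
    outer_edge (a + i - 1) (leaves S') ` left_leaning_from a S \<union> left_leaning_from (a + i - 1) S' \<union>
    (if right_leaf S i then {new_edge (a + i - 1) (leaves S')} else {})"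
  using assms(1,4,5,6)
proof (induction S arbitrary: i a rule: binary_induct)
  case (Node L R)
  let ?b = "a + leaves L" and ?s = "leaves S'"
  have pos: "0 < leaves L" "0 < leaves R" "0 < ?s" using Node assms leaves_binary_pos by auto
  define X where "X a = (if R = Leaf then {} else {(a, a + leaves R - 1)})" for a
  show ?case
  proof (cases "i \<le> leaves L")
    case True
    have lL: "leaves (graft L i S') = leaves L + ?s - 1"
      using leaves_graft(1)[of L S' i] Node True binary_wf assms by auto
    have "outer_edge (a + i - 1) ?s (p, q) = (p + (?s - 1), q + (?s - 1))"
      if "?b \<le> p" "?b \<le> q" for p q
      using that True Node pos by (auto simp: outer_edge_def)
    then have o: "outer_edge (a + i - 1) ?s v = (\<lambda>(p, q). (p + (?s - 1), q + (?s - 1))) v"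
        if "?b \<le> fst v" "?b \<le> snd v" for v
      using that by (cases v) auto
    have "outer_edge (a + i - 1) ?s ` left_leaning_from ?b R =
        (\<lambda>(p, q). (p + (?s - 1), q + (?s - 1))) ` left_leaning_from ?b R"
      using leaning_bounds(1)[OF Node.hyps(2), of _ _ ?b] by (intro image_cong refl o) fastforce+
    also have "\<dots> = left_leaning_from (?b + (?s - 1)) R"
      by (rule left_leaning_shift[OF Node.hyps(2), symmetric])
    also have "?b + (?s - 1) = a + leaves (graft L i S')" using lL pos by simp
    finally have R: "left_leaning_from (a + leaves (graft L i S')) R =
        outer_edge (a + i - 1) ?s ` left_leaning_from ?b R" by simp
    have X: "X (a + leaves (graft L i S')) = outer_edge (a + i - 1) ?s ` X ?b"
      using lL pos o[of "(?b, ?b + leaves R - 1)"] by (auto simp: X_def)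
    have "left_leaning_from a (graft (Node [L, R]) i S') =
        left_leaning_from a (graft L i S') \<union> left_leaning_from (a + leaves (graft L i S')) R \<union> X (a +
            leaves (graft L i S'))"
      using True by (simp add: X_def)
    also have "left_leaning_from a (graft L i S') =
        outer_edge (a + i - 1) (leaves S') ` left_leaning_from a L \<union> left_leaning_from (a + i - 1) S' \<union>
        (if right_leaf L i then {new_edge (a + i - 1) (leaves S')} else {})"
      using Node True by blast
    finally show ?thesis using True unfolding R X by (simp add: X_def image_Un Un_ac)
  next
    case False
    have bnd: "p < ?b" "q < ?b" if "(p, q) \<in> left_leaning_from a L" for p q
      using leaning_bounds(1)[OF Node.hyps(1) that] by auto
    have "outer_edge (a + i - 1) ?s v = v" if "v \<in> left_leaning_from a L" for v
      using bnd[of "fst v" "snd v"] that False by (auto simp: outer_edge_def prod_eq_iff)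
    then have L: "outer_edge (a + i - 1) ?s ` left_leaning_from a L = left_leaning_from a L" by simp
    have ii: "?b + (i - leaves L) - 1 = a + i - 1" using False by simp
    have IH: "left_leaning_from ?b (graft R (i - leaves L) S') =
        outer_edge (a + i - 1) ?s ` left_leaning_from ?b R \<union> left_leaning_from (a + i - 1) S' \<union>
        (if right_leaf R (i - leaves L) then {new_edge (a + i - 1) ?s} else {})"
      using Node.IH(2)[of "i - leaves L" ?b] Node.prems False unfolding ii by auto
    have lR: "leaves (graft R (i - leaves L) S') = leaves R + ?s - 1"
      using leaves_graft(1)[of R S' "i - leaves L"] Node False binary_wf assms by auto
    show ?thesis
    proof (cases "R = Leaf")
      case True
      then have i: "i = leaves L + 1" using Node.prems False by auto
      show ?thesis using True False L assms(3) i
        by (auto simp: new_edge_def)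
    next
      case R: False
      then have gR: "graft R (i - leaves L) S' \<noteq> Leaf"
        by (cases R) auto
      have x: "outer_edge (a + i - 1) ?s (?b, ?b + leaves R - 1) =
          (?b, ?b + leaves (graft R (i - leaves L) S') - 1)"
        using False Node.prems pos lR by (auto simp: outer_edge_def)
      have e1: "left_leaning_from a (graft (Node [L, R]) i S') = left_leaning_from a L \<union>
          left_leaning_from ?b (graft R (i - leaves L) S') \<union> {(?b, ?b +
              leaves (graft R (i - leaves L) S') - 1)}"
      proof -
        have "i - leaves L \<le> leaves R" using Node.prems by simp
        then show ?thesis using False gR by simp
      qed
      have e2: "left_leaning_from a (Node [L, R]) =
          left_leaning_from a L \<union> left_leaning_from ?b R \<union> {(?b, ?b + leaves R - 1)}"
        using R by simp
      have e3: "right_leaf (Node [L, R]) i = right_leaf R (i - leaves L)" using False R by simp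
      show ?thesis unfolding e1 e2 e3 IH image_Un L image_insert image_empty x by (simp only: Un_ac)
    qed
  qed
qed auto

text \<open>
  The leaf numbers at which the new edge of a graft gets its name are free: a leaf that is a right
  child is no first leaf of a left-leaning edge, and a left child is no last leaf of a
  right-leaning edge.
\<close>

lemma right_leaf_names:
  assumes "binary S" "1 \<le> i" "i \<le> leaves S"
  shows "right_leaf S i \<Longrightarrow> 2 \<le> i \<and> a + i - 1 \<notin> fst ` left_leaning_from a S"
    and "\<not> right_leaf S i \<Longrightarrow> (S \<noteq> Leaf \<longrightarrow> i < leaves S) \<and> a + i - 1 \<notin> snd ` right_leaning_from a S"
proof -
  have "(right_leaf S i \<longrightarrow> 2 \<le> i \<and> a + i - 1 \<notin> fst ` left_leaning_from a S) \<and>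
    (\<not> right_leaf S i \<longrightarrow> (S \<noteq> Leaf \<longrightarrow> i < leaves S) \<and> a + i - 1 \<notin> snd ` right_leaning_from a S)"
    using assms
  proof (induction S arbitrary: i a rule: binary_induct)
    case (Node L R)
    let ?b = "a + leaves L"
    have pos: "0 < leaves L" "0 < leaves R" using Node leaves_binary_pos by auto
    have lb: "a < x \<and> x < ?b" if "x \<in> fst ` left_leaning_from a L" for x
      using leaning_bounds(1)[OF Node.hyps(1), of _ _ a] that by fastforce
    have lb': "?b < x" if "x \<in> fst ` left_leaning_from ?b R" for x
      using leaning_bounds(1)[OF Node.hyps(2), of _ _ ?b] that by fastforce
    have rb: "Suc x < ?b" if "x \<in> snd ` right_leaning_from a L" for x
      using leaning_bounds(2)[OF Node.hyps(1), of _ _ a] that by fastforce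
    have rb': "?b < x \<and> Suc x < ?b + leaves R" if "x \<in> snd ` right_leaning_from ?b R" for x
      using leaning_bounds(2)[OF Node.hyps(2), of _ _ ?b] that by fastforce
    show ?case
    proof (cases "i \<le> leaves L")
      case True
      have IH: "right_leaf L i \<longrightarrow> 2 \<le> i \<and> a + i - 1 \<notin> fst ` left_leaning_from a L"
        "\<not> right_leaf L i \<longrightarrow> (L \<noteq> Leaf \<longrightarrow> i < leaves L) \<and> a + i - 1 \<notin> snd ` right_leaning_from a L"
        using Node.IH(1)[of i a] Node.prems True by auto
      have n: "a + i - 1 \<notin> fst ` left_leaning_from ?b R" "a + i - 1 \<noteq> ?b" "a +
          i - 1 \<notin> snd ` right_leaning_from ?b R"
      proof -
        have "\<not> ?b < a + i - 1" using True by linarith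
        then show "a + i - 1 \<notin> fst ` left_leaning_from ?b R" "a + i - 1 \<notin> snd ` right_leaning_from ?b R"
          using lb'[of "a + i - 1"] rb'[of "a + i - 1"] by blast+
        show "a + i - 1 \<noteq> ?b" using True Node.prems by linarith
      qed
      show ?thesis
      proof (cases "right_leaf L i")
        case r: True
        then show ?thesis using IH n True by (simp add: image_Un)
      next
        case r: False
        then have "L \<noteq> Leaf \<longrightarrow> a + i - 1 \<noteq> ?b - 1" using IH Node.prems by auto
        then show ?thesis using r IH n True pos by (simp add: image_Un)
      qed
    next
      case False
      have ii: "?b + (i - leaves L) - 1 = a + i - 1" using False by simp
      have IH: "right_leaf R (i - leaves L) \<longrightarrow> 2 \<le> i - leaves L \<and> a + i - 1 \<notin> fst ` left_leaning_from ?b R"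
        "\<not> right_leaf R (i - leaves L) \<longrightarrow> (R \<noteq> Leaf \<longrightarrow> i - leaves L < leaves R) \<and>
            a + i - 1 \<notin> snd ` right_leaning_from ?b R"
        using Node.IH(2)[of "i - leaves L" ?b] Node.prems False unfolding ii by auto
      have n: "a + i - 1 \<notin> fst ` left_leaning_from a L" "a + i - 1 \<notin> snd ` right_leaning_from a L" "a +
          i - 1 \<noteq> ?b - 1"
      proof -
        have "\<not> a + i - 1 < ?b" "\<not> Suc (a + i - 1) < ?b" using False by linarith+
        then show "a + i - 1 \<notin> fst ` left_leaning_from a L" "a + i - 1 \<notin> snd ` right_leaning_from a L"
          using lb[of "a + i - 1"] rb[of "a + i - 1"] by blast+
        show "a + i - 1 \<noteq> ?b - 1" using False pos by linarith
      qed
      show ?thesis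
      proof (cases "R = Leaf")
        case True
        then show ?thesis using n False pos by (auto simp: image_Un)
      next
        case R: False
        have "right_leaf R (i - leaves L) \<longrightarrow> a + i - 1 \<noteq> ?b" using IH False by auto
        then show ?thesis using R IH n False pos by (auto simp: image_Un)
      qed
    qed
  qed auto
  then show "right_leaf S i \<Longrightarrow> 2 \<le> i \<and> a + i - 1 \<notin> fst ` left_leaning_from a S"
    "\<not> right_leaf S i \<Longrightarrow> (S \<noteq> Leaf \<longrightarrow> i < leaves S) \<and> a + i - 1 \<notin> snd ` right_leaning_from a S" by auto
qed

section \<open>The standard orientation of a binary tree\<close>

lemma orientation_sign_reorder:
  "distinct es \<Longrightarrow> distinct fs \<Longrightarrow> distinct es' \<Longrightarrow> distinct fs' \<Longrightarrow> set es = set es' \<Longrightarrow> set fs = set fs' \<Longrightarrow>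
    inj_on fst (set es) \<Longrightarrow> inj_on snd (set fs) \<Longrightarrow>
    list_sign (es @ fs) * perm_sign (map fst es @ map snd fs) =
    list_sign (es' @ fs') * perm_sign (map fst es' @ map snd fs')"
proof -
  assume a: "distinct es" "distinct fs" "distinct es'" "distinct fs'" "set es = set es'" "set fs = set fs'"
    "inj_on fst (set es)" "inj_on snd (set fs)"
  have 1: "cross_sign es fs = cross_sign es' fs'" by (rule cross_sign_set) (use a in auto)
  have 2: "cross_sign (map fst es) (map snd fs) = cross_sign (map fst es') (map snd fs')"
    by (rule cross_sign_set) (use a in \<open>auto simp: distinct_map\<close>)
  have 3: "perm_sign (map fst es) * perm_sign es = perm_sign (map fst es') * perm_sign es'"
    using a by (intro perm_sign_reorder) auto
  have 4: "perm_sign (map snd fs) * perm_sign fs = perm_sign (map snd fs') * perm_sign fs'"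
    using a by (intro perm_sign_reorder) auto
  have "list_sign (es @ fs) * perm_sign (map fst es @ map snd fs) =
      (perm_sign (map fst es) * perm_sign es) * (perm_sign (map snd fs) * perm_sign fs) *
      (cross_sign es fs * cross_sign (map fst es) (map snd fs))"
    by (simp add: list_sign_perm_sign perm_sign_append ac_simps)
  also have "\<dots> = list_sign (es' @ fs') * perm_sign (map fst es' @ map snd fs')"
    unfolding 1 2 3 4 by (simp add: list_sign_perm_sign perm_sign_append ac_simps)
  finally show ?thesis .
qed

text \<open>
  Up to a sign depending on the number of left-leaning edges, the orientation is the wedge of all
  edges in the order of their numbers. The formulation with lists grouped by the direction of
  the edges does not depend on the choice of the lists (\<open>orientation_sign_reorder\<close>).
\<close>

definition canopy_orientation :: "tree \<Rightarrow> orientation \<Rightarrow> bool" where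
  "canopy_orientation S \<omega> \<longleftrightarrow>
     (\<exists>es fs. distinct es \<and> distinct fs \<and> set es = left_leaning S \<and> set fs = right_leaning S \<and>
        orientation_sign \<omega> * list_sign (es @ fs) * perm_sign (map fst es @ map snd fs) =
        (-1) ^ (length es + tri (leaves S - 1)))"

lemma Diff_Un_disjoint:
  "A' \<subseteq> A \<Longrightarrow> B' \<subseteq> B \<Longrightarrow> A \<inter> B = {} \<Longrightarrow> z \<notin> A \<Longrightarrow> z \<notin> B \<Longrightarrow>
    (A \<union> B \<union> {z}) - (A' \<union> B' \<union> (if c then {z} else {})) = (A - A') \<union> (B - B') \<union> (if c then {} else {z})"
  by (cases c) (simp_all, blast+)

lemma leaning_graft:
  assumes "binary S" "binary S'" "2 \<le> leaves S" "2 \<le> leaves S'" "1 \<le> i" "i \<le> leaves S"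
  shows "left_leaning (graft S i S') = outer_edge i (leaves S') ` left_leaning S \<union> inner_edge i ` left_leaning
      S' \<union>
      (if right_leaf S i then {new_edge i (leaves S')} else {})" (is ?A)
    and "right_leaning (graft S i S') = outer_edge i (leaves S') ` right_leaning S \<union> inner_edge i `
        right_leaning S' \<union>
      (if right_leaf S i then {} else {new_edge i (leaves S')})" (is ?B)
proof -
  let ?o = "outer_edge i (leaves S')" and ?n = "inner_edge i" and ?z = "new_edge i (leaves S')"
  have "left_leaning_from i S' = ?n ` left_leaning S'"
    using left_leaning_shift[OF assms(2), of 1 "i - 1"] assms(5)
    by (auto simp: left_leaning_def inner_edge_def split_def intro!: image_cong)
  moreover have "S' \<noteq> Leaf" using assms by auto
  ultimately show A: ?A
    using left_leaning_graft[OF assms(1,2) _ assms(5,6), of 1] assms by (simp add: left_leaning_def)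
  have g: "binary (graft S i S')" "2 \<le> leaves (graft S i S')"
    using graft_binary[OF assms(1,2,5,6)] leaves_graft(1)[of S S' i] assms binary_wf by auto
  note eg = edges_graft[OF binary_wf[OF assms(1)] binary_wf[OF assms(2)] assms(5,6,3,4)]
  note lg = leaning_edges[OF g] and lS = leaning_edges[OF assms(1,3)] and lS' = leaning_edges[OF assms(2,4)]
  have inj: "inj ?o" "inj ?n" using inj_outer_edge inj_inner_edge assms by auto
  have "right_leaning (graft S i S') = edges (graft S i S') - left_leaning (graft S i S')"
    using lg(1,2) by blast
  also have "\<dots> = (?o ` edges S \<union> ?n ` edges S' \<union> {?z}) - (?o ` left_leaning S \<union> ?n ` left_leaning S' \<union> (if
      right_leaf S i then {?z} else {}))"
    unfolding eg(1) A ..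
  also have "\<dots> = ?o ` (edges S - left_leaning S) \<union> ?n ` (edges S' - left_leaning S') \<union> (if right_leaf S i then
      {} else {?z})"
  proof -
    have sub: "?o ` left_leaning S \<subseteq> ?o ` edges S" "?n ` left_leaning S' \<subseteq> ?n ` edges S'"
      using lS(1) lS'(1) by blast+
    show ?thesis unfolding image_set_diff[OF inj(1)] image_set_diff[OF inj(2)]
      by (rule Diff_Un_disjoint[OF sub eg(2-4)])
  qed
  also have "edges S - left_leaning S = right_leaning S" using lS(1,2) by blast
  also have "edges S' - left_leaning S' = right_leaning S'" using lS'(1,2) by blast
  finally show ?B .
qed

text \<open>
  The composition of the associahedra has sign exponent \<open>i (s + 1)\<close> in degree 0. The number of
  the new edge is one end of the block that replaces leaf \<open>i\<close>: the first one if the new edge is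
  left-leaning, the last one otherwise. In both cases the total exponent changes by
  \<open>(r - 1) (s - 1)\<close>, in accordance with \<open>tri_add\<close>, plus one in the former case.
\<close>

lemma canopy_orientation_graft:
  assumes S: "binary S" "2 \<le> leaves S" "orients \<omega> (edges S)" "canopy_orientation S \<omega>"
    and S': "binary S'" "2 \<le> leaves S'" "orients \<omega>' (edges S')" "canopy_orientation S' \<omega>'"
    and i: "1 \<le> i" "i \<le> leaves S"
  shows "canopy_orientation (graft S i S') (K_graft_orientation S \<omega> i S' \<omega>')"
proof -
  let ?r = "leaves S" and ?s = "leaves S'"
  let ?o = "map (outer_edge i ?s)" and ?n = "map (inner_edge i)" and ?z = "new_edge i ?s"
  obtain es fs where ef: "distinct es" "distinct fs" "set es = left_leaning S" "set fs = right_leaning S"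
    "orientation_sign \<omega> * list_sign (es @ fs) * perm_sign (map fst es @ map snd fs) =
        (-1) ^ (length es + tri (?r - 1))"
    using S(4) by (auto simp: canopy_orientation_def)
  obtain es' fs' where ef': "distinct es'" "distinct fs'" "set es' = left_leaning S'" "set fs' =
      right_leaning S'"
    "orientation_sign \<omega>' * list_sign (es' @ fs') * perm_sign (map fst es' @ map snd fs') =
        (-1) ^ (length es' + tri (?s - 1))"
    using S'(4) by (auto simp: canopy_orientation_def)
  note lS = leaning_edges[OF S(1,2)] and lS' = leaning_edges[OF S'(1,2)]
  have cardS: "card (edges S) = ?r - 2" and cardS': "card (edges S') = ?s - 2"
    using lS lS' by (auto simp: card_Un_disjoint)
  have len: "length es + length fs = ?r - 2" "length es' + length fs' = ?s - 2"
    using lS(9) lS'(9) ef(1-4) ef'(1-4) by (metis distinct_card)+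
  have dist: "distinct (es @ fs)" "distinct (es' @ fs')" "set (es @ fs) = edges S" "set (es' @ fs') = edges S'"
    using ef ef' lS(1,2) lS'(1,2) by auto
  have d1: "distinct (map fst es @ map snd fs)" "set (map fst es @ map snd fs) = {2..<?r}"
    using ef lS(5-8) by (auto simp: distinct_map)
  have d2: "distinct (map fst es' @ map snd fs')" "set (map fst es' @ map snd fs') = {2..<?s}"
    using ef' lS'(5-8) by (auto simp: distinct_map)
  let ?\<omega> = "K_graft_orientation S \<omega> i S' \<omega>'"
  have wf: "wf_tree S" "wf_tree S'" using S S' binary_wf by auto
  have lg: "leaves (graft S i S') = ?r + ?s - 1" using leaves_graft(1)[OF wf i] by simp
  define c where "c = list_sign (?o (es @ fs) @ ?n (es' @ fs') @ [?z])"
  have os: "orientation_sign ?\<omega> =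
    (-1) ^ (i * (?s + 1)) * orientation_sign \<omega> * orientation_sign \<omega>' * list_sign (es @ fs) *
        list_sign (es' @ fs') * c"
  proof -
    \<comment> \<open>The cell of a binary tree has degree 0.\<close>
    have l0: "?s - 2 - card (edges S') = 0" using cardS' by simp
    have sorted: "sorted_list_of_set (set (snd \<omega>)) = sorted_list_of_set (set (es @ fs))"
      "sorted_list_of_set (set (snd \<omega>')) = sorted_list_of_set (set (es' @ fs'))"
      using S(3) S'(3) dist by (auto simp: orients_def)
    have sq: "list_sign (es @ fs) * list_sign (es @ fs) = 1" "list_sign (es' @ fs') * list_sign (es' @ fs') = 1"
        by simp_all
    define k where "k = list_sign (?o (sorted_list_of_set (set (es @ fs))) @ ?n (sorted_list_of_set (set (es' @
        fs'))) @ [?z])"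
    have 1: "list_sign (?o (snd \<omega>) @ ?n (snd \<omega>') @ [?z]) = list_sign (snd \<omega>) * list_sign (snd \<omega>') * k"
      using list_sign_graft(2)[of "snd \<omega>" "snd \<omega>'" i ?s ?z] S(3) S'(3) i S'(2) unfolding sorted k_def
      by (auto simp: orients_def)
    have 2: "c = list_sign (es @ fs) * list_sign (es' @ fs') * k"
      using list_sign_graft(2)[of "es @ fs" "es' @ fs'" i ?s ?z] dist i S'(2) unfolding k_def c_def by simp
    have "k = list_sign (es @ fs) * list_sign (es' @ fs') * c"
      unfolding 2 using sq by (simp add: ac_simps)
    then show ?thesis
      using 1 unfolding K_graft_orientation_def orientation_sign_def Let_def l0 by (simp add: ac_simps)
  qed
  have injs: "inj (outer_edge i ?s)" "inj (inner_edge i)" using inj_outer_edge inj_inner_edge i S' by auto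
  note eg = edges_graft[OF wf i S(2) S'(2)]
  note gr = leaning_graft[OF S(1) S'(1) S(2) S'(2) i]
  have inner_outer: "set (?o (es @ fs)) \<inter> set (?n (es' @ fs')) = {}"
    using eg(2) dist(3,4) by (simp only: set_map)
  have zn: "?z \<notin> set (?o (es @ fs)) \<union> set (?n (es' @ fs'))"
    using eg(3,4) dist(3,4) by (simp only: set_map Un_iff simp_thms)
  have dist_oe: "distinct (?o es @ ?n es')" "distinct (?o fs @ ?n fs')" "?z \<notin> set (?o es @ ?n es')" "?z \<notin> set
      (?o fs @ ?n fs')"
    using inner_outer zn ef(1,2) ef'(1,2) injs by (auto simp: distinct_map intro: inj_on_subset)
  have c_swap: "c = (-1) ^ (length fs * length es') * list_sign (?o es @ ?n es' @ ?o fs @ ?n fs' @ [?z])"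
    using perm_sign_swap_middle[of "?o fs" "?n es'" "?o es" "?n fs' @ [?z]"] inner_outer
    unfolding c_def by (simp add: list_sign_perm_sign Int_Un_distrib Int_Un_distrib2)
  have XX: "orientation_sign \<omega> * list_sign (es @ fs) * perm_sign (map fst es @ map snd fs) *
      (orientation_sign \<omega>' * list_sign (es' @ fs') * perm_sign (map fst es' @ map snd fs')) =
      (-1) ^ (length es + tri (?r - 1) + (length es' + tri (?s - 1)))"
    unfolding ef(5) ef'(5) by (simp add: power_add)
  have t: "tri (?r + ?s - 1 - 1) = tri (?r - 1) + tri (?s - 1) + (?r - 1) * (?s - 1)"
    using tri_add[of "?r - 1" "?s - 1"] S(2) S'(2) by (simp add: numeral_2_eq_2)
  show ?thesis
  proof (cases "right_leaf S i")
    case True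
    have j: "i \<notin> fst ` set es" "2 \<le> i"
      using right_leaf_names(1)[OF S(1) i True, of 1] ef by (auto simp: left_leaning_def)
    let ?es = "?z # ?o es @ ?n es'" and ?fs = "?o fs @ ?n fs'"
    have le: "length ?es = length es + length es' + 1" by simp
    have front: "list_sign (?o es @ ?n es' @ ?o fs @ ?n fs' @ [?z]) = (-1) ^ (?r + ?s) * list_sign (?es @ ?fs)"
    proof -
      have "list_sign ((?o es @ ?n es' @ ?o fs @ ?n fs') @ ?z # []) =
          (-1) ^ length (?o es @ ?n es' @ ?o fs @ ?n fs') *
              list_sign (?z # (?o es @ ?n es' @ ?o fs @ ?n fs') @ [])"
        by (rule list_sign_move_to_front) (use zn in auto)
      moreover have "length (?o es @ ?n es' @ ?o fs @ ?n fs') = ?r - 2 + (?s - 2)" using len by simp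
      moreover have "(-1::int) ^ (?r - 2 + (?s - 2)) = (-1) ^ (?r + ?s)"
        using S(2) S'(2) by (intro minus_one_power_cong) auto
      ultimately show ?thesis by simp
    qed
    have perm: "perm_sign (map fst ?es @ map snd ?fs) =
        (-1) ^ (length es' * length fs + ?r + (?r - i) * (?s - 1)) *
        perm_sign (map fst es @ map snd fs) * perm_sign (map fst es' @ map snd fs')"
      using p_sign_graft_common(1)[OF d1 d2 i S(2) S'(2) j] by simp
    have "orientation_sign ?\<omega> * list_sign (?es @ ?fs) * perm_sign (map fst ?es @ map snd ?fs) =
        (-1) ^ (i * (?s + 1)) * (-1) ^ (length fs * length es') * (-1) ^ (?r + ?s) *
        (-1) ^ (length es' * length fs + ?r + (?r - i) * (?s - 1)) *
        (list_sign (?es @ ?fs) * list_sign (?es @ ?fs)) *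
        (orientation_sign \<omega> * list_sign (es @ fs) * perm_sign (map fst es @ map snd fs) *
         (orientation_sign \<omega>' * list_sign (es' @ fs') * perm_sign (map fst es' @ map snd fs')))"
      unfolding os c_swap front perm by (simp only: ac_simps)
    also have "\<dots> = (-1) ^ (i * (?s + 1) + length fs * length es' + (?r + ?s) +
        (length es' * length fs + ?r + (?r - i) * (?s - 1)) +
        (length es + tri (?r - 1) + (length es' + tri (?s - 1))))"
      unfolding XX list_sign_mult_self by (simp only: power_add mult_1_right)
    also have "\<dots> = (-1) ^ (length ?es + tri (leaves (graft S i S') - 1))"
    proof (rule minus_one_power_cong)
      have "even (i * (?s + 1) + ?s + (?r - i) * (?s - 1) + 1 + (?r - 1) * (?s - 1))"
      proof -
        have "even (?r - i) \<longleftrightarrow> (even ?r \<longleftrightarrow> even i)" "even (?r - 1) \<longleftrightarrow> odd ?r" "even (?s - 1) \<longleftrightarrow> odd ?s"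
          using i S(2) S'(2) by presburger+
        then show ?thesis by auto
      qed
      then show "even (i * (?s + 1) + length fs * length es' + (?r + ?s) +
        (length es' * length fs + ?r + (?r - i) * (?s - 1)) +
        (length es + tri (?r - 1) + (length es' + tri (?s - 1))) + (length ?es +
            tri (leaves (graft S i S') - 1)))"
        unfolding lg t le mult.commute[of "length es'" "length fs"] by presburger
    qed
    finally show ?thesis unfolding canopy_orientation_def
      using dist_oe gr True ef(3,4) ef'(3,4) by (intro exI[of _ ?es] exI[of _ ?fs]) auto
  next
    case False
    have "S \<noteq> Leaf" using S by auto
    then have j: "i \<notin> snd ` set fs" "i < ?r"
      using right_leaf_names(2)[OF S(1) i False, of 1] ef by (auto simp: right_leaning_def)
    let ?es = "?o es @ ?n es'" and ?fs = "?o fs @ ?n fs' @ [?z]"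
    have le: "length ?es = length es + length es'" by simp
    have perm: "perm_sign (map fst ?es @ map snd ?fs) =
        (-1) ^ (length es' * length fs + (?r - 1 - i) * (?s - 1)) *
        perm_sign (map fst es @ map snd fs) * perm_sign (map fst es' @ map snd fs')"
      using p_sign_graft_common(2)[OF d1 d2 i S(2) S'(2) j] by simp
    have "orientation_sign ?\<omega> * list_sign (?es @ ?fs) * perm_sign (map fst ?es @ map snd ?fs) =
        (-1) ^ (i * (?s + 1)) * (-1) ^ (length fs * length es') *
        (-1) ^ (length es' * length fs + (?r - 1 - i) * (?s - 1)) *
        (list_sign (?es @ ?fs) * list_sign (?es @ ?fs)) *
        (orientation_sign \<omega> * list_sign (es @ fs) * perm_sign (map fst es @ map snd fs) *
         (orientation_sign \<omega>' * list_sign (es' @ fs') * perm_sign (map fst es' @ map snd fs')))"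
      unfolding os c_swap perm append_assoc by (simp only: ac_simps)
    also have "\<dots> = (-1) ^ (i * (?s + 1) + length fs * length es' +
        (length es' * length fs + (?r - 1 - i) * (?s - 1)) +
        (length es + tri (?r - 1) + (length es' + tri (?s - 1))))"
      unfolding XX list_sign_mult_self by (simp only: power_add mult_1_right)
    also have "\<dots> = (-1) ^ (length ?es + tri (leaves (graft S i S') - 1))"
    proof (rule minus_one_power_cong)
      have "even (i * (?s + 1) + (?r - 1 - i) * (?s - 1) + (?r - 1) * (?s - 1))"
      proof -
        have "even (?r - 1 - i) \<longleftrightarrow> (odd ?r \<longleftrightarrow> even i)" "even (?r - 1) \<longleftrightarrow> odd ?r" "even (?s - 1) \<longleftrightarrow> odd ?s"
          using j S(2) S'(2) by presburger+
        then show ?thesis by auto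
      qed
      then show "even (i * (?s + 1) + length fs * length es' +
        (length es' * length fs + (?r - 1 - i) * (?s - 1)) +
        (length es + tri (?r - 1) + (length es' + tri (?s - 1))) + (length ?es +
            tri (leaves (graft S i S') - 1)))"
        unfolding lg t le mult.commute[of "length es'" "length fs"] by presburger
    qed
    finally show ?thesis unfolding canopy_orientation_def
      using dist_oe gr False ef(3,4) ef'(3,4) by (intro exI[of _ ?es] exI[of _ ?fs]) auto
  qed
qed

lemma orients_K_graft:
  assumes "wf_tree S" "wf_tree S'" "2 \<le> leaves S" "2 \<le> leaves S'" "1 \<le> i" "i \<le> leaves S"
    "orients \<omega> (edges S)" "orients \<omega>' (edges S')"
  shows "orients (K_graft_orientation S \<omega> i S' \<omega>') (edges (graft S i S'))"
proof -
  note eg = edges_graft[OF assms(1,2,5,6,3,4)]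
  have "inj (outer_edge i (leaves S'))" "inj (inner_edge i)" using inj_outer_edge inj_inner_edge assms by auto
  then show ?thesis using assms(7,8) eg
    by (auto simp: orients_def K_graft_orientation_def Let_def distinct_map minus_one_power_iff intro:
        inj_on_subset)
qed

lemma std_orientation_canopy:
  "std_orientation S \<omega> \<Longrightarrow> binary S \<and> 2 \<le> leaves S \<and> orients \<omega> (edges S) \<and> canopy_orientation S \<omega>"
proof (induction rule: std_orientation.induct)
  case corolla
  have "edges (Node [Leaf, Leaf]) = {}" by (simp add: edges_def)
  then show ?case by (auto simp: orients_def canopy_orientation_def left_leaning_def right_leaning_def
        orientation_sign_def tri_def)
next
  case (graft S \<omega> S' \<omega>' i)
  then have g: "binary (graft S i S')" using graft_binary by blast
  moreover have "2 \<le> leaves (graft S i S')" using leaves_graft(1)[of S S' i] graft binary_wf by auto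
  ultimately show ?case
    using canopy_orientation_graft[of S \<omega> S' \<omega>' i] orients_K_graft[of S S' i \<omega> \<omega>'] graft binary_wf by blast
qed

text \<open>
  A tree \<open>[L, R]\<close> is the corolla with \<open>R\<close> grafted to its second and then \<open>L\<close> to its first leaf.
\<close>

lemma std_orientation_exists: "binary S \<Longrightarrow> 2 \<le> leaves S \<Longrightarrow> \<exists>\<omega>. std_orientation S \<omega>"
proof (induction S rule: binary_induct)
  case (Node L R)
  have leaf: "2 \<le> leaves T \<or> T = Leaf" if "binary T" for T
    using that
  proof (cases T rule: binary_cases)
    case (2 L R)
    then show ?thesis using leaves_binary_pos[of L] leaves_binary_pos[of R] by simp
  qed simp
  have 1: "\<exists>\<omega>. std_orientation (Node [Leaf, R]) \<omega>"
  proof (cases "R = Leaf")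
    case True
    then show ?thesis using std_orientation.corolla by blast
  next
    case False
    then obtain \<omega> where "std_orientation R \<omega>" using Node leaf by blast
    then have "std_orientation (graft (Node [Leaf, Leaf]) 2 R) (K_graft_orientation (Node [Leaf, Leaf]) (1, [])
        2 R \<omega>)"
      by (intro std_orientation.graft std_orientation.corolla) auto
    moreover have "graft (Node [Leaf, Leaf]) 2 R = Node [Leaf, R]" by simp
    ultimately show ?thesis by metis
  qed
  then obtain \<omega> where w: "std_orientation (Node [Leaf, R]) \<omega>" by blast
  show ?case
  proof (cases "L = Leaf")
    case True
    then show ?thesis using 1 by simp
  next
    case False
    then obtain \<omega>' where "std_orientation L \<omega>'" using Node leaf by blast
    then have "std_orientation (graft (Node [Leaf, R]) 1 L) (K_graft_orientation (Node [Leaf, R]) \<omega> 1 L \<omega>')"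
      by (intro std_orientation.graft w) auto
    moreover have "graft (Node [Leaf, R]) 1 L = Node [L, R]" by simp
    ultimately show ?thesis by metis
  qed
qed simp

lemma xi_sign:
  assumes "binary S" "2 \<le> leaves S" "distinct es" "distinct fs" "set es = left_leaning S" "set fs =
      right_leaning S"
  shows "orientation_sign (xi S) * list_sign (es @ fs) =
      (-1) ^ (length es + tri (leaves S - 1)) * perm_sign (map fst es @ map snd fs)"
    and "orients (xi S) (edges S)"
proof -
  have "std_orientation S (xi S)"
    unfolding xi_def using std_orientation_exists[OF assms(1,2)] by (rule someI_ex)
  then have *: "orients (xi S) (edges S)" "canopy_orientation S (xi S)" using std_orientation_canopy by auto
  show "orients (xi S) (edges S)" by fact
  obtain es' fs' where ef: "distinct es'" "distinct fs'" "set es' = left_leaning S" "set fs' = right_leaning S"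
    "orientation_sign (xi S) * list_sign (es' @ fs') * perm_sign (map fst es' @ map snd fs') =
        (-1) ^ (length es' + tri (leaves S - 1))" using *(2) by (auto simp: canopy_orientation_def)
  have r: "list_sign (es @ fs) * perm_sign (map fst es @ map snd fs) =
    list_sign (es' @ fs') * perm_sign (map fst es' @ map snd fs')"
    by (rule orientation_sign_reorder) (use assms ef leaning_edges[OF assms(1,2)] in auto)
  have "length es = length es'" using assms ef by (metis distinct_card)
  have e: "orientation_sign (xi S) * (list_sign (es @ fs) * perm_sign (map fst es @ map snd fs)) =
      (-1) ^ (length es + tri (leaves S - 1))"
    unfolding r \<open>length es = length es'\<close> using ef(5) by (simp only: mult.assoc)
  have "orientation_sign (xi S) * list_sign (es @ fs) =
    orientation_sign (xi S) * (list_sign (es @ fs) * perm_sign (map fst es @ map snd fs)) *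
        perm_sign (map fst es @ map snd fs)"
    by (simp add: mult.assoc)
  then show "orientation_sign (xi S) * list_sign (es @ fs) =
      (-1) ^ (length es + tri (leaves S - 1)) * perm_sign (map fst es @ map snd fs)"
    unfolding e .
qed

section \<open>The order on binary trees and the transfer of labels\<close>

lemma down_move_Node: "down_move a T T' e f \<Longrightarrow> T \<noteq> Leaf \<and> T' \<noteq> Leaf"
  by (induction rule: down_move.induct) auto

text \<open>
  A move affects exactly one left-leaning edge: it is shortened with the first leaf kept, and if
  \<open>B\<close> is a leaf then it disappears.
\<close>

lemma down_move_props:
  "down_move a T T' e f \<Longrightarrow> binary T \<Longrightarrow>
     binary T' \<and> leaves T' = leaves T \<and> e \<in> left_leaning_from a T \<and> fst f = fst e \<and> snd f < snd e \<and>
     left_leaning_from a T' = (left_leaning_from a T - {e}) \<union> (if fst f < snd f then {f} else {}) \<and>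
     (fst f < snd f \<longrightarrow> f \<in> vertices_from a T)"
proof (induction rule: down_move.induct)
  case (here a A B C)
  then have b: "binary A" "binary B" "binary C" by auto
  let ?b = "a + leaves A" let ?c = "?b + leaves B" let ?d = "?c + leaves C"
  note pos = leaves_binary_pos[OF b(1)] leaves_binary_pos[OF b(2)] leaves_binary_pos[OF b(3)]
  define X where "X = (if C = Leaf then {} else {(?c, ?d - 1)})"
  define f where "f = (?b, ?c - 1)"
  have B: "B = Leaf \<longleftrightarrow> \<not> fst f < snd f"
    using b(2)
  proof (cases B rule: binary_cases)
    case (2 L R)
    then show ?thesis using leaves_binary_pos[of L] leaves_binary_pos[of R] by (simp add: f_def)
  qed (simp add: f_def)
  have nin: "(?b, ?d - 1) \<notin> left_leaning_from a A" "(?b, ?d - 1) \<notin> left_leaning_from ?b B"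
     "(?b, ?d - 1) \<notin> left_leaning_from ?c C" "(?b, ?d - 1) \<notin> X" "(?b, ?d - 1) \<noteq> f"
    using leaning_bounds(1)[OF b(1), of ?b "?d - 1" a] leaning_bounds(1)[OF b(2), of ?b "?d - 1" ?b]
      leaning_bounds(1)[OF b(3), of ?b "?d - 1" ?c] pos by (auto simp: X_def f_def)
  have l: "left_leaning_from a (Node [A, Node [B, C]]) =
      left_leaning_from a A \<union> left_leaning_from ?b B \<union> left_leaning_from ?c C \<union> X \<union> {(?b, ?d - 1)}"
    by (auto simp: X_def add.assoc)
  have r: "left_leaning_from a (Node [Node [A, B], C]) =
      left_leaning_from a A \<union> left_leaning_from ?b B \<union> left_leaning_from ?c C \<union> X \<union> (if fst f < snd f then {f}
          else {})"
    using B by (auto simp: X_def f_def add.assoc)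
  have "fst f < snd f \<longrightarrow> f \<in> vertices_from a (Node [A, Node [B, C]])"
  proof
    assume "fst f < snd f"
    then have "B \<noteq> Leaf" using B by simp
    with b(2) show "f \<in> vertices_from a (Node [A, Node [B, C]])"
        by (cases B rule: binary_cases) (auto simp: f_def)
  qed
  moreover have "left_leaning_from a (Node [Node [A, B], C]) =
      (left_leaning_from a (Node [A, Node [B, C]]) - {(?b, ?d - 1)}) \<union> (if fst f < snd f then {f} else {})"
    unfolding l r using nin by blast
  moreover have "(?b, ?d - 1) \<in> left_leaning_from a (Node [A, Node [B, C]])" unfolding l by blast
  ultimately show ?case using here b pos unfolding f_def
      by (auto simp del: left_leaning_from.simps vertices_from.simps)
next
  case (left a L L' e f R)
  then have b: "binary L" "binary R" by auto
  have IH: "binary L'" "leaves L' = leaves L" "e \<in> left_leaning_from a L" "fst f = fst e" "snd f < snd e"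
     "left_leaning_from a L' = (left_leaning_from a L - {e}) \<union> (if fst f < snd f then {f} else {})"
     "fst f < snd f \<longrightarrow> f \<in> vertices_from a L" using left b by auto
  have "e \<notin> left_leaning_from (a + leaves L) R" "e \<noteq> (a + leaves L, a + leaves L + leaves R - 1)"
    using leaning_bounds(1)[OF b(1), of "fst e" "snd e" a] leaning_bounds(1)[OF b(2), of "fst e" "snd e" "a +
        leaves L"] IH(3) by auto
  then have "left_leaning_from a (Node [L', R]) =
      (left_leaning_from a (Node [L, R]) - {e}) \<union> (if fst f < snd f then {f} else {})"
    unfolding left_leaning_from.simps IH(2,6) by auto
  then show ?case using IH b by simp
next
  case (right a L R R' e f)
  then have b: "binary L" "binary R" by auto
  have IH: "binary R'" "leaves R' = leaves R" "e \<in> left_leaning_from (a + leaves L) R" "fst f =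
      fst e" "snd f < snd e"
     "left_leaning_from (a + leaves L) R' = (left_leaning_from (a +
         leaves L) R - {e}) \<union> (if fst f < snd f then {f} else {})"
     "fst f < snd f \<longrightarrow> f \<in> vertices_from (a + leaves L) R" using right b by auto
  have n: "R \<noteq> Leaf" "R' \<noteq> Leaf" using down_move_Node[OF right(1)] by auto
  have "e \<notin> left_leaning_from a L" "e \<noteq> (a + leaves L, a + leaves L + leaves R - 1)"
    using leaning_bounds(1)[OF b(1), of "fst e" "snd e" a] leaning_bounds(1)[OF b(2), of "fst e" "snd e" "a +
        leaves L"] IH(3) by auto
  then have "left_leaning_from a (Node [L, R']) =
      (left_leaning_from a (Node [L, R]) - {e}) \<union> (if fst f < snd f then {f} else {})"
    unfolding left_leaning_from.simps IH(2,6) using n by auto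
  then show ?case using IH b by simp
qed

text \<open>
  For sets of intervals with distinct first leaves: each member of \<open>F\<close> is contained in the member
  of \<open>G\<close> with the same first leaf.
\<close>

definition left_le :: "edge set \<Rightarrow> edge set \<Rightarrow> bool" where
  "left_le F G \<longleftrightarrow> (\<forall>p q. (p, q) \<in> F \<longrightarrow> (\<exists>q'\<ge>q. (p, q') \<in> G))"

lemma left_le_trans: "left_le F G \<Longrightarrow> left_le G H \<Longrightarrow> left_le F H"
  unfolding left_le_def by (meson order_trans)

lemma down_move_global:
  assumes "down_move 1 T T' e f" "binary T"
  shows "binary T'" "leaves T' = leaves T" "e \<in> left_leaning T" "fst f = fst e"
    "left_leaning T' = (left_leaning T - {e}) \<union> (if f \<in> edges T then {f} else {})"
    "left_le (left_leaning T') (left_leaning T)"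
    "card (left_leaning T') \<le> card (left_leaning T)"
    "card (left_leaning T') = card (left_leaning T) \<Longrightarrow> f \<in> edges T"
proof -
  note m = down_move_props[OF assms]
  show "binary T'" "leaves T' = leaves T" "fst f = fst e" using m by auto
  show e: "e \<in> left_leaning T" using m by (simp add: left_leaning_def)
  have f: "fst f < snd f \<longleftrightarrow> f \<in> edges T"
  proof
    assume "fst f < snd f"
    moreover have "1 < fst e" using leaning_bounds(1)[OF assms(2), of "fst e" "snd e" 1] m by auto
    ultimately show "f \<in> edges T" using m by (auto simp: edges_def)
  next
    assume "f \<in> edges T"
    then show "fst f < snd f" using edges_bounds(2)[OF binary_wf[OF assms(2)], of "fst f" "snd f"] by simp
  qed
  show l: "left_leaning T' = (left_leaning T - {e}) \<union> (if f \<in> edges T then {f} else {})"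
    using m unfolding f by (simp add: left_leaning_def)
  show "left_le (left_leaning T') (left_leaning T)"
    unfolding left_le_def
  proof (intro allI impI)
    fix p q assume "(p, q) \<in> left_leaning T'"
    then consider "(p, q) \<in> left_leaning T" | "(p, q) = f" unfolding l by (auto split: if_splits)
    then show "\<exists>q'\<ge>q. (p, q') \<in> left_leaning T"
    proof cases
      case 2
      then have "p = fst e" "q < snd e" using m by auto
      then show ?thesis using e by (intro exI[of _ "snd e"]) simp
    qed blast
  qed
  have fin: "finite (left_leaning T)" using finite_leaning(1)[OF assms(2)] by (simp add: left_leaning_def)
  have c: "card (left_leaning T - {e}) + 1 = card (left_leaning T)"
    using e fin by (metis Suc_eq_plus1 card_Suc_Diff1)
  have "card (left_leaning T') \<le> card (left_leaning T - {e}) + card (if f \<in> edges T then {f} else {})"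
    unfolding l by (rule card_Un_le)
  then show "card (left_leaning T') \<le> card (left_leaning T)"
    "card (left_leaning T') = card (left_leaning T) \<Longrightarrow> f \<in> edges T"
    using c by (auto split: if_splits)
qed

lemma tree_le_imp:
  assumes "tree_le S T" "binary T"
  shows "binary S \<and> leaves S = leaves T \<and> left_le (left_leaning S) (left_leaning T) \<and>
    card (left_leaning S) \<le> card (left_leaning T)"
  using assms(1) unfolding tree_le_def
proof (induction rule: rtranclp_induct)
  case base
  then show ?case using assms(2) by (auto simp: left_le_def)
next
  case (step S1 S2)
  then obtain e f where "down_move 1 S1 S2 e f" by (auto simp: down_step_def)
  then show ?case using down_move_global[of S1 S2 e f] step left_le_trans by (metis order_trans)
qed

definition moves :: "nat \<Rightarrow> tree \<Rightarrow> tree \<Rightarrow> bool" where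
  "moves a = (\<lambda>T T'. \<exists>e f. down_move a T T' e f)\<^sup>*\<^sup>*"

lemma moves_refl: "moves a T T" and moves_trans: "moves a T T' \<Longrightarrow> moves a T' T'' \<Longrightarrow> moves a T T''"
  by (simp_all add: moves_def)

lemma moves_step: "down_move a T T' e f \<Longrightarrow> moves a T T'"
  unfolding moves_def by (rule r_into_rtranclp) blast

lemma moves_left: "moves a L L' \<Longrightarrow> moves a (Node [L, R]) (Node [L', R])"
  unfolding moves_def
proof (induction rule: rtranclp_induct)
  case (step y z)
  then have "\<exists>e f. down_move a (Node [y, R]) (Node [z, R]) e f" using down_move.left by blast
  with step.IH show ?case by (rule rtranclp.rtrancl_into_rtrancl)
qed simp

lemma moves_right: "moves (a + leaves L) R R' \<Longrightarrow> moves a (Node [L, R]) (Node [L, R'])"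
  unfolding moves_def
proof (induction rule: rtranclp_induct)
  case (step y z)
  then have "\<exists>e f. down_move a (Node [L, y]) (Node [L, z]) e f" using down_move.right by blast
  with step.IH show ?case by (rule rtranclp.rtrancl_into_rtrancl)
qed simp

text \<open>
  If a tree has a subtree on its right spine that starts after the first \<open>l\<close> leaves, then moves
  along the spine turn it into \<open>[L, R]\<close>, where \<open>R\<close> is this subtree. The left-leaning edges that
  start before are cut off at the boundary between \<open>L\<close> and \<open>R\<close>, and are shortened no further.
\<close>

lemma spine_moves:
  "binary T \<Longrightarrow> 1 \<le> l \<Longrightarrow> l < leaves T \<Longrightarrow>
    l = leaves T - 1 \<or> (a + l, a + leaves T - 1) \<in> left_leaning_from a T \<Longrightarrow>
    \<exists>L R. binary L \<and> binary R \<and> leaves L = l \<and> leaves L + leaves R = leaves T \<and> moves a T (Node [L, R]) \<and>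
      (\<forall>p q. (p, q) \<in> left_leaning_from a T \<longrightarrow> p + 1 < a + l \<longrightarrow>
          (\<exists>q'\<ge>min q (a + l - 1). (p, q') \<in> left_leaning_from a L)) \<and>
      (\<forall>p q. (p, q) \<in> left_leaning_from a T \<longrightarrow> a + l < p \<longrightarrow> (p, q) \<in> left_leaning_from (a + l) R)"
proof (induction T arbitrary: a l rule: binary_induct)
  case (Node A R0)
  let ?b = "a + leaves A"
  have pos: "0 < leaves A" "0 < leaves R0" using Node leaves_binary_pos by auto
  have bA: "p < q \<and> q < ?b" if "(p, q) \<in> left_leaning_from a A" for p q
    using leaning_bounds(1)[OF Node.hyps(1) that] by auto
  have bR: "?b < p \<and> q < ?b + leaves R0" if "(p, q) \<in> left_leaning_from ?b R0" for p q
    using leaning_bounds(1)[OF Node.hyps(2) that] by auto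
  have cases: "(p, q) \<in> left_leaning_from a A \<or> (p, q) \<in> left_leaning_from ?b R0 \<or>
      (p = ?b \<and> q = ?b + leaves R0 - 1)" if "(p, q) \<in> left_leaning_from a (Node [A, R0])" for p q
    using that by (auto split: if_splits)
  show ?case
  proof (cases "leaves A = l")
    case True
    have "\<forall>p q. (p, q) \<in> left_leaning_from a (Node [A, R0]) \<longrightarrow> p + 1 < a + l \<longrightarrow>
        (\<exists>q'\<ge>min q (a + l - 1). (p, q') \<in> left_leaning_from a A)"
      using cases bR True by (metis add_lessD1 less_irrefl min.cobounded1 not_less_iff_gr_or_eq)
    moreover have "\<forall>p q. (p, q) \<in> left_leaning_from a (Node [A, R0]) \<longrightarrow> a + l < p \<longrightarrow>
        (p, q) \<in> left_leaning_from (a + l) R0"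
      using cases bA True by (metis less_irrefl order_less_trans)
    ultimately show ?thesis using True Node.hyps moves_refl by (intro exI[of _ A] exI[of _ R0]) auto
  next
    case False
    have lt: "leaves A < l" and cond: "l - leaves A =
        leaves R0 - 1 \<or> (?b + (l - leaves A), ?b + leaves R0 - 1) \<in> left_leaning_from ?b R0"
    proof -
      have "leaves A < l \<and> (l - leaves A = leaves R0 - 1 \<or> (?b + (l - leaves A), ?b +
          leaves R0 - 1) \<in> left_leaning_from ?b R0)"
      proof (cases "l = leaves (Node [A, R0]) - 1")
        case True
        then show ?thesis using False pos by auto
      next
        case l: False
        then have m: "(a + l, a + leaves (Node [A, R0]) - 1) \<in> left_leaning_from a (Node [A, R0])"
            using Node.prems by blast
        have "a + leaves (Node [A, R0]) - 1 = ?b + leaves R0 - 1" by simp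
        then have "(a + l, ?b + leaves R0 - 1) \<in> left_leaning_from ?b R0"
          using cases[OF m] bA[of "a + l" "?b + leaves R0 - 1"] False pos by auto
        then show ?thesis using bR[of "a + l" "?b + leaves R0 - 1"] by auto
      qed
      then show "leaves A < l" "l - leaves A = leaves R0 - 1 \<or> (?b + (l - leaves A), ?b +
          leaves R0 - 1) \<in> left_leaning_from ?b R0" by auto
    qed
    have e: "?b + (l - leaves A) = a + l" using lt by simp
    obtain B C where BC: "binary B" "binary C" "leaves B = l - leaves A" "leaves B + leaves C =
        leaves R0" "moves ?b R0 (Node [B, C])"
      "\<And>p q. (p, q) \<in> left_leaning_from ?b R0 \<Longrightarrow> p + 1 < a + l \<Longrightarrow>
          \<exists>q'\<ge>min q (a + l - 1). (p, q') \<in> left_leaning_from ?b B"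
      "\<And>p q. (p, q) \<in> left_leaning_from ?b R0 \<Longrightarrow> a + l < p \<Longrightarrow> (p, q) \<in> left_leaning_from (a + l) C"
    proof -
      have c1: "1 \<le> l - leaves A" "l - leaves A < leaves R0" using lt Node.prems(2) by auto
      show thesis using Node.IH(2)[OF c1 cond, unfolded e] that by blast
    qed
    have "moves a (Node [A, R0]) (Node [Node [A, B], C])"
      using moves_right[OF BC(5)] moves_step[OF down_move.here] moves_trans by blast
    moreover have "\<exists>q'\<ge>min q (a + l - 1). (p, q') \<in> left_leaning_from a (Node [A, B])"
      if m: "(p, q) \<in> left_leaning_from a (Node [A, R0])" "p + 1 < a + l" for p q
    proof -
      consider "(p, q) \<in> left_leaning_from a A" | "(p, q) \<in> left_leaning_from ?b R0" | "p = ?b" "q =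
          ?b + leaves R0 - 1"
        using cases[OF m(1)] by blast
      then show ?thesis
      proof cases
        case 1
        then show ?thesis by (intro exI[of _ q]) auto
      next
        case 2
        then show ?thesis using BC(6)[OF 2 m(2)] by auto
      next
        case 3
        then have "leaves B \<noteq> 1" using m(2) BC(3) lt by auto
        then have "B \<noteq> Leaf" by auto
        then show ?thesis using 3 BC(3) lt by (intro exI[of _ "a + l - 1"]) auto
      qed
    qed
    moreover have "(p, q) \<in> left_leaning_from (a + l) C"
      if m: "(p, q) \<in> left_leaning_from a (Node [A, R0])" "a + l < p" for p q
      using cases[OF m(1)] bA[of p q] BC(7)[of p q] m(2) lt by auto
    ultimately show ?thesis using BC(1-4) Node.hyps lt
      by (intro exI[of _ "Node [A, B]"] exI[of _ C]) auto
  qed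
qed auto

text \<open>
  To reach \<open>[L', R']\<close> from \<open>T\<close>, first move to a tree with the same number of leaves on the left,
  losing as little as possible, then continue in both subtrees.
\<close>

lemma left_le_imp_moves:
  "binary S \<Longrightarrow> binary T \<Longrightarrow> leaves S = leaves T \<Longrightarrow>
    left_le (left_leaning_from a S) (left_leaning_from a T) \<Longrightarrow> moves a T S"
proof (induction S arbitrary: a T rule: binary_induct)
  case Leaf
  then have "T = Leaf"
  proof (cases T rule: binary_cases)
    case (2 L R)
    then show ?thesis using Leaf leaves_binary_pos[of L] leaves_binary_pos[of R] by simp
  qed simp
  then show ?case by (simp add: moves_refl)
next
  case (Node L' R')
  let ?l = "leaves L'"
  have pos: "0 < leaves L'" "0 < leaves R'" using Node leaves_binary_pos by auto
  have lT: "leaves T = ?l + leaves R'" using Node.prems by simp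
  have cond: "?l = leaves T - 1 \<or> (a + ?l, a + leaves T - 1) \<in> left_leaning_from a T"
  proof (cases "R' = Leaf")
    case True
    then show ?thesis using lT by simp
  next
    case False
    then have "(a + ?l, a + leaves T - 1) \<in> left_leaning_from a (Node [L', R'])"
        using lT by (simp add: add.assoc)
    then obtain q where q: "a + leaves T - 1 \<le> q" "(a + ?l, q) \<in> left_leaning_from a T"
      using Node.prems(3) unfolding left_le_def by blast
    then have "q = a + leaves T - 1" using leaning_bounds(1)[OF Node.prems(1) q(2)] by auto
    then show ?thesis using q by simp
  qed
  obtain L R where LR: "binary L" "binary R" "leaves L = ?l" "leaves L + leaves R =
      leaves T" "moves a T (Node [L, R])"
    "\<And>p q. (p, q) \<in> left_leaning_from a T \<Longrightarrow> p + 1 < a + ?l \<Longrightarrow>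
        \<exists>q'\<ge>min q (a + ?l - 1). (p, q') \<in> left_leaning_from a L"
    "\<And>p q. (p, q) \<in> left_leaning_from a T \<Longrightarrow> a + ?l < p \<Longrightarrow> (p, q) \<in> left_leaning_from (a + ?l) R"
    using spine_moves[OF Node.prems(1), of ?l a] cond pos lT by auto
  have "moves a L L'"
  proof (rule Node.IH(1)[OF LR(1)])
    show "left_le (left_leaning_from a L') (left_leaning_from a L)"
      unfolding left_le_def
    proof (intro allI impI)
      fix p q assume pq: "(p, q) \<in> left_leaning_from a L'"
      then have b: "p < q" "q < a + ?l" using leaning_bounds(1)[OF Node.hyps(1) pq] by auto
      obtain q' where q': "q \<le> q'" "(p, q') \<in> left_leaning_from a T"
        using Node.prems(3) pq unfolding left_le_def by auto
      obtain q'' where "min q' (a + ?l - 1) \<le> q''" "(p, q'') \<in> left_leaning_from a L"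
        using LR(6)[OF q'(2)] b by auto
      then show "\<exists>q'\<ge>q. (p, q') \<in> left_leaning_from a L" using q' b by (intro exI[of _ q'']) auto
    qed
  qed (use LR in simp)
  moreover have "moves (a + ?l) R R'"
  proof (rule Node.IH(2)[OF LR(2)])
    show "left_le (left_leaning_from (a + ?l) R') (left_leaning_from (a + ?l) R)"
      unfolding left_le_def
    proof (intro allI impI)
      fix p q assume pq: "(p, q) \<in> left_leaning_from (a + ?l) R'"
      then have b: "a + ?l < p" using leaning_bounds(1)[OF Node.hyps(2) pq] by auto
      obtain q' where q': "q \<le> q'" "(p, q') \<in> left_leaning_from a T"
        using Node.prems(3) pq unfolding left_le_def by auto
      then show "\<exists>q'\<ge>q. (p, q') \<in> left_leaning_from (a + ?l) R" using LR(7)[OF q'(2) b] by auto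
    qed
  qed (use LR lT in simp)
  ultimately have "moves a (Node [L, R]) (Node [L', R'])"
    using moves_left[of a L L' R] moves_right[of a L' R R'] moves_trans by blast
  then show ?case using LR(5) moves_trans by blast
qed

lemma tree_le_iff:
  assumes "binary T"
  shows "tree_le S T \<and> binary S \<longleftrightarrow> binary S \<and> leaves S = leaves T \<and> left_le (left_leaning S) (left_leaning T)"
proof -
  have "moves 1 T S \<Longrightarrow> tree_le S T"
    unfolding moves_def tree_le_def down_step_def by simp
  then show ?thesis using tree_le_imp[of S T] left_le_imp_moves[of S T 1] assms
    by (auto simp: left_leaning_def)
qed

lemma label_path_props:
  assumes "label_path T es S ls" "binary (T_min T)" "set es = left_leaning (T_min T)"
  shows "binary S \<and> set ls = left_leaning S \<and> map fst ls = map fst es"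
  using assms(1)
proof induction
  case start
  then show ?case using assms by simp
next
  case (move S ls S' e f)
  note m = down_move_global[OF move(2)]
  have b: "binary S" "set ls = left_leaning S" "map fst ls = map fst es" using move by auto
  have "set (map (\<lambda>x. if x = e then f else x) ls) = (set ls - {e}) \<union> {f}"
    using m(3)[OF b(1)] b(2) by auto
  moreover have "map fst (map (\<lambda>x. if x = e then f else x) ls) = map fst ls"
    using m(4)[OF b(1)] by auto
  ultimately show ?case using m(1,5)[OF b(1)] b move(3) by simp
qed

text \<open>
  No move raises the number of left-leaning edges. So if the number is the same at both ends of a
  sequence of moves, then every move of the sequence transfers a label.
\<close>

lemma label_path_exists:
  assumes "tree_le S (T_min T)" "binary (T_min T)"
    "card (left_leaning S) = card (left_leaning (T_min T))"
  shows "\<exists>ls. label_path T es S ls"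
  using assms(1,3) unfolding tree_le_def
proof (induction rule: rtranclp_induct)
  case base
  then show ?case using label_path.start by blast
next
  case (step S1 S2)
  obtain e f where m: "down_move 1 S1 S2 e f" using step(2) by (auto simp: down_step_def)
  have t: "tree_le S1 (T_min T)" using step(1) by (simp add: tree_le_def)
  have b: "binary S1" and c: "card (left_leaning S1) \<le> card (left_leaning (T_min T))"
    using tree_le_imp[OF t assms(2)] by auto
  have "card (left_leaning S1) = card (left_leaning (T_min T))" "f \<in> edges S1"
    using down_move_global(7,8)[OF m b] c step.prems by auto
  then show ?case using step.IH label_path.move[OF _ m] by blast
qed

lemma labelling_props:
  assumes "tree_le S (T_min T)" "binary (T_min T)" "2 \<le> leaves (T_min T)"
    "card (left_leaning S) = card (left_leaning (T_min T))" "set es = left_leaning (T_min T)"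
  shows "set (labelling T es S) = left_leaning S" "map fst (labelling T es S) = map fst es"
proof -
  obtain ls where ls: "label_path T es S ls" using label_path_exists assms by blast
  have "ls' = ls" if "label_path T es S ls'" for ls'
  proof -
    have a: "binary S" "set ls = left_leaning S" "map fst ls = map fst es" "set ls' =
        left_leaning S" "map fst ls' = map fst es"
      using label_path_props[OF ls assms(2,5)] label_path_props[OF that assms(2,5)] by auto
    have "2 \<le> leaves S" using tree_le_imp[OF assms(1,2)] assms(3) by simp
    then have "inj_on fst (set ls \<union> set ls')" using a leaning_edges(5)[of S] by simp
    then show ?thesis using a by (metis inj_on_map_eq_map)
  qed
  then have "labelling T es S = ls" unfolding labelling_def using ls by blast
  then show "set (labelling T es S) = left_leaning S" "map fst (labelling T es S) = map fst es"
    using label_path_props[OF ls assms(2,5)] by auto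
qed

section \<open>The cells in the value of the map\<close>

text \<open>
  In the left comb of a list of trees all the trees but the first hang at left-leaning edges.
\<close>

fun nonfirst_children :: "nat \<Rightarrow> tree list \<Rightarrow> edge set" where
  "nonfirst_children a [] = {}"
| "nonfirst_children a (u # us) = left_leaning_from a u \<union>
     (if u = Leaf then {} else {(a, a + leaves u - 1)}) \<union> nonfirst_children (a + leaves u) us"

lemma foldl_comb:
  "binary t \<Longrightarrow> \<forall>u\<in>set us. binary u \<Longrightarrow>
    binary (foldl (\<lambda>x y. Node [x, y]) t us) \<and>
    leaves (foldl (\<lambda>x y. Node [x, y]) t us) = leaves t + sum_list (map leaves us) \<and>
    left_leaning_from a (foldl (\<lambda>x y. Node [x, y]) t us) =
        left_leaning_from a t \<union> nonfirst_children (a + leaves t) us \<and>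
    (us \<noteq> [] \<longrightarrow> foldl (\<lambda>x y. Node [x, y]) t us \<noteq> Leaf)"
proof (induction us arbitrary: t)
  case (Cons u us)
  have "binary (Node [t, u])" using Cons by simp
  then have "binary (foldl (\<lambda>x y. Node [x, y]) (Node [t, u]) us) \<and>
    leaves (foldl (\<lambda>x y. Node [x, y]) (Node [t, u]) us) = leaves (Node [t, u]) + sum_list (map leaves us) \<and>
    left_leaning_from a (foldl (\<lambda>x y. Node [x, y]) (Node [t, u]) us) =
      left_leaning_from a (Node [t, u]) \<union> nonfirst_children (a + leaves (Node [t, u])) us \<and>
    (us \<noteq> [] \<longrightarrow> foldl (\<lambda>x y. Node [x, y]) (Node [t, u]) us \<noteq> Leaf)"
    using Cons by (intro Cons.IH) auto
  then show ?case by (cases us) (auto simp: add.assoc)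
qed simp

lemma T_min_binary:
  "wf_tree T \<Longrightarrow> binary (T_min T) \<and> leaves (T_min T) = leaves T \<and> (T_min T = Leaf \<longleftrightarrow> T = Leaf)"
proof (induction T)
  case (Node ts)
  then obtain t u us where ts: "ts = t # u # us" by (cases ts; cases "tl ts") auto
  have IH: "binary (T_min v) \<and> leaves (T_min v) = leaves v" if "v \<in> set ts" for v
    using Node that by auto
  have "sum_list (map leaves (map T_min (u # us))) = sum_list (map leaves (u # us))"
    using IH by (intro arg_cong[of _ _ sum_list]) (auto simp: ts)
  then show ?case using foldl_comb[of "T_min t" "map T_min (u # us)" 0] IH
    by (simp add: ts del: foldl.simps(2))
qed simp

text \<open>
  The edges of \<open>T\<close> that are not left-leaning in \<open>T_min\<close> are those that lead to a first child, and
  such an edge has the same first leaf as its parent.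
\<close>

lemma left_leaning_T_min:
  "wf_tree T \<Longrightarrow> left_leaning_from a (T_min T) \<subseteq> vertices_from a T \<and>
     (\<forall>v\<in>vertices_from a T. v \<in> left_leaning_from a (T_min T) \<or> v = (a, a + leaves T - 1) \<or>
        (\<exists>w\<in>vertices_from a T. w \<noteq> v \<and> fst w = fst v))"
  "\<forall>t\<in>set ts. wf_tree t \<Longrightarrow> nonfirst_children a (map T_min ts) \<subseteq> vertices_from_list a ts \<and>
     (\<forall>v\<in>vertices_from_list a ts. v \<in> nonfirst_children a (map T_min ts) \<or>
        (\<exists>w\<in>vertices_from_list a ts. w \<noteq> v \<and> fst w = fst v))"
proof (induction a T and a ts rule: vertices_from_vertices_from_list.induct)
  case (2 a ts)
  then obtain t u us where ts: "ts = t # u # us" by (cases ts; cases "tl ts") auto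
  have wf: "wf_tree t" "\<forall>v\<in>set ts. wf_tree v" using 2(2) by (auto simp: ts)
  have l: "left_leaning_from a (T_min (Node ts)) =
      left_leaning_from a (T_min t) \<union> nonfirst_children (a + leaves t) (map T_min (u # us))"
    using foldl_comb[of "T_min t" "map T_min (u # us)" a] T_min_binary wf by (simp add: ts)
  have n: "nonfirst_children a (map T_min ts) = left_leaning_from a (T_min t) \<union>
      (if t = Leaf then {} else {(a, a + leaves t - 1)}) \<union> nonfirst_children (a +
          leaves t) (map T_min (u # us))"
    using T_min_binary[OF wf(1)] by (simp add: ts)
  have IH: "nonfirst_children a (map T_min ts) \<subseteq> vertices_from_list a ts"
     "\<And>v. v\<in>vertices_from_list a ts \<Longrightarrow> v \<in> nonfirst_children a (map T_min ts) \<or>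
        (\<exists>w\<in>vertices_from_list a ts. w \<noteq> v \<and> fst w = fst v)" using 2(1)[OF wf(2)] by auto
  have sub: "left_leaning_from a (T_min (Node ts)) \<subseteq> vertices_from a (Node ts)"
    using IH(1) unfolding l n by auto
  show ?case
  proof (intro conjI sub ballI)
    fix v assume v: "v \<in> vertices_from a (Node ts)"
    show "v \<in> left_leaning_from a (T_min (Node ts)) \<or> v = (a, a + leaves (Node ts) - 1) \<or>
        (\<exists>w\<in>vertices_from a (Node ts). w \<noteq> v \<and> fst w = fst v)"
    proof (cases "v = (a, a + leaves (Node ts) - 1)")
      case False
      then have vl: "v \<in> vertices_from_list a ts" using v by simp
      show ?thesis
      proof (cases "\<exists>w\<in>vertices_from_list a ts. w \<noteq> v \<and> fst w = fst v")
        case True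
        then show ?thesis by auto
      next
        case n2: False
        then have "v \<in> left_leaning_from a (T_min (Node ts)) \<or> v = (a, a + leaves t - 1)"
          using IH(2)[OF vl] unfolding l n by (auto split: if_splits)
        moreover have "(a, a + leaves (Node ts) - 1) \<in> vertices_from a (Node ts)" by simp
        ultimately show ?thesis using False by (metis fst_conv)
      qed
    qed simp
  qed
next
  case (4 a t ts)
  have wf: "wf_tree t" "\<forall>v\<in>set ts. wf_tree v" using 4(3) by auto
  have n: "nonfirst_children a (map T_min (t # ts)) = left_leaning_from a (T_min t) \<union>
      (if t = Leaf then {} else {(a, a + leaves t - 1)}) \<union> nonfirst_children (a + leaves t) (map T_min ts)"
    using T_min_binary[OF wf(1)] by simp
  have IH1: "left_leaning_from a (T_min t) \<subseteq> vertices_from a t"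
     "\<And>v. v\<in>vertices_from a t \<Longrightarrow> v \<in> left_leaning_from a (T_min t) \<or> v = (a, a + leaves t - 1) \<or>
        (\<exists>w\<in>vertices_from a t. w \<noteq> v \<and> fst w = fst v)" using 4(1)[OF wf(1)] by auto
  have IH2: "nonfirst_children (a + leaves t) (map T_min ts) \<subseteq> vertices_from_list (a + leaves t) ts"
     "\<And>v. v\<in>vertices_from_list (a + leaves t) ts \<Longrightarrow> v \<in> nonfirst_children (a + leaves t) (map T_min ts) \<or>
        (\<exists>w\<in>vertices_from_list (a + leaves t) ts. w \<noteq> v \<and> fst w = fst v)" using 4(2)[OF wf(2)] by auto
  have r: "(if t = Leaf then {} else {(a, a + leaves t - 1)}) \<subseteq> vertices_from a t" by (cases t) auto
  have nl: "v \<in> vertices_from a t \<Longrightarrow> t \<noteq> Leaf" for v by auto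
  show ?case
  proof (intro conjI ballI)
    show "nonfirst_children a (map T_min (t # ts)) \<subseteq> vertices_from_list a (t # ts)"
      unfolding n using IH1(1) IH2(1) r by auto
    fix v assume "v \<in> vertices_from_list a (t # ts)"
    then consider "v \<in> vertices_from a t" | "v \<in> vertices_from_list (a + leaves t) ts" by auto
    then show "v \<in> nonfirst_children a (map T_min (t # ts)) \<or> (\<exists>w\<in>vertices_from_list a (t # ts). w \<noteq> v \<and>
        fst w = fst v)"
    proof cases
      case 1
      then show ?thesis unfolding n using IH1(2)[OF 1] nl[OF 1] by auto
    next
      case 2
      then show ?thesis unfolding n using IH2(2)[OF 2] by auto
    qed
  qed
qed auto

text \<open>
  For the edges of a tree: every vertex has a leaf as its first child.
\<close>

definition distinct_starts :: "edge set \<Rightarrow> bool" where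
  "distinct_starts F \<longleftrightarrow> inj_on fst F \<and> 1 \<notin> fst ` F"

text \<open>
  For the edges of a tree: every vertex has a leaf as its last child.
\<close>

definition distinct_ends :: "nat \<Rightarrow> edge set \<Rightarrow> bool" where
  "distinct_ends n G \<longleftrightarrow> inj_on snd G \<and> n \<notin> snd ` G"

lemma left_leaning_T_min_edges:
  assumes "wf_tree T" "2 \<le> leaves T"
  shows "left_leaning (T_min T) \<subseteq> edges T" "distinct_starts (edges T) \<longleftrightarrow> left_leaning (T_min T) = edges T"
    "binary (T_min T)" "leaves (T_min T) = leaves T"
proof -
  note b = T_min_binary[OF assms(1)]
  show "binary (T_min T)" "leaves (T_min T) = leaves T" using b by auto
  have g1: "1 < fst v" if "v \<in> left_leaning (T_min T)" for v
    using leaning_bounds(1)[of "T_min T" "fst v" "snd v" 1] b that by (auto simp: left_leaning_def)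
  show sub: "left_leaning (T_min T) \<subseteq> edges T"
  proof
    fix v assume v: "v \<in> left_leaning (T_min T)"
    then have "v \<in> vertices_from 1 T" using left_leaning_T_min(1)[OF assms(1), of 1]
        by (auto simp: left_leaning_def)
    then show "v \<in> edges T" using g1[OF v] by (auto simp: edges_def)
  qed
  show "distinct_starts (edges T) \<longleftrightarrow> left_leaning (T_min T) = edges T"
  proof
    assume f: "distinct_starts (edges T)"
    have "v \<in> left_leaning (T_min T)" if v: "v \<in> edges T" for v
    proof -
      have "fst v \<noteq> 1" using f v unfolding distinct_starts_def by (metis image_eqI)
      have "\<not> (\<exists>w\<in>vertices_from 1 T. w \<noteq> v \<and> fst w = fst v)"
      proof
        assume "\<exists>w\<in>vertices_from 1 T. w \<noteq> v \<and> fst w = fst v"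
        then obtain w where w: "w \<in> vertices_from 1 T" "w \<noteq> v" "fst w = fst v" by blast
        then have "w \<in> edges T" using \<open>fst v \<noteq> 1\<close> by (auto simp: edges_def)
        then show False using w v f by (auto simp: distinct_starts_def dest: inj_onD)
      qed
      then show ?thesis using left_leaning_T_min(1)[OF assms(1), of 1] v
          by (auto simp: left_leaning_def edges_def)
    qed
    then show "left_leaning (T_min T) = edges T" using sub by auto
  next
    assume e: "left_leaning (T_min T) = edges T"
    have "inj_on fst (edges T)" using leaning_edges(5)[of "T_min T"] b assms e by simp
    moreover have "1 \<notin> fst ` edges T" using g1 e by fastforce
    ultimately show "distinct_starts (edges T)" by (simp add: distinct_starts_def)
  qed
qed

text \<open>
  Replace every vertex by a right comb. As its last child is a leaf, the new edges are left-leaning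
  and the old ones become right-leaning.
\<close>

lemma T_max_exists:
  "wf_tree V \<Longrightarrow> inj_on snd (vertices_from a V) \<Longrightarrow>
     \<exists>S. binary S \<and> leaves S = leaves V \<and> (S = Leaf \<longleftrightarrow> V = Leaf) \<and>
         right_leaning_from a S = vertices_from a V - {(a, a + leaves V - 1)}"
  "\<forall>t\<in>set ts. wf_tree t \<Longrightarrow> ts \<noteq> [] \<Longrightarrow> inj_on snd (vertices_from_list a ts) \<Longrightarrow>
     a + sum_list (map leaves ts) - 1 \<notin> snd ` vertices_from_list a ts \<Longrightarrow>
     \<exists>S. binary S \<and> leaves S = sum_list (map leaves ts) \<and> right_leaning_from a S = vertices_from_list a ts"
proof (induction a V and a ts rule: vertices_from_vertices_from_list.induct)
  case (1 a)
  then show ?case by (intro exI[of _ Leaf]) simp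
next
  case (2 a ts)
  let ?r = "(a, a + leaves (Node ts) - 1)"
  have v: "vertices_from a (Node ts) = insert ?r (vertices_from_list a ts)" by simp
  have nr: "?r \<notin> vertices_from_list a ts" by (rule root_notin_children[OF 2(2)])
  have "inj_on snd (vertices_from_list a ts)" "snd ?r \<notin> snd ` vertices_from_list a ts"
    using 2(3) nr unfolding v by auto
  then obtain S where S: "binary S" "leaves S = sum_list (map leaves ts)" "right_leaning_from a S =
      vertices_from_list a ts"
    using 2(1,2) by force
  obtain t u us where ts: "ts = t # u # us" using 2(2) by (cases ts; cases "tl ts") auto
  have "0 < leaves t" "0 < leaves u" using 2(2) leaves_pos by (auto simp: ts)
  then have "S \<noteq> Leaf" using S(2) by (auto simp: ts)
  then show ?case using S nr unfolding v by (intro exI[of _ S]) auto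
next
  case (4 a t ts)
  have wf: "wf_tree t" "\<forall>t\<in>set ts. wf_tree t" using 4(3) by auto
  have pos: "0 < leaves t" using leaves_pos[OF wf(1)] .
  show ?case
  proof (cases ts)
    case Nil
    have "t = Leaf"
    proof (rule ccontr)
      assume "t \<noteq> Leaf"
      then have "(a, a + leaves t - 1) \<in> vertices_from_list a (t # ts)" by (cases t) auto
      then show False using 4(6) by (force simp: Nil)
    qed
    then show ?thesis by (intro exI[of _ Leaf]) (simp add: Nil)
  next
    case (Cons u us)
    have inj: "inj_on snd (vertices_from a t)" "inj_on snd (vertices_from_list (a + leaves t) ts)"
      using 4(5) by (auto intro: inj_on_subset)
    have e: "a + leaves t + sum_list (map leaves ts) - 1 = a + sum_list (map leaves (t # ts)) - 1" by simp
    have "a + leaves t + sum_list (map leaves ts) - 1 \<notin> snd ` vertices_from_list (a + leaves t) ts"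
      using 4(6) unfolding e by auto
    then obtain R where R: "binary R" "leaves R = sum_list (map leaves ts)"
      "right_leaning_from (a + leaves t) R = vertices_from_list (a + leaves t) ts"
      using 4(2)[OF wf(2) _ inj(2)] Cons by auto
    obtain L where L: "binary L" "leaves L = leaves t" "L = Leaf \<longleftrightarrow> t = Leaf"
       "right_leaning_from a L = vertices_from a t - {(a, a + leaves t - 1)}"
      using 4(1)[OF wf(1) inj(1)] by auto
    have "vertices_from a t = right_leaning_from a L \<union> (if L = Leaf then {} else {(a, a + leaves L - 1)})"
      unfolding L(4,2,3) by (cases t) auto
    then show ?thesis using L R by (intro exI[of _ "Node [L, R]"]) auto
  qed
qed auto

lemma max_tree_exists:
  assumes "wf_tree V" "2 \<le> leaves V" "distinct_ends (leaves V) (edges V)"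
  obtains S where "binary S" "leaves S = leaves V" "right_leaning S = edges V"
proof -
  have "inj_on snd (vertices_from 1 V)"
    unfolding vertices_edges(1)[OF assms(1,2)] using assms(3) vertices_edges(2)[OF assms(1,2)]
    by (auto simp: distinct_ends_def)
  then show ?thesis using T_max_exists(1)[OF assms(1), of 1] that by (auto simp: edges_def right_leaning_def)
qed

lemma binary_laminar:
  assumes "binary S" "2 \<le> leaves S"
  shows "laminar (insert (1, leaves S) (left_leaning S \<union> right_leaning S))"
  using laminar_edges[OF binary_wf[OF assms(1)]] leaning_edges(1)[OF assms] by simp

lemma parent_of_left_leaning:
  assumes "binary S" "(p, q) \<in> left_leaning S"
  shows "\<exists>a<p. (a, q) \<in> insert (1, leaves S) (right_leaning S)"
  using left_leaning_parent[OF assms(1), of p q 1] assms(2) by (auto simp: left_leaning_def right_leaning_def)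

lemma left_leaning_end_le:
  assumes "binary S" "2 \<le> leaves S" "(p, q) \<in> left_leaning S" "(a, b) \<in> insert (1, leaves S) (right_leaning S)"
      "a < p" "p \<le> b"
  shows "q \<le> b"
  using laminarD[OF binary_laminar[OF assms(1,2)], of a b p q] assms by auto

text \<open>
  The first leaves of the left-leaning edges are the numbers not used by right-leaning ones. The
  left-leaning edge that starts at \<open>p\<close> ends together with the smallest among the root and the
  right-leaning edges that contain \<open>p\<close> and start before it.
\<close>

lemma right_leaning_inj:
  assumes "binary S" "binary S'" "2 \<le> leaves S" "leaves S = leaves S'" "right_leaning S = right_leaning S'"
  shows "S = S'"
proof -
  have *: "left_leaning S \<subseteq> left_leaning S'" if a: "binary S" "binary S'" "2 \<le> leaves S" "leaves S =
      leaves S'" "right_leaning S = right_leaning S'" for S S'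
  proof
    fix v assume v: "v \<in> left_leaning S"
    obtain p q where pq: "v = (p, q)" by fastforce
    have s2: "2 \<le> leaves S'" using a by simp
    have "p \<in> fst ` left_leaning S" using v pq by force
    then have "p \<in> {2..<leaves S} - snd ` right_leaning S"
      using leaning_edges(7,8)[OF a(1,3)] by blast
    then have "p \<in> fst ` left_leaning S'"
      using leaning_edges(8)[OF a(2) s2] unfolding a(4,5) by blast
    then obtain q' where q': "(p, q') \<in> left_leaning S'" by auto
    obtain x where x: "x < p" "(x, q) \<in> insert (1, leaves S) (right_leaning S)"
      using parent_of_left_leaning[OF a(1)] v pq by blast
    obtain x' where x': "x' < p" "(x', q') \<in> insert (1, leaves S') (right_leaning S')"
      using parent_of_left_leaning[OF a(2) q'] by blast
    have "p < q" "p < q'" using leaning_bounds(1)[OF a(1), of p q 1] leaning_bounds(1)[OF a(2), of p q' 1] v pq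
        q' by (auto simp: left_leaning_def)
    have "q' \<le> q"
      by (rule left_leaning_end_le[OF a(2) s2 q', of x q]) (use x a(4,5) \<open>p < q\<close> in simp_all)
    moreover have "q \<le> q'"
      by (rule left_leaning_end_le[OF a(1,3), of p q x' q']) (use x' v pq a(4,5) \<open>p < q'\<close> in simp_all)
    ultimately show "v \<in> left_leaning S'" using q' pq by simp
  qed
  have "left_leaning S = left_leaning S'" by (intro equalityI *) (use assms in simp_all)
  moreover have "2 \<le> leaves S'" using assms by simp
  ultimately have "edges S = edges S'"
    using leaning_edges(1)[OF assms(1,3)] leaning_edges(1)[OF assms(2)] assms(5) by simp
  then show ?thesis using edges_inj assms binary_wf by metis
qed

text \<open>
  The condition \<open>S \<le> T_min\<close> in terms of the edges \<open>F\<close> of \<open>T\<close> and the right-leaning edges \<open>G\<close> of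
  \<open>S\<close>; the interval \<open>(1, n)\<close> is the root.
\<close>

definition dominated :: "nat \<Rightarrow> edge set \<Rightarrow> edge set \<Rightarrow> bool" where
  "dominated n F G \<longleftrightarrow> (\<forall>p q. (p, q) \<in> F \<longrightarrow> (\<exists>a b. (a, b) \<in> insert (1, n) G \<and> a < p \<and> p < b \<and> b \<le> q))"

definition matching :: "nat \<Rightarrow> edge set \<Rightarrow> edge set \<Rightarrow> bool" where
  "matching n F G \<longleftrightarrow> distinct_starts F \<and> distinct_ends n G \<and> fst ` F \<inter> snd ` G = {} \<and>
     card F + card G = n - 2 \<and> dominated n F G"

lemma left_le_iff_dominated:
  assumes "binary S" "2 \<le> leaves S" "fst ` F = fst ` left_leaning S" "inj_on fst F"
  shows "left_le (left_leaning S) F \<longleftrightarrow> dominated (leaves S) F (right_leaning S)"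
proof
  assume l: "left_le (left_leaning S) F"
  show "dominated (leaves S) F (right_leaning S)"
    unfolding dominated_def
  proof (intro allI impI)
    fix p q assume pq: "(p, q) \<in> F"
    then have "p \<in> fst ` left_leaning S" using assms(3) by force
    then obtain q0 where q0: "(p, q0) \<in> left_leaning S" by auto
    then obtain q' where q': "q0 \<le> q'" "(p, q') \<in> F" using l by (auto simp: left_le_def)
    then have "q' = q" using inj_onD[OF assms(4), of "(p, q')" "(p, q)"] pq by simp
    obtain a where "a < p" "(a, q0) \<in> insert (1, leaves S) (right_leaning S)"
      using parent_of_left_leaning[OF assms(1) q0] by blast
    moreover have "p < q0" using leaning_bounds(1)[OF assms(1), of p q0 1] q0 by (auto simp: left_leaning_def)
    ultimately show "\<exists>a b. (a, b) \<in> insert (1, leaves S) (right_leaning S) \<and> a < p \<and> p < b \<and> b \<le> q"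
      using q' \<open>q' = q\<close> by blast
  qed
next
  assume d: "dominated (leaves S) F (right_leaning S)"
  show "left_le (left_leaning S) F"
    unfolding left_le_def
  proof (intro allI impI)
    fix p q0 assume q0: "(p, q0) \<in> left_leaning S"
    then have "p \<in> fst ` F" using assms(3) by force
    then obtain q where q: "(p, q) \<in> F" by auto
    then obtain a b where "(a, b) \<in> insert (1, leaves S) (right_leaning S)" "a < p" "p < b" "b \<le> q"
      using d unfolding dominated_def by blast
    then have "q0 \<le> q" using left_leaning_end_le[OF assms(1,2) q0, of a b] by auto
    then show "\<exists>q'\<ge>q0. (p, q') \<in> F" using q by blast
  qed
qed

lemma interior_sign:
  assumes "binary S" "2 \<le> leaves S" "distinct ls" "set ls = left_leaning S"
  shows "orientation_sign (interior ls (xi S)) = p_sign (leaves S) ls (sorted_list_of_set (right_leaning S))"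
proof -
  let ?fs = "sorted_list_of_set (right_leaning S)"
  note l = leaning_edges[OF assms(1,2)]
  have fs: "distinct ?fs" "set ?fs = right_leaning S" using l(4) by auto
  note x = xi_sign[OF assms(1,2,3) fs(1) assms(4) fs(2)]
  have d: "set (snd (xi S)) - set ls = right_leaning S"
    using x(2) l(1,2) assms(4) by (auto simp: orients_def)
  have "orientation_sign (interior ls (xi S)) =
      (orientation_sign (xi S) * list_sign (ls @ ?fs)) * (-1) ^ tri (length ls)"
    using l(4) by (simp add: interior_def orientation_sign_def[of "(_, _)"] Let_def d tri_def)
  also have "\<dots> = p_sign (leaves S) ls ?fs"
    unfolding x(1) by (simp add: p_sign_def tri_Suc power_add ac_simps)
  finally show ?thesis .
qed

text \<open>
  Each tree \<open>V\<close> that matches \<open>T\<close> arises from exactly one summand, namely from the binary tree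
  with the edges of \<open>V\<close> as its right-leaning edges.
\<close>

lemma lookup_p_value:
  assumes T: "wf_tree T" "2 \<le> leaves T" and es: "distinct es" "set es = edges T"
  shows "Poly_Mapping.lookup (p_value T es :: tree \<Rightarrow>\<^sub>0 'k::field) V =
    (if wf_tree V \<and> leaves V = leaves T \<and> matching (leaves T) (edges T) (edges V)
     then of_int (p_sign (leaves T) es (sorted_list_of_set (edges V))) else 0)"
proof -
  let ?n = "leaves T" and ?F = "edges T"
  define A where "A = {S. binary S \<and> tree_le S (T_min T) \<and> card (left_leaning S) = length es}"
  note tm = left_leaning_T_min_edges[OF T]
  have k: "length es = card ?F" using es by (metis distinct_card)
  have AI: "S \<in> A \<longleftrightarrow> binary S \<and> leaves S = ?n \<and> left_le (left_leaning S) (left_leaning (T_min T)) \<and>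
      card (left_leaning S) = card ?F" for S
    using tree_le_iff[OF tm(3), of S] tm(4) k by (auto simp: A_def)
  \<comment> \<open>Moves do not create left-leaning edges, so \<open>T_min\<close> has at least as many as \<open>S\<close>, hence all of \<open>F\<close>.\<close>
  have good: "distinct_starts ?F" if "S \<in> A" for S
  proof -
    have "card (left_leaning S) \<le> card (left_leaning (T_min T))"
      using tree_le_imp[of S "T_min T"] that tm(3) by (auto simp: A_def)
    then have "card ?F \<le> card (left_leaning (T_min T))" using that by (simp add: AI)
    then have "left_leaning (T_min T) = ?F" using tm(1) card_seteq[OF finite_edges tm(1)] by blast
    then show ?thesis using tm(2) by simp
  qed
  define summand where "summand S = (let ls = labelling T es S in cell (collapse (set ls) S) (interior ls (xi
      S)) :: tree \<Rightarrow>\<^sub>0 'k)" for S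
  have pv: "(p_value T es :: tree \<Rightarrow>\<^sub>0 'k) = (\<Sum>S\<in>A. summand S)" by (simp add: p_value_def A_def summand_def)
  have finA: "finite A"
    by (rule finite_subset[OF _ finite_trees[of ?n]]) (auto simp: AI binary_wf)
  have S: "matching ?n ?F (right_leaning S)"
    "summand S = cell (collapse (left_leaning S) S) (interior (labelling T es S) (xi S))"
    "orientation_sign (interior (labelling T es S) (xi S)) =
        p_sign ?n es (sorted_list_of_set (right_leaning S))"
    "edges (collapse (left_leaning S) S) = right_leaning S"
    if "S \<in> A" for S
  proof -
    have F: "left_leaning (T_min T) = ?F" using good[OF that] tm(2) by simp
    have "tree_le S (T_min T)" using that by (simp add: A_def)
    then have b: "binary S" "leaves S = ?n" "left_le (left_leaning S) ?F" "card (left_leaning S) =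
        card ?F" "2 \<le> leaves S" "tree_le S (T_min T)"
      using that F T(2) by (auto simp: AI)
    note l = leaning_edges[OF b(1,5)]
    have c2: "card (left_leaning S) = card (left_leaning (T_min T))" using b(4) F by simp
    have lb: "set (labelling T es S) = left_leaning S" "map fst (labelling T es S) = map fst es"
      using labelling_props[OF b(6) tm(3) _ c2, of es] tm(4) T(2) es(2) F by auto
    have dl: "distinct (labelling T es S)"
    proof -
      have "length (labelling T es S) = length es" using lb(2) by (metis length_map)
      then show ?thesis using lb(1) b(4) k by (metis card_distinct)
    qed
    show "summand S = cell (collapse (left_leaning S) S) (interior (labelling T es S) (xi S))"
      by (simp add: summand_def lb)
    show "orientation_sign (interior (labelling T es S) (xi S)) =
        p_sign ?n es (sorted_list_of_set (right_leaning S))"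
      using interior_sign[OF b(1,5) dl lb(1)] b(2) lb(2) by (simp add: p_sign_def) (metis length_map)
    have inj: "inj_on fst ?F" using good[OF that] by (simp add: distinct_starts_def)
    have sub: "fst ` left_leaning S \<subseteq> fst ` ?F" using b(3) by (force simp: left_le_def)
    have "card (fst ` left_leaning S) = card (fst ` ?F)"
        using card_image[OF inj] card_image[OF l(5)] b(4) by simp
    then have ff: "fst ` ?F = fst ` left_leaning S" using sub by (intro card_subset_eq[symmetric]) auto
    have "dominated ?n ?F (right_leaning S)" using left_le_iff_dominated[OF b(1,5) ff inj] b(2,3) by simp
    moreover have "?n \<notin> snd ` right_leaning S"
    proof -
      have "snd ` right_leaning S \<subseteq> {2..<?n}" unfolding b(2)[symmetric] l(8)[symmetric] by blast
      then show ?thesis by force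
    qed
    ultimately show "matching ?n ?F (right_leaning S)"
      using good[OF that] l(6,7,9) ff b(2,4) by (simp add: matching_def distinct_ends_def)
    show "edges (collapse (left_leaning S) S) = right_leaning S"
      using collapse_props(3)[OF binary_wf[OF b(1)]] l(1,2) by blast
  qed
  have lk: "Poly_Mapping.lookup (p_value T es :: tree \<Rightarrow>\<^sub>0 'k) V =
      (\<Sum>S\<in>A. if collapse (left_leaning S) S = V then of_int (p_sign ?n es (sorted_list_of_set (right_leaning
          S))) else 0 :: 'k)"
    unfolding pv lookup_sum
  proof (intro sum.cong refl)
    fix S assume "S \<in> A"
    from S(2,3)[OF this] show "Poly_Mapping.lookup (summand S) V =
        (if collapse (left_leaning S) S = V then of_int (p_sign ?n es (sorted_list_of_set (right_leaning S)))
            else 0)"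
      by (simp add: cell_def lookup_single when_def)
  qed
  show ?thesis
  proof (cases "wf_tree V \<and> leaves V = ?n \<and> matching ?n ?F (edges V)")
    case True
    then have V: "wf_tree V" "leaves V = ?n" "matching ?n ?F (edges V)" "2 \<le> leaves V" using T by auto
    obtain S0 where S0: "binary S0" "leaves S0 = leaves V" "right_leaning S0 = edges V"
      using max_tree_exists[OF V(1,4)] V(2,3) by (auto simp: matching_def)
    have s2: "2 \<le> leaves S0" using S0 V by simp
    note l = leaning_edges[OF S0(1) s2]
    have fg: "distinct_starts ?F" using V(3) by (simp add: matching_def)
    then have F: "left_leaning (T_min T) = ?F" using tm(2) by simp
    have inj: "inj_on fst ?F" "1 \<notin> fst ` ?F" using fg by (auto simp: distinct_starts_def)
    have c: "card (left_leaning S0) = card ?F" using l(9) S0 V(2,3) by (simp add: matching_def)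
    have "fst ` ?F \<subseteq> {2..<?n}"
      using edges_bounds[OF T(1)] inj(2) by (force simp: image_iff)
    then have "fst ` ?F \<subseteq> fst ` left_leaning S0"
    proof -
      have "fst ` left_leaning S0 \<union> snd ` edges V = {2..<?n}" using l(8) S0 V(2) by simp
      moreover have "fst ` ?F \<inter> snd ` edges V = {}" using V(3) by (simp add: matching_def)
      ultimately show ?thesis using \<open>fst ` ?F \<subseteq> {2..<?n}\<close> by blast
    qed
    moreover have "card (fst ` left_leaning S0) = card (fst ` ?F)"
        using card_image[OF inj(1)] card_image[OF l(5)] c by simp
    ultimately have ff: "fst ` ?F = fst ` left_leaning S0" using l(3) by (intro card_subset_eq) auto
    have "left_le (left_leaning S0) ?F"
      using left_le_iff_dominated[OF S0(1) s2 ff inj(1)] V(2,3) S0 by (simp add: matching_def)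
    then have S0A: "S0 \<in> A" using S0 c V(2) F by (simp add: AI)
    have eq: "collapse (left_leaning S) S = V \<longleftrightarrow> S = S0" if "S \<in> A" for S
    proof -
      have b: "binary S" "leaves S = ?n" using that by (auto simp: AI)
      have "collapse (left_leaning S) S = V \<longleftrightarrow> edges (collapse (left_leaning S) S) = edges V"
        using edges_inj[of "collapse (left_leaning S) S" V] collapse_props(1,2)[OF binary_wf[OF b(1)]] V b(2)
            T(2) by auto
      also have "\<dots> \<longleftrightarrow> right_leaning S = right_leaning S0" using S(4)[OF that] S0(3) by simp
      also have "\<dots> \<longleftrightarrow> S = S0" using right_leaning_inj[of S S0] b S0 V(2) T(2) by auto
      finally show ?thesis .
    qed
    have "Poly_Mapping.lookup (p_value T es :: tree \<Rightarrow>\<^sub>0 'k) V =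
        (\<Sum>S\<in>A. if S = S0 then of_int (p_sign ?n es (sorted_list_of_set (right_leaning S))) else 0)"
      unfolding lk by (intro sum.cong refl) (simp add: eq)
    also have "\<dots> = of_int (p_sign ?n es (sorted_list_of_set (edges V)))"
      using S0A finA S0(3) by simp
    finally show ?thesis using True by simp
  next
    case False
    have "collapse (left_leaning S) S \<noteq> V" if "S \<in> A" for S
    proof
      assume e: "collapse (left_leaning S) S = V"
      have b: "binary S" "leaves S = ?n" using that by (auto simp: AI)
      have "wf_tree V" "leaves V = ?n" "edges V = right_leaning S"
        using collapse_props(1,2)[OF binary_wf[OF b(1)], of "left_leaning S"] S(4)[OF that] e b(2) by auto
      then show False using False S(1)[OF that] by simp
    qed
    then have "Poly_Mapping.lookup (p_value T es :: tree \<Rightarrow>\<^sub>0 'k) V = 0"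
      unfolding lk by (intro sum.neutral) simp
    then show ?thesis using False by argo
  qed
qed

section \<open>Matching families of intervals\<close>

definition tree_family :: "nat \<Rightarrow> edge set \<Rightarrow> bool" where
  "tree_family n F \<longleftrightarrow> finite F \<and> laminar (insert (1, n) F) \<and>
     (\<forall>p q. (p, q) \<in> F \<longrightarrow> 1 \<le> p \<and> p < q \<and> q \<le> n \<and> (p, q) \<noteq> (1, n))"

lemma tree_family_edges: "wf_tree T \<Longrightarrow> tree_family (leaves T) (edges T)"
  using edges_bounds laminar_edges by (fastforce simp: tree_family_def)

lemma tree_family_subset: "tree_family n F \<Longrightarrow> F' \<subseteq> F \<Longrightarrow> tree_family n F'"
  unfolding tree_family_def by (meson finite_subset insert_mono laminar_subset subsetD)

lemma nested:
  assumes "tree_family n F" "(a, b) \<in> insert (1, n) F" "(c, d) \<in> insert (1, n) F" "a < c" "c \<le> b"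
  shows "d \<le> b"
  using assms unfolding tree_family_def by (meson laminarD)

lemma tree_family_bounds:
  assumes "tree_family n F" "(p, q) \<in> F"
  shows "1 \<le> p" "p < q" "q \<le> n" "(p, q) \<noteq> (1, n)"
  using assms unfolding tree_family_def by blast+

lemma distinct_starts_starts:
  assumes "tree_family n F" "distinct_starts F" "(p, q) \<in> F"
  shows "2 \<le> p" "p < n"
proof -
  have "p \<noteq> 1" using assms(2,3) unfolding distinct_starts_def by force
  then show "2 \<le> p" "p < n" using tree_family_bounds[OF assms(1,3)] by auto
qed

lemma distinct_ends_ends:
  assumes "tree_family n G" "distinct_ends n G" "(p, q) \<in> G"
  shows "2 \<le> q" "q < n"
proof -
  have "q \<noteq> n" using assms(2,3) unfolding distinct_ends_def by force
  then show "2 \<le> q" "q < n" using tree_family_bounds[OF assms(1,3)] by auto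
qed

text \<open>
  Distinct first leaves other than \<open>1\<close> and distinct last leaves other than \<open>n\<close> all lie in
  \<open>{2..<n}\<close>; so the condition on cardinalities in \<open>matching\<close> says that every number occurs.
\<close>

lemma starts_ends_card:
  assumes "tree_family n F" "tree_family n G" "distinct_starts F" "distinct_ends n G" "fst ` F \<inter> snd ` G = {}"
  shows "card F + card G \<le> n - 2" "card F + card G = n - 2 \<Longrightarrow> fst ` F \<union> snd ` G = {2..<n}"
proof -
  have fin: "finite F" "finite G" using assms by (auto simp: tree_family_def)
  have sub: "fst ` F \<union> snd ` G \<subseteq> {2..<n}"
    using distinct_starts_starts[OF assms(1,3)] distinct_ends_ends[OF assms(2,4)] by force
  have "card F + card G = card (fst ` F \<union> snd ` G)"
    using card_Un_disjoint[OF _ _ assms(5)] fin assms(3,4)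
        by (simp add: card_image distinct_starts_def distinct_ends_def)
  then show "card F + card G \<le> n - 2" "card F + card G = n - 2 \<Longrightarrow> fst ` F \<union> snd ` G = {2..<n}"
    using card_mono[OF _ sub] card_subset_eq[OF _ sub] by auto
qed

lemma matching_cover:
  assumes "tree_family n F" "tree_family n G" "matching n F G" "2 \<le> x" "x < n"
  shows "(\<exists>q. (x, q) \<in> F) \<or> (\<exists>p. (p, x) \<in> G)"
proof -
  have "x \<in> fst ` F \<union> snd ` G"
    using starts_ends_card(2)[of n F G] assms by (simp add: matching_def)
  then show ?thesis by force
qed

lemma distinct_starts_eq: "distinct_starts F \<Longrightarrow> (p, q) \<in> F \<Longrightarrow> (p, q') \<in> F \<Longrightarrow> q = q'"
  unfolding distinct_starts_def by (metis fst_conv inj_onD snd_conv)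

lemma distinct_ends_eq: "distinct_ends n G \<Longrightarrow> (p, q) \<in> insert (1, n) G \<Longrightarrow> (p', q) \<in> insert (1, n) G \<Longrightarrow> p = p'"
  unfolding distinct_ends_def by (metis Pair_inject fst_conv image_eqI inj_onD insertE snd_conv)

lemma inj_fstD: "inj_on fst A \<Longrightarrow> (p, q) \<in> A \<Longrightarrow> (p, q') \<in> A \<Longrightarrow> q = q'"
  by (metis fst_conv inj_onD snd_conv)

lemma inj_sndD: "inj_on snd A \<Longrightarrow> (p, q) \<in> A \<Longrightarrow> (p', q) \<in> A \<Longrightarrow> p = p'"
  by (metis fst_conv inj_onD snd_conv)

lemma starts_ends_disjointD:
  "fst ` A \<inter> snd ` B = {} \<Longrightarrow> (x, q) \<in> A \<Longrightarrow> (p, x) \<in> B \<Longrightarrow> False"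
  by (metis disjoint_iff fst_conv image_eqI snd_conv)

lemma starts_ends_disjointI:
  "(\<And>x p q. (x, q) \<in> A \<Longrightarrow> (p, x) \<in> B \<Longrightarrow> False) \<Longrightarrow> fst ` A \<inter> snd ` B = {}"
  by (auto simp: disjoint_iff)

lemma matchingD:
  assumes "matching n F G"
  shows "distinct_starts F" "distinct_ends n G" "\<And>x p q. (x, q) \<in> F \<Longrightarrow> (p, x) \<in> G \<Longrightarrow> False"
    "\<And>p q. (p, q) \<in> F \<Longrightarrow> \<exists>a b. (a, b) \<in> insert (1, n) G \<and> a < p \<and> p < b \<and> b \<le> q"
  using assms unfolding matching_def dominated_def by (blast, blast, metis starts_ends_disjointD, blast)

definition outside :: "edge \<Rightarrow> edge set \<Rightarrow> edge set" where
  "outside e F = {x \<in> F. \<not> (fst e \<le> fst x \<and> snd x \<le> snd e)}"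

definition inside :: "edge \<Rightarrow> edge set \<Rightarrow> edge set" where
  "inside e F = {x \<in> F - {e}. fst e \<le> fst x \<and> snd x \<le> snd e}"

lemma outside_inside: "F - {e} = outside e F \<union> inside e F"
  by (auto simp: outside_def inside_def)

lemma insideD:
  assumes "x \<in> inside (j, m) F"
  shows "x \<in> F" "j \<le> fst x" "snd x \<le> m" "x \<noteq> (j, m)"
  using assms by (auto simp: inside_def)

lemma insideI: "(p, q) \<in> F \<Longrightarrow> j \<le> p \<Longrightarrow> q \<le> m \<Longrightarrow> (p, q) \<noteq> (j, m) \<Longrightarrow> (p, q) \<in> inside (j, m) F"
  by (auto simp: inside_def)

lemma outsideD: "x \<in> outside e F \<Longrightarrow> x \<in> F"
  by (auto simp: outside_def)

text \<open>
  Nesting: an edge outside \<open>(j, m)\<close> neither starts in the interior of this interval nor ends there.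
\<close>

lemma outside_cases:
  assumes "tree_family n F" "(j, m) \<in> F" "(p, q) \<in> outside (j, m) F"
  shows "p \<le> j \<or> m < p" "q < j \<or> m \<le> q"
proof -
  have pq: "(p, q) \<in> F" "\<not> (j \<le> p \<and> q \<le> m)" using assms(3) by (auto simp: outside_def)
  show "p \<le> j \<or> m < p" using nested[OF assms(1), of j m p q] pq assms(2) by force
  show "q < j \<or> m \<le> q" using nested[OF assms(1), of p q j m] nested[OF assms(1), of j m p q] pq assms(2)
      tree_family_bounds[OF assms(1) pq(1)] by force
qed

text \<open>
  Both pieces of \<open>F\<close> at \<open>e\<close> match the corresponding pieces of \<open>G\<close>, in the numbering of the whole
  tree. The two conditions in which \<open>fst e\<close> and \<open>snd e\<close> occur together stem from leaf \<open>j\<close> of the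
  outer tree, which is named \<open>fst e\<close> as a first leaf and \<open>snd e\<close> as a last leaf.
\<close>

definition split_matching :: "nat \<Rightarrow> edge \<Rightarrow> edge set \<Rightarrow> edge set \<Rightarrow> bool" where
  "split_matching n e F G \<longleftrightarrow>
     distinct_starts (outside e F) \<and> distinct_ends n (outside e G) \<and>
     fst ` outside e F \<inter> snd ` outside e G = {} \<and>
     \<not> (fst e \<in> fst ` outside e F \<and> snd e \<in> snd ` outside e G) \<and>
     (\<forall>p q. (p, q) \<in> outside e F \<longrightarrow> (\<exists>a b. (a, b) \<in> insert (1, n) (outside e G) \<and> a < p \<and> p < b \<and> b \<le> q \<and>
        \<not> (p = fst e \<and> b = snd e))) \<and>
     inj_on fst (inside e F) \<and> fst e \<notin> fst ` inside e F \<and>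
     inj_on snd (inside e G) \<and> snd e \<notin> snd ` inside e G \<and>
     fst ` inside e F \<inter> snd ` inside e G = {} \<and>
     (\<forall>p q. (p, q) \<in> inside e F \<longrightarrow> (\<exists>a b. (a, b) \<in> insert e (inside e G) \<and> a < p \<and> p < b \<and> b \<le> q))"

lemma split_matchingD:
  assumes "split_matching n (j, m) F G"
  shows "distinct_starts (outside (j, m) F)" "distinct_ends n (outside (j, m) G)"
    "\<And>x p q. (x, q) \<in> outside (j, m) F \<Longrightarrow> (p, x) \<in> outside (j, m) G \<Longrightarrow> False"
    "\<And>p q. (j, q) \<in> outside (j, m) F \<Longrightarrow> (p, m) \<in> outside (j, m) G \<Longrightarrow> False"
    "\<And>p q. (p, q) \<in> outside (j, m) F \<Longrightarrow>
       \<exists>a b. (a, b) \<in> insert (1, n) (outside (j, m) G) \<and> a < p \<and> p < b \<and> b \<le> q \<and> \<not> (p = j \<and> b = m)"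
    "\<And>p q q'. (p, q) \<in> inside (j, m) F \<Longrightarrow> (p, q') \<in> inside (j, m) F \<Longrightarrow> q = q'"
    "\<And>q. (j, q) \<in> inside (j, m) F \<Longrightarrow> False"
    "\<And>p p' q. (p, q) \<in> inside (j, m) G \<Longrightarrow> (p', q) \<in> inside (j, m) G \<Longrightarrow> p = p'"
    "\<And>p. (p, m) \<in> inside (j, m) G \<Longrightarrow> False"
    "\<And>x p q. (x, q) \<in> inside (j, m) F \<Longrightarrow> (p, x) \<in> inside (j, m) G \<Longrightarrow> False"
    "\<And>p q. (p, q) \<in> inside (j, m) F \<Longrightarrow>
       \<exists>a b. (a, b) \<in> insert (j, m) (inside (j, m) G) \<and> a < p \<and> p < b \<and> b \<le> q"
proof -
  have a: "distinct_starts (outside (j, m) F)" "distinct_ends n (outside (j, m) G)"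
     "fst ` outside (j, m) F \<inter> snd ` outside (j, m) G = {}"
     "\<not> (j \<in> fst ` outside (j, m) F \<and> m \<in> snd ` outside (j, m) G)"
     "\<forall>p q. (p, q) \<in> outside (j, m) F \<longrightarrow> (\<exists>a b. (a, b) \<in> insert (1, n) (outside (j, m) G) \<and> a < p \<and> p < b \<and>
         b \<le> q \<and>
        \<not> (p = j \<and> b = m))"
     "inj_on fst (inside (j, m) F)" "j \<notin> fst ` inside (j, m) F"
     "inj_on snd (inside (j, m) G)" "m \<notin> snd ` inside (j, m) G"
     "fst ` inside (j, m) F \<inter> snd ` inside (j, m) G = {}"
     "\<forall>p q. (p, q) \<in> inside (j, m) F \<longrightarrow> (\<exists>a b. (a, b) \<in> insert (j, m) (inside (j, m) G) \<and> a < p \<and> p < b \<and> b \<le> q)"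
    using assms unfolding split_matching_def fst_conv snd_conv by - (elim conjE, assumption)+
  show "distinct_starts (outside (j, m) F)" "distinct_ends n (outside (j, m) G)" by (rule a)+
  have "fst ` outside (j, m) F \<inter> snd ` outside (j, m) G = {}" by (rule a)
  then show "\<And>x p q. (x, q) \<in> outside (j, m) F \<Longrightarrow> (p, x) \<in> outside (j, m) G \<Longrightarrow> False"
    by (rule starts_ends_disjointD)
  have nj: "\<not> (j \<in> fst ` outside (j, m) F \<and> m \<in> snd ` outside (j, m) G)" by (rule a)
  show "False" if "(j, q) \<in> outside (j, m) F" "(p, m) \<in> outside (j, m) G" for p q
    using nj imageI[OF that(1), of fst] imageI[OF that(2), of snd] by simp
  show "\<And>p q. (p, q) \<in> outside (j, m) F \<Longrightarrow>
       \<exists>a b. (a, b) \<in> insert (1, n) (outside (j, m) G) \<and> a < p \<and> p < b \<and> b \<le> q \<and> \<not> (p = j \<and> b = m)"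
           by (rule a(5)[rule_format])
  have "inj_on fst (inside (j, m) F)" by (rule a)
  then show "\<And>p q q'. (p, q) \<in> inside (j, m) F \<Longrightarrow> (p, q') \<in> inside (j, m) F \<Longrightarrow> q = q'"
    by (rule inj_fstD)
  have "j \<notin> fst ` inside (j, m) F" by (rule a)
  then show "\<And>q. (j, q) \<in> inside (j, m) F \<Longrightarrow> False" by (metis fst_conv image_eqI)
  have "inj_on snd (inside (j, m) G)" by (rule a)
  then show "\<And>p p' q. (p, q) \<in> inside (j, m) G \<Longrightarrow> (p', q) \<in> inside (j, m) G \<Longrightarrow> p = p'"
    by (rule inj_sndD)
  have "m \<notin> snd ` inside (j, m) G" by (rule a)
  then show "\<And>p. (p, m) \<in> inside (j, m) G \<Longrightarrow> False" by (metis snd_conv image_eqI)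
  have "fst ` inside (j, m) F \<inter> snd ` inside (j, m) G = {}" by (rule a)
  then show "\<And>x p q. (x, q) \<in> inside (j, m) F \<Longrightarrow> (p, x) \<in> inside (j, m) G \<Longrightarrow> False"
    by (rule starts_ends_disjointD)
  show "\<And>p q. (p, q) \<in> inside (j, m) F \<Longrightarrow>
       \<exists>a b. (a, b) \<in> insert (j, m) (inside (j, m) G) \<and> a < p \<and> p < b \<and> b \<le> q" by (rule a(11)[rule_format])
qed

lemma distinct_startsI: "(\<And>p q q'. (p, q) \<in> F \<Longrightarrow> (p, q') \<in> F \<Longrightarrow> q = q') \<Longrightarrow> (\<And>q. (1, q) \<notin> F) \<Longrightarrow> distinct_starts F"
  unfolding distinct_starts_def by (force simp: inj_on_def)

lemma distinct_endsI: "(\<And>p p' q. (p, q) \<in> G \<Longrightarrow> (p', q) \<in> G \<Longrightarrow> p = p') \<Longrightarrow> (\<And>p. (p, n) \<notin> G) \<Longrightarrow> distinct_ends n G"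
  unfolding distinct_ends_def by (force simp: inj_on_def)

lemma matchingI:
  assumes "distinct_starts F" "distinct_ends n G" "\<And>x p q. (x, q) \<in> F \<Longrightarrow> (p, x) \<in> G \<Longrightarrow>
      False" "card F + card G = n - 2"
    "\<And>p q. (p, q) \<in> F \<Longrightarrow> \<exists>a b. (a, b) \<in> insert (1, n) G \<and> a < p \<and> p < b \<and> b \<le> q"
  shows "matching n F G"
proof -
  have "fst ` F \<inter> snd ` G = {}" by (rule starts_ends_disjointI) (rule assms(3))
  then show ?thesis using assms(1,2,4,5) unfolding matching_def dominated_def by blast
qed

lemma split_matchingI:
  assumes "distinct_starts (outside (j, m) F)" "distinct_ends n (outside (j, m) G)"
    "\<And>x p q. (x, q) \<in> outside (j, m) F \<Longrightarrow> (p, x) \<in> outside (j, m) G \<Longrightarrow> False"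
    "\<And>p q. (j, q) \<in> outside (j, m) F \<Longrightarrow> (p, m) \<in> outside (j, m) G \<Longrightarrow> False"
    "\<And>p q. (p, q) \<in> outside (j, m) F \<Longrightarrow>
       \<exists>a b. (a, b) \<in> insert (1, n) (outside (j, m) G) \<and> a < p \<and> p < b \<and> b \<le> q \<and> \<not> (p = j \<and> b = m)"
    "\<And>p q q'. (p, q) \<in> inside (j, m) F \<Longrightarrow> (p, q') \<in> inside (j, m) F \<Longrightarrow> q = q'"
    "\<And>q. (j, q) \<in> inside (j, m) F \<Longrightarrow> False"
    "\<And>p p' q. (p, q) \<in> inside (j, m) G \<Longrightarrow> (p', q) \<in> inside (j, m) G \<Longrightarrow> p = p'"
    "\<And>p. (p, m) \<in> inside (j, m) G \<Longrightarrow> False"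
    "\<And>x p q. (x, q) \<in> inside (j, m) F \<Longrightarrow> (p, x) \<in> inside (j, m) G \<Longrightarrow> False"
    "\<And>p q. (p, q) \<in> inside (j, m) F \<Longrightarrow>
       \<exists>a b. (a, b) \<in> insert (j, m) (inside (j, m) G) \<and> a < p \<and> p < b \<and> b \<le> q"
  shows "split_matching n (j, m) F G"
  unfolding split_matching_def fst_conv snd_conv
proof (intro conjI)
  show "inj_on fst (inside (j, m) F)" using assms(6) by (force simp: inj_on_def)
  show "inj_on snd (inside (j, m) G)" using assms(8) by (force simp: inj_on_def)
  show "fst ` outside (j, m) F \<inter> snd ` outside (j, m) G = {}" by (rule starts_ends_disjointI) (rule assms(3))
  show "fst ` inside (j, m) F \<inter> snd ` inside (j, m) G = {}" by (rule starts_ends_disjointI) (rule assms(10))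
  show "\<not> (j \<in> fst ` outside (j, m) F \<and> m \<in> snd ` outside (j, m) G)" using assms(4) by force
  show "j \<notin> fst ` inside (j, m) F" using assms(7) by force
  show "m \<notin> snd ` inside (j, m) G" using assms(9) by force
  show "\<forall>p q. (p, q) \<in> outside (j, m) F \<longrightarrow>
       (\<exists>a b. (a, b) \<in> insert (1, n) (outside (j, m) G) \<and> a < p \<and> p < b \<and> b \<le> q \<and> \<not> (p = j \<and> b = m))"
    using assms(5) by blast
  show "\<forall>p q. (p, q) \<in> inside (j, m) F \<longrightarrow>
       (\<exists>a b. (a, b) \<in> insert (j, m) (inside (j, m) G) \<and> a < p \<and> p < b \<and> b \<le> q)"
    using assms(11) by blast
qed (use assms(1,2) in blast)+

text \<open>
  The families of a tree in the source and of a tree in the boundary of its image.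
\<close>

locale family_pair =
  fixes n :: nat and F G :: "edge set"
  assumes n: "2 \<le> n" and F: "tree_family n F" and G: "tree_family n G"
    and card: "card F + card G = n - 1"
begin

lemma finite [simp]: "finite F" "finite G" using F G by (auto simp: tree_family_def)

lemma card_Diff_F: "f \<in> F \<Longrightarrow> card (F - {f}) + card G = n - 2"
  using card card_Suc_Diff1[of F f] by simp

lemma card_Diff_G: "g \<in> G \<Longrightarrow> card F + card (G - {g}) = n - 2"
  using card card_Suc_Diff1[of G g] by simp

lemma FD: "tree_family n (F - {f})" and GD: "tree_family n (G - {g})"
  using F G tree_family_subset by blast+

text \<open>
  There are \<open>n - 1\<close> names in \<open>{2..<n}\<close>, so some leaf \<open>c\<close> is the first leaf of an edge in \<open>F\<close> and the
  last leaf of an edge in \<open>G\<close>. A term survives only if it removes this coincidence. The two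
  possible removals give equivalent domination conditions: the removal of \<open>(a, c)\<close> costs the
  witness \<open>(a, c)\<close>, but the next larger interval of \<open>G\<close>, which ends at \<open>d\<close>, takes its place, as
  nesting forces \<open>d \<le> q\<close>.
\<close>

lemma one_shared_leaf:
  assumes good: "distinct_starts F" "distinct_ends n G"
  obtains c q a where "(c, q) \<in> F" "(a, c) \<in> G"
    "\<And>g. g \<in> G \<Longrightarrow> g \<noteq> (a, c) \<Longrightarrow> \<not> matching n F (G - {g})"
    "\<And>f. f \<in> F \<Longrightarrow> f \<noteq> (c, q) \<Longrightarrow> \<not> matching n (F - {f}) G"
    "matching n F (G - {(a, c)}) \<longleftrightarrow> matching n (F - {(c, q)}) G"
    "\<And>e. e \<in> F \<Longrightarrow> e \<in> G \<Longrightarrow> \<not> split_matching n e F G"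
proof -
  have "fst ` F \<inter> snd ` G \<noteq> {}"
    using starts_ends_card(1)[OF F G good] card n by auto
  then obtain c q a where f: "(c, q) \<in> F" and g: "(a, c) \<in> G" by auto
  have X: "\<not> matching n F (G - {g'})" if "g' \<in> G" "g' \<noteq> (a, c)" for g'
    using matchingD(3)[of n F "G - {g'}" c q a] f g that by auto
  have Y: "\<not> matching n (F - {f'}) G" if "f' \<in> F" "f' \<noteq> (c, q)" for f'
    using matchingD(3)[of n "F - {f'}" G c q a] f g that by auto
  have Z: "\<not> split_matching n e F G" if "e \<in> F" "e \<in> G" for e
  proof
    assume s: "split_matching n e F G"
    obtain j m where e: "e = (j, m)" by fastforce
    have eF: "(j, m) \<in> F" and eG: "(j, m) \<in> G" using that e by auto
    note sD = split_matchingD[OF s[unfolded e]]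
    have jm: "j < m" using tree_family_bounds[OF F eF] by simp
    have "(c, q) \<noteq> (j, m)"
      using nested[OF G, of a c j m] g eG jm tree_family_bounds[OF G g] by auto
    moreover have "(a, c) \<noteq> (j, m)"
      using nested[OF F, of j m c q] f eF jm tree_family_bounds[OF F f] by auto
    ultimately consider "(c, q) \<in> outside (j, m) F" "(a, c) \<in> outside (j, m) G"
      | "(c, q) \<in> inside (j, m) F" "(a, c) \<in> inside (j, m) G"
      | "(c, q) \<in> outside (j, m) F" "(a, c) \<in> inside (j, m) G"
      | "(c, q) \<in> inside (j, m) F" "(a, c) \<in> outside (j, m) G"
      using f g outside_inside[of F "(j, m)"] outside_inside[of G "(j, m)"] by blast
    then show False
    proof cases
      case 1
      then show False using sD(3) by blast
    next
      case 2
      then show False using sD(10) by blast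
    next
      case 3
      have "a < c" using tree_family_bounds[OF G g] by simp
      then have "j < c" "c \<le> m" "c \<noteq> m" using insideD[OF 3(2)] distinct_ends_eq[OF good(2), of a c j] g eG
          by auto
      then show False using outside_cases(1)[OF F eF 3(1)] by auto
    next
      case 4
      have "c < q" using tree_family_bounds[OF F f] by simp
      then have "j \<le> c" "c < m" using insideD[OF 4(1)] by auto
      then show False using outside_cases(2)[OF G eG 4(2)] by auto
    qed
  qed
  have XY: "matching n F (G - {(a, c)}) \<longleftrightarrow> matching n (F - {(c, q)}) G"
  proof
    assume x: "matching n F (G - {(a, c)})"
    show "matching n (F - {(c, q)}) G"
    proof (rule matchingI)
      show "distinct_starts (F - {(c, q)})" using good(1)
          by (auto simp: distinct_starts_def intro: inj_on_subset)
      show "\<And>x p y. (x, y) \<in> F - {(c, q)} \<Longrightarrow> (p, x) \<in> G \<Longrightarrow> False"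
        using matchingD(3)[OF x] distinct_starts_eq[OF good(1) f] by auto
      show "\<And>p y. (p, y) \<in> F - {(c, q)} \<Longrightarrow> \<exists>a b. (a, b) \<in> insert (1, n) G \<and> a < p \<and> p < b \<and> b \<le> y"
        using matchingD(4)[OF x] by blast
    qed (use good card_Diff_F f in auto)
  next
    assume y: "matching n (F - {(c, q)}) G"
    have cq: "2 \<le> c" "c < q" "q \<le> n" "c < n" using distinct_starts_starts[OF F good(1) f] tree_family_bounds[OF
        F f] by auto
    have ac: "a < c" using tree_family_bounds[OF G g] by simp
    \<comment> \<open>The parent of \<open>(a, c)\<close> ends at \<open>d\<close>. If \<open>q < d\<close>, then the number \<open>c + 1\<close> must occur, but
      neither an edge of \<open>F\<close> that starts there nor an edge of \<open>G\<close> that ends there is possible.\<close>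
    define D where "D = {b. \<exists>x. (x, b) \<in> insert (1, n) G \<and> x \<le> a \<and> c < b}"
    have "n \<in> D" using cq tree_family_bounds[OF G g] by (auto simp: D_def)
    define d where "d = (LEAST b. b \<in> D)"
    have "d \<in> D" unfolding d_def using \<open>n \<in> D\<close> by (rule LeastI)
    then obtain w where w: "(w, d) \<in> insert (1, n) G" "w \<le> a" "c < d" by (auto simp: D_def)
    have dmin: "d \<le> b" if "(x, b) \<in> insert (1, n) G" "x \<le> a" "c < b" for x b
      unfolding d_def using that by (intro Least_le) (auto simp: D_def)
    have "d \<le> q"
    proof (rule ccontr)
      assume "\<not> d \<le> q"
      then have dq: "q < d" by simp
      have "d \<le> n" using dmin[of 1 n] cq tree_family_bounds[OF G g] by auto
      then have "2 \<le> Suc c" "Suc c < n" using cq dq by auto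
      then consider q1 where "(Suc c, q1) \<in> F - {(c, q)}" | a1 where "(a1, Suc c) \<in> G"
        using matching_cover[OF FD G y] by blast
      then show False
      proof cases
        case 1
        then obtain x b where xb: "(x, b) \<in> insert (1, n) G" "x < Suc c" "Suc c < b" "b \<le> q1"
          using matchingD(4)[OF y] by blast
        have "x \<le> a"
        proof (rule ccontr)
          assume "\<not> x \<le> a"
          then show False using nested[OF G, of a c x b] g xb by auto
        qed
        then have "d \<le> b" using dmin[OF xb(1)] xb by simp
        moreover have "q1 \<le> q" using nested[OF F, of c q "Suc c" q1] f 1 cq by auto
        ultimately show False using xb dq by simp
      next
        case 2
        have "a1 < Suc c" using tree_family_bounds[OF G 2] by simp
        then have "a1 \<le> a" using nested[OF G, of a c a1 "Suc c"] g 2 by force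
        then have "d \<le> Suc c" using dmin[of a1 "Suc c"] 2 by simp
        then show False using dq cq by simp
      qed
    qed
    have wG: "(w, d) \<in> insert (1, n) (G - {(a, c)})" using w by auto
    show "matching n F (G - {(a, c)})"
    proof (rule matchingI)
      show "distinct_ends n (G - {(a, c)})" using good(2) by (auto simp: distinct_ends_def intro: inj_on_subset)
      show "\<And>x p y. (x, y) \<in> F \<Longrightarrow> (p, x) \<in> G - {(a, c)} \<Longrightarrow> False"
        using matchingD(3)[OF y] distinct_ends_eq[OF good(2), of _ c a] g by auto
      fix p q' assume pq: "(p, q') \<in> F"
      show "\<exists>x b. (x, b) \<in> insert (1, n) (G - {(a, c)}) \<and> x < p \<and> p < b \<and> b \<le> q'"
      proof (cases "(p, q') = (c, q)")
        case True
        then show ?thesis using wG w \<open>d \<le> q\<close> ac by (intro exI[of _ w] exI[of _ d]) auto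
      next
        case False
        then obtain x b where xb: "(x, b) \<in> insert (1, n) G" "x < p" "p < b" "b \<le> q'"
          using matchingD(4)[OF y] pq by blast
        show ?thesis
        proof (cases "(x, b) = (a, c)")
          case True
          then have "q \<le> q'" using nested[OF F, of p q' c q] pq f xb by auto
          then show ?thesis using wG w \<open>d \<le> q\<close> xb True by (intro exI[of _ w] exI[of _ d]) auto
        next
          case False
          then show ?thesis using xb by blast
        qed
      qed
    qed (use good card_Diff_G g in auto)
  qed
  show ?thesis using that[OF f g X Y XY Z] by blast
qed

text \<open>
  Removal of the larger interval \<open>(i, m)\<close> is the stronger condition, since the smaller interval
  can replace the larger one as a witness less often than conversely. If the two conditions
  differ, then the edge of \<open>F\<close> that starts at \<open>j\<close> ends at \<open>m\<close>, so the smaller interval belongs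
  to \<open>F\<close>, and both families split along it. The interval \<open>(i, m)\<close> may be the root, which
  cannot be removed.
\<close>

lemma common_end:
  assumes fg: "distinct_starts F" and g1: "(j, m) \<in> G" and g2: "(i, m) \<in> insert (1, n) G" and ij: "i < j"
  shows "\<And>f. \<not> matching n (F - {f}) G"
    and "\<And>g. g \<noteq> (j, m) \<Longrightarrow> g \<noteq> (i, m) \<Longrightarrow> \<not> matching n F (G - {g})"
    and "\<And>e. e \<in> F \<Longrightarrow> e \<in> G \<Longrightarrow> e \<noteq> (j, m) \<Longrightarrow> \<not> split_matching n e F G"
    and "(i, m) \<in> G \<Longrightarrow> matching n F (G - {(i, m)}) \<Longrightarrow> matching n F (G - {(j, m)})"
    and "(j, m) \<in> F \<and> split_matching n (j, m) F G \<longleftrightarrow>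
      matching n F (G - {(j, m)}) \<and> \<not> ((i, m) \<in> G \<and> matching n F (G - {(i, m)}))"
proof -
  have jm: "j < m" "m \<le> n" "1 \<le> j" using tree_family_bounds[OF G g1] by auto
  have i1: "1 \<le> i" using g2 tree_family_bounds[OF G, of i m] by auto
  have notlg: "\<not> distinct_ends n G" using distinct_ends_eq[of n G i m j] g1 g2 ij by auto
  show "\<not> matching n (F - {f}) G" for f using matchingD(2) notlg by blast
  show "\<not> matching n F (G - {g})" if "g \<noteq> (j, m)" "g \<noteq> (i, m)" for g
  proof
    assume "matching n F (G - {g})"
    then have "distinct_ends n (G - {g})" by (rule matchingD)
    then show False using distinct_ends_eq[of n "G - {g}" i m j] g1 g2 ij that by auto
  qed
  show "\<not> split_matching n e F G" if e: "e \<in> F" "e \<in> G" "e \<noteq> (j, m)" for e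
  proof
    assume s: "split_matching n e F G"
    obtain x y where xy: "e = (x, y)" by fastforce
    note sD = split_matchingD[OF s[unfolded xy]]
    have eG: "(x, y) \<in> G" using e xy by simp
    have xyb: "x < y" using tree_family_bounds[OF G eG] by simp
    show False
    proof (cases "(j, m) \<in> inside (x, y) G")
      case True
      then have b: "x \<le> j" "m \<le> y" using insideD by fastforce+
      have "m \<noteq> y" using sD(9)[of j] True by auto
      then have "m < y" using b by simp
      then have "m \<noteq> n" using tree_family_bounds[OF G eG] by auto
      then have g2G: "(i, m) \<in> G" using g2 by auto
      have "x \<le> i" using nested[OF G, of i m x y] g2 eG \<open>m < y\<close> b jm by force
      then have "(i, m) \<in> inside (x, y) G" using insideI[OF g2G] \<open>m < y\<close> by auto
      then show False using sD(8)[OF True] ij by blast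
    next
      case False
      then have o1: "(j, m) \<in> outside (x, y) G" using g1 e(3) xy outside_inside[of G "(x, y)"] by blast
      have "(i, m) \<in> insert (1, n) (outside (x, y) G)"
      proof (rule ccontr)
        assume a: "\<not> ?thesis"
        then have "(i, m) \<in> G" using g2 by auto
        then have "x \<le> i" "m \<le> y" using a by (auto simp: outside_def)
        then show False using o1 ij by (auto simp: outside_def)
      qed
      then show False using distinct_ends_eq[OF sD(2), of i m j] o1 ij by auto
    qed
  qed
  show X21: "matching n F (G - {(j, m)})" if g2G: "(i, m) \<in> G" and x2: "matching n F (G - {(i, m)})"
  proof (rule matchingI)
    note lg2 = matchingD(2)[OF x2]
    show "distinct_ends n (G - {(j, m)})"
    proof (rule distinct_endsI)
      fix p p' q assume *: "(p, q) \<in> G - {(j, m)}" "(p', q) \<in> G - {(j, m)}"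
      show "p = p'"
      proof (cases "q = m")
        case True
        have "x = i" if "(x, m) \<in> G - {(j, m)}" for x
          using distinct_ends_eq[OF lg2, of x m j] that g1 ij by (cases "x = i") auto
        then show ?thesis using * True by blast
      next
        case False
        then show ?thesis using distinct_ends_eq[OF lg2, of p q p'] * by auto
      qed
    next
      have "m \<noteq> n" using lg2 g1 ij unfolding distinct_ends_def by force
      then show "(p, n) \<notin> G - {(j, m)}" for p using lg2 unfolding distinct_ends_def by force
    qed
    show "False" if "(x, q) \<in> F" "(p, x) \<in> G - {(j, m)}" for x p q
    proof (cases "(p, x) = (i, m)")
      case True
      then show False using matchingD(3)[OF x2, of x q j] that g1 ij by auto
    next
      case False
      then show False using matchingD(3)[OF x2, of x q p] that by auto
    qed
    show "\<exists>a b. (a, b) \<in> insert (1, n) (G - {(j, m)}) \<and> a < p \<and> p < b \<and> b \<le> q" if pq: "(p, q) \<in> F" for p q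
    proof -
      obtain a b where ab: "(a, b) \<in> insert (1, n) (G - {(i, m)})" "a < p" "p < b" "b \<le> q"
        using matchingD(4)[OF x2 pq] by blast
      show ?thesis
      proof (cases "(a, b) = (j, m)")
        case True
        then show ?thesis using ab g2G ij by (intro exI[of _ i] exI[of _ m]) auto
      next
        case False
        then show ?thesis using ab by blast
      qed
    qed
  qed (use fg card_Diff_G g1 in auto)
  show "(j, m) \<in> F \<and> split_matching n (j, m) F G \<longleftrightarrow>
      matching n F (G - {(j, m)}) \<and> \<not> ((i, m) \<in> G \<and> matching n F (G - {(i, m)}))"
  proof
    assume a: "matching n F (G - {(j, m)}) \<and> \<not> ((i, m) \<in> G \<and> matching n F (G - {(i, m)}))"
    then have x1: "matching n F (G - {(j, m)})" and nx2: "(i, m) \<in> G \<Longrightarrow> \<not> matching n F (G - {(i, m)})" by auto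
    note lg1 = matchingD(2)[OF x1]
    have j2: "2 \<le> j" "j < n" using ij i1 jm by auto
    have "\<not> (\<exists>p. (p, j) \<in> G - {(j, m)})"
    proof
      assume "\<exists>p. (p, j) \<in> G - {(j, m)}"
      then obtain p where p: "(p, j) \<in> G" by auto
      then show False using nested[OF G, of p j j m] g1 jm tree_family_bounds[OF G p] by auto
    qed
    then obtain q where q: "(j, q) \<in> F" using matching_cover[OF F GD x1 j2] by blast
    have mq: "m \<le> q"
    proof -
      obtain a b where ab: "(a, b) \<in> insert (1, n) (G - {(j, m)})" "a < j" "j < b" "b \<le> q"
        using matchingD(4)[OF x1 q] by blast
      then show ?thesis using nested[OF G, of a b j m] g1 by auto
    qed
    have qm: "q = m"
    proof (rule ccontr)
      assume "q \<noteq> m"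
      then have lt: "m < q" using mq by simp
      have qn: "q \<le> n" using tree_family_bounds[OF F q] by simp
      have g2G: "(i, m) \<in> G" using g2 lt qn by auto
      \<comment> \<open>If \<open>m < q\<close>, then the parent of \<open>(i, m)\<close> replaces it as a witness, so that its removal would
        be possible as well. The bound on the end \<open>d\<close> of the parent comes from the number \<open>m + 1\<close>.\<close>
      define D where "D = {b. \<exists>x. (x, b) \<in> insert (1, n) G \<and> x \<le> i \<and> m < b}"
      have "n \<in> D" using lt qn i1 by (auto simp: D_def)
      define d where "d = (LEAST b. b \<in> D)"
      have "d \<in> D" unfolding d_def using \<open>n \<in> D\<close> by (rule LeastI)
      then obtain w where w: "(w, d) \<in> insert (1, n) G" "w \<le> i" "m < d" by (auto simp: D_def)
      have dmin: "d \<le> b" if "(x, b) \<in> insert (1, n) G" "x \<le> i" "m < b" for x b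
        unfolding d_def using that by (intro Least_le) (auto simp: D_def)
      have "d \<le> q"
      proof (rule ccontr)
        assume "\<not> d \<le> q"
        then have dq: "q < d" by simp
        have "d \<le> n" using dmin[of 1 n] lt qn i1 by auto
        then have "2 \<le> Suc m" "Suc m < n" using lt dq jm by auto
        then consider q1 where "(Suc m, q1) \<in> F" | a1 where "(a1, Suc m) \<in> G"
          using matching_cover[OF F GD x1] by blast
        then show False
        proof cases
          case 1
          obtain x b where xb: "(x, b) \<in> insert (1, n) (G - {(j, m)})" "x < Suc m" "Suc m < b" "b \<le> q1"
            using matchingD(4)[OF x1 1] by blast
          have "x \<le> i"
          proof (rule ccontr)
            assume "\<not> x \<le> i"
            then show False using nested[OF G, of i m x b] g2G xb by auto
          qed
          then have "d \<le> b" using dmin[of x b] xb by auto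
          moreover have "q1 \<le> q" using nested[OF F, of j q "Suc m" q1] q 1 jm lt by auto
          ultimately show False using xb dq by simp
        next
          case 2
          have "a1 < Suc m" using tree_family_bounds[OF G 2] by simp
          then have "a1 \<le> i" using nested[OF G, of i m a1 "Suc m"] g2G 2 by force
          then have "d \<le> Suc m" using dmin[of a1 "Suc m"] 2 by simp
          then show False using dq lt by simp
        qed
      qed
      have wG: "(w, d) \<in> insert (1, n) (G - {(i, m)})" using w by auto
      have "matching n F (G - {(i, m)})"
      proof (rule matchingI)
        show "distinct_ends n (G - {(i, m)})"
        proof (rule distinct_endsI)
          fix p p' y assume *: "(p, y) \<in> G - {(i, m)}" "(p', y) \<in> G - {(i, m)}"
          show "p = p'"
          proof (cases "y = m")
            case True
            have "x = j" if "(x, m) \<in> G - {(i, m)}" for x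
              using distinct_ends_eq[OF lg1, of x m i] that g2G ij by (cases "x = j") auto
            then show ?thesis using * True by blast
          next
            case False
            then show ?thesis using distinct_ends_eq[OF lg1, of p y p'] * by auto
          qed
        next
          show "(p, n) \<notin> G - {(i, m)}" for p using lg1 lt qn unfolding distinct_ends_def by force
        qed
        show "False" if "(x, y) \<in> F" "(p, x) \<in> G - {(i, m)}" for x p y
        proof (cases "(p, x) = (j, m)")
          case True
          then show False using matchingD(3)[OF x1, of x y i] that g2G ij by auto
        next
          case False
          then show False using matchingD(3)[OF x1, of x y p] that by auto
        qed
        show "\<exists>a b. (a, b) \<in> insert (1, n) (G - {(i, m)}) \<and> a < p \<and> p < b \<and> b \<le> y" if pq: "(p, y) \<in> F" for p y
        proof -
          obtain a b where ab: "(a, b) \<in> insert (1, n) (G - {(j, m)})" "a < p" "p < b" "b \<le> y"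
            using matchingD(4)[OF x1 pq] by blast
          show ?thesis
          proof (cases "(a, b) = (i, m)")
            case False
            then show ?thesis using ab by blast
          next
            case True
            then have my: "i < p" "p < m" "m \<le> y" using ab by auto
            consider "p < j" | "p = j" | "j < p" by linarith
            then show ?thesis
            proof cases
              case 1
              then have "q \<le> y" using nested[OF F, of p y j q] pq q my jm by auto
              then show ?thesis using wG w \<open>d \<le> q\<close> my by (intro exI[of _ w] exI[of _ d]) auto
            next
              case 2
              then have "y = q" using distinct_starts_eq[OF fg] pq q by blast
              then show ?thesis using wG w \<open>d \<le> q\<close> my by (intro exI[of _ w] exI[of _ d]) auto
            next
              case 3
              then show ?thesis using g1 ij my by (intro exI[of _ j] exI[of _ m]) auto
            qed
          qed
        qed
      qed (use fg card_Diff_G g2G in auto)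
      then show False using nx2 g2G by blast
    qed
    have eF: "(j, m) \<in> F" using q qm by simp
    have "split_matching n (j, m) F G"
    proof (rule split_matchingI)
      show "distinct_starts (outside (j, m) F)"
        using fg unfolding distinct_starts_def outside_def by (auto intro: inj_on_subset)
      have sub: "outside (j, m) G \<subseteq> G - {(j, m)}" by (auto simp: outside_def)
      then show "distinct_ends n (outside (j, m) G)"
        using lg1 unfolding distinct_ends_def by (auto intro: inj_on_subset)
      have noj: "(j, y) \<notin> outside (j, m) F" for y
        using distinct_starts_eq[OF fg eF, of y] by (auto simp: outside_def)
      show "False" if "(x, y) \<in> outside (j, m) F" "(p, x) \<in> outside (j, m) G" for x p y
        using matchingD(3)[OF x1, of x y p] that sub by (auto simp: outside_def)
      show "False" if "(j, y) \<in> outside (j, m) F" "(p, m) \<in> outside (j, m) G" for p y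
        using noj that by blast
      show "\<exists>a b. (a, b) \<in> insert (1, n) (outside (j, m) G) \<and> a < p \<and> p < b \<and> b \<le> y \<and> \<not> (p = j \<and> b = m)"
        if o: "(p, y) \<in> outside (j, m) F" for p y
      proof -
        obtain a b where ab: "(a, b) \<in> insert (1, n) (G - {(j, m)})" "a < p" "p < b" "b \<le> y"
          using matchingD(4)[OF x1 outsideD[OF o]] by blast
        have pj: "p \<noteq> j" using noj o by blast
        have "(a, b) \<in> insert (1, n) (outside (j, m) G)"
        proof (rule ccontr)
          assume "\<not> ?thesis"
          then have "j \<le> a" "b \<le> m" using ab(1) by (auto simp: outside_def)
          then show False using outside_cases(1)[OF F eF o] ab by auto
        qed
        then show ?thesis using ab pj by blast
      qed
      show "y = y'" if "(p, y) \<in> inside (j, m) F" "(p, y') \<in> inside (j, m) F" for p y y'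
        using distinct_starts_eq[OF fg] insideD(1) that by blast
      show "False" if "(j, y) \<in> inside (j, m) F" for y
        using distinct_starts_eq[OF fg eF] insideD(1,4)[OF that] by blast
      show "p = p'" if "(p, y) \<in> inside (j, m) G" "(p', y) \<in> inside (j, m) G" for p p' y
        using distinct_ends_eq[OF lg1, of p y p'] insideD(1,4)[OF that(1)] insideD(1,4)[OF that(2)] by auto
      show "False" if "(p, m) \<in> inside (j, m) G" for p
        using distinct_ends_eq[OF lg1, of p m i] insideD[OF that] g2 ij by auto
      show "False" if "(x, y) \<in> inside (j, m) F" "(p, x) \<in> inside (j, m) G" for x p y
        using matchingD(3)[OF x1, of x y p] insideD[OF that(1)] insideD[OF that(2)] by auto
      show "\<exists>a b. (a, b) \<in> insert (j, m) (inside (j, m) G) \<and> a < p \<and> p < b \<and> b \<le> y"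
        if o: "(p, y) \<in> inside (j, m) F" for p y
      proof -
        have py: "(p, y) \<in> F" "j \<le> p" "y \<le> m" "p \<noteq> j"
          using insideD[OF o] distinct_starts_eq[OF fg eF, of y] by auto
        obtain a b where ab: "(a, b) \<in> insert (1, n) (G - {(j, m)})" "a < p" "p < b" "b \<le> y"
          using matchingD(4)[OF x1 py(1)] by blast
        show ?thesis
        proof (cases "j \<le> a")
          case True
          then have "(a, b) \<in> inside (j, m) G" using ab py j2 by (auto simp: inside_def)
          then show ?thesis using ab by blast
        next
          case False
          then have "m \<le> b" using nested[OF G, of a b j m] g1 ab py by auto
          then show ?thesis using ab py by (intro exI[of _ j] exI[of _ m]) auto
        qed
      qed
    qed
    then show "(j, m) \<in> F \<and> split_matching n (j, m) F G" using eF by simp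
  next
    assume a: "(j, m) \<in> F \<and> split_matching n (j, m) F G"
    then have eF: "(j, m) \<in> F" and s: "split_matching n (j, m) F G" by auto
    note sD = split_matchingD[OF s]
    have Gsplit: "x \<in> outside (j, m) G \<or> x \<in> inside (j, m) G" if "x \<in> G - {(j, m)}" for x
      using that outside_inside[of G "(j, m)"] by blast
    have g2o: "(i, m) \<in> insert (1, n) (outside (j, m) G)"
      using g2 ij by (auto simp: outside_def)
    have Fi: "j < p" "p < m" if "(p, y) \<in> inside (j, m) F" for p y
      using insideD[OF that] sD(7) that tree_family_bounds[OF F, of p y] by (cases "p = j"; force)+
    have Gi: "j < y" "y < m" if "(p, y) \<in> inside (j, m) G" for p y
      using insideD[OF that] sD(9) that tree_family_bounds[OF G, of p y] by (cases "y = m"; force)+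
    have x1: "matching n F (G - {(j, m)})"
    proof (rule matchingI)
      show "distinct_ends n (G - {(j, m)})"
      proof (rule distinct_endsI)
        fix p p' q assume *: "(p, q) \<in> G - {(j, m)}" "(p', q) \<in> G - {(j, m)}"
        have mix: False if "(x, q) \<in> outside (j, m) G" "(x', q) \<in> inside (j, m) G" for x x'
          using outside_cases(2)[OF G g1 that(1)] Gi[OF that(2)] by auto
        show "p = p'" using Gsplit[OF *(1)] Gsplit[OF *(2)] mix sD(8)[of p q p'] distinct_ends_eq[OF sD(2), of p
            q p'] by blast
      next
        fix p show "(p, n) \<notin> G - {(j, m)}"
        proof
          assume "(p, n) \<in> G - {(j, m)}"
          then consider "(p, n) \<in> outside (j, m) G" | "(p, n) \<in> inside (j, m) G" using Gsplit by blast
          then show False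
          proof cases
            case 1
            then show False using sD(2) by (force simp: distinct_ends_def)
          next
            case 2
            then show False using Gi(2)[OF 2] jm by simp
          qed
        qed
      qed
      show "False" if xy: "(x, y) \<in> F" "(p, x) \<in> G - {(j, m)}" for x p y
      proof -
        have px: "p < x" using tree_family_bounds[OF G, of p x] xy by auto
        have F3: "(x, y) \<in> outside (j, m) F \<or> (x, y) \<in> inside (j, m) F \<or> (x, y) = (j, m)"
          using xy outside_inside[of F "(j, m)"] by blast
        show False using Gsplit[OF xy(2)]
        proof
          assume o: "(p, x) \<in> outside (j, m) G"
          have c: "x < j \<or> m \<le> x" using outside_cases(2)[OF G g1 o] .
          show False using F3 sD(3)[of x y p] o Fi[of x y] c jm by auto
        next
          assume o: "(p, x) \<in> inside (j, m) G"
          have c: "j < x" "x < m" using Gi[OF o] by auto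
          show False using F3 sD(10)[of x y p] o outside_cases(1)[OF F eF, of x y] c by auto
        qed
      qed
      show "\<exists>a b. (a, b) \<in> insert (1, n) (G - {(j, m)}) \<and> a < p \<and> p < b \<and> b \<le> y" if xy: "(p, y) \<in> F" for p y
      proof -
        consider "(p, y) \<in> outside (j, m) F" | "(p, y) \<in> inside (j, m) F" | "(p, y) = (j, m)"
          using xy outside_inside[of F "(j, m)"] by blast
        then show ?thesis
        proof cases
          case 1
          have "insert (1, n) (outside (j, m) G) \<subseteq> insert (1, n) (G - {(j, m)})" by (auto simp: outside_def)
          then show ?thesis using sD(5)[OF 1] by blast
        next
          case 2
          obtain x b where xb: "(x, b) \<in> insert (j, m) (inside (j, m) G)" "x < p" "p < b" "b \<le> y"
            using sD(11)[OF 2] by blast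
          show ?thesis
          proof (cases "(x, b) = (j, m)")
            case True
            then show ?thesis using xb g2 ij by (intro exI[of _ i] exI[of _ m]) auto
          next
            case False
            then have "(x, b) \<in> G - {(j, m)}" using xb(1) insideD(1,4) by blast
            then show ?thesis using xb by blast
          qed
        next
          case 3
          then show ?thesis using g2 ij jm by (intro exI[of _ i] exI[of _ m]) auto
        qed
      qed
    qed (use fg card_Diff_G g1 in auto)
    moreover have "\<not> matching n F (G - {(i, m)})" if g2G: "(i, m) \<in> G"
    proof
      assume x2: "matching n F (G - {(i, m)})"
      obtain x b where xb: "(x, b) \<in> insert (1, n) (G - {(i, m)})" "x < j" "j < b" "b \<le> m"
        using matchingD(4)[OF x2 eF] by blast
      have "m \<le> b" using nested[OF G, of x b j m] g1 xb by auto
      then have "b = m" using xb by simp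
      then show False using distinct_ends_eq[OF matchingD(2)[OF x2], of x m j] xb g1 ij by auto
    qed
    ultimately show "matching n F (G - {(j, m)}) \<and> \<not> ((i, m) \<in> G \<and> matching n F (G - {(i, m)}))" by blast
  qed
qed

text \<open>
  Removal of the larger interval \<open>(j, r)\<close> is the stronger condition, since it keeps \<open>(j, m)\<close>, whose
  witness has to end sooner. If there is no such witness, then the edge of \<open>G\<close> that ends at \<open>m\<close>
  is \<open>(j, m)\<close> itself, and both families split along this interval. The interval \<open>(j, r)\<close> may
  be the root.
\<close>

lemma common_start:
  assumes f1: "(j, m) \<in> F" and f2: "(j, r) \<in> insert (1, n) F" and mr: "m < r"
  shows "\<And>g. \<not> matching n F (G - {g})"
    and "\<And>f. f \<noteq> (j, m) \<Longrightarrow> f \<noteq> (j, r) \<Longrightarrow> \<not> matching n (F - {f}) G"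
    and "\<And>e. e \<in> F \<Longrightarrow> e \<in> G \<Longrightarrow> e \<noteq> (j, m) \<Longrightarrow> \<not> split_matching n e F G"
    and "(j, r) \<in> F \<Longrightarrow> matching n (F - {(j, r)}) G \<Longrightarrow> matching n (F - {(j, m)}) G"
    and "(j, m) \<in> G \<and> split_matching n (j, m) F G \<longleftrightarrow>
      matching n (F - {(j, m)}) G \<and> \<not> ((j, r) \<in> F \<and> matching n (F - {(j, r)}) G)"
proof -
  have jm: "j < m" "m \<le> n" "1 \<le> j" using tree_family_bounds[OF F f1] by auto
  have rn: "r \<le> n" using f2 tree_family_bounds[OF F, of j r] by auto
  have fge: "y = y'" if "distinct_starts F'" "(x, y) \<in> insert (1, n) F'" "(x, y') \<in> insert (1, n) F'" for F' x y
      y'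
    using that distinct_starts_eq[of F' x y y'] unfolding distinct_starts_def by force
  have notfg: "\<not> distinct_starts F" using fge[of F j m r] f1 f2 mr by auto
  show "\<not> matching n F (G - {g})" for g using matchingD(1) notfg by blast
  show "\<not> matching n (F - {f}) G" if "f \<noteq> (j, m)" "f \<noteq> (j, r)" for f
  proof
    assume "matching n (F - {f}) G"
    then have "distinct_starts (F - {f})" by (rule matchingD)
    then show False using fge[of "F - {f}" j m r] f1 f2 mr that by auto
  qed
  show "\<not> split_matching n e F G" if e: "e \<in> F" "e \<in> G" "e \<noteq> (j, m)" for e
  proof
    assume s: "split_matching n e F G"
    obtain x y where xy: "e = (x, y)" by fastforce
    note sD = split_matchingD[OF s[unfolded xy]]
    have eF: "(x, y) \<in> F" using e xy by simp
    have xyb: "x < y" using tree_family_bounds[OF F eF] by simp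
    show False
    proof (cases "(j, m) \<in> inside (x, y) F")
      case True
      then have b: "x \<le> j" "m \<le> y" using insideD by fastforce+
      have "x \<noteq> j" using sD(7)[of m] True by auto
      then have xj: "x < j" using b by simp
      then have "j \<noteq> 1" using tree_family_bounds[OF F eF] by auto
      then have f2F: "(j, r) \<in> F" using f2 by auto
      have "r \<le> y" using nested[OF F, of x y j r] f2 eF xj b jm by force
      then have "(j, r) \<in> inside (x, y) F" using insideI[OF f2F] xj by auto
      then show False using sD(6)[OF True] mr by blast
    next
      case False
      then have o1: "(j, m) \<in> outside (x, y) F" using f1 e(3) xy outside_inside[of F "(x, y)"] by blast
      have "(j, r) \<in> insert (1, n) (outside (x, y) F)"
      proof (rule ccontr)
        assume a: "\<not> ?thesis"
        then have "(j, r) \<in> F" using f2 by auto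
        then have "x \<le> j" "r \<le> y" using a by (auto simp: outside_def)
        then show False using o1 mr by (auto simp: outside_def)
      qed
      then show False using fge[OF sD(1), of j r m] o1 mr by auto
    qed
  qed
  show Y21: "matching n (F - {(j, m)}) G" if f2F: "(j, r) \<in> F" and y2: "matching n (F - {(j, r)}) G"
  proof (rule matchingI)
    note fg2 = matchingD(1)[OF y2]
    have j1: "j \<noteq> 1" using fg2 f1 mr unfolding distinct_starts_def by force
    show "distinct_starts (F - {(j, m)})"
    proof (rule distinct_startsI)
      fix p q q' assume *: "(p, q) \<in> F - {(j, m)}" "(p, q') \<in> F - {(j, m)}"
      show "q = q'"
      proof (cases "p = j")
        case True
        have "x = r" if "(j, x) \<in> F - {(j, m)}" for x
          using distinct_starts_eq[OF fg2, of j x m] that f1 mr by (cases "x = r") auto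
        then show ?thesis using * True by blast
      next
        case False
        then show ?thesis using distinct_starts_eq[OF fg2, of p q q'] * by auto
      qed
    next
      show "(1, q) \<notin> F - {(j, m)}" for q using fg2 j1 unfolding distinct_starts_def by force
    qed
    show "distinct_ends n G" by (rule matchingD[OF y2])
    show "False" if "(x, q) \<in> F - {(j, m)}" "(p, x) \<in> G" for x p q
    proof (cases "(x, q) = (j, r)")
      case True
      then show False using matchingD(3)[OF y2, of x m p] that f1 mr by auto
    next
      case False
      then show False using matchingD(3)[OF y2, of x q p] that by auto
    qed
    show "\<exists>a b. (a, b) \<in> insert (1, n) G \<and> a < p \<and> p < b \<and> b \<le> q" if "(p, q) \<in> F - {(j, m)}" for p q
    proof (cases "(p, q) = (j, r)")
      case True
      have "(j, m) \<in> F - {(j, r)}" using f1 mr by auto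
      then obtain a b where "(a, b) \<in> insert (1, n) G" "a < j" "j < b" "b \<le> m"
        using matchingD(4)[OF y2] by blast
      then show ?thesis using True mr by (intro exI[of _ a] exI[of _ b]) auto
    next
      case False
      then show ?thesis using matchingD(4)[OF y2, of p q] that by auto
    qed
  qed (use card_Diff_F f1 in auto)
  show "(j, m) \<in> G \<and> split_matching n (j, m) F G \<longleftrightarrow>
      matching n (F - {(j, m)}) G \<and> \<not> ((j, r) \<in> F \<and> matching n (F - {(j, r)}) G)"
  proof
    assume a: "matching n (F - {(j, m)}) G \<and> \<not> ((j, r) \<in> F \<and> matching n (F - {(j, r)}) G)"
    then have y1: "matching n (F - {(j, m)}) G" and ny2: "(j, r) \<in> F \<Longrightarrow> \<not> matching n (F - {(j, r)}) G" by auto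
    note fg1 = matchingD(1)[OF y1] and lg = matchingD(2)[OF y1]
    \<comment> \<open>A witness for \<open>(j, m)\<close> would make the removal of \<open>(j, r)\<close> possible as well.\<close>
    have nowit: "\<not> (a < j \<and> b \<le> m \<and> j < b)" if ab: "(a, b) \<in> insert (1, n) G" for a b
    proof
      assume w: "a < j \<and> b \<le> m \<and> j < b"
      have "1 \<le> a" using ab tree_family_bounds[OF G, of a b] by auto
      then have "j \<noteq> 1" using w by auto
      then have f2F: "(j, r) \<in> F" using f2 by auto
      have "matching n (F - {(j, r)}) G"
      proof (rule matchingI)
        show "distinct_starts (F - {(j, r)})"
        proof (rule distinct_startsI)
          fix p q q' assume *: "(p, q) \<in> F - {(j, r)}" "(p, q') \<in> F - {(j, r)}"
          show "q = q'"
          proof (cases "p = j")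
            case True
            have "x = m" if "(j, x) \<in> F - {(j, r)}" for x
              using distinct_starts_eq[OF fg1, of j x r] that f2F mr by (cases "x = m") auto
            then show ?thesis using * True by blast
          next
            case False
            then show ?thesis using distinct_starts_eq[OF fg1, of p q q'] * by auto
          qed
        next
          show "(1, q) \<notin> F - {(j, r)}" for q using fg1 \<open>j \<noteq> 1\<close> unfolding distinct_starts_def by force
        qed
        show "False" if "(x, q) \<in> F - {(j, r)}" "(p, x) \<in> G" for x p q
        proof (cases "(x, q) = (j, m)")
          case True
          then show False using matchingD(3)[OF y1, of x r p] that f2F mr by auto
        next
          case False
          then show False using matchingD(3)[OF y1, of x q p] that by auto
        qed
        show "\<exists>a b. (a, b) \<in> insert (1, n) G \<and> a < p \<and> p < b \<and> b \<le> q" if "(p, q) \<in> F - {(j, r)}" for p q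
        proof (cases "(p, q) = (j, m)")
          case True
          then show ?thesis using ab w by blast
        next
          case False
          then show ?thesis using matchingD(4)[OF y1, of p q] that by auto
        qed
      qed (use lg card_Diff_F f2F in auto)
      then show False using ny2 f2F by blast
    qed
    have "\<exists>a. (a, m) \<in> G"
    proof -
      have "2 \<le> m" "m < n" using jm mr rn by auto
      then consider x where "(m, x) \<in> F" | a where "(a, m) \<in> G" using matching_cover[OF FD G y1] by blast
      then show ?thesis
      proof cases
        case 1
        then show ?thesis using nested[OF F, of j m m x] f1 jm tree_family_bounds[OF F 1] by auto
      qed blast
    qed
    then obtain a where aG: "(a, m) \<in> G" by blast
    have am: "a < m" "1 \<le> a" using tree_family_bounds[OF G aG] by auto
    have mn: "m < n" using mr rn by simp
    have "a = j"
    proof (rule ccontr)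
      assume "a \<noteq> j"
      then consider "a < j" | "j < a" by linarith
      then show False
      proof cases
        case 1
        then show False using nowit[of a m] aG jm by auto
      next
        case 2
        then have "2 \<le> a" "a < n" using jm am mn by auto
        then consider q where "(a, q) \<in> F - {(j, m)}" | x where "(x, a) \<in> G"
            using matching_cover[OF FD G y1] by blast
        then show False
        proof cases
          case 1
          then have "q \<le> m" using nested[OF F, of j m a q] f1 2 am by auto
          obtain x b where xb: "(x, b) \<in> insert (1, n) G" "x < a" "a < b" "b \<le> q"
            using matchingD(4)[OF y1 1] by blast
          have "m \<le> b" using nested[OF G, of x b a m] aG xb by auto
          then have "b = m" using xb \<open>q \<le> m\<close> by simp
          then show False using distinct_ends_eq[OF lg, of x m a] xb aG by auto
        next
          case xa: 2
          then show False using nested[OF G, of x a a m] aG am tree_family_bounds[OF G xa] by auto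
        qed
      qed
    qed
    then have eG: "(j, m) \<in> G" using aG by simp
    have "split_matching n (j, m) F G"
    proof (rule split_matchingI)
      have sub: "outside (j, m) F \<subseteq> F - {(j, m)}" by (auto simp: outside_def)
      then show "distinct_starts (outside (j, m) F)"
        using fg1 unfolding distinct_starts_def by (auto intro: inj_on_subset)
      show "distinct_ends n (outside (j, m) G)"
        using lg unfolding distinct_ends_def outside_def by (auto intro: inj_on_subset)
      have nom: "(x, m) \<notin> outside (j, m) G" for x
        using distinct_ends_eq[OF lg, of x m j] eG by (auto simp: outside_def)
      show "False" if "(x, y) \<in> outside (j, m) F" "(p, x) \<in> outside (j, m) G" for x p y
        using matchingD(3)[OF y1, of x y p] that sub by (auto simp: outside_def)
      show "False" if "(j, y) \<in> outside (j, m) F" "(p, m) \<in> outside (j, m) G" for p y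
        using nom that by blast
      show "\<exists>a b. (a, b) \<in> insert (1, n) (outside (j, m) G) \<and> a < p \<and> p < b \<and> b \<le> y \<and> \<not> (p = j \<and> b = m)"
        if o: "(p, y) \<in> outside (j, m) F" for p y
      proof -
        obtain x b where xb: "(x, b) \<in> insert (1, n) G" "x < p" "p < b" "b \<le> y"
          using matchingD(4)[OF y1, of p y] o sub by blast
        have "(x, b) \<in> insert (1, n) (outside (j, m) G)"
        proof (rule ccontr)
          assume "\<not> ?thesis"
          then have "j \<le> x" "b \<le> m" using xb(1) by (auto simp: outside_def)
          then show False using outside_cases(1)[OF F f1 o] xb by auto
        qed
        moreover have "\<not> (p = j \<and> b = m)"
        proof
          assume "p = j \<and> b = m"
          then show False using distinct_ends_eq[OF lg, of x m j] xb eG by auto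
        qed
        ultimately show ?thesis using xb by blast
      qed
      show "y = y'" if "(p, y) \<in> inside (j, m) F" "(p, y') \<in> inside (j, m) F" for p y y'
        using distinct_starts_eq[OF fg1, of p y y'] insideD(1,4)[OF that(1)] insideD(1,4)[OF that(2)] by auto
      show "False" if "(j, y) \<in> inside (j, m) F" for y
        using fge[OF fg1, of j y r] insideD[OF that] f2 mr by auto
      show "p = p'" if "(p, y) \<in> inside (j, m) G" "(p', y) \<in> inside (j, m) G" for p p' y
        using distinct_ends_eq[OF lg, of p y p'] insideD(1)[OF that(1)] insideD(1)[OF that(2)] by auto
      show "False" if "(p, m) \<in> inside (j, m) G" for p
        using distinct_ends_eq[OF lg, of p m j] insideD[OF that] eG by auto
      show "False" if "(x, y) \<in> inside (j, m) F" "(p, x) \<in> inside (j, m) G" for x p y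
        using matchingD(3)[OF y1, of x y p] insideD[OF that(1)] insideD[OF that(2)] by auto
      show "\<exists>a b. (a, b) \<in> insert (j, m) (inside (j, m) G) \<and> a < p \<and> p < b \<and> b \<le> y"
        if o: "(p, y) \<in> inside (j, m) F" for p y
      proof -
        have py: "(p, y) \<in> F - {(j, m)}" "j \<le> p" "y \<le> m"
          using insideD[OF o] by auto
        obtain x b where xb: "(x, b) \<in> insert (1, n) G" "x < p" "p < b" "b \<le> y"
          using matchingD(4)[OF y1 py(1)] by blast
        show ?thesis
        proof (cases "j \<le> x")
          case True
          then have "(x, b) \<in> insert (j, m) (inside (j, m) G)" using xb py mn by (auto simp: inside_def)
          then show ?thesis using xb by blast
        next
          case False
          then have "m \<le> b" using nested[OF G, of x b j m] eG xb py by auto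
          then have "b = m" using xb py by simp
          then show ?thesis using distinct_ends_eq[OF lg, of x m j] xb eG False by auto
        qed
      qed
    qed
    then show "(j, m) \<in> G \<and> split_matching n (j, m) F G" using eG by simp
  next
    assume a: "(j, m) \<in> G \<and> split_matching n (j, m) F G"
    then have eG: "(j, m) \<in> G" and s: "split_matching n (j, m) F G" by auto
    note sD = split_matchingD[OF s]
    have mn: "m < n" using mr rn by simp
    have Fsplit: "x \<in> outside (j, m) F \<or> x \<in> inside (j, m) F" if "x \<in> F - {(j, m)}" for x
      using that outside_inside[of F "(j, m)"] by blast
    have Gsplit: "x \<in> outside (j, m) G \<or> x \<in> inside (j, m) G \<or> x = (j, m)" if "x \<in> G" for x
      using that outside_inside[of G "(j, m)"] by blast
    have Fi: "j < p" "p < m" if "(p, y) \<in> inside (j, m) F" for p y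
      using insideD[OF that] sD(7) that tree_family_bounds[OF F, of p y] by (cases "p = j"; force)+
    have Gi: "j < y" "y < m" if "(p, y) \<in> inside (j, m) G" for p y
      using insideD[OF that] sD(9) that tree_family_bounds[OF G, of p y] by (cases "y = m"; force)+
    have nom: "(x, m) \<notin> outside (j, m) G" for x
    proof
      assume x: "(x, m) \<in> outside (j, m) G"
      show False
      proof (cases "(j, r) \<in> F")
        case True
        then have "(j, r) \<in> outside (j, m) F" using mr by (auto simp: outside_def)
        then show False using sD(4) x by blast
      next
        case False
        then have "j = 1" using f2 by auto
        then show False using x tree_family_bounds[OF G, of x m] by (auto simp: outside_def)
      qed
    qed
    have y1: "matching n (F - {(j, m)}) G"
    proof (rule matchingI)
      show "distinct_starts (F - {(j, m)})"
      proof (rule distinct_startsI)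
        fix p q q' assume *: "(p, q) \<in> F - {(j, m)}" "(p, q') \<in> F - {(j, m)}"
        have mix: False if "(p, x) \<in> outside (j, m) F" "(p, x') \<in> inside (j, m) F" for x x'
          using outside_cases(1)[OF F f1 that(1)] Fi[OF that(2)] by auto
        show "q = q'" using Fsplit[OF *(1)] Fsplit[OF *(2)] mix sD(6)[of p q q'] distinct_starts_eq[OF sD(1), of
            p q q'] by blast
      next
        fix q show "(1, q) \<notin> F - {(j, m)}"
        proof
          assume "(1, q) \<in> F - {(j, m)}"
          then consider "(1, q) \<in> outside (j, m) F" | "(1, q) \<in> inside (j, m) F" using Fsplit by blast
          then show False
          proof cases
            case 1
            then show False using sD(1) by (force simp: distinct_starts_def)
          next
            case 2
            then show False using Fi(1)[OF 2] jm by simp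
          qed
        qed
      qed
      show "distinct_ends n G"
      proof (rule distinct_endsI)
        fix p p' q assume *: "(p, q) \<in> G" "(p', q) \<in> G"
        have mix: False if "(x, q) \<in> outside (j, m) G" "(x', q) \<in> inside (j, m) G" for x x'
          using outside_cases(2)[OF G eG that(1)] Gi[OF that(2)] by auto
        have mixo: False if "(x, q) \<in> outside (j, m) G" "q = m" for x using nom that by blast
        have mixi: False if "(x, q) \<in> inside (j, m) G" "q = m" for x using Gi(2)[OF that(1)] that by simp
        show "p = p'" using Gsplit[OF *(1)] Gsplit[OF *(2)] mix mixo mixi sD(8)[of p q p'] distinct_ends_eq[OF
            sD(2), of p q p'] by blast
      next
        fix p show "(p, n) \<notin> G"
        proof
          assume "(p, n) \<in> G"
          then consider "(p, n) \<in> outside (j, m) G" | "(p, n) \<in> inside (j, m) G" | "n = m" using Gsplit by blast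
          then show False
          proof cases
            case 1
            then show False using sD(2) by (force simp: distinct_ends_def)
          next
            case 2
            then show False using Gi(2)[OF 2] jm by simp
          qed (use mn in simp)
        qed
      qed
      show "False" if xy: "(x, y) \<in> F - {(j, m)}" "(p, x) \<in> G" for x p y
        using Fsplit[OF xy(1)]
      proof
        assume o: "(x, y) \<in> outside (j, m) F"
        have c: "x \<le> j \<or> m < x" using outside_cases(1)[OF F f1 o] .
        show False using Gsplit[OF xy(2)] sD(3)[of x y p] o Gi[of p x] c jm by auto
      next
        assume o: "(x, y) \<in> inside (j, m) F"
        have c: "j < x" "x < m" using Fi[OF o] by auto
        show False using Gsplit[OF xy(2)] sD(10)[of x y p] o outside_cases(2)[OF G eG, of p x] c by auto
      qed
      show "\<exists>a b. (a, b) \<in> insert (1, n) G \<and> a < p \<and> p < b \<and> b \<le> y" if xy: "(p, y) \<in> F - {(j, m)}" for p y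
        using Fsplit[OF xy]
      proof
        assume o: "(p, y) \<in> outside (j, m) F"
        have "insert (1, n) (outside (j, m) G) \<subseteq> insert (1, n) G" by (auto simp: outside_def)
        then show ?thesis using sD(5)[OF o] by blast
      next
        assume o: "(p, y) \<in> inside (j, m) F"
        have "insert (j, m) (inside (j, m) G) \<subseteq> insert (1, n) G" using eG by (auto simp: inside_def)
        then show ?thesis using sD(11)[OF o] by blast
      qed
    qed (use card_Diff_F f1 in auto)
    moreover have "\<not> matching n (F - {(j, r)}) G" if f2F: "(j, r) \<in> F"
    proof
      assume y2: "matching n (F - {(j, r)}) G"
      obtain x b where xb: "(x, b) \<in> insert (1, n) G" "x < j" "j < b" "b \<le> m"
        using matchingD(4)[OF y2, of j m] f1 mr by auto
      have "m \<le> b" using nested[OF G, of x b j m] eG xb by auto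
      then have "b = m" using xb by simp
      then have "(x, m) \<in> outside (j, m) G" using xb mn by (auto simp: outside_def)
      then show False using nom by blast
    qed
    ultimately show "matching n (F - {(j, m)}) G \<and> \<not> ((j, r) \<in> F \<and> matching n (F - {(j, r)}) G)" by blast
  qed
qed

end

section \<open>Matching families and grafting\<close>

text \<open>
  The renumbering of first leaves and of last leaves in a graft.
\<close>

definition outer_start :: "nat \<Rightarrow> nat \<Rightarrow> nat \<Rightarrow> nat" where
  "outer_start j s p = (if p \<le> j then p else p + s - 1)"

definition outer_end :: "nat \<Rightarrow> nat \<Rightarrow> nat \<Rightarrow> nat" where
  "outer_end j s q = (if q < j then q else q + s - 1)"

lemma outer_edge_pair: "outer_edge j s (p, q) = (outer_start j s p, outer_end j s q)"
  by (simp add: outer_edge_def outer_start_def outer_end_def)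

lemma outer_ineqs:
  assumes "2 \<le> s"
  shows "outer_start j s p = outer_start j s p' \<longleftrightarrow> p = p'" "outer_start j s p < outer_start j s p' \<longleftrightarrow> p < p'"
    "outer_end j s q = outer_end j s q' \<longleftrightarrow> q = q'" "outer_end j s q \<le> outer_end j s q' \<longleftrightarrow> q \<le> q'"
    "outer_start j s p = j \<longleftrightarrow> p = j" "outer_end j s q = j + s - 1 \<longleftrightarrow> q = j"
    "outer_start j s p = outer_end j s q \<longleftrightarrow> p = q \<and> p \<noteq> j"
    "outer_start j s p < outer_end j s q \<and> \<not> (outer_start j s p = j \<and> outer_end j s q = j + s - 1) \<longleftrightarrow> p < q"
  using assms by (auto simp: outer_start_def outer_end_def)

lemma Ball_outer: "(\<forall>p q. (p, q) \<in> outer_edge j s ` A \<longrightarrow> P p q) \<longleftrightarrow>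
    (\<forall>p q. (p, q) \<in> A \<longrightarrow> P (outer_start j s p) (outer_end j s q))"
proof safe
  fix p q assume "\<forall>p q. (p, q) \<in> outer_edge j s ` A \<longrightarrow> P p q" "(p, q) \<in> A"
  then show "P (outer_start j s p) (outer_end j s q)" by (metis image_eqI outer_edge_pair)
next
  fix p q a b assume "\<forall>p q. (p, q) \<in> A \<longrightarrow> P (outer_start j s p) (outer_end j s q)" "(p, q) =
      outer_edge j s (a, b)" "(a, b) \<in> A"
  then show "P p q" by (simp add: outer_edge_pair)
qed

lemma Bex_outer: "(\<exists>p q. (p, q) \<in> outer_edge j s ` A \<and> P p q) \<longleftrightarrow>
    (\<exists>p q. (p, q) \<in> A \<and> P (outer_start j s p) (outer_end j s q))"
  using Ball_outer[of j s A "\<lambda>p q. \<not> P p q"] by blast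

lemma inj_fst_iff: "inj_on fst A \<and> c \<notin> fst ` A \<longleftrightarrow>
    (\<forall>p q. (p, q) \<in> A \<longrightarrow> p \<noteq> c \<and> (\<forall>p' q'. (p', q') \<in> A \<longrightarrow> p = p' \<longrightarrow> q = q'))" (is "?L \<longleftrightarrow> ?R")
proof
  assume l: ?L
  have "p \<noteq> c" if "(p, q) \<in> A" for p q using l imageI[OF that, of fst] by auto
  then show ?R using inj_fstD[where A = A] l by blast
next
  assume r: ?R
  have "x = y" if "x \<in> A" "y \<in> A" "fst x = fst y" for x y
    using r that by (metis prod.collapse)
  then have "inj_on fst A" by (rule inj_onI)
  moreover have "fst x \<noteq> c" if "x \<in> A" for x using r[rule_format, of "fst x" "snd x"] that by simp
  ultimately show ?L by blast
qed

lemma inj_snd_iff: "inj_on snd A \<and> c \<notin> snd ` A \<longleftrightarrow>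
    (\<forall>p q. (p, q) \<in> A \<longrightarrow> q \<noteq> c \<and> (\<forall>p' q'. (p', q') \<in> A \<longrightarrow> q = q' \<longrightarrow> p = p'))" (is "?L \<longleftrightarrow> ?R")
proof
  assume l: ?L
  have "q \<noteq> c" if "(p, q) \<in> A" for p q using l imageI[OF that, of snd] by auto
  then show ?R using inj_sndD[where A = A] l by blast
next
  assume r: ?R
  have "x = y" if "x \<in> A" "y \<in> A" "snd x = snd y" for x y
    using r that by (metis prod.collapse)
  then have "inj_on snd A" by (rule inj_onI)
  moreover have "snd x \<noteq> c" if "x \<in> A" for x using r[rule_format, of "fst x" "snd x"] that by simp
  ultimately show ?L by blast
qed

lemma distinct_starts_iff: "distinct_starts F \<longleftrightarrow>
    (\<forall>p q. (p, q) \<in> F \<longrightarrow> p \<noteq> 1 \<and> (\<forall>p' q'. (p', q') \<in> F \<longrightarrow> p = p' \<longrightarrow> q = q'))"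
  unfolding distinct_starts_def by (rule inj_fst_iff)

lemma distinct_ends_iff: "distinct_ends n G \<longleftrightarrow>
    (\<forall>p q. (p, q) \<in> G \<longrightarrow> q \<noteq> n \<and> (\<forall>p' q'. (p', q') \<in> G \<longrightarrow> q = q' \<longrightarrow> p = p'))"
  unfolding distinct_ends_def by (rule inj_snd_iff)

lemma disjoint_names_iff: "fst ` F \<inter> snd ` G = {} \<longleftrightarrow> (\<forall>p q. (p, q) \<in> F \<longrightarrow> (\<forall>a b. (a, b) \<in> G \<longrightarrow> p \<noteq> b))"
proof
  assume "fst ` F \<inter> snd ` G = {}"
  then show "\<forall>p q. (p, q) \<in> F \<longrightarrow> (\<forall>a b. (a, b) \<in> G \<longrightarrow> p \<noteq> b)"
    using starts_ends_disjointD[of F G] by blast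
next
  assume r: "\<forall>p q. (p, q) \<in> F \<longrightarrow> (\<forall>a b. (a, b) \<in> G \<longrightarrow> p \<noteq> b)"
  show "fst ` F \<inter> snd ` G = {}"
    by (rule starts_ends_disjointI) (use r in blast)
qed

definition prematching :: "nat \<Rightarrow> edge set \<Rightarrow> edge set \<Rightarrow> bool" where
  "prematching n F G \<longleftrightarrow> distinct_starts F \<and> distinct_ends n G \<and> fst ` F \<inter> snd ` G = {} \<and> dominated n F G"

lemma matching_iff: "matching n F G \<longleftrightarrow> prematching n F G \<and> card F + card G = n - 2"
  by (auto simp: matching_def prematching_def)

text \<open>
  Renumbering preserves all comparisons, except that a first leaf \<open>j\<close> and a last leaf \<open>j\<close> of the
  outer tree are equal before and different afterwards.
\<close>

lemma prematching_outer:
  assumes F: "tree_family r F" and G: "tree_family r G" and j: "1 \<le> j" "j \<le> r" and rs: "2 \<le> r" "2 \<le> s"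
  defines "n \<equiv> r + s - 1" and "m \<equiv> j + s - 1"
  defines "OF \<equiv> outer_edge j s ` F" and "OG \<equiv> outer_edge j s ` G"
  shows "(distinct_starts OF \<and> distinct_ends n OG \<and> fst ` OF \<inter> snd ` OG = {} \<and> \<not> (j \<in> fst ` OF \<and> m \<in> snd ` OG) \<and>
     (\<forall>p q. (p, q) \<in> OF \<longrightarrow> (\<exists>a b. (a, b) \<in> insert (1, n) OG \<and> a < p \<and> p < b \<and> b \<le> q \<and> \<not> (p = j \<and> b = m))))
    \<longleftrightarrow> prematching r F G"
proof -
  note oi = outer_ineqs[OF rs(2)]
  have s1: "outer_start j s p = 1 \<longleftrightarrow> p = 1" if "(p, q) \<in> F" for p q
    using tree_family_bounds(1)[OF F that] j rs by (auto simp: outer_start_def)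
  have en: "outer_end j s q = n \<longleftrightarrow> q = r" if "(p, q) \<in> G" for p q
    using tree_family_bounds(3)[OF G that] j rs by (auto simp: outer_end_def n_def)
  have 1: "distinct_starts OF \<longleftrightarrow> distinct_starts F"
    unfolding distinct_starts_iff OF_def Ball_outer oi using s1 by blast
  have 2: "distinct_ends n OG \<longleftrightarrow> distinct_ends r G"
    unfolding distinct_ends_iff OG_def Ball_outer oi using en by blast
  have 3: "fst ` OF \<inter> snd ` OG = {} \<and> \<not> (j \<in> fst ` OF \<and> m \<in> snd ` OG) \<longleftrightarrow> fst ` F \<inter> snd ` G = {}"
  proof -
    have a: "j \<in> fst ` OF \<longleftrightarrow> (\<exists>q. (j, q) \<in> F)"
    proof -
      have "j \<in> fst ` OF \<longleftrightarrow> (\<exists>p q. (p, q) \<in> OF \<and> p = j)" by force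
      also have "\<dots> \<longleftrightarrow> (\<exists>q. (j, q) \<in> F)" unfolding OF_def Bex_outer oi by blast
      finally show ?thesis .
    qed
    have b: "m \<in> snd ` OG \<longleftrightarrow> (\<exists>p. (p, j) \<in> G)"
    proof -
      have "m \<in> snd ` OG \<longleftrightarrow> (\<exists>p q. (p, q) \<in> OG \<and> q = m)" by force
      also have "\<dots> \<longleftrightarrow> (\<exists>q. (q, j) \<in> G)" unfolding OG_def Bex_outer m_def oi by blast
      finally show ?thesis .
    qed
    show ?thesis unfolding a b disjoint_names_iff unfolding OF_def OG_def Ball_outer oi by blast
  qed
  have o8: "(outer_start j s p < outer_end j s b \<and> \<not> (p = j \<and> b = j)) = (p < b)" for p b
    using rs by (auto simp: outer_start_def outer_end_def)
  have root: "insert (1, n) OG = outer_edge j s ` insert (1, r) G"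
    using j rs by (auto simp: OG_def n_def outer_edge_def)
  have 4: "(\<forall>p q. (p, q) \<in> OF \<longrightarrow> (\<exists>a b. (a, b) \<in> insert (1, n) OG \<and> a < p \<and> p < b \<and> b \<le> q \<and> \<not> (p = j \<and> b = m)))
     \<longleftrightarrow> dominated r F G"
  proof -
    have "(\<forall>p q. (p, q) \<in> OF \<longrightarrow> (\<exists>a b. (a, b) \<in> insert (1, n) OG \<and> a < p \<and> p < b \<and> b \<le> q \<and> \<not> (p = j \<and> b = m))) \<longleftrightarrow>
       (\<forall>p q. (p, q) \<in> OF \<longrightarrow> (\<exists>a b. (a, b) \<in> insert (1, n) OG \<and> a < p \<and> (p < b \<and> \<not> (p = j \<and> b = m)) \<and> b \<le> q))"
      by (simp only: conj_ac)
    also have "\<dots> \<longleftrightarrow> dominated r F G"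
      unfolding root OF_def Ball_outer Bex_outer m_def oi o8 dominated_def ..
    finally show ?thesis .
  qed
  show ?thesis unfolding prematching_def 1[symmetric] 2[symmetric] 3[symmetric] 4[symmetric]
      by (simp only: conj_assoc)
qed

lemma inner_edge_pair: "inner_edge j (p, q) = (p + j - 1, q + j - 1)"
  by (simp add: inner_edge_def)

lemma Ball_inner: "(\<forall>p q. (p, q) \<in> inner_edge j ` A \<longrightarrow> P p q) \<longleftrightarrow> (\<forall>p q. (p, q) \<in> A \<longrightarrow> P (p + j - 1) (q + j - 1))"
proof safe
  fix p q assume "\<forall>p q. (p, q) \<in> inner_edge j ` A \<longrightarrow> P p q" "(p, q) \<in> A"
  then show "P (p + j - 1) (q + j - 1)" by (metis image_eqI inner_edge_pair)
next
  fix p q a b assume "\<forall>p q. (p, q) \<in> A \<longrightarrow> P (p + j - 1) (q + j - 1)" "(p, q) = inner_edge j (a, b)" "(a, b) \<in> A"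
  then show "P p q" by (simp add: inner_edge_pair)
qed

lemma Bex_inner: "(\<exists>p q. (p, q) \<in> inner_edge j ` A \<and> P p q) \<longleftrightarrow> (\<exists>p q. (p, q) \<in> A \<and> P (p + j - 1) (q + j - 1))"
  using Ball_inner[of j A "\<lambda>p q. \<not> P p q"] by blast

lemma prematching_inner:
  assumes F: "tree_family s F" and G: "tree_family s G" and j: "1 \<le> j" and s: "2 \<le> s"
  defines "m \<equiv> j + s - 1"
  defines "IF \<equiv> inner_edge j ` F" and "IG \<equiv> inner_edge j ` G"
  shows "(inj_on fst IF \<and> j \<notin> fst ` IF \<and> inj_on snd IG \<and> m \<notin> snd ` IG \<and> fst ` IF \<inter> snd ` IG = {} \<and>
     (\<forall>p q. (p, q) \<in> IF \<longrightarrow> (\<exists>a b. (a, b) \<in> insert (j, m) IG \<and> a < p \<and> p < b \<and> b \<le> q)))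
    \<longleftrightarrow> prematching s F G"
proof -
  have oi: "p + j - 1 = q + j - 1 \<longleftrightarrow> p = q" "p + j - 1 < q + j - 1 \<longleftrightarrow> p < q" "p + j - 1 \<le> q + j - 1 \<longleftrightarrow>
      p \<le> q" for p q
    using j by auto
  have 1: "inj_on fst IF \<and> j \<notin> fst ` IF \<longleftrightarrow> distinct_starts F"
  proof -
    have "inj_on fst IF \<and> j \<notin> fst ` IF \<longleftrightarrow> (\<forall>p q. (p, q) \<in> IF \<longrightarrow> p \<noteq> j \<and> (\<forall>p' q'. (p', q') \<in> IF \<longrightarrow> p = p' \<longrightarrow>
        q = q'))"
      using inj_fst_iff[of IF j] .
    also have "\<dots> \<longleftrightarrow> (\<forall>p q. (p, q) \<in> F \<longrightarrow> p + j - 1 \<noteq> j \<and> (\<forall>p' q'. (p', q') \<in> F \<longrightarrow> p = p' \<longrightarrow> q = q'))"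
      unfolding IF_def Ball_inner oi ..
    also have "\<dots> \<longleftrightarrow> distinct_starts F"
    proof -
      have "p + j - 1 \<noteq> j \<longleftrightarrow> p \<noteq> 1" for p using j by auto
      then show ?thesis unfolding distinct_starts_iff by simp
    qed
    finally show ?thesis .
  qed
  have 2: "inj_on snd IG \<and> m \<notin> snd ` IG \<longleftrightarrow> distinct_ends s G"
  proof -
    have "inj_on snd IG \<and> m \<notin> snd ` IG \<longleftrightarrow> (\<forall>p q. (p, q) \<in> IG \<longrightarrow> q \<noteq> m \<and> (\<forall>p' q'. (p', q') \<in> IG \<longrightarrow> q = q' \<longrightarrow>
        p = p'))"
      using inj_snd_iff[of IG m] .
    also have "\<dots> \<longleftrightarrow> (\<forall>p q. (p, q) \<in> G \<longrightarrow> q + j - 1 \<noteq> m \<and> (\<forall>p' q'. (p', q') \<in> G \<longrightarrow> q = q' \<longrightarrow> p = p'))"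
      unfolding IG_def Ball_inner oi ..
    also have "\<dots> \<longleftrightarrow> distinct_ends s G"
    proof -
      have "q + j - 1 \<noteq> m \<longleftrightarrow> q \<noteq> s" for q using j s by (auto simp: m_def)
      then show ?thesis unfolding distinct_ends_iff by simp
    qed
    finally show ?thesis .
  qed
  have 3: "fst ` IF \<inter> snd ` IG = {} \<longleftrightarrow> fst ` F \<inter> snd ` G = {}"
    unfolding disjoint_names_iff unfolding IF_def IG_def Ball_inner oi ..
  have root: "insert (j, m) IG = inner_edge j ` insert (1, s) G"
    using j s by (auto simp: IG_def m_def inner_edge_def)
  have 4: "(\<forall>p q. (p, q) \<in> IF \<longrightarrow> (\<exists>a b. (a, b) \<in> insert (j, m) IG \<and> a < p \<and> p < b \<and> b \<le> q)) \<longleftrightarrow> dominated s F G"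
    unfolding root unfolding IF_def Ball_inner Bex_inner oi dominated_def ..
  show ?thesis unfolding prematching_def 1[symmetric] 2[symmetric] 3[symmetric] 4[symmetric]
      by (simp only: conj_assoc)
qed

lemma Collect_separated:
  "(\<And>x. x \<in> A \<Longrightarrow> \<not> P x) \<Longrightarrow> (\<And>x. x \<in> B \<Longrightarrow> P x) \<Longrightarrow> P e \<Longrightarrow> {x \<in> A \<union> B \<union> {e}. \<not> P x} = A"
  "(\<And>x. x \<in> A \<Longrightarrow> \<not> P x) \<Longrightarrow> (\<And>x. x \<in> B \<Longrightarrow> P x) \<Longrightarrow> e \<notin> B \<Longrightarrow> {x \<in> A \<union> B \<union> {e} - {e}. P x} = B"
  by blast+

lemma graft_family:
  assumes T: "wf_tree T'" "wf_tree T''" "1 \<le> j" "j \<le> leaves T'" "2 \<le> leaves T'" "2 \<le> leaves T''"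
  defines "s \<equiv> leaves T''" and "T \<equiv> graft T' j T''"
  shows "outside (new_edge j s) (edges T) = outer_edge j s ` edges T'"
    and "inside (new_edge j s) (edges T) = inner_edge j ` edges T''"
    and "card (edges T) = card (edges T') + card (edges T'') + 1"
proof -
  note eg = edges_graft[OF T, folded T_def s_def]
  have s: "2 \<le> s" using T by (simp add: s_def)
  have o: "\<not> (j \<le> fst v \<and> snd v \<le> j + s - 1)" if vo: "v \<in> outer_edge j s ` edges T'" for v
  proof -
    obtain p q where pq: "(p, q) \<in> edges T'" "v = outer_edge j s (p, q)" using vo by auto
    have "p < q" using edges_bounds(2)[OF T(1) pq(1)] .
    then show ?thesis using pq s by (auto simp: outer_edge_def)
  qed
  have i: "j \<le> fst v \<and> snd v \<le> j + s - 1" if vo: "v \<in> inner_edge j ` edges T''" for v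
  proof -
    obtain p q where pq: "(p, q) \<in> edges T''" "v = inner_edge j (p, q)" using vo by auto
    then show ?thesis using edges_bounds(1-3)[OF T(2) pq(1)] by (auto simp: inner_edge_def s_def)
  qed
  have ne: "fst (new_edge j s) = j" "snd (new_edge j s) = j + s - 1" by (simp_all add: new_edge_def)
  show "outside (new_edge j s) (edges T) = outer_edge j s ` edges T'"
    unfolding outside_def eg(1) ne by (rule Collect_separated(1)[OF o i]) (simp_all add: ne)
  show "inside (new_edge j s) (edges T) = inner_edge j ` edges T''"
    unfolding inside_def eg(1) ne by (rule Collect_separated(2)[OF o i eg(4)])
  have inj: "inj (outer_edge j s)" "inj (inner_edge j)" using inj_outer_edge inj_inner_edge s T by auto
  show "card (edges T) = card (edges T') + card (edges T'') + 1"
    unfolding eg(1) using eg(2-4) card_image[OF inj_on_subset[OF inj(1)], of "edges T'"] card_image[OF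
        inj_on_subset[OF inj(2)], of "edges T''"]
    by (simp add: card_Un_disjoint)
qed

text \<open>
  The cardinalities are right for both pieces because neither piece can have more names than
  there are numbers, and the sum is as large as possible.
\<close>

lemma split_matching_graft:
  assumes T: "wf_tree T'" "wf_tree T''" "2 \<le> leaves T'" "2 \<le> leaves T''"
    and U: "wf_tree U'" "wf_tree U''" "leaves U' = leaves T'" "leaves U'' = leaves T''"
    and j: "1 \<le> j" "j \<le> leaves T'"
    and card: "card (edges (graft T' j T'')) + card (edges (graft U' j U'')) = leaves T' + leaves T'' - 2"
  shows "split_matching (leaves T' + leaves T'' - 1) (new_edge j (leaves T'')) (edges (graft T' j T'')) (edges
      (graft U' j U''))
    \<longleftrightarrow> matching (leaves T') (edges T') (edges U') \<and> matching (leaves T'') (edges T'') (edges U'')"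
proof -
  let ?r = "leaves T'" and ?s = "leaves T''"
  have gT: "outside (new_edge j ?s) (edges (graft T' j T'')) = outer_edge j ?s ` edges T'"
    "inside (new_edge j ?s) (edges (graft T' j T'')) = inner_edge j ` edges T''"
    "card (edges (graft T' j T'')) = card (edges T') + card (edges T'') + 1"
    using graft_family[of T' T'' j] T j by auto
  have gU: "outside (new_edge j ?s) (edges (graft U' j U'')) = outer_edge j ?s ` edges U'"
    "inside (new_edge j ?s) (edges (graft U' j U'')) = inner_edge j ` edges U''"
    "card (edges (graft U' j U'')) = card (edges U') + card (edges U'') + 1"
    using graft_family[of U' U'' j] T U j by auto
  have fam: "tree_family ?r (edges T')" "tree_family ?s (edges T'')" "tree_family ?r (edges U')" "tree_family ?s
      (edges U'')"
    using tree_family_edges T U by metis+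
  have "split_matching (?r + ?s - 1) (new_edge j ?s) (edges (graft T' j T'')) (edges (graft U' j U'')) \<longleftrightarrow>
    prematching ?r (edges T') (edges U') \<and> prematching ?s (edges T'') (edges U'')"
    unfolding prematching_outer[OF fam(1,3) j T(3,4), symmetric] prematching_inner[OF fam(2,4) j(1) T(4),
        symmetric]
    unfolding split_matching_def gT gU unfolding new_edge_def fst_conv snd_conv by (simp only: conj_assoc)
  also have "\<dots> \<longleftrightarrow> matching ?r (edges T') (edges U') \<and> matching ?s (edges T'') (edges U'')"
  proof
    assume p: "prematching ?r (edges T') (edges U') \<and> prematching ?s (edges T'') (edges U'')"
    have "card (edges T') + card (edges U') \<le> ?r - 2" "card (edges T'') + card (edges U'') \<le> ?s - 2"
      using starts_ends_card(1)[OF fam(1,3)] starts_ends_card(1)[OF fam(2,4)] p by (auto simp: prematching_def)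
    then show "matching ?r (edges T') (edges U') \<and> matching ?s (edges T'') (edges U'')"
      using p card gT(3) gU(3) T by (auto simp: matching_iff)
  qed (auto simp: matching_iff)
  finally show ?thesis .
qed

definition coeff :: "nat \<Rightarrow> edge set \<Rightarrow> edge set \<Rightarrow> int" where
  "coeff n F G = (if matching n F G then p_sign n (sorted_list_of_set F) (sorted_list_of_set G) else 0)"

lemma coeff_lists:
  assumes "matching n F G" "distinct es" "set es = F" "distinct gs" "set gs = G"
  shows "coeff n F G = list_sign es * list_sign gs * p_sign n es gs"
proof -
  have fin: "finite F" "finite G" using assms by auto
  have "p_sign n (sorted_list_of_set F) (sorted_list_of_set G) =
      list_sign (sorted_list_of_set F) * list_sign es * (list_sign (sorted_list_of_set G) * list_sign gs) *
          p_sign n es gs"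
    using assms(1) fin assms(2-) by (intro p_sign_reorder) (auto simp: matching_def distinct_starts_def
        distinct_ends_def)
  then show ?thesis using assms(1) fin by (simp add: coeff_def)
qed

text \<open>
  The sign in \<open>e \<and> \<omega>\<close>, where \<open>\<omega>\<close> is the increasing wedge of \<open>F - {e}\<close>.
\<close>

definition front_sign :: "edge \<Rightarrow> edge set \<Rightarrow> int" where
  "front_sign e F = (\<Prod>x\<in>F - {e}. if e < x then 1 else -1)"

lemma front_sign_list:
  assumes "distinct (e # es)" "F = set (e # es)"
  shows "front_sign e F = list_sign (e # es) * list_sign es"
proof -
  have "set (e # es) - {e} = set es" using assms(1) by auto
  then have "list_sign (e # es) = front_sign e F * list_sign es"
    using assms by (simp add: front_sign_def prod_list_sign)
  then have "list_sign (e # es) * list_sign es = front_sign e F * (list_sign es * list_sign es)"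
    by (simp only: mult.assoc)
  then show ?thesis by (simp only: list_sign_mult_self mult_1_right)
qed

lemma sign_exchange:
  assumes f: "(c, q) \<in> F" and g: "(a, c) \<in> G"
    and X: "matching n F (G - {(a, c)})" and Y: "matching n (F - {(c, q)}) G" and fin: "finite F" "finite G"
  shows "front_sign (a, c) G * coeff n F (G - {(a, c)}) = - (front_sign (c, q) F * coeff n (F - {(c, q)}) G)"
proof -
  let ?es = "sorted_list_of_set (F - {(c, q)})" and ?gs = "sorted_list_of_set (G - {(a, c)})"
  have l: "distinct ((c, q) # ?es)" "F = set ((c, q) # ?es)" "distinct ((a, c) # ?gs)" "G = set ((a, c) # ?gs)"
    "distinct ?es" "F - {(c, q)} = set ?es" "distinct ?gs" "G - {(a, c)} = set ?gs"
    using f g fin by auto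
  have c1: "coeff n F (G - {(a, c)}) = list_sign ((c, q) # ?es) * list_sign ?gs * p_sign n ((c, q) # ?es) ?gs"
    by (rule coeff_lists[OF X l(1) l(2)[symmetric] l(7) l(8)[symmetric]])
  have c2: "coeff n (F - {(c, q)}) G = list_sign ?es * list_sign ((a, c) # ?gs) * p_sign n ?es ((a, c) # ?gs)"
    by (rule coeff_lists[OF Y l(5) l(6)[symmetric] l(3) l(4)[symmetric]])
  have "c \<notin> fst ` set ?es"
  proof
    assume "c \<in> fst ` set ?es"
    then obtain v where "v \<in> F - {(c, q)}" "fst v = c" using fin by auto
    then show False using distinct_starts_eq[OF matchingD(1)[OF X], of c "snd v" q] f by (cases v) auto
  qed
  then have mv: "p_sign n ((c, q) # ?es) ?gs = - p_sign n ?es ((a, c) # ?gs)"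
    by (intro p_sign_move) auto
  show ?thesis
    unfolding c1 c2 mv front_sign_list[OF l(1,2)] front_sign_list[OF l(3,4)]
    by (simp add: ac_simps del: list_sign.simps)
qed

lemma sign_same_end:
  assumes g: "(j, m) \<in> G" "(i, m) \<in> G" "i \<noteq> j"
    and X1: "matching n F (G - {(j, m)})" and X2: "matching n F (G - {(i, m)})" and fin: "finite F" "finite G"
  shows "front_sign (j, m) G * coeff n F (G - {(j, m)}) = - (front_sign (i, m) G * coeff n F (G - {(i, m)}))"
proof -
  let ?es = "sorted_list_of_set F" and ?gs = "sorted_list_of_set (G - {(j, m), (i, m)})"
  have l: "distinct ((j, m) # (i, m) # ?gs)" "G = set ((j, m) # (i, m) # ?gs)"
    "distinct ((i, m) # (j, m) # ?gs)" "G = set ((i, m) # (j, m) # ?gs)"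
    "distinct ((j, m) # ?gs)" "G - {(i, m)} = set ((j, m) # ?gs)"
    "distinct ((i, m) # ?gs)" "G - {(j, m)} = set ((i, m) # ?gs)" "distinct ?es" "F = set ?es"
    using g fin by auto
  have c1: "coeff n F (G - {(j, m)}) = list_sign ?es * list_sign ((i, m) # ?gs) * p_sign n ?es ((i, m) # ?gs)"
    by (rule coeff_lists[OF X1 l(9) l(10)[symmetric] l(7) l(8)[symmetric]])
  have c2: "coeff n F (G - {(i, m)}) = list_sign ?es * list_sign ((j, m) # ?gs) * p_sign n ?es ((j, m) # ?gs)"
    by (rule coeff_lists[OF X2 l(9) l(10)[symmetric] l(5) l(6)[symmetric]])
  have p: "p_sign n ?es ((j, m) # ?gs) = p_sign n ?es ((i, m) # ?gs)" by (simp add: p_sign_def)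
  have sw: "list_sign ((j, m) # (i, m) # ?gs) = - list_sign ((i, m) # (j, m) # ?gs)"
    using list_sign_swap[of "(j, m)" "(i, m)" "[]" ?gs] g by simp
  have sq: "x * y * (z * y * w) = x * z * w" if "y * y = 1" for x y z w :: int
    using that by (metis mult.assoc mult.commute mult.right_neutral)
  show ?thesis
    unfolding c1 c2 p front_sign_list[OF l(1,2)] front_sign_list[OF l(3,4)] sq[OF list_sign_mult_self] sw
        by simp
qed

lemma sign_same_start:
  assumes f: "(j, m) \<in> F" "(j, r) \<in> F" "m \<noteq> r"
    and Y1: "matching n (F - {(j, m)}) G" and Y2: "matching n (F - {(j, r)}) G" and fin: "finite F" "finite G"
  shows "front_sign (j, m) F * coeff n (F - {(j, m)}) G = - (front_sign (j, r) F * coeff n (F - {(j, r)}) G)"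
proof -
  let ?gs = "sorted_list_of_set G" and ?es = "sorted_list_of_set (F - {(j, m), (j, r)})"
  have l: "distinct ((j, m) # (j, r) # ?es)" "F = set ((j, m) # (j, r) # ?es)"
    "distinct ((j, r) # (j, m) # ?es)" "F = set ((j, r) # (j, m) # ?es)"
    "distinct ((j, m) # ?es)" "F - {(j, r)} = set ((j, m) # ?es)"
    "distinct ((j, r) # ?es)" "F - {(j, m)} = set ((j, r) # ?es)" "distinct ?gs" "G = set ?gs"
    using f fin by auto
  have c1: "coeff n (F - {(j, m)}) G = list_sign ((j, r) # ?es) * list_sign ?gs * p_sign n ((j, r) # ?es) ?gs"
    by (rule coeff_lists[OF Y1 l(7) l(8)[symmetric] l(9) l(10)[symmetric]])
  have c2: "coeff n (F - {(j, r)}) G = list_sign ((j, m) # ?es) * list_sign ?gs * p_sign n ((j, m) # ?es) ?gs"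
    by (rule coeff_lists[OF Y2 l(5) l(6)[symmetric] l(9) l(10)[symmetric]])
  have p: "p_sign n ((j, m) # ?es) ?gs = p_sign n ((j, r) # ?es) ?gs" by (simp add: p_sign_def)
  have sw: "list_sign ((j, m) # (j, r) # ?es) = - list_sign ((j, r) # (j, m) # ?es)"
    using list_sign_swap[of "(j, m)" "(j, r)" "[]" ?es] f by simp
  have sq: "x * y * (y * z * w) = x * z * w" if "y * y = 1" for x y z w :: int
    using that by (metis mult.assoc mult.right_neutral)
  show ?thesis
    unfolding c1 c2 p front_sign_list[OF l(1,2)] front_sign_list[OF l(3,4)] sq[OF list_sign_mult_self] sw
        by simp
qed

context family_pair begin

text \<open>
  Here \<open>z e\<close> stands for the coefficient of \<open>G\<close> when \<open>e\<close> becomes non-metric.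
\<close>

lemma boundary_identity:
  fixes z :: "edge \<Rightarrow> int"
  assumes z0: "\<And>e. e \<in> F \<Longrightarrow> e \<notin> G \<or> \<not> split_matching n e F G \<Longrightarrow> z e = 0"
    and zX: "\<And>e. e \<in> F \<Longrightarrow> e \<in> G \<Longrightarrow> split_matching n e F G \<Longrightarrow> matching n F (G - {e}) \<Longrightarrow>
      front_sign e F * z e = front_sign e G * coeff n F (G - {e})"
    and zY: "\<And>e. e \<in> F \<Longrightarrow> e \<in> G \<Longrightarrow> split_matching n e F G \<Longrightarrow> matching n (F - {e}) G \<Longrightarrow>
      z e = coeff n (F - {e}) G"
  shows "(\<Sum>e\<in>F. front_sign e F * (z e - coeff n (F - {e}) G)) = (\<Sum>g\<in>G. front_sign g G * coeff n F (G - {g}))"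
proof -
  have single: "(\<Sum>x\<in>A. h x) = h a" if "finite A" "a \<in> A" "\<And>x. x \<in> A \<Longrightarrow> x \<noteq> a \<Longrightarrow>
      h x = 0" for A a and h :: "edge \<Rightarrow> int"
    using that by (metis (no_types, lifting) Diff_iff insertI1 sum.neutral sum.remove add.right_neutral
        singletonI)
  have two: "(\<Sum>x\<in>A. h x) = h a + (if b \<in> A then h b else 0)"
    if "finite A" "a \<in> A" "a \<noteq> b" "\<And>x. x \<in> A \<Longrightarrow> x \<noteq> a \<Longrightarrow> x \<noteq> b \<Longrightarrow> h x = 0" for A a b and h :: "edge \<Rightarrow> int"
  proof -
    have "(\<Sum>x\<in>A. h x) = h a + (\<Sum>x\<in>A - {a}. h x)" using that(1,2) by (rule sum.remove)
    also have "(\<Sum>x\<in>A - {a}. h x) = (if b \<in> A then h b else 0)"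
    proof (cases "b \<in> A")
      case True
      then show ?thesis using single[of "A - {a}" b h] that by auto
    next
      case False
      then show ?thesis using that by (auto intro!: sum.neutral)
    qed
    finally show ?thesis .
  qed
  show ?thesis
  proof (cases "distinct_starts F")
    case fg: True
    show ?thesis
    proof (cases "distinct_ends n G")
      case lg: True
      obtain c q a where f: "(c, q) \<in> F" and g: "(a, c) \<in> G"
        and X: "\<And>g. g \<in> G \<Longrightarrow> g \<noteq> (a, c) \<Longrightarrow> \<not> matching n F (G - {g})"
        and Y: "\<And>f. f \<in> F \<Longrightarrow> f \<noteq> (c, q) \<Longrightarrow> \<not> matching n (F - {f}) G"
        and XY: "matching n F (G - {(a, c)}) \<longleftrightarrow> matching n (F - {(c, q)}) G"
        and Z: "\<And>e. e \<in> F \<Longrightarrow> e \<in> G \<Longrightarrow> \<not> split_matching n e F G"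
        using one_shared_leaf[OF fg lg] by blast
      have z: "z e = 0" if "e \<in> F" for e using z0 Z that by blast
      have "(\<Sum>e\<in>F. front_sign e F * (z e - coeff n (F - {e}) G)) =
          - (front_sign (c, q) F * coeff n (F - {(c, q)}) G)"
        using single[of F "(c, q)" "\<lambda>e. front_sign e F * (z e - coeff n (F - {e}) G)"] f z Y
            by (simp add: coeff_def)
      also have "\<dots> = front_sign (a, c) G * coeff n F (G - {(a, c)})"
      proof (cases "matching n F (G - {(a, c)})")
        case True
        then show ?thesis using sign_exchange[OF f g True] XY by simp
      next
        case False
        then show ?thesis using XY by (simp add: coeff_def)
      qed
      also have "\<dots> = (\<Sum>g\<in>G. front_sign g G * coeff n F (G - {g}))"
        using single[of G "(a, c)" "\<lambda>g. front_sign g G * coeff n F (G - {g})"] g X by (simp add: coeff_def)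
      finally show ?thesis .
    next
      case False
      obtain i j m where g1: "(j, m) \<in> G" and g2: "(i, m) \<in> insert (1, n) G" and ij: "i < j"
      proof -
        obtain p q p' where *: "(p, q) \<in> insert (1, n) G" "(p', q) \<in> insert (1, n) G" "p \<noteq> p'"
          using False distinct_endsI[of G n] tree_family_bounds(4)[OF G] by (metis insertI1 insertI2)
        consider "p < p'" | "p' < p" using *(3) by linarith
        then show thesis
        proof cases
          case 1
          then have "(p', q) \<in> G" using * tree_family_bounds(1)[OF G, of p q] by auto
          then show thesis using that 1 * by blast
        next
          case 2
          then have "(p, q) \<in> G" using * tree_family_bounds(1)[OF G, of p' q] by auto
          then show thesis using that 2 * by blast
        qed
      qed
      note ce = common_end[OF fg g1 g2 ij]
      define X1 where "X1 = front_sign (j, m) G * coeff n F (G - {(j, m)})"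
      define X2 where "X2 = front_sign (i, m) G * coeff n F (G - {(i, m)})"
      have Z: "(\<Sum>e\<in>F. front_sign e F * (z e - coeff n (F - {e}) G)) = (\<Sum>e\<in>F. front_sign e F * z e)"
        using ce(1) by (simp add: coeff_def)
      have zz: "z e = 0" if "e \<in> F" "e \<noteq> (j, m)" for e using z0[OF that(1)] ce(3)[of e] that by blast
      have Z1: "(\<Sum>e\<in>F. front_sign e F * z e) = (if (j, m) \<in> F then front_sign (j, m) F * z (j, m) else 0)"
      proof (cases "(j, m) \<in> F")
        case True
        then show ?thesis using single[of F "(j, m)" "\<lambda>e. front_sign e F * z e"] zz by simp
      next
        case False
        then have "z e = 0" if "e \<in> F" for e using zz that by blast
        then show ?thesis using False by simp
      qed
      have XX: "(\<Sum>g\<in>G. front_sign g G * coeff n F (G - {g})) = X1 + (if (i, m) \<in> G then X2 else 0)"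
        unfolding X1_def X2_def using ce(2) g1 ij by (intro two) (auto simp: coeff_def)
      have "(if (j, m) \<in> F then front_sign (j, m) F * z (j, m) else 0) = X1 + (if (i, m) \<in> G then X2 else 0)"
      proof (cases "(j, m) \<in> F \<and> split_matching n (j, m) F G")
        case True
        then have m: "matching n F (G - {(j, m)})" "\<not> ((i, m) \<in> G \<and> matching n F (G - {(i, m)}))"
            using ce(5) by auto
        then show ?thesis using zX[of "(j, m)"] True g1 by (auto simp: X1_def X2_def coeff_def)
      next
        case False
        then have l: "(if (j, m) \<in> F then front_sign (j, m) F * z (j, m) else 0) = 0" using z0 by auto
        have c: "\<not> matching n F (G - {(j, m)}) \<or> ((i, m) \<in> G \<and> matching n F (G - {(i, m)}))"
            using ce(5) False by blast
        show ?thesis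
        proof (cases "(i, m) \<in> G \<and> matching n F (G - {(i, m)})")
          case True
          then have "matching n F (G - {(j, m)})" using ce(4) by blast
          then have "X1 = - X2" unfolding X1_def X2_def using sign_same_end[OF g1 _ _ _ _] True ij by auto
          then show ?thesis using l True by simp
        next
          case False
          then have "\<not> matching n F (G - {(j, m)})" using c by blast
          then show ?thesis using l False by (simp add: X1_def X2_def coeff_def)
        qed
      qed
      then show ?thesis using Z Z1 XX by simp
    qed
  next
    case False
    obtain j m r where f1: "(j, m) \<in> F" and f2: "(j, r) \<in> insert (1, n) F" and mr: "m < r"
    proof -
      obtain p q q' where *: "(p, q) \<in> insert (1, n) F" "(p, q') \<in> insert (1, n) F" "q \<noteq> q'"
        using False distinct_startsI[of F] tree_family_bounds(4)[OF F] by (metis insertI1 insertI2)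
      consider "q < q'" | "q' < q" using *(3) by linarith
      then show thesis
      proof cases
        case 1
        then have "(p, q) \<in> F" using * tree_family_bounds(3)[OF F, of p q'] by auto
        then show thesis using that 1 * by blast
      next
        case 2
        then have "(p, q') \<in> F" using * tree_family_bounds(3)[OF F, of p q] by auto
        then show thesis using that 2 * by blast
      qed
    qed
    note cs = common_start[OF f1 f2 mr]
    define Y1 where "Y1 = front_sign (j, m) F * coeff n (F - {(j, m)}) G"
    define Y2 where "Y2 = front_sign (j, r) F * coeff n (F - {(j, r)}) G"
    have X0: "(\<Sum>g\<in>G. front_sign g G * coeff n F (G - {g})) = 0"
      using cs(1) by (simp add: coeff_def)
    have zz: "z e = 0" if "e \<in> F" "e \<noteq> (j, m)" for e using z0[OF that(1)] cs(3)[of e] that by blast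
    have "(\<Sum>e\<in>F. front_sign e F * (z e - coeff n (F - {e}) G)) =
        front_sign (j, m) F * (z (j, m) - coeff n (F - {(j, m)}) G) +
        (if (j, r) \<in> F then front_sign (j, r) F * (z (j, r) - coeff n (F - {(j, r)}) G) else 0)"
      using f1 mr cs(2) zz by (intro two) (auto simp: coeff_def)
    also have "\<dots> = front_sign (j, m) F * z (j, m) - Y1 - (if (j, r) \<in> F then Y2 else 0)"
      using zz mr by (simp add: Y1_def Y2_def right_diff_distrib)
    also have "\<dots> = 0"
    proof (cases "(j, m) \<in> G \<and> split_matching n (j, m) F G")
      case True
      then have m: "matching n (F - {(j, m)}) G" "\<not> ((j, r) \<in> F \<and> matching n (F - {(j, r)}) G)"
          using cs(5) by auto
      then show ?thesis using zY[of "(j, m)"] True f1 by (auto simp: Y1_def Y2_def coeff_def)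
    next
      case False
      then have l: "z (j, m) = 0" using z0 f1 by auto
      have c: "\<not> matching n (F - {(j, m)}) G \<or> ((j, r) \<in> F \<and> matching n (F - {(j, r)}) G)"
          using cs(5) False by blast
      show ?thesis
      proof (cases "(j, r) \<in> F \<and> matching n (F - {(j, r)}) G")
        case True
        then have "matching n (F - {(j, m)}) G" using cs(4) by blast
        then have "Y1 = - Y2" unfolding Y1_def Y2_def using sign_same_start[OF f1 _ _ _ _] True mr by auto
        then show ?thesis using l True by simp
      next
        case False
        then have "\<not> matching n (F - {(j, m)}) G" using c by blast
        then show ?thesis using l False by (simp add: Y1_def Y2_def coeff_def)
      qed
    qed
    finally show ?thesis using X0 by simp
  qed
qed

end

section \<open>The associahedra in coordinates\<close>

abbreviation coord :: "('t \<Rightarrow>\<^sub>0 'k::field) \<Rightarrow> 't \<Rightarrow> 'k" where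
  "coord \<equiv> Poly_Mapping.lookup"

text \<open>
  Chains of mixed degree are allowed, so that boundaries in degree 0 need no special treatment.
\<close>

definition tree_support :: "nat \<Rightarrow> (tree \<Rightarrow>\<^sub>0 'k::field) \<Rightarrow> bool" where
  "tree_support n x \<longleftrightarrow> 2 \<le> n \<and> (\<forall>T. coord x T \<noteq> 0 \<longrightarrow> wf_tree T \<and> leaves T = n)"

lemma K_chains_iff:
  "x \<in> K_chains n k \<longleftrightarrow> (\<forall>T. coord x T \<noteq> 0 \<longrightarrow> wf_tree T \<and> leaves T = n \<and> 2 \<le> n \<and> card (edges T) + k + 2 = n)"
  unfolding K_chains_def mem_Collect_eq Ball_def in_keys_iff ..

lemma tree_supportI: "x \<in> K_chains n k \<Longrightarrow> 2 \<le> n \<Longrightarrow> tree_support n x"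
  by (auto simp: K_chains_iff tree_support_def)

lemma lookup_lin_ext:
  "coord (lin_ext f x) U = (\<Sum>T\<in>Poly_Mapping.keys x. coord x T * coord (f T) U)"
  by (simp add: lin_ext_def lookup_sum)

lemma finite_expansions: "finite (expansions T)"
proof -
  have "expansions T \<subseteq> Sigma {T'. wf_tree T' \<and> leaves T' = leaves T} edges"
    by (auto simp: expansions_def)
  then show ?thesis by (rule finite_subset) (simp add: finite_trees)
qed

lemma lookup_cell: "coord (cell T \<omega>) U = (if T = U then of_int (orientation_sign \<omega>) else 0)"
  by (simp add: cell_def lookup_single when_def)

lemma front_sign_std: "finite F \<Longrightarrow> e \<in> F \<Longrightarrow> front_sign e F = list_sign (e # sorted_list_of_set (F - {e}))"
  using front_sign_list[of e "sorted_list_of_set (F - {e})" F] by auto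

text \<open>
  Read at a fixed tree, the boundary is a sum over the edges of this tree.
\<close>

lemma lookup_K_bdry:
  assumes x: "tree_support n x"
  shows "coord (K_bdry x) U =
    (if wf_tree U \<and> leaves U = n then \<Sum>e\<in>edges U. of_int (front_sign e (edges U)) *
        coord x (collapse {e} U) else 0)"
proof -
  have inner: "coord (\<Sum>(T', e')\<in>expansions T. cell T' (prepend e' (std_order (edges T))) :: tree \<Rightarrow>\<^sub>0 'a) U =
      (\<Sum>e\<in>edges U. if wf_tree U \<and> leaves U = n \<and> collapse {e} U =
          T then of_int (front_sign e (edges U)) else 0)"
    if T: "wf_tree T" "leaves T = n" for T
  proof -
    define h where "h v = (of_int (list_sign (snd v # sorted_list_of_set (edges T))) :: 'a)" for v :: "tree \<times>
        edge"
    have "coord (\<Sum>(T', e')\<in>expansions T. cell T' (prepend e' (std_order (edges T))) :: tree \<Rightarrow>\<^sub>0 'a) U =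
        (\<Sum>v\<in>expansions T. if fst v = U then h v else 0)"
      unfolding lookup_sum by (intro sum.cong refl)
        (simp add: split_def lookup_cell orientation_sign_def prepend_def std_order_def h_def del:
            list_sign.simps)
    also have "\<dots> = (\<Sum>v\<in>{v \<in> expansions T. fst v = U}. h v)"
      using finite_expansions by (simp add: sum.inter_filter)
    also have "{v \<in> expansions T. fst v = U} = Pair U ` {e \<in> edges U. wf_tree U \<and> leaves U = n \<and>
        collapse {e} U = T}"
      using T by (auto simp: expansions_def)
    also have "(\<Sum>v\<in>Pair U ` {e \<in> edges U. wf_tree U \<and> leaves U = n \<and> collapse {e} U = T}. h v) =
        (\<Sum>e\<in>{e \<in> edges U. wf_tree U \<and> leaves U = n \<and> collapse {e} U = T}. h (U, e))"
      by (subst sum.reindex) (auto simp: inj_on_def)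
    also have "\<dots> = (\<Sum>e\<in>{e \<in> edges U. wf_tree U \<and> leaves U = n \<and>
        collapse {e} U = T}. of_int (front_sign e (edges U)))"
    proof (intro sum.cong refl)
      fix e assume e: "e \<in> {e \<in> edges U. wf_tree U \<and> leaves U = n \<and> collapse {e} U = T}"
      then have "edges T = edges U - {e}" using collapse_props(3)[of U "{e}"] by auto
      then show "h (U, e) = of_int (front_sign e (edges U))"
        using e by (simp add: h_def front_sign_std del: list_sign.simps)
    qed
    finally show ?thesis by (simp add: sum.inter_filter)
  qed
  have "coord (K_bdry x) U = (\<Sum>T\<in>Poly_Mapping.keys x. \<Sum>e\<in>edges U. coord x T *
      (if wf_tree U \<and> leaves U = n \<and> collapse {e} U = T then of_int (front_sign e (edges U)) else 0))"
    unfolding K_bdry_def lookup_lin_ext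
  proof (intro sum.cong refl)
    fix T assume "T \<in> Poly_Mapping.keys x"
    then have "wf_tree T" "leaves T = n" using x by (auto simp: tree_support_def in_keys_iff)
    from inner[OF this] show "coord x T * coord (\<Sum>(T', e')\<in>expansions T. cell T' (prepend e' (std_order (edges
        T)))) U =
        (\<Sum>e\<in>edges U. coord x T * (if wf_tree U \<and> leaves U = n \<and>
            collapse {e} U = T then of_int (front_sign e (edges U)) else 0))"
      by (simp only: sum_distrib_left)
  qed
  also have "\<dots> = (\<Sum>e\<in>edges U. \<Sum>T\<in>Poly_Mapping.keys x. coord x T *
      (if wf_tree U \<and> leaves U = n \<and> collapse {e} U = T then of_int (front_sign e (edges U)) else 0))"
    by (rule sum.swap)
  also have "\<dots> = (\<Sum>e\<in>edges U. if wf_tree U \<and> leaves U =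
      n then of_int (front_sign e (edges U)) * coord x (collapse {e} U) else 0)"
  proof (intro sum.cong refl)
    fix e
    have "(\<Sum>T\<in>Poly_Mapping.keys x. coord x T *
        (if wf_tree U \<and> leaves U = n \<and> collapse {e} U = T then of_int (front_sign e (edges U)) else 0)) =
        (\<Sum>T\<in>Poly_Mapping.keys x. if T = collapse {e} U then
          (if wf_tree U \<and> leaves U = n then of_int (front_sign e (edges U)) * coord x T else 0) else 0)"
      by (intro sum.cong refl) auto
    also have "\<dots> = (if wf_tree U \<and> leaves U = n then of_int (front_sign e (edges U)) *
        coord x (collapse {e} U) else 0)"
      by (simp add: in_keys_iff)
    finally show "(\<Sum>T\<in>Poly_Mapping.keys x. coord x T *
        (if wf_tree U \<and> leaves U = n \<and> collapse {e} U = T then of_int (front_sign e (edges U)) else 0)) =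
        (if wf_tree U \<and> leaves U = n then of_int (front_sign e (edges U)) * coord x (collapse {e} U) else 0)" .
  qed
  finally have eq: "coord (K_bdry x) U =
      (\<Sum>e\<in>edges U. if wf_tree U \<and> leaves U = n then of_int (front_sign e (edges U)) *
          coord x (collapse {e} U) else 0)" .
  show ?thesis
  proof (cases "wf_tree U \<and> leaves U = n")
    case True
    then show ?thesis using eq by simp
  next
    case False
    show ?thesis unfolding eq by (simp only: False if_False sum.neutral_const)
  qed
qed

lemma tree_support_K_bdry:
  assumes "tree_support n x"
  shows "tree_support n (K_bdry x)"
  unfolding tree_support_def
proof (intro conjI allI impI)
  show "2 \<le> n" using assms by (simp add: tree_support_def)
  fix U assume "coord (K_bdry x) U \<noteq> 0"
  then have "wf_tree U \<and> leaves U = n" unfolding lookup_K_bdry[OF assms, of U] by presburger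
  then show "wf_tree U" "leaves U = n" by auto
qed

lemma graft_inj:
  assumes "wf_tree T" "wf_tree T'" "wf_tree U" "wf_tree U'" "leaves T = leaves U" "leaves T' = leaves U'"
    "1 \<le> i" "i \<le> leaves T" "2 \<le> leaves T" "2 \<le> leaves T'" "graft T i T' = graft U i U'"
  shows "T = U" "T' = U'"
proof -
  have inj: "inj (outer_edge i (leaves T'))" "inj (inner_edge i)"
      using inj_outer_edge inj_inner_edge assms by auto
  have "outer_edge i (leaves T') ` edges T = outer_edge i (leaves T') ` edges U"
    using graft_family(1)[of T T' i] graft_family(1)[of U U' i] assms by simp
  then have "edges T = edges U" using inj(1) by (simp add: inj_image_eq_iff)
  then show "T = U" using edges_inj assms by blast
  have "inner_edge i ` edges T' = inner_edge i ` edges U'"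
    using graft_family(2)[of T T' i] graft_family(2)[of U U' i] assms by simp
  then have "edges T' = edges U'" using inj(2) by (simp add: inj_image_eq_iff)
  then show "T' = U'" using edges_inj assms by blast
qed

definition graft_sign :: "nat \<Rightarrow> tree \<Rightarrow> tree \<Rightarrow> int" where
  "graft_sign i T T' = orientation_sign (K_graft_orientation T (std_order (edges T)) i T' (std_order (edges
      T')))"

text \<open>
  A graft of trees with given numbers of leaves determines its factors, so at most one pair
  contributes to each coordinate.
\<close>

lemma lookup_K_comp:
  assumes x: "tree_support r x" and y: "tree_support s y" and i: "1 \<le> i" "i \<le> r"
  shows "wf_tree U' \<Longrightarrow> leaves U' = r \<Longrightarrow> wf_tree U'' \<Longrightarrow> leaves U'' = s \<Longrightarrow>
      coord (K_comp x i y) (graft U' i U'') = coord x U' * coord y U'' * of_int (graft_sign i U' U'')"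
    and "(\<And>U' U''. wf_tree U' \<Longrightarrow> leaves U' = r \<Longrightarrow> wf_tree U'' \<Longrightarrow> leaves U'' = s \<Longrightarrow> U \<noteq> graft U' i U'') \<Longrightarrow>
      coord (K_comp x i y) U = 0"
proof -
  have rs: "2 \<le> r" "2 \<le> s" using x y by (auto simp: tree_support_def)
  have kx: "wf_tree T \<and> leaves T = r" if "T \<in> Poly_Mapping.keys x" for T
    using x that by (auto simp: tree_support_def in_keys_iff)
  have ky: "wf_tree T \<and> leaves T = s" if "T \<in> Poly_Mapping.keys y" for T
    using y that by (auto simp: tree_support_def in_keys_iff)
  have l: "coord (K_comp x i y) U = (\<Sum>T\<in>Poly_Mapping.keys x. \<Sum>T'\<in>Poly_Mapping.keys y.
      coord x T * (coord y T' * (if graft T i T' = U then of_int (graft_sign i T T') else 0)))" for U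
    unfolding K_comp_def lookup_lin_ext lookup_cell graft_sign_def sum_distrib_left ..
  show "coord (K_comp x i y) (graft U' i U'') = coord x U' * coord y U'' * of_int (graft_sign i U' U'')"
    if U: "wf_tree U'" "leaves U' = r" "wf_tree U''" "leaves U'' = s"
  proof -
    have e: "graft T i T' = graft U' i U'' \<longleftrightarrow> T = U' \<and> T' = U''"
      if "T \<in> Poly_Mapping.keys x" "T' \<in> Poly_Mapping.keys y" for T T'
      using graft_inj[of T T' U' U'' i] kx[OF that(1)] ky[OF that(2)] U i rs by auto
    have "coord (K_comp x i y) (graft U' i U'') = (\<Sum>T\<in>Poly_Mapping.keys x. \<Sum>T'\<in>Poly_Mapping.keys y.
        if T' = U'' then (if T = U' then coord x T * (coord y T' * of_int (graft_sign i T T')) else 0) else 0)"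
      unfolding l by (intro sum.cong refl) (auto simp: e)
    also have "\<dots> = (\<Sum>T\<in>Poly_Mapping.keys x. if T =
        U' then coord x T * (coord y U'' * of_int (graft_sign i T U'')) else 0)"
      by (intro sum.cong refl) (simp add: in_keys_iff)
    also have "\<dots> = coord x U' * coord y U'' * of_int (graft_sign i U' U'')"
      by (simp add: in_keys_iff)
    finally show ?thesis .
  qed
  show "coord (K_comp x i y) U = 0"
    if n: "\<And>U' U''. wf_tree U' \<Longrightarrow> leaves U' = r \<Longrightarrow> wf_tree U'' \<Longrightarrow> leaves U'' = s \<Longrightarrow> U \<noteq> graft U' i U''"
    unfolding l using n kx ky by (intro sum.neutral ballI) force
qed

lemma tree_support_K_comp:
  assumes "tree_support r x" "tree_support s y" "1 \<le> i" "i \<le> r"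
  shows "tree_support (r + s - 1) (K_comp x i y)"
  unfolding tree_support_def
proof (intro conjI allI impI)
  show "2 \<le> r + s - 1" using assms by (auto simp: tree_support_def)
  fix U assume "coord (K_comp x i y) U \<noteq> 0"
  then obtain U' U'' where "wf_tree U'" "leaves U' = r" "wf_tree U''" "leaves U'' = s" "U = graft U' i U''"
    using lookup_K_comp(2)[OF assms] by blast
  then show "wf_tree U" "leaves U = r + s - 1" using leaves_graft(1)[of U' U'' i] assms by auto
qed

lemma collapse_graft:
  assumes T: "wf_tree T'" "wf_tree T''" "1 \<le> j" "j \<le> leaves T'" "2 \<le> leaves T'" "2 \<le> leaves T''"
    and AB: "A \<subseteq> edges T'" "B \<subseteq> edges T''"
  shows "collapse (outer_edge j (leaves T'') ` A \<union> inner_edge j ` B) (graft T' j T'') =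
    graft (collapse A T') j (collapse B T'')"
proof (rule edges_inj)
  let ?o = "outer_edge j (leaves T'')"
  have inj: "inj ?o" "inj (inner_edge j)" using inj_outer_edge inj_inner_edge T by auto
  note c' = collapse_props[OF T(1), of A] and c'' = collapse_props[OF T(2), of B]
  have g: "wf_tree (graft T' j T'')" "leaves (graft T' j T'') = leaves T' + leaves T'' - 1"
    using leaves_graft(1)[of T' T'' j] T by auto
  note cg = collapse_props[OF g(1), of "?o ` A \<union> inner_edge j ` B"]
  show "wf_tree (collapse (?o ` A \<union> inner_edge j ` B) (graft T' j T''))" by (rule cg)
  show "2 \<le> leaves (collapse (?o ` A \<union> inner_edge j ` B) (graft T' j T''))" using cg g T by auto
  have h: "wf_tree (graft (collapse A T') j (collapse B T''))" "leaves (graft (collapse A T') j (collapse B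
      T'')) = leaves T' + leaves T'' - 1"
    using leaves_graft(1)[of "collapse A T'" "collapse B T''" j] T c' c'' by auto
  show "wf_tree (graft (collapse A T') j (collapse B T''))" by (rule h)
  show "leaves (collapse (?o ` A \<union> inner_edge j ` B) (graft T' j T'')) =
      leaves (graft (collapse A T') j (collapse B T''))"
    using cg g h by simp
  note eg = edges_graft[OF T]
  have e: "edges (graft (collapse A T') j (collapse B T'')) =
      ?o ` (edges T' - A) \<union> inner_edge j ` (edges T'' - B) \<union> {new_edge j (leaves T'')}"
    using edges_graft(1)[of "collapse A T'" "collapse B T''" j] T c' c'' by simp
  have "?o ` A \<subseteq> ?o ` edges T'" "inner_edge j ` B \<subseteq> inner_edge j ` edges T''" using AB by blast+
  from Diff_Un_disjoint[OF this eg(2-4), of False]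
  show "edges (collapse (?o ` A \<union> inner_edge j ` B) (graft T' j T'')) =
      edges (graft (collapse A T') j (collapse B T''))"
    unfolding cg(3) eg(1) e image_set_diff[OF inj(1)] image_set_diff[OF inj(2)] by simp
qed

lemma card_vertices_le:
  "wf_tree T \<Longrightarrow> card (vertices_from a T) + 1 \<le> leaves T"
  "\<forall>t\<in>set ts. wf_tree t \<Longrightarrow> card (vertices_from_list a ts) + length ts \<le> sum_list (map leaves ts)"
proof (induction a T and a ts rule: vertices_from_vertices_from_list.induct)
  case (2 a ts)
  have "card (vertices_from a (Node ts)) \<le> card (vertices_from_list a ts) + 1"
    unfolding vertices_from.simps by (simp add: card_insert_if finite_vertices_from)
  then show ?case using 2 by simp
next
  case (4 a t ts)
  have "card (vertices_from_list a (t # ts)) \<le> card (vertices_from a t) + card (vertices_from_list (a +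
      leaves t) ts)"
    unfolding vertices_from_list.simps by (rule card_Un_le)
  then show ?case using 4 by fastforce
qed auto

lemma card_edges_le: "wf_tree T \<Longrightarrow> 2 \<le> leaves T \<Longrightarrow> card (edges T) \<le> leaves T - 2"
  using card_vertices_le(1)[of T 1] vertices_edges[of T] by simp

definition graft_list_sign :: "nat \<Rightarrow> nat \<Rightarrow> edge list \<Rightarrow> edge list \<Rightarrow> int" where
  "graft_list_sign i s es fs = list_sign (map (outer_edge i s) es @ map (inner_edge i) fs @ [new_edge i s])"

lemma graft_list_sign_std:
  assumes "distinct es" "distinct fs" "0 < i" "0 < s"
  shows "graft_list_sign i s es fs = list_sign es * list_sign fs *
    graft_list_sign i s (sorted_list_of_set (set es)) (sorted_list_of_set (set fs))"
  unfolding graft_list_sign_def by (rule list_sign_graft(2)[OF assms])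

lemma graft_sign_eq:
  "graft_sign i T T' = (-1) ^ (leaves T * (leaves T' - 2 - card (edges T')) + i * (leaves T' + 1)) *
    graft_list_sign i (leaves T') (sorted_list_of_set (edges T)) (sorted_list_of_set (edges T'))"
  by (simp add: graft_sign_def graft_list_sign_def K_graft_orientation_def orientation_sign_def std_order_def
      Let_def)

text \<open>
  In the second part the sign has two sources: the edge passes all the edges of the outer tree, and
  the degree of the inner cell is raised by one, which changes the sign of the composition by
  the parity of the number of leaves of the outer tree.
\<close>

lemma graft_sign_collapse:
  assumes U: "wf_tree U'" "wf_tree U''" "1 \<le> i" "i \<le> leaves U'" "2 \<le> leaves U'" "2 \<le> leaves U''"
  shows "e \<in> edges U' \<Longrightarrow> front_sign (outer_edge i (leaves U'') e) (edges (graft U' i U'')) *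
      graft_sign i (collapse {e} U') U'' =
      front_sign e (edges U') * graft_sign i U' U''"
    and "e \<in> edges U'' \<Longrightarrow> front_sign (inner_edge i e) (edges (graft U' i U'')) *
        graft_sign i U' (collapse {e} U'') =
      (-1) ^ (card (edges U') + leaves U') * front_sign e (edges U'') * graft_sign i U' U''"
proof -
  let ?s = "leaves U''"
  let ?o = "outer_edge i ?s" and ?n = "inner_edge i" and ?z = "new_edge i ?s"
  let ?es = "sorted_list_of_set (edges U')" and ?fs = "sorted_list_of_set (edges U'')"
  note eg = edges_graft[OF U]
  have inj: "inj ?o" "inj ?n" using inj_outer_edge inj_inner_edge U by auto
  have dist: "distinct (map ?o es @ map ?n fs @ [?z])"
      if "distinct es" "distinct fs" "set es \<subseteq> edges U'" "set fs \<subseteq> edges U''" for es fs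
    using that eg(2-4) inj by (auto simp: distinct_map intro: inj_on_subset)
  show "front_sign (?o e) (edges (graft U' i U'')) * graft_sign i (collapse {e} U') U'' =
      front_sign e (edges U') * graft_sign i U' U''"
    if e: "e \<in> edges U'"
  proof -
    let ?es' = "sorted_list_of_set (edges U' - {e})"
    let ?r = "map ?o ?es' @ map ?n ?fs @ [?z]"
    have "distinct (map ?o (e # ?es') @ map ?n ?fs @ [?z])" using e by (intro dist) auto
    moreover have "edges (graft U' i U'') = set (map ?o (e # ?es') @ map ?n ?fs @ [?z])"
      unfolding eg(1) using e by auto
    ultimately have f: "front_sign (?o e) (edges (graft U' i U'')) = list_sign (?o e # ?r) * list_sign ?r"
      by (intro front_sign_list) simp_all
    have l: "list_sign (?o e # ?r) = front_sign e (edges U') * graft_list_sign i ?s ?es ?fs"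
    proof -
      have "list_sign (?o e # ?r) = graft_list_sign i ?s (e # ?es') ?fs" by (simp add: graft_list_sign_def)
      also have "\<dots> = list_sign (e # ?es') * list_sign ?fs *
          graft_list_sign i ?s (sorted_list_of_set (set (e # ?es'))) (sorted_list_of_set (set ?fs))"
        using U by (intro graft_list_sign_std) auto
      also have "set (e # ?es') = edges U'" using e by auto
      also have "list_sign (e # ?es') = front_sign e (edges U')"
          using e by (simp only: front_sign_std finite_edges)
      finally show ?thesis by simp
    qed
    have g: "graft_sign i (collapse {e} U') U'' =
        (-1) ^ (leaves U' * (leaves U'' - 2 - card (edges U'')) + i * (leaves U'' + 1)) * list_sign ?r"
      using collapse_props[OF U(1), of "{e}"] by (simp add: graft_sign_eq graft_list_sign_def)
    show ?thesis unfolding f l g unfolding graft_sign_eq by (simp add: ac_simps del: list_sign.simps)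
  qed
  show "front_sign (?n e) (edges (graft U' i U'')) * graft_sign i U' (collapse {e} U'') =
      (-1) ^ (card (edges U') + leaves U') * front_sign e (edges U'') * graft_sign i U' U''"
    if e: "e \<in> edges U''"
  proof -
    let ?fs' = "sorted_list_of_set (edges U'' - {e})"
    let ?r = "map ?o ?es @ map ?n ?fs' @ [?z]"
    have d: "distinct (map ?o ?es @ map ?n (e # ?fs') @ [?z])" using e by (intro dist) auto
    moreover have "edges (graft U' i U'') = set (map ?o ?es @ map ?n (e # ?fs') @ [?z])"
      unfolding eg(1) using e by auto
    ultimately have f: "front_sign (?n e) (edges (graft U' i U'')) = list_sign (?n e # ?r) * list_sign ?r"
      by (intro front_sign_list) auto
    have l: "list_sign (?n e # ?r) = (-1) ^ card (edges U') * front_sign e (edges U'') *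
        graft_list_sign i ?s ?es ?fs"
    proof -
      have "list_sign (map ?o ?es @ ?n e # (map ?n ?fs' @ [?z])) =
          (-1) ^ length (map ?o ?es) * list_sign (?n e # map ?o ?es @ (map ?n ?fs' @ [?z]))"
        by (rule list_sign_move_to_front) (use d in auto)
      then have "list_sign (?n e # ?r) = (-1) ^ card (edges U') * graft_list_sign i ?s ?es (e # ?fs')"
        by (simp add: graft_list_sign_def del: list_sign.simps flip: mult.assoc power_add)
      also have "graft_list_sign i ?s ?es (e # ?fs') = list_sign ?es * list_sign (e # ?fs') *
          graft_list_sign i ?s (sorted_list_of_set (set ?es)) (sorted_list_of_set (set (e # ?fs')))"
        using U e by (intro graft_list_sign_std) auto
      also have "set (e # ?fs') = edges U''" using e by auto
      also have "list_sign (e # ?fs') = front_sign e (edges U'')"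
          using e by (simp only: front_sign_std finite_edges)
      finally show ?thesis by simp
    qed
    have c: "leaves U'' - 2 - card (edges U'' - {e}) = Suc (leaves U'' - 2 - card (edges U''))"
      using card_edges_le[OF U(2,6)] e card_Suc_Diff1[OF finite_edges e] by simp
    have g: "graft_sign i U' (collapse {e} U'') =
        (-1) ^ leaves U' * (-1) ^ (leaves U' * (leaves U'' - 2 - card (edges U'')) + i * (leaves U'' + 1)) *
            list_sign ?r"
      using collapse_props[OF U(2), of "{e}"] c by (simp add: graft_sign_eq graft_list_sign_def power_add)
    show ?thesis unfolding f l g power_add unfolding graft_sign_eq
        by (simp add: ac_simps power_add del: list_sign.simps)
  qed
qed

lemma K_Leibniz:
  assumes x: "x \<in> K_chains r k" and y: "y \<in> K_chains s l" and rs: "2 \<le> r" "2 \<le> s" and i: "1 \<le> i" "i \<le> r"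
  shows "K_bdry (K_comp x i y) = K_comp (K_bdry x) i y + scale ((-1) ^ k) (K_comp x i (K_bdry y))"
proof (rule poly_mapping_eqI)
  fix U
  have sx: "tree_support r x" and sy: "tree_support s y" using tree_supportI x y rs by auto
  note bx = tree_support_K_bdry[OF sx] and by' = tree_support_K_bdry[OF sy]
  let ?n = "r + s - 1"
  show "coord (K_bdry (K_comp x i y)) U = coord (K_comp (K_bdry x) i y +
      scale ((-1) ^ k) (K_comp x i (K_bdry y))) U"
  proof (cases "\<exists>U' U''. wf_tree U' \<and> leaves U' = r \<and> wf_tree U'' \<and> leaves U'' = s \<and> U = graft U' i U''")
    case False
    then have z: "coord (K_comp (K_bdry x) i y) U = 0" "coord (K_comp x i (K_bdry y)) U = 0"
      using lookup_K_comp(2)[OF bx sy i] lookup_K_comp(2)[OF sx by' i] by blast+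
    have "coord (K_bdry (K_comp x i y)) U = 0"
    proof (cases "wf_tree U \<and> leaves U = ?n")
      case True
      have "coord (K_comp x i y) (collapse {e} U) = 0" if e: "e \<in> edges U" for e
      proof (rule lookup_K_comp(2)[OF sx sy i])
        fix V' V'' assume V: "wf_tree V'" "leaves V' = r" "wf_tree V''" "leaves V'' = s"
        show "collapse {e} U \<noteq> graft V' i V''"
        proof
          assume "collapse {e} U = graft V' i V''"
          then have "new_edge i s \<in> edges (collapse {e} U)" using edges_graft(1)[of V' V'' i] V i rs by auto
          then have "(i, i + s - 1) \<in> edges U" using collapse_props(3)[of U "{e}"] True
              by (auto simp: new_edge_def)
          then obtain U' U'' where "wf_tree U'" "wf_tree U''" "2 \<le> leaves U''" "i + s - 1 =
              i + leaves U'' - 1" "U = graft U' i U''" "leaves U = leaves U' + leaves U'' - 1"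
            using decompose[of U i "i + s - 1"] True by blast
          moreover then have "leaves U'' = s" "leaves U' = r" using True rs by auto
          ultimately show False using False by blast
        qed
      qed
      then show ?thesis using lookup_K_bdry[OF tree_support_K_comp[OF sx sy i], of U] True by simp
    next
      case False
      then show ?thesis using lookup_K_bdry[OF tree_support_K_comp[OF sx sy i], of U] by argo
    qed
    then show ?thesis using z by (simp add: lookup_add)
  next
    case True
    then obtain U' U'' where U: "wf_tree U'" "leaves U' = r" "wf_tree U''" "leaves U'' = s" "U = graft U' i U''"
        by blast
    have Ui: "wf_tree U'" "wf_tree U''" "1 \<le> i" "i \<le> leaves U'" "2 \<le> leaves U'" "2 \<le> leaves U''"
        using U i rs by auto
    have wU: "wf_tree U" "leaves U = ?n" using leaves_graft(1)[of U' U'' i] U i rs by auto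
    let ?o = "outer_edge i s" and ?n = "inner_edge i" and ?z = "new_edge i s"
    note eg = edges_graft[OF Ui, folded U(5), unfolded U(4)]
    have inj: "inj ?o" "inj ?n" using inj_outer_edge inj_inner_edge U rs i by auto
    define h where "h e = (of_int (front_sign e (edges U)) * coord (K_comp x i y) (collapse {e} U) :: 'a)" for e
    have hz: "h ?z = 0"
    proof -
      have "coord (K_comp x i y) (collapse {?z} U) = 0"
      proof (rule lookup_K_comp(2)[OF sx sy i])
        fix V' V'' assume V: "wf_tree V'" "leaves V' = r" "wf_tree V''" "leaves V'' = s"
        have "?z \<in> edges (graft V' i V'')" using edges_graft(1)[of V' V'' i] V i rs by auto
        moreover have "?z \<notin> edges (collapse {?z} U)" using collapse_props(3)[OF wU(1)] by simp
        ultimately show "collapse {?z} U \<noteq> graft V' i V''" by metis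
      qed
      then show ?thesis by (simp add: h_def)
    qed
    have ho: "h (?o e) = (of_int (front_sign e (edges U')) * coord x (collapse {e} U')) * coord y U'' *
        of_int (graft_sign i U' U'')"
      if e: "e \<in> edges U'" for e
    proof -
      have c: "collapse {?o e} U = graft (collapse {e} U') i U''"
        using collapse_graft[OF Ui, of "{e}" "{}"] e U edges_inj[of "collapse {} U''" U''] collapse_props[OF
            U(3), of "{}"] rs by simp
      have "h (?o e) = of_int (front_sign (?o e) (edges U)) * (coord x (collapse {e} U') * coord y U'' *
          of_int (graft_sign i (collapse {e} U') U''))"
        unfolding h_def c using lookup_K_comp(1)[OF sx sy i, of "collapse {e} U'" U''] collapse_props[OF U(1),
            of "{e}"] U by simp
      also have "\<dots> = coord x (collapse {e} U') * coord y U'' * of_int (front_sign (?o e) (edges U) *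
          graft_sign i (collapse {e} U') U'')"
        by simp
      also have "front_sign (?o e) (edges U) * graft_sign i (collapse {e} U') U'' =
          front_sign e (edges U') * graft_sign i U' U''"
        using graft_sign_collapse(1)[OF Ui e] U by simp
      finally show ?thesis by simp
    qed
    have hn: "h (?n e) = (-1) ^ k * (coord x U' * (of_int (front_sign e (edges U'')) *
        coord y (collapse {e} U'')) * of_int (graft_sign i U' U''))"
      if e: "e \<in> edges U''" for e
    proof (cases "coord x U' = 0")
      case False
      have c: "collapse {?n e} U = graft U' i (collapse {e} U'')"
        using collapse_graft[OF Ui, of "{}" "{e}"] e U edges_inj[of "collapse {} U'" U'] collapse_props[OF U(1),
            of "{}"] rs by simp
      have "h (?n e) = of_int (front_sign (?n e) (edges U)) * (coord x U' * coord y (collapse {e} U'') *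
          of_int (graft_sign i U' (collapse {e} U'')))"
        unfolding h_def c using lookup_K_comp(1)[OF sx sy i, of U' "collapse {e} U''"] collapse_props[OF U(3),
            of "{e}"] U by simp
      also have "\<dots> = coord x U' * coord y (collapse {e} U'') * of_int (front_sign (?n e) (edges U) *
          graft_sign i U' (collapse {e} U''))"
        by simp
      also have "front_sign (?n e) (edges U) * graft_sign i U' (collapse {e} U'') =
          (-1) ^ (card (edges U') + r) * front_sign e (edges U'') * graft_sign i U' U''"
        using graft_sign_collapse(2)[OF Ui e] U by simp
      also have "(-1::int) ^ (card (edges U') + r) = (-1) ^ k"
      proof (rule minus_one_power_cong)
        have "card (edges U') + k + 2 = r" using x False by (auto simp: K_chains_iff)
        then show "even (card (edges U') + r + k)" by presburger
      qed
      finally show ?thesis by simp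
    next
      case True
      have c: "collapse {?n e} U = graft U' i (collapse {e} U'')"
        using collapse_graft[OF Ui, of "{}" "{e}"] e U edges_inj[of "collapse {} U'" U'] collapse_props[OF U(1),
            of "{}"] rs by simp
      show ?thesis unfolding h_def c
        using lookup_K_comp(1)[OF sx sy i, of U' "collapse {e} U''"] collapse_props[OF U(3), of "{e}"] U True
            by simp
    qed
    have "coord (K_bdry (K_comp x i y)) U = (\<Sum>e\<in>edges U. h e)"
      using lookup_K_bdry[OF tree_support_K_comp[OF sx sy i], of U] wU by (simp add: h_def)
    also have "\<dots> = (\<Sum>e\<in>?o ` edges U'. h e) + (\<Sum>e\<in>?n ` edges U''. h e)"
    proof -
      have "(\<Sum>e\<in>edges U. h e) = (\<Sum>e\<in>?o ` edges U' \<union> ?n ` edges U''. h e) + h ?z"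
        unfolding eg(1) using eg(3,4) by simp
      then show ?thesis using hz eg(2) by (simp add: sum.union_disjoint)
    qed
    also have "(\<Sum>e\<in>?o ` edges U'. h e) = coord (K_comp (K_bdry x) i y) U"
    proof -
      have "(\<Sum>e\<in>?o ` edges U'. h e) = (\<Sum>e\<in>edges U'. h (?o e))"
        using inj(1) by (subst sum.reindex) (auto intro: inj_on_subset)
      also have "\<dots> = (\<Sum>e\<in>edges U'. of_int (front_sign e (edges U')) * coord x (collapse {e} U')) * coord y U'' *
          of_int (graft_sign i U' U'')"
        by (simp add: ho sum_distrib_right)
      also have "\<dots> = coord (K_comp (K_bdry x) i y) U"
        using lookup_K_comp(1)[OF bx sy i U(1-4)] lookup_K_bdry[OF sx, of U'] U by simp
      finally show ?thesis .
    qed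
    also have "(\<Sum>e\<in>?n ` edges U''. h e) = (-1) ^ k * coord (K_comp x i (K_bdry y)) U"
    proof -
      have "(\<Sum>e\<in>?n ` edges U''. h e) = (\<Sum>e\<in>edges U''. h (?n e))"
        using inj(2) by (subst sum.reindex) (auto intro: inj_on_subset)
      also have "\<dots> = (-1) ^ k * (coord x U' * (\<Sum>e\<in>edges U''. of_int (front_sign e (edges U'')) *
          coord y (collapse {e} U'')) * of_int (graft_sign i U' U''))"
        by (simp add: hn sum_distrib_left sum_distrib_right)
      also have "\<dots> = (-1) ^ k * coord (K_comp x i (K_bdry y)) U"
        using lookup_K_comp(1)[OF sx by' i U(1-4)] lookup_K_bdry[OF sy, of U''] U by simp
      finally show ?thesis .
    qed
    finally show ?thesis by (simp add: lookup_add)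
  qed
qed

section \<open>The boundary of the cubical chains\<close>

lemma W_chains_iff:
  "x \<in> W_chains n k \<longleftrightarrow> (\<forall>T M. coord x (T, M) \<noteq> 0 \<longrightarrow> wf_tree T \<and> leaves T = n \<and> 2 \<le> n \<and> M \<subseteq> edges T \<and> card M = k)"
  unfolding W_chains_def mem_Collect_eq Ball_def in_keys_iff by auto

lemma W_chains_0 [simp]: "0 \<in> W_chains n k"
  by (simp add: W_chains_iff)

lemma W_chains_add: "x \<in> W_chains n k \<Longrightarrow> y \<in> W_chains n k \<Longrightarrow> x + y \<in> W_chains n k"
  unfolding W_chains_iff lookup_add by (metis add.left_neutral)

lemma W_chains_scale: "x \<in> W_chains n k \<Longrightarrow> scale c x \<in> W_chains n k"
  unfolding W_chains_iff lookup_scale by (metis mult_zero_right)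

lemma W_chains_diff: "x \<in> W_chains n k \<Longrightarrow> y \<in> W_chains n k \<Longrightarrow> x - y \<in> W_chains n k"
  unfolding W_chains_iff lookup_minus by (metis diff_self diff_zero)

lemma W_chains_sum: "(\<And>a. a \<in> A \<Longrightarrow> f a \<in> W_chains n k) \<Longrightarrow> (\<Sum>a\<in>A. f a) \<in> W_chains n k"
  by (induction A rule: infinite_finite_induct) (auto intro: W_chains_add)

lemma W_chains_single:
  "wf_tree T \<Longrightarrow> leaves T = n \<Longrightarrow> 2 \<le> n \<Longrightarrow> M \<subseteq> edges T \<Longrightarrow> card M = k \<Longrightarrow> Poly_Mapping.single (T, M) c \<in> W_chains n k"
  by (simp add: W_chains_iff lookup_single when_def)

text \<open>
  The difference of the two facets in the direction of \<open>e\<close>: non-metric edge minus collapsed edge.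
\<close>

definition W_facets :: "tree \<Rightarrow> edge set \<Rightarrow> edge \<Rightarrow> (mtree \<Rightarrow>\<^sub>0 'k::field)" where
  "W_facets T M e = Poly_Mapping.single (T, M - {e}) 1 - Poly_Mapping.single (collapse {e} T, M - {e}) 1"

lemma cell_std: "finite M \<Longrightarrow> cell (T, M) (std_order M) = Poly_Mapping.single (T, M) 1"
  by (simp add: cell_def orientation_sign_def std_order_def)

lemma W_bdry_single:
  assumes "finite M"
  shows "W_bdry (Poly_Mapping.single (T, M) 1 :: mtree \<Rightarrow>\<^sub>0 'k::field) =
    (\<Sum>e\<in>M. scale (of_int (front_sign e M)) (W_facets T M e))"
proof -
  have o: "orients (std_order M) (snd (T, M))" "orientation_sign (std_order M) = 1"
    using assms by (simp_all add: orients_def std_order_def orientation_sign_def)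
  have "W_bdry (Poly_Mapping.single (T, M) 1) = W_bdry (cell (T, M) (std_order M))"
      by (simp add: cell_std assms)
  also have "\<dots> = W_bdry_cell (T, M) (std_order M)" using o(1) by (rule W_bdry_cell)
  also have "\<dots> = (\<Sum>e\<in>M. scale (of_int (front_sign e M)) (W_facets T M e))"
    unfolding W_bdry_cell_sum[OF o(1)] o(2) by (simp add: W_facets_def front_sign_def)
  finally show ?thesis .
qed

lemma W_facets_in:
  assumes "wf_tree T" "leaves T = n" "2 \<le> n" "M \<subseteq> edges T" "e \<in> M"
  shows "W_facets T M e \<in> W_chains n (card M - 1)"
proof -
  have "card (M - {e}) = card M - 1" using assms by (simp add: card_Diff_singleton)
  moreover have "M - {e} \<subseteq> edges (collapse {e} T)" using collapse_props(3)[OF assms(1)] assms(4) by auto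
  ultimately show ?thesis unfolding W_facets_def
    using collapse_props(1,2)[OF assms(1)] assms by (intro W_chains_diff W_chains_single) auto
qed

lemma sum_singles: "x = (\<Sum>X\<in>Poly_Mapping.keys x. scale (coord x X) (Poly_Mapping.single X (1::'k::field)))"
proof (rule poly_mapping_eqI)
  fix Y
  have "coord (\<Sum>X\<in>Poly_Mapping.keys x. scale (coord x X) (Poly_Mapping.single X (1::'k))) Y =
      (\<Sum>X\<in>Poly_Mapping.keys x. if X = Y then coord x X else 0)"
    by (simp add: lookup_sum lookup_single when_def if_distrib cong: if_cong)
  then show "coord x Y = coord (\<Sum>X\<in>Poly_Mapping.keys x. scale (coord x X) (Poly_Mapping.single X (1::'k))) Y"
    by (simp add: in_keys_iff)
qed

lemma lin_ext_0 [simp]: "lin_ext f 0 = 0"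
  by (simp add: lin_ext_def)

lemma lin_ext_sum: "lin_ext f (\<Sum>a\<in>A. g a) = (\<Sum>a\<in>A. lin_ext f (g a))"
  by (induction A rule: infinite_finite_induct) (simp_all add: lin_ext_add)

lemma lin_ext_minus: "lin_ext f (x - y) = lin_ext f x - lin_ext f y"
proof -
  have "lin_ext f x = lin_ext f (x - y) + lin_ext f y" by (simp flip: lin_ext_add)
  then show ?thesis by simp
qed

lemma lin_ext_combination: "lin_ext f x = (\<Sum>X\<in>Poly_Mapping.keys x. scale (coord x X) (lin_ext f
    (Poly_Mapping.single X 1)))"
  by (simp add: lin_ext_def)

lemma W_bdry_in:
  assumes "x \<in> W_chains n k"
  shows "W_bdry x \<in> W_chains n (k - 1)"
proof -
  have "W_bdry x = (\<Sum>X\<in>Poly_Mapping.keys x. scale (coord x X) (W_bdry (Poly_Mapping.single X 1)))"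
    unfolding W_bdry_def by (rule lin_ext_combination)
  also have "\<dots> \<in> W_chains n (k - 1)"
  proof (intro W_chains_sum W_chains_scale)
    fix X assume "X \<in> Poly_Mapping.keys x"
    then obtain T M where X: "X = (T, M)" "coord x (T, M) \<noteq> 0" by (cases X) (auto simp: in_keys_iff)
    then have T: "wf_tree T" "leaves T = n" "2 \<le> n" "M \<subseteq> edges T" "card M = k"
      using assms by (auto simp: W_chains_iff)
    then have "finite M" using finite_subset finite_edges by blast
    then show "W_bdry (Poly_Mapping.single X 1) \<in> W_chains n (k - 1)"
      unfolding X W_bdry_single[OF \<open>finite M\<close>] using W_facets_in[OF T(1-4)] T(5)
      by (intro W_chains_sum W_chains_scale) auto
  qed
  finally show ?thesis .
qed

text \<open>
  The sign that a composition of basis elements acquires when its orientation is sorted.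
\<close>

definition W_sign :: "nat \<Rightarrow> nat \<Rightarrow> edge set \<Rightarrow> edge set \<Rightarrow> int" where
  "W_sign i s M N = list_sign (map (outer_edge i s) (sorted_list_of_set M) @ map (inner_edge i)
      (sorted_list_of_set N))"

lemma W_comp_single:
  "W_comp (Poly_Mapping.single (T', M) 1) i (Poly_Mapping.single (T'', N) 1) =
   Poly_Mapping.single (graft T' i T'', outer_edge i (leaves T'') ` M \<union> inner_edge i ` N) (of_int (W_sign i
       (leaves T'') M N) :: 'k::field)"
  by (simp add: W_comp_def cell_def orientation_sign_def W_graft_def W_graft_orientation_def std_order_def
      W_sign_def)

lemma W_comp_sum_left: "W_comp (\<Sum>a\<in>A. scale (c a) (f a)) i y = (\<Sum>a\<in>A. scale (c a) (W_comp (f a) i y))"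
  by (simp add: W_comp_def lin_ext_sum lin_ext_scale)

lemma W_comp_diff_left: "W_comp (x - x') i y = W_comp x i y - W_comp x' i y"
  by (simp add: W_comp_def lin_ext_minus)

lemma W_comp_sum_right:
  "W_comp (Poly_Mapping.single X 1) i (\<Sum>a\<in>A. scale (c a) (f a)) =
      (\<Sum>a\<in>A. scale (c a) (W_comp (Poly_Mapping.single X 1) i (f a)))"
  by (simp add: W_comp_def lin_ext_sum lin_ext_scale)

lemma W_comp_diff_right: "W_comp (Poly_Mapping.single X 1) i (y - y') =
    W_comp (Poly_Mapping.single X 1) i y - W_comp (Poly_Mapping.single X 1) i y'"
  by (simp add: W_comp_def lin_ext_minus)

lemma W_sign_remove:
  assumes fin: "finite M" "finite N" and i: "0 < i" "0 < s"
    and disj: "outer_edge i s ` M \<inter> inner_edge i ` N = {}"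
  shows "e \<in> M \<Longrightarrow> front_sign (outer_edge i s e) (outer_edge i s ` M \<union> inner_edge i ` N) * W_sign i s M N =
      front_sign e M * W_sign i s (M - {e}) N"
    and "e \<in> N \<Longrightarrow> front_sign (inner_edge i e) (outer_edge i s ` M \<union> inner_edge i ` N) * W_sign i s M N =
      (-1) ^ card M * front_sign e N * W_sign i s M (N - {e})"
proof -
  let ?o = "outer_edge i s" and ?n = "inner_edge i"
  let ?es = "sorted_list_of_set M" and ?fs = "sorted_list_of_set N"
  have inj: "inj ?o" "inj ?n" using inj_outer_edge inj_inner_edge i by auto
  have dist: "distinct (map ?o es @ map ?n fs)"
      if "distinct es" "distinct fs" "set es = M" "set fs = N" for es fs
    using that disj inj by (auto simp: distinct_map intro: inj_on_subset)
  have std: "list_sign (map ?o es @ map ?n fs) = list_sign es * list_sign fs * W_sign i s (set es) (set fs)"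
    if "distinct es" "distinct fs" for es fs
    unfolding W_sign_def by (rule list_sign_graft(1)[OF that i])
  have sq: "W_sign i s A B * W_sign i s A B = 1" for A B by (simp add: W_sign_def)
  have fin2: "x * w = y * z" if "x = y * w * z" "w * w = 1" for x y z w :: int
    using that by (metis mult.assoc mult.commute mult.right_neutral)
  show "front_sign (?o e) (?o ` M \<union> ?n ` N) * W_sign i s M N = front_sign e M * W_sign i s (M - {e}) N"
    if e: "e \<in> M"
  proof -
    let ?es' = "sorted_list_of_set (M - {e})"
    let ?r = "map ?o ?es' @ map ?n ?fs"
    have "distinct (map ?o (e # ?es') @ map ?n ?fs)" using e fin by (intro dist) auto
    moreover have "?o ` M \<union> ?n ` N = set (map ?o (e # ?es') @ map ?n ?fs)" using e fin by auto
    ultimately have f: "front_sign (?o e) (?o ` M \<union> ?n ` N) = list_sign (?o e # ?r) * list_sign ?r"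
      by (intro front_sign_list) simp_all
    have "list_sign (?o e # ?r) = list_sign (e # ?es') * list_sign ?fs * W_sign i s (set (e # ?es')) (set ?fs)"
      using std[of "e # ?es'" ?fs] fin by simp
    also have "list_sign (e # ?es') = front_sign e M" using e fin by (simp only: front_sign_std)
    also have "set (e # ?es') = M" using e fin by auto
    finally have l: "list_sign (?o e # ?r) = front_sign e M * W_sign i s M N" using fin by simp
    show ?thesis by (rule fin2[OF _ sq]) (simp add: f l W_sign_def del: list_sign.simps)
  qed
  show "front_sign (?n e) (?o ` M \<union> ?n ` N) * W_sign i s M N =
      (-1) ^ card M * front_sign e N * W_sign i s M (N - {e})"
    if e: "e \<in> N"
  proof -
    let ?fs' = "sorted_list_of_set (N - {e})"
    let ?r = "map ?o ?es @ map ?n ?fs'"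
    have d: "distinct (map ?o ?es @ map ?n (e # ?fs'))" using e fin by (intro dist) auto
    moreover have "?o ` M \<union> ?n ` N = set (map ?o ?es @ map ?n (e # ?fs'))" using e fin by auto
    ultimately have f: "front_sign (?n e) (?o ` M \<union> ?n ` N) = list_sign (?n e # ?r) * list_sign ?r"
      by (intro front_sign_list) auto
    have "list_sign (map ?o ?es @ ?n e # map ?n ?fs') =
        (-1) ^ length (map ?o ?es) * list_sign (?n e # map ?o ?es @ map ?n ?fs')"
      by (rule list_sign_move_to_front) (use d in auto)
    then have "list_sign (?n e # ?r) = (-1) ^ card M * list_sign (map ?o ?es @ map ?n (e # ?fs'))"
      by (simp del: list_sign.simps flip: mult.assoc power_add)
    also have "list_sign (map ?o ?es @ map ?n (e # ?fs')) =
        list_sign ?es * list_sign (e # ?fs') * W_sign i s (set ?es) (set (e # ?fs'))"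
      using fin by (intro std) auto
    also have "list_sign (e # ?fs') = front_sign e N" using e fin by (simp only: front_sign_std)
    also have "set (e # ?fs') = N" using e fin by auto
    finally have l: "list_sign (?n e # ?r) = (-1) ^ card M * front_sign e N * W_sign i s M N" using fin by simp
    show ?thesis by (rule fin2[OF _ sq]) (simp add: f l W_sign_def del: list_sign.simps)
  qed
qed

lemma collapse_empty: "wf_tree T \<Longrightarrow> 2 \<le> leaves T \<Longrightarrow> collapse {} T = T"
  using edges_inj[of "collapse {} T" T] collapse_props[of T "{}"] by simp

lemma W_comp_facets:
  assumes T: "wf_tree T'" "wf_tree T''" "1 \<le> i" "i \<le> leaves T'" "2 \<le> leaves T'" "2 \<le> leaves T''"
    and M: "M \<subseteq> edges T'" "N \<subseteq> edges T''"
  defines "s \<equiv> leaves T''"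
  defines "L \<equiv> outer_edge i s ` M \<union> inner_edge i ` N"
  shows "e \<in> M \<Longrightarrow> W_comp (W_facets T' M e) i (Poly_Mapping.single (T'', N) 1) =
      scale (of_int (W_sign i s (M - {e}) N)) (W_facets (graft T' i T'') L (outer_edge i s e) :: mtree \<Rightarrow>\<^sub>0
          'k::field)"
    and "e \<in> N \<Longrightarrow> W_comp (Poly_Mapping.single (T', M) 1) i (W_facets T'' N e) =
      scale (of_int (W_sign i s M (N - {e}))) (W_facets (graft T' i T'') L (inner_edge i e) :: mtree \<Rightarrow>\<^sub>0
          'k::field)"
proof -
  let ?o = "outer_edge i s" and ?n = "inner_edge i"
  have inj: "inj ?o" "inj ?n" using inj_outer_edge inj_inner_edge T by (auto simp: s_def)
  note eg = edges_graft[OF T, folded s_def]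
  have disj: "?o ` M \<inter> ?n ` N = {}" using eg(2) M by blast
  have sc: "scale c (Poly_Mapping.single X 1 - Poly_Mapping.single Y 1) =
      Poly_Mapping.single X c - Poly_Mapping.single Y (c :: 'k)" for c X Y
    by (rule poly_mapping_eqI) (simp add: lookup_minus lookup_single when_def)
  show "W_comp (W_facets T' M e) i (Poly_Mapping.single (T'', N) 1) =
      scale (of_int (W_sign i s (M - {e}) N)) (W_facets (graft T' i T'') L (?o e) :: mtree \<Rightarrow>\<^sub>0 'k)"
          if e: "e \<in> M"
  proof -
    have "?o e \<notin> ?n ` N" using disj e by blast
    then have 1: "L - {?o e} = ?o ` (M - {e}) \<union> ?n ` N" unfolding L_def image_set_diff[OF inj(1)]
        by (simp add: Un_Diff)
    have 2: "collapse {?o e} (graft T' i T'') = graft (collapse {e} T') i T''"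
      using collapse_graft[OF T, of "{e}" "{}"] e M collapse_empty[OF T(2,6)] by (auto simp: s_def)
    show ?thesis unfolding W_facets_def W_comp_diff_left W_comp_single sc 1 2 by (simp add: s_def)
  qed
  show "W_comp (Poly_Mapping.single (T', M) 1) i (W_facets T'' N e) =
      scale (of_int (W_sign i s M (N - {e}))) (W_facets (graft T' i T'') L (?n e) :: mtree \<Rightarrow>\<^sub>0 'k)"
          if e: "e \<in> N"
  proof -
    have "?n e \<notin> ?o ` M" using disj e by blast
    then have 1: "L - {?n e} = ?o ` M \<union> ?n ` (N - {e})" unfolding L_def image_set_diff[OF inj(2)]
        by (simp add: Un_Diff)
    have 2: "collapse {?n e} (graft T' i T'') = graft T' i (collapse {e} T'')"
      using collapse_graft[OF T, of "{}" "{e}"] e M collapse_empty[OF T(1,5)] by (auto simp: s_def)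
    show ?thesis unfolding W_facets_def W_comp_diff_right W_comp_single sc 1 2
        using collapse_props(1)[OF T(2)] by (simp add: s_def)
  qed
qed

lemma W_Leibniz:
  assumes T: "wf_tree T'" "wf_tree T''" "1 \<le> i" "i \<le> leaves T'" "2 \<le> leaves T'" "2 \<le> leaves T''"
    and M: "M \<subseteq> edges T'" "N \<subseteq> edges T''"
  defines "x \<equiv> Poly_Mapping.single (T', M) 1 :: mtree \<Rightarrow>\<^sub>0 'k::field" and "y \<equiv> Poly_Mapping.single (T'', N) 1 ::
      mtree \<Rightarrow>\<^sub>0 'k"
  shows "W_bdry (W_comp x i y) = W_comp (W_bdry x) i y + scale ((-1) ^ card M) (W_comp x i (W_bdry y))"
proof -
  let ?s = "leaves T''"
  let ?o = "outer_edge i ?s" and ?n = "inner_edge i" and ?T = "graft T' i T''"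
  let ?L = "?o ` M \<union> ?n ` N"
  have inj: "inj ?o" "inj ?n" using inj_outer_edge inj_inner_edge T by auto
  note eg = edges_graft[OF T]
  have disj: "?o ` M \<inter> ?n ` N = {}" using eg(2) M by blast
  have fin: "finite M" "finite N" using M finite_subset finite_edges by blast+
  note ws = W_sign_remove[OF fin _ _ disj]
  have sc: "Poly_Mapping.single X c = scale c (Poly_Mapping.single X (1::'k))" for X :: mtree and c
    by (rule poly_mapping_eqI) (simp add: lookup_single when_def)
  have "W_bdry (W_comp x i y) = scale (of_int (W_sign i ?s M N)) (W_bdry (Poly_Mapping.single (?T, ?L)
      (1::'k)))"
    unfolding x_def y_def W_comp_single by (subst sc) (simp add: W_bdry_def lin_ext_scale)
  also have "\<dots> = (\<Sum>e\<in>?L. scale (of_int (front_sign e ?L * W_sign i ?s M N)) (W_facets ?T ?L e))"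
    using fin by (simp add: W_bdry_single scale_sum mult.commute)
  also have "\<dots> = (\<Sum>e\<in>?o ` M. scale (of_int (front_sign e ?L * W_sign i ?s M N)) (W_facets ?T ?L e)) +
      (\<Sum>e\<in>?n ` N. scale (of_int (front_sign e ?L * W_sign i ?s M N)) (W_facets ?T ?L e))"
    using fin disj by (intro sum.union_disjoint) auto
  also have "(\<Sum>e\<in>?o ` M. scale (of_int (front_sign e ?L * W_sign i ?s M N)) (W_facets ?T ?L e)) =
      W_comp (W_bdry x) i y"
  proof -
    have "(\<Sum>e\<in>?o ` M. scale (of_int (front_sign e ?L * W_sign i ?s M N)) (W_facets ?T ?L e)) =
        (\<Sum>e\<in>M. scale (of_int (front_sign (?o e) ?L * W_sign i ?s M N)) (W_facets ?T ?L (?o e)))"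
      using inj(1) by (subst sum.reindex) (auto intro: inj_on_subset)
    also have "\<dots> = (\<Sum>e\<in>M. scale (of_int (front_sign e M)) (W_comp (W_facets T' M e) i y))"
    proof (intro sum.cong refl)
      fix e assume e: "e \<in> M"
      have "front_sign (?o e) ?L * W_sign i ?s M N = front_sign e M * W_sign i ?s (M - {e}) N"
          using ws(1) T e by auto
      then show "scale (of_int (front_sign (?o e) ?L * W_sign i ?s M N)) (W_facets ?T ?L (?o e)) =
          scale (of_int (front_sign e M)) (W_comp (W_facets T' M e) i y)"
        unfolding y_def W_comp_facets(1)[OF T M e] by simp
    qed
    also have "\<dots> = W_comp (W_bdry x) i y" unfolding x_def W_bdry_single[OF fin(1)] W_comp_sum_left ..
    finally show ?thesis .
  qed
  also have "(\<Sum>e\<in>?n ` N. scale (of_int (front_sign e ?L * W_sign i ?s M N)) (W_facets ?T ?L e)) =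
      scale ((-1) ^ card M) (W_comp x i (W_bdry y))"
  proof -
    have "(\<Sum>e\<in>?n ` N. scale (of_int (front_sign e ?L * W_sign i ?s M N)) (W_facets ?T ?L e)) =
        (\<Sum>e\<in>N. scale (of_int (front_sign (?n e) ?L * W_sign i ?s M N)) (W_facets ?T ?L (?n e)))"
      using inj(2) by (subst sum.reindex) (auto intro: inj_on_subset)
    also have "\<dots> = (\<Sum>e\<in>N. scale ((-1) ^ card M) (scale (of_int (front_sign e N)) (W_comp x i (W_facets T'' N
        e))))"
    proof (intro sum.cong refl)
      fix e assume e: "e \<in> N"
      have "front_sign (?n e) ?L * W_sign i ?s M N = (-1) ^ card M * front_sign e N * W_sign i ?s M (N - {e})"
          using ws(2) T e by auto
      then show "scale (of_int (front_sign (?n e) ?L * W_sign i ?s M N)) (W_facets ?T ?L (?n e)) =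
          scale ((-1) ^ card M) (scale (of_int (front_sign e N)) (W_comp x i (W_facets T'' N e)))"
        unfolding x_def W_comp_facets(2)[OF T M e] by (simp add: mult.assoc)
    qed
    also have "\<dots> = scale ((-1) ^ card M) (W_comp x i (W_bdry y))"
      unfolding x_def y_def W_bdry_single[OF fin(2)] W_comp_sum_right scale_sum ..
    finally show ?thesis .
  qed
  finally show ?thesis .
qed

lemma W_comp_in_single:
  assumes T: "wf_tree T'" "wf_tree T''" "1 \<le> i" "i \<le> leaves T'" "2 \<le> leaves T'" "2 \<le> leaves T''"
    and M: "M \<subseteq> edges T'" "N \<subseteq> edges T''"
  shows "W_comp (Poly_Mapping.single (T', M) 1) i (Poly_Mapping.single (T'', N) 1) \<in> W_chains (leaves T' +
      leaves T'' - 1) (card M + card N)"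
proof -
  note eg = edges_graft[OF T]
  have inj: "inj (outer_edge i (leaves T''))" "inj (inner_edge i)" using inj_outer_edge inj_inner_edge T by auto
  have fin: "finite M" "finite N" using M finite_subset finite_edges by blast+
  have disj: "outer_edge i (leaves T'') ` M \<inter> inner_edge i ` N = {}" using eg(2) M by blast
  have "card (outer_edge i (leaves T'') ` M \<union> inner_edge i ` N) = card M + card N"
    using fin disj inj by (subst card_Un_disjoint) (auto simp: card_image inj_on_subset)
  moreover have "outer_edge i (leaves T'') ` M \<union> inner_edge i ` N \<subseteq> edges (graft T' i T'')" unfolding eg(1)
      using M by blast
  ultimately show ?thesis unfolding W_comp_single
    using leaves_graft(1)[of T' T'' i] T by (intro W_chains_single) auto
qed

lemma W_comp_in:
  assumes x: "x \<in> W_chains r k" and y: "y \<in> W_chains s l" and i: "1 \<le> i" "i \<le> r"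
  shows "W_comp x i y \<in> W_chains (r + s - 1) (k + l)"
proof -
  have "W_comp x i y = (\<Sum>X\<in>Poly_Mapping.keys x. scale (coord x X) (W_comp (Poly_Mapping.single X 1) i y))"
    unfolding W_comp_def by (rule lin_ext_combination)
  also have "\<dots> \<in> W_chains (r + s - 1) (k + l)"
  proof (intro W_chains_sum W_chains_scale)
    fix X assume "X \<in> Poly_Mapping.keys x"
    then obtain T M where X: "X = (T, M)" "coord x (T, M) \<noteq> 0" by (cases X) (auto simp: in_keys_iff)
    then have T: "wf_tree T" "leaves T = r" "2 \<le> r" "M \<subseteq> edges T" "card M = k"
        using x by (auto simp: W_chains_iff)
    have "W_comp (Poly_Mapping.single X 1) i y = (\<Sum>Y\<in>Poly_Mapping.keys y. scale (coord y Y) (W_comp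
        (Poly_Mapping.single X 1) i (Poly_Mapping.single Y 1)))"
      by (subst sum_singles[of y], subst W_comp_sum_right) simp
    also have "\<dots> \<in> W_chains (r + s - 1) (k + l)"
    proof (intro W_chains_sum W_chains_scale)
      fix Y assume "Y \<in> Poly_Mapping.keys y"
      then obtain T' N where Y: "Y = (T', N)" "coord y (T', N) \<noteq> 0" by (cases Y) (auto simp: in_keys_iff)
      then have T': "wf_tree T'" "leaves T' = s" "2 \<le> s" "N \<subseteq> edges T'" "card N = l"
          using y by (auto simp: W_chains_iff)
      show "W_comp (Poly_Mapping.single X 1) i (Poly_Mapping.single Y 1) \<in> W_chains (r + s - 1) (k + l)"
        unfolding X Y using W_comp_in_single[of T T' i M N] T T' i by auto
    qed
    finally show "W_comp (Poly_Mapping.single X 1) i y \<in> W_chains (r + s - 1) (k + l)" .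
  qed
  finally show ?thesis .
qed

section \<open>The morphism on all chains\<close>

lemma coeff_matching: "coeff n F G \<noteq> 0 \<Longrightarrow> matching n F G"
  by (auto simp: coeff_def split: if_splits)

lemma matching_names:
  assumes "wf_tree T" "wf_tree V" "leaves V = leaves T" "matching (leaves T) (edges T) (edges V)"
  shows "distinct (map fst (sorted_list_of_set (edges T)) @ map snd (sorted_list_of_set (edges V)))"
    and "set (map fst (sorted_list_of_set (edges T)) @ map snd (sorted_list_of_set (edges V))) = {2..<leaves T}"
proof -
  have f: "tree_family (leaves T) (edges T)" "tree_family (leaves T) (edges V)"
    using tree_family_edges assms(1-3) by metis+
  have m: "distinct_starts (edges T)" "distinct_ends (leaves T) (edges V)" "fst ` edges T \<inter> snd ` edges V = {}"
    "card (edges T) + card (edges V) = leaves T - 2"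
    using assms(4) by (auto simp: matching_def)
  show "distinct (map fst (sorted_list_of_set (edges T)) @ map snd (sorted_list_of_set (edges V)))"
    using m by (simp add: distinct_map distinct_starts_def distinct_ends_def)
  show "set (map fst (sorted_list_of_set (edges T)) @ map snd (sorted_list_of_set (edges V))) = {2..<leaves T}"
    using starts_ends_card(2)[OF f m] by simp
qed

text \<open>
  A tree of the source and one of the target with a common edge, whose pieces match.
\<close>

locale graft_pair =
  fixes T' T'' U' U'' :: tree and j :: nat
  assumes T: "wf_tree T'" "wf_tree T''" "2 \<le> leaves T'" "2 \<le> leaves T''"
    and U: "wf_tree U'" "wf_tree U''" "leaves U' = leaves T'" "leaves U'' = leaves T''"
    and j: "1 \<le> j" "j \<le> leaves T'"
    and m': "matching (leaves T') (edges T') (edges U')"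
    and m'': "matching (leaves T'') (edges T'') (edges U'')"
begin

abbreviation "r \<equiv> leaves T'"
abbreviation "s \<equiv> leaves T''"
abbreviation "n \<equiv> r + s - 1"
abbreviation "e \<equiv> new_edge j s"
abbreviation "F \<equiv> edges (graft T' j T'')"
abbreviation "G \<equiv> edges (graft U' j U'')"
abbreviation "es' \<equiv> sorted_list_of_set (edges T')"
abbreviation "es'' \<equiv> sorted_list_of_set (edges T'')"
abbreviation "gs' \<equiv> sorted_list_of_set (edges U')"
abbreviation "gs'' \<equiv> sorted_list_of_set (edges U'')"
abbreviation "ee \<equiv> map (outer_edge j s) es' @ map (inner_edge j) es''"
abbreviation "gg \<equiv> map (outer_edge j s) gs' @ map (inner_edge j) gs''"

text \<open>
  The coefficient of \<open>graft U' j U''\<close> in the value of \<open>p\<close> at \<open>graft T' j T''\<close> with the edge \<open>e\<close>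
  non-metric.
\<close>

definition composite_coeff :: int where
  "composite_coeff = W_sign j s (edges T') (edges T'') *
     (coeff r (edges T') (edges U') * coeff s (edges T'') (edges U'') * graft_sign j U' U'')"

lemma distinct_Cons_set:
  "distinct (x # xs) \<Longrightarrow> set (x # xs) = A \<Longrightarrow>
     distinct xs \<and> set xs = A - {x} \<and> distinct (xs @ [x]) \<and> set (xs @ [x]) = A"
  by auto

lemma lists:
  shows "distinct (e # ee)" "set (e # ee) = F" "distinct ee" "set ee = F - {e}"
    and "distinct (e # gg)" "set (e # gg) = G" "distinct gg" "set gg = G - {e}"
    and "distinct (gg @ [e])" "set (gg @ [e]) = G"
proof -
  have eT: "F = outer_edge j s ` edges T' \<union> inner_edge j ` edges T'' \<union> {e}"
    "outer_edge j s ` edges T' \<inter> inner_edge j ` edges T'' = {}"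
    "e \<notin> outer_edge j s ` edges T'" "e \<notin> inner_edge j ` edges T''"
    using edges_graft[of T' T'' j] T j by auto
  have eU: "G = outer_edge j s ` edges U' \<union> inner_edge j ` edges U'' \<union> {e}"
    "outer_edge j s ` edges U' \<inter> inner_edge j ` edges U'' = {}"
    "e \<notin> outer_edge j s ` edges U'" "e \<notin> inner_edge j ` edges U''"
    using edges_graft[of U' U'' j] T U j by auto
  have inj: "inj (outer_edge j s)" "inj (inner_edge j)" using inj_outer_edge inj_inner_edge T j by auto
  have injA: "inj_on (outer_edge j s) A" "inj_on (inner_edge j) A" for A
    using inj by (auto intro: inj_on_subset)
  show 1: "distinct (e # ee)" and 2: "distinct (e # gg)"
    using eT(2-4) eU(2-4) by (simp_all add: distinct_map injA)
  show 3: "set (e # ee) = F" and 4: "set (e # gg) = G" unfolding eT(1) eU(1) by auto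
  show "distinct ee" "set ee = F - {e}" using distinct_Cons_set[OF 1 3] by blast+
  show "distinct gg" "set gg = G - {e}" "distinct (gg @ [e])" "set (gg @ [e]) = G"
    using distinct_Cons_set[OF 2 4] by blast+
qed

lemma length_lists: "length es'' = s - 2 - card (edges U'')" "length gg = length gs' + length gs''"
  using m'' by (auto simp: matching_def)

lemma composite_coeff_eq:
  "composite_coeff = list_sign ee * list_sign (gg @ [e]) *
     ((-1) ^ (r * length es'' + j * (s + 1)) * p_sign r es' gs' * p_sign s es'' gs'')"
  using m' m'' U length_lists(1)
  by (simp add: composite_coeff_def coeff_def W_sign_def graft_sign_eq graft_list_sign_def)

lemma e_eq: "e = (j, j + s - 1)" by (simp add: new_edge_def)

text \<open>
  Here \<open>e\<close> counts as an edge of the source: leaf \<open>j\<close> is not a first leaf in \<open>T'\<close>.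
\<close>

lemma composite_coeff_Diff_G:
  assumes "matching n F (G - {e})"
  shows "front_sign e F * composite_coeff = front_sign e G * coeff n F (G - {e})"
proof -
  have eF: "(j, j + s - 1) \<in> F" using lists(2) e_eq by auto
  have fg: "distinct_starts F" using assms by (simp add: matching_def)
  have j2: "2 \<le> j" using fg eF j by (cases "j = 1") (force simp: distinct_starts_def)+
  have nj: "j \<notin> fst ` set es'"
  proof
    assume "j \<in> fst ` set es'"
    then obtain q where q: "(j, q) \<in> edges T'" by auto
    then have "outer_edge j s (j, q) \<in> set ee" by auto
    then have "(j, outer_end j s q) \<in> F - {e}" unfolding lists(4) outer_edge_pair by (simp add: outer_start_def)
    then show False using distinct_starts_eq[OF fg eF, of "outer_end j s q"] e_eq by auto
  qed
  have p: "p_sign n (e # ee) gg = (-1) ^ length gg * ((-1) ^ (r * length es'' + j * (s + 1)) *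
      p_sign r es' gs' * p_sign s es'' gs'')"
    using p_sign_graft(1)[OF matching_names[OF T(1) U(1,3) m'] matching_names[OF T(2) U(2,4) m''] j T(3,4) nj
        j2]
    by simp
  have c: "coeff n F (G - {e}) = list_sign (e # ee) * list_sign gg * p_sign n (e # ee) gg"
    by (rule coeff_lists[OF assms lists(1,2,7,8)])
  have mv: "list_sign (gg @ [e]) = (-1) ^ length gg * list_sign (e # gg)"
    using list_sign_move_to_front[of e gg "[]"] lists(5) by simp
  have fF: "front_sign e F = list_sign (e # ee) * list_sign ee" and fG: "front_sign e G =
      list_sign (e # gg) * list_sign gg"
    using front_sign_list[OF lists(1) lists(2)[symmetric]] front_sign_list[OF lists(5) lists(6)[symmetric]]
        by auto
  show ?thesis
    unfolding composite_coeff_eq c p mv fF fG by (simp add: ac_simps del: list_sign.simps map_append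
        length_append)
qed

text \<open>
  Here \<open>e\<close> counts as an edge of the target: leaf \<open>j\<close> is not a last leaf in \<open>U'\<close>.
\<close>

lemma composite_coeff_Diff_F:
  assumes "matching n (F - {e}) G"
  shows "composite_coeff = coeff n (F - {e}) G"
proof -
  have eG: "(j, j + s - 1) \<in> G" using lists(6) e_eq by auto
  have lg: "distinct_ends n G" using assms by (simp add: matching_def)
  have jr: "j < r" using lg eG j by (cases "j = r") (force simp: distinct_ends_def)+
  have nj: "j \<notin> snd ` set gs'"
  proof
    assume "j \<in> snd ` set gs'"
    then obtain p where q: "(p, j) \<in> edges U'" by auto
    then have "outer_edge j s (p, j) \<in> set gg" by auto
    then have "(outer_start j s p, j + s - 1) \<in> G - {e}" unfolding lists(8) outer_edge_pair
        by (simp add: outer_end_def)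
    then show False using distinct_ends_eq[OF lg, of "outer_start j s p" "j + s - 1" j] eG e_eq by auto
  qed
  have p: "p_sign n ee (gg @ [e]) = (-1) ^ (r * length es'' + j * (s + 1)) * p_sign r es' gs' *
      p_sign s es'' gs''"
    using p_sign_graft(2)[OF matching_names[OF T(1) U(1,3) m'] matching_names[OF T(2) U(2,4) m''] j T(3,4) nj
        jr]
    by simp
  show ?thesis
    unfolding coeff_lists[OF assms lists(3,4,9,10)] p composite_coeff_eq ..
qed

end

text \<open>
  What \<open>boundary_identity\<close> asks of the coefficient \<open>z\<close> of \<open>U\<close> in the value at \<open>T\<close> with \<open>e\<close> non-metric.
\<close>

definition nonmetric_coeff :: "tree \<Rightarrow> tree \<Rightarrow> edge \<Rightarrow> int \<Rightarrow> bool" where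
  "nonmetric_coeff T U e z \<longleftrightarrow>
      (e \<notin> edges U \<or> \<not> split_matching (leaves T) e (edges T) (edges U) \<longrightarrow> z = 0) \<and>
      (e \<in> edges U \<longrightarrow> split_matching (leaves T) e (edges T) (edges U) \<longrightarrow>
          matching (leaves T) (edges T) (edges U - {e}) \<longrightarrow>
         front_sign e (edges T) * z = front_sign e (edges U) * coeff (leaves T) (edges T) (edges U - {e})) \<and>
      (e \<in> edges U \<longrightarrow> split_matching (leaves T) e (edges T) (edges U) \<longrightarrow>
          matching (leaves T) (edges T - {e}) (edges U) \<longrightarrow>
         z = coeff (leaves T) (edges T - {e}) (edges U))"

locale p_morphism =
  fixes p :: "(mtree \<Rightarrow>\<^sub>0 'k::field) \<Rightarrow> (tree \<Rightarrow>\<^sub>0 'k)"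
  assumes is_p: "is_p p"
begin

lemma p_graded: "graded_operad_morphism W_operad K_operad p"
  using is_p by (simp add: is_p_def)

lemma p_in: "x \<in> W_chains n k \<Longrightarrow> p x \<in> K_chains n k"
  using p_graded by (simp add: graded_operad_morphism_def W_operad_def K_operad_def)

lemma p_add: "x \<in> W_chains n k \<Longrightarrow> y \<in> W_chains n k \<Longrightarrow> p (x + y) = p x + p y"
  using p_graded unfolding graded_operad_morphism_def W_operad_def K_operad_def by simp

lemma p_scale: "x \<in> W_chains n k \<Longrightarrow> p (scale c x) = scale c (p x)"
  using p_graded unfolding graded_operad_morphism_def W_operad_def K_operad_def by simp

lemma p_comp: "x \<in> W_chains r k \<Longrightarrow> y \<in> W_chains s l \<Longrightarrow> 1 \<le> i \<Longrightarrow> i \<le> r \<Longrightarrow> p (W_comp x i y) = K_comp (p x) i (p y)"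
  using p_graded unfolding graded_operad_morphism_def W_operad_def K_operad_def by simp

lemma p_0 [simp]: "p 0 = 0"
  using p_scale[OF W_chains_0, of 0] by simp

lemma p_sum: "(\<And>a. a \<in> A \<Longrightarrow> f a \<in> W_chains n k) \<Longrightarrow> p (\<Sum>a\<in>A. f a) = (\<Sum>a\<in>A. p (f a))"
proof (induction A rule: infinite_finite_induct)
  case (insert a A)
  then show ?case using p_add[of "f a" n k "\<Sum>a\<in>A. f a"] by (simp add: W_chains_sum)
qed simp_all

lemma p_diff: "x \<in> W_chains n k \<Longrightarrow> y \<in> W_chains n k \<Longrightarrow> p (x - y) = p x - p y"
  using p_add[OF W_chains_diff, of x n k y y] by simp

lemma p_fully_metric:
  assumes "wf_tree T" "2 \<le> leaves T"
  shows "coord (p (Poly_Mapping.single (T, edges T) 1)) V =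
    (if wf_tree V \<and> leaves V = leaves T then of_int (coeff (leaves T) (edges T) (edges V)) else 0)"
proof -
  have "p (cell (fully_metric T) (1, sorted_list_of_set (edges T))) = p_value T (sorted_list_of_set (edges T))"
    using is_p assms by (simp add: is_p_def)
  moreover have "cell (fully_metric T) (1, sorted_list_of_set (edges T)) =
      Poly_Mapping.single (T, edges T) (1::'k)"
    using cell_std[of "edges T" T] by (simp add: fully_metric_def std_order_def)
  ultimately have e: "p (Poly_Mapping.single (T, edges T) 1) = p_value T (sorted_list_of_set (edges T))" by simp
  show ?thesis
    unfolding e lookup_p_value[OF assms distinct_sorted_list_of_set set_sorted_list_of_set[OF finite_edges]]
    by (simp add: coeff_def)
qed

text \<open>
  A tree with one non-metric edge \<open>e\<close> is a composite of two fully metric trees, so its image is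
  supported on trees that contain \<open>e\<close>.
\<close>

lemma p_one_nonmetric:
  assumes T: "wf_tree T" "2 \<le> leaves T" "e \<in> edges T"
    and U: "wf_tree U" "leaves U = leaves T" "card (edges T) + card (edges U) = leaves T - 1"
  shows "\<exists>z. coord (p (Poly_Mapping.single (T, edges T - {e}) 1)) U = of_int z \<and> nonmetric_coeff T U e z"
proof -
  obtain j m where e: "e = (j, m)" by fastforce
  obtain T' T'' where d: "wf_tree T'" "wf_tree T''" "1 \<le> j" "j \<le> leaves T'" "2 \<le> leaves T'" "2 \<le> leaves T''"
    "m = j + leaves T'' - 1" "T = graft T' j T''" "leaves T = leaves T' + leaves T'' - 1"
    using decompose[of T j m] T e by blast
  let ?r = "leaves T'" and ?s = "leaves T''"
  have ee: "e = new_edge j ?s" using e d(7) by (simp add: new_edge_def)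
  note eT = edges_graft[OF d(1-6)]
  define sg where "sg = W_sign j ?s (edges T') (edges T'')"
  have sq: "sg * sg = 1" by (simp add: sg_def W_sign_def)
  define x where "x = Poly_Mapping.single (T', edges T') (1::'k)"
  define y where "y = Poly_Mapping.single (T'', edges T'') (1::'k)"
  have xW: "x \<in> W_chains ?r (card (edges T'))" and yW: "y \<in> W_chains ?s (card (edges T''))"
    unfolding x_def y_def using d by (auto intro!: W_chains_single)
  have TE: "edges T - {e} = outer_edge j ?s ` edges T' \<union> inner_edge j ` edges T''"
    unfolding d(8) eT(1) ee using eT(3,4) by blast
  have s1: "Poly_Mapping.single (T, edges T - {e}) 1 = scale (of_int sg) (W_comp x j y)"
  proof (rule poly_mapping_eqI)
    fix X
    have "of_int sg * of_int sg = (1::'k)" using sq by (metis of_int_1 of_int_mult)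
    then show "coord (Poly_Mapping.single (T, edges T - {e}) 1) X = coord (scale (of_int sg) (W_comp x j y)) X"
      unfolding x_def y_def W_comp_single TE d(8)[symmetric] sg_def[symmetric]
          by (simp add: lookup_single when_def)
  qed
  have pz: "p (Poly_Mapping.single (T, edges T - {e}) 1) = scale (of_int sg) (K_comp (p x) j (p y))"
    unfolding s1 using p_scale[OF W_comp_in[OF xW yW d(3,4)]] p_comp[OF xW yW d(3,4)] by simp
  have sx: "tree_support ?r (p x)" and sy: "tree_support ?s (p y)"
    using tree_supportI p_in xW yW d by blast+
  show ?thesis
  proof (cases "e \<in> edges U")
    case False
    have "coord (K_comp (p x) j (p y)) U = 0"
    proof (rule lookup_K_comp(2)[OF sx sy d(3,4)])
      fix U' U'' assume "wf_tree U'" "leaves U' = ?r" "wf_tree U''" "leaves U'' = ?s"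
      then have "e \<in> edges (graft U' j U'')" using edges_graft(1)[of U' U'' j] d ee by simp
      then show "U \<noteq> graft U' j U''" using False by metis
    qed
    then show ?thesis using False unfolding nonmetric_coeff_def by (intro exI[of _ 0]) (simp add: pz)
  next
    case True
    then obtain U' U'' where u: "wf_tree U'" "wf_tree U''" "2 \<le> leaves U'" "2 \<le> leaves U''"
      "m = j + leaves U'' - 1" "U = graft U' j U''" "leaves U = leaves U' + leaves U'' - 1"
      using decompose[of U j m] U e by blast
    have ls: "leaves U'' = ?s" "leaves U' = ?r" using u(4,5,7) d(6,7,9) U(2) u(3) d(5) by auto
    define z where "z = sg * (coeff ?r (edges T') (edges U') * coeff ?s (edges T'') (edges U'') *
        graft_sign j U' U'')"
    have cz: "coord (p (Poly_Mapping.single (T, edges T - {e}) 1)) U = of_int z"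
      unfolding pz u(6) lookup_scale lookup_K_comp(1)[OF sx sy d(3,4) u(1) ls(2) u(2) ls(1)]
      unfolding x_def y_def p_fully_metric[OF d(1,5)] p_fully_metric[OF d(2,6)]
      using u(1,2) ls by (simp add: z_def mult.assoc)
    have sm: "split_matching (leaves T) e (edges T) (edges U) \<longleftrightarrow>
        matching ?r (edges T') (edges U') \<and> matching ?s (edges T'') (edges U'')"
      using split_matching_graft[OF d(1,2,5,6) u(1,2) ls(2,1) d(3,4)] U(3) d(5,6,9)
          unfolding d(8)[symmetric] u(6)[symmetric] ee d(9) by simp
    show ?thesis
    proof (cases "split_matching (leaves T) e (edges T) (edges U)")
      case False
      then have "z = 0" using sm coeff_matching unfolding z_def by (metis mult_zero_left mult_zero_right)
      then show ?thesis using cz False unfolding nonmetric_coeff_def by (intro exI[of _ z]) simp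
    next
      case split: True
      interpret g: graft_pair T' T'' U' U'' j
        using d u ls split sm by unfold_locales auto
      have zc: "z = g.composite_coeff" by (simp add: z_def g.composite_coeff_def sg_def)
      have 1: "front_sign e (edges T) * z = front_sign e (edges U) * coeff (leaves T) (edges T) (edges U - {e})"
        if "matching (leaves T) (edges T) (edges U - {e})"
        using g.composite_coeff_Diff_G that unfolding d(8)[symmetric] u(6)[symmetric] ee[symmetric]
            d(9)[symmetric] zc by blast
      have 2: "z = coeff (leaves T) (edges T - {e}) (edges U)"
        if "matching (leaves T) (edges T - {e}) (edges U)"
        using g.composite_coeff_Diff_F that unfolding d(8)[symmetric] u(6)[symmetric] ee[symmetric]
            d(9)[symmetric] zc by blast
      show ?thesis using cz 1 2 split True unfolding nonmetric_coeff_def by (intro exI[of _ z]) blast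
    qed
  qed
qed

text \<open>
  Coordinatewise this is \<open>boundary_identity\<close>; trees of the wrong degree have coefficient 0 on
  both sides.
\<close>

lemma p_chain_map_fully_metric:
  assumes T: "wf_tree T" "2 \<le> leaves T"
  shows "p (W_bdry (Poly_Mapping.single (T, edges T) 1)) = K_bdry (p (Poly_Mapping.single (T, edges T) 1))"
proof (rule poly_mapping_eqI)
  fix U
  let ?n = "leaves T" and ?F = "edges T"
  have fW: "W_facets T ?F e \<in> W_chains ?n (card ?F - 1)" if "e \<in> ?F" for e
    using W_facets_in[of T ?n ?F e] T that by simp
  have pW: "p (W_bdry (Poly_Mapping.single (T, ?F) 1)) =
      (\<Sum>e\<in>?F. scale (of_int (front_sign e ?F)) (p (W_facets T ?F e)))"
    unfolding W_bdry_single[OF finite_edges]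
  proof (subst p_sum[where n = ?n and k = "card ?F - 1"])
    show "scale (of_int (front_sign e ?F)) (W_facets T ?F e) \<in> W_chains ?n (card ?F - 1)" if "e \<in> ?F" for e
      by (rule W_chains_scale[OF fW[OF that]])
    show "(\<Sum>e\<in>?F. p (scale (of_int (front_sign e ?F)) (W_facets T ?F e))) =
        (\<Sum>e\<in>?F. scale (of_int (front_sign e ?F)) (p (W_facets T ?F e)))"
      by (intro sum.cong refl) (rule p_scale[OF fW])
  qed
  have pf: "p (W_facets T ?F e) = p (Poly_Mapping.single (T, ?F - {e}) 1) - p (Poly_Mapping.single (collapse {e}
      T, edges (collapse {e} T)) 1)"
    if "e \<in> ?F" for e
  proof -
    have c: "card (?F - {e}) = card ?F - 1" using that by (simp add: card_Diff_singleton)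
    have "Poly_Mapping.single (T, ?F - {e}) (1::'k) \<in> W_chains ?n (card ?F - 1)"
      using T c by (intro W_chains_single) auto
    moreover have "Poly_Mapping.single (collapse {e} T, ?F - {e}) (1::'k) \<in> W_chains ?n (card ?F - 1)"
      using T c collapse_props[OF T(1), of "{e}"] by (intro W_chains_single) auto
    ultimately show ?thesis unfolding W_facets_def collapse_props(3)[OF T(1)] by (rule p_diff)
  qed
  have pin: "Poly_Mapping.single (T, ?F) (1::'k) \<in> W_chains ?n (card ?F)"
      using T by (intro W_chains_single) auto
  have sp: "tree_support ?n (p (Poly_Mapping.single (T, ?F) 1))" by (rule tree_supportI[OF p_in[OF pin] T(2)])
  have left: "coord (p (W_bdry (Poly_Mapping.single (T, ?F) 1))) U = (\<Sum>e\<in>?F. of_int (front_sign e ?F) *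
      (coord (p (Poly_Mapping.single (T, ?F - {e}) 1)) U -
       (if wf_tree U \<and> leaves U = ?n then of_int (coeff ?n (?F - {e}) (edges U)) else 0)))"
    unfolding pW lookup_sum
  proof (intro sum.cong refl)
    fix e assume e: "e \<in> ?F"
    have c: "wf_tree (collapse {e} T)" "leaves (collapse {e} T) = ?n" "edges (collapse {e} T) = ?F - {e}"
      using collapse_props[OF T(1)] by auto
    then have "2 \<le> leaves (collapse {e} T)" using T by simp
    from p_fully_metric[OF c(1) this, of U, unfolded c(2,3)]
    show "coord (scale (of_int (front_sign e ?F)) (p (W_facets T ?F e))) U = of_int (front_sign e ?F) *
        (coord (p (Poly_Mapping.single (T, ?F - {e}) 1)) U - (if wf_tree U \<and>
            leaves U = ?n then of_int (coeff ?n (?F - {e}) (edges U)) else 0))"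
      unfolding lookup_scale pf[OF e] lookup_minus c(3) by simp
  qed
  have right: "coord (K_bdry (p (Poly_Mapping.single (T, ?F) 1))) U =
      (if wf_tree U \<and> leaves U = ?n then \<Sum>g\<in>edges U. of_int (front_sign g (edges U)) *
          of_int (coeff ?n ?F (edges U - {g})) else 0)"
  proof (cases "wf_tree U \<and> leaves U = ?n")
    case True
    then have "coord (p (Poly_Mapping.single (T, ?F) 1)) (collapse {g} U) =
        of_int (coeff ?n ?F (edges U - {g}))" for g
      using p_fully_metric[OF T, of "collapse {g} U"] collapse_props[of U "{g}"] by simp
    then show ?thesis using lookup_K_bdry[OF sp, of U] True by simp
  next
    case False
    then show ?thesis using lookup_K_bdry[OF sp, of U] by presburger
  qed
  have single_in: "p (Poly_Mapping.single (T, ?F - {e}) 1) \<in> K_chains ?n (card ?F - 1)" if "e \<in> ?F" for e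
  proof -
    have c: "card (?F - {e}) = card ?F - 1" using that by (simp add: card_Diff_singleton)
    show ?thesis using T c by (intro p_in W_chains_single) auto
  qed
  show "coord (p (W_bdry (Poly_Mapping.single (T, ?F) 1))) U =
      coord (K_bdry (p (Poly_Mapping.single (T, ?F) 1))) U"
  proof (cases "wf_tree U \<and> leaves U = ?n \<and> card ?F + card (edges U) = ?n - 1")
    case True
    then have U: "wf_tree U" "leaves U = ?n" "card ?F + card (edges U) = ?n - 1" by auto
    interpret family_pair ?n ?F "edges U"
      using T U tree_family_edges[OF T(1)] tree_family_edges[OF U(1)] by unfold_locales auto
    have "\<forall>e\<in>?F. \<exists>z. coord (p (Poly_Mapping.single (T, ?F - {e}) 1)) U = of_int z \<and> nonmetric_coeff T U e z"
      using p_one_nonmetric[OF T _ U] by blast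
    then obtain z where z: "\<And>e. e \<in> ?F \<Longrightarrow> coord (p (Poly_Mapping.single (T, ?F - {e}) 1)) U = of_int (z e)"
      and zc: "\<And>e. e \<in> ?F \<Longrightarrow> nonmetric_coeff T U e (z e)"
      by metis
    have "(\<Sum>e\<in>?F. front_sign e ?F * (z e - coeff ?n (?F - {e}) (edges U))) =
        (\<Sum>g\<in>edges U. front_sign g (edges U) * coeff ?n ?F (edges U - {g}))"
      by (rule boundary_identity) (use zc in \<open>unfold nonmetric_coeff_def, blast\<close>)+
    then have "(of_int (\<Sum>e\<in>?F. front_sign e ?F * (z e - coeff ?n (?F - {e}) (edges U))) :: 'k) =
        of_int (\<Sum>g\<in>edges U. front_sign g (edges U) * coeff ?n ?F (edges U - {g}))"
      by (rule arg_cong)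
    moreover have "coord (p (W_bdry (Poly_Mapping.single (T, ?F) 1))) U =
        of_int (\<Sum>e\<in>?F. front_sign e ?F * (z e - coeff ?n (?F - {e}) (edges U)))"
      unfolding left using U(1,2) by (simp add: z)
    ultimately show ?thesis unfolding right using U(1,2) by simp
  next
    case False
    have l0: "coord (p (W_bdry (Poly_Mapping.single (T, ?F) 1))) U = 0"
      unfolding left
    proof (intro sum.neutral ballI)
      fix e assume e: "e \<in> ?F"
      have c: "card (?F - {e}) + 1 = card ?F" using e by (metis Suc_eq_plus1 card_Suc_Diff1 finite_edges)
      have "coord (p (Poly_Mapping.single (T, ?F - {e}) 1)) U = 0"
      proof (rule ccontr)
        assume "\<not> ?thesis"
        then have "wf_tree U" "leaves U = ?n" "card (edges U) + (card ?F - 1) + 2 = ?n"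
          using single_in[OF e] by (auto simp: K_chains_iff)
        then show False using False c by auto
      qed
      moreover have "coeff ?n (?F - {e}) (edges U) = 0" if "wf_tree U" "leaves U = ?n"
      proof (rule ccontr)
        assume "\<not> ?thesis"
        then have "card (?F - {e}) + card (edges U) = ?n - 2" using coeff_matching by (auto simp: matching_def)
        then show False using False that c T(2) by auto
      qed
      ultimately show "of_int (front_sign e ?F) * (coord (p (Poly_Mapping.single (T, ?F - {e}) 1)) U -
          (if wf_tree U \<and> leaves U = ?n then of_int (coeff ?n (?F - {e}) (edges U)) else 0)) = (0 :: 'k)"
              by simp
    qed
    have "coeff ?n ?F (edges U - {g}) = 0" if "wf_tree U" "leaves U = ?n" "g \<in> edges U" for g
    proof (rule ccontr)
      have c: "card (edges U - {g}) + 1 = card (edges U)"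
          using that(3) by (metis Suc_eq_plus1 card_Suc_Diff1 finite_edges)
      assume "\<not> ?thesis"
      then have "card ?F + card (edges U - {g}) = ?n - 2" using coeff_matching by (auto simp: matching_def)
      then show False using False that c T(2) by auto
    qed
    then have "coord (K_bdry (p (Poly_Mapping.single (T, ?F) 1))) U = 0" unfolding right by simp
    then show ?thesis using l0 by simp
  qed
qed

lemma K_bdry_scale: "K_bdry (scale c x) = scale c (K_bdry x)"
  by (simp add: K_bdry_def lin_ext_scale)

text \<open>
  By induction on the number of non-metric edges: cut at one of them and use that both boundaries
  are derivations.
\<close>

lemma p_chain_map_single:
  assumes "wf_tree T" "2 \<le> leaves T" "M \<subseteq> edges T"
  shows "p (W_bdry (Poly_Mapping.single (T, M) 1)) = K_bdry (p (Poly_Mapping.single (T, M) 1))"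
  using assms
proof (induction "card (edges T - M)" arbitrary: T M rule: less_induct)
  case less
  show ?case
  proof (cases "M = edges T")
    case True
    then show ?thesis using p_chain_map_fully_metric less.prems by simp
  next
    case False
    then obtain j m where e: "(j, m) \<in> edges T" "(j, m) \<notin> M" using less.prems(3) by auto
    obtain T' T'' where d: "wf_tree T'" "wf_tree T''" "1 \<le> j" "j \<le> leaves T'" "2 \<le> leaves T'" "2 \<le> leaves T''"
      "m = j + leaves T'' - 1" "T = graft T' j T''" "leaves T = leaves T' + leaves T'' - 1"
      using decompose[OF less.prems(1) e(1)] by blast
    let ?r = "leaves T'" and ?s = "leaves T''"
    let ?o = "outer_edge j ?s" and ?i = "inner_edge j"
    note eT = edges_graft[OF d(1-6), folded d(8)]
    have inj: "inj ?o" "inj ?i" using inj_outer_edge inj_inner_edge d by auto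
    have ne: "new_edge j ?s = (j, m)" using d(7) by (simp add: new_edge_def)
    define M' where "M' = {v \<in> edges T'. ?o v \<in> M}"
    define M'' where "M'' = {v \<in> edges T''. ?i v \<in> M}"
    have M: "M = ?o ` M' \<union> ?i ` M''"
      using less.prems(3) e(2) unfolding eT(1) M'_def M''_def ne by blast
    have sub: "M' \<subseteq> edges T'" "M'' \<subseteq> edges T''" by (auto simp: M'_def M''_def)
    define x where "x = Poly_Mapping.single (T', M') (1::'k)"
    define y where "y = Poly_Mapping.single (T'', M'') (1::'k)"
    have xW: "x \<in> W_chains ?r (card M')" and yW: "y \<in> W_chains ?s (card M'')"
      unfolding x_def y_def using d sub by (auto intro!: W_chains_single)
    define sg where "sg = W_sign j ?s M' M''"
    have sq: "of_int sg * of_int sg = (1::'k)" unfolding sg_def W_sign_def by (simp flip: of_int_mult)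
    have s1: "Poly_Mapping.single (T, M) 1 = scale (of_int sg) (W_comp x j y)"
      by (rule poly_mapping_eqI)
        (use sq in \<open>simp add: x_def y_def W_comp_single M d(8)[symmetric] sg_def[symmetric] lookup_single
            when_def\<close>)
    have smaller: "card (edges T' - M') < card (edges T - M)" "card (edges T'' - M'') < card (edges T - M)"
    proof -
      have s1: "?o ` (edges T' - M') \<subset> edges T - M"
      proof
        show "?o ` (edges T' - M') \<subseteq> edges T - M" unfolding eT(1) M'_def by auto
        show "?o ` (edges T' - M') \<noteq> edges T - M" using e eT(3) unfolding ne by blast
      qed
      have s2: "?i ` (edges T'' - M'') \<subset> edges T - M"
      proof
        show "?i ` (edges T'' - M'') \<subseteq> edges T - M" unfolding eT(1) M''_def by auto
        show "?i ` (edges T'' - M'') \<noteq> edges T - M" using e eT(4) unfolding ne by blast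
      qed
      have "card (?o ` (edges T' - M')) = card (edges T' - M')" "card (?i ` (edges T'' - M'')) =
          card (edges T'' - M'')"
        using inj by (auto intro!: card_image intro: inj_on_subset)
      then show "card (edges T' - M') < card (edges T - M)" "card (edges T'' - M'') < card (edges T - M)"
        using psubset_card_mono[OF _ s1] psubset_card_mono[OF _ s2] by auto
    qed
    have IHx: "p (W_bdry x) = K_bdry (p x)" unfolding x_def using less.hyps[OF smaller(1) d(1,5) sub(1)] .
    have IHy: "p (W_bdry y) = K_bdry (p y)" unfolding y_def using less.hyps[OF smaller(2) d(2,6) sub(2)] .
    let ?c = "(-1) ^ card M' :: 'k"
    let ?N = "?r + ?s - 1" and ?k = "card M' + card M'' - 1"
    \<comment> \<open>The truncated subtraction is harmless, since the boundary of a chain of degree 0 is zero.\<close>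
    have a: "W_comp (W_bdry x) j y \<in> W_chains ?N ?k"
    proof (cases "card M' = 0")
      case True
      then have "W_bdry x = 0" unfolding x_def using sub finite_subset[OF sub(1)] by (simp add: W_bdry_single)
      then show ?thesis by (simp add: W_comp_def)
    next
      case False
      then show ?thesis using W_comp_in[OF W_bdry_in[OF xW] yW d(3,4)] by simp
    qed
    have b: "W_comp x j (W_bdry y) \<in> W_chains ?N ?k"
    proof (cases "card M'' = 0")
      case True
      then have "W_bdry y = 0" unfolding y_def using sub finite_subset[OF sub(2)] by (simp add: W_bdry_single)
      then show ?thesis by (simp add: W_comp_def x_def)
    next
      case False
      then show ?thesis using W_comp_in[OF xW W_bdry_in[OF yW] d(3,4)] by simp
    qed
    have "p (W_bdry (W_comp x j y)) = p (W_comp (W_bdry x) j y + scale ?c (W_comp x j (W_bdry y)))"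
      unfolding x_def y_def W_Leibniz[OF d(1-6) sub] ..
    also have "\<dots> = p (W_comp (W_bdry x) j y) + scale ?c (p (W_comp x j (W_bdry y)))"
      using p_add[OF a W_chains_scale[OF b]] p_scale[OF b] by simp
    also have "\<dots> = K_comp (K_bdry (p x)) j (p y) + scale ?c (K_comp (p x) j (K_bdry (p y)))"
      using p_comp[OF W_bdry_in[OF xW] yW d(3,4)] p_comp[OF xW W_bdry_in[OF yW] d(3,4)] IHx IHy by simp
    also have "\<dots> = K_bdry (K_comp (p x) j (p y))"
      by (rule K_Leibniz[OF p_in[OF xW] p_in[OF yW] d(5,6,3,4), symmetric])
    also have "K_comp (p x) j (p y) = p (W_comp x j y)"
      by (rule p_comp[OF xW yW d(3,4), symmetric])
    finally have main: "p (W_bdry (W_comp x j y)) = K_bdry (p (W_comp x j y))" .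
    note xy = W_comp_in[OF xW yW d(3,4)]
    have "p (W_bdry (Poly_Mapping.single (T, M) 1)) = scale (of_int sg) (p (W_bdry (W_comp x j y)))"
      unfolding s1 using p_scale[OF W_bdry_in[OF xy]] by (simp add: W_bdry_def lin_ext_scale)
    also have "\<dots> = K_bdry (p (Poly_Mapping.single (T, M) 1))"
      unfolding main s1 p_scale[OF xy] K_bdry_scale ..
    finally show ?thesis .
  qed
qed

lemma p_chain_map:
  assumes x: "x \<in> W_chains n k"
  shows "p (W_bdry x) = K_bdry (p x)"
proof -
  let ?S = "\<lambda>X. Poly_Mapping.single X (1::'k)"
  have X: "?S X \<in> W_chains n k" "p (W_bdry (?S X)) = K_bdry (p (?S X))" if key: "X \<in> Poly_Mapping.keys x" for X
  proof -
    obtain T M where TM: "X = (T, M)" by fastforce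
    then have "wf_tree T" "leaves T = n" "2 \<le> n" "M \<subseteq> edges T" "card M = k"
      using x key by (auto simp: W_chains_iff in_keys_iff)
    then show "?S X \<in> W_chains n k" "p (W_bdry (?S X)) = K_bdry (p (?S X))"
      unfolding TM using p_chain_map_single by (auto intro: W_chains_single)
  qed
  have "p (W_bdry x) = p (\<Sum>X\<in>Poly_Mapping.keys x. scale (coord x X) (W_bdry (?S X)))"
    unfolding W_bdry_def by (subst lin_ext_combination) simp
  also have "\<dots> = (\<Sum>X\<in>Poly_Mapping.keys x. p (scale (coord x X) (W_bdry (?S X))))"
    using X(1) by (intro p_sum[where n = n and k = "k - 1"] W_chains_scale W_bdry_in)
  also have "\<dots> = (\<Sum>X\<in>Poly_Mapping.keys x. K_bdry (p (scale (coord x X) (?S X))))"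
    using X p_scale[OF W_bdry_in[OF X(1)]] p_scale[OF X(1)] by (intro sum.cong refl) (simp add: K_bdry_scale)
  also have "\<dots> = K_bdry (\<Sum>X\<in>Poly_Mapping.keys x. p (scale (coord x X) (?S X)))"
    by (simp add: K_bdry_def lin_ext_sum)
  also have "(\<Sum>X\<in>Poly_Mapping.keys x. p (scale (coord x X) (?S X))) =
      p (\<Sum>X\<in>Poly_Mapping.keys x. scale (coord x X) (?S X))"
    using X(1) by (intro p_sum[where n = n and k = k, symmetric] W_chains_scale)
  also have "(\<Sum>X\<in>Poly_Mapping.keys x. scale (coord x X) (?S X)) = x"
    by (rule sum_singles[symmetric])
  finally show ?thesis .
qed

end

theorem proposition10:
  fixes p :: "(mtree \<Rightarrow>\<^sub>0 'k::field) \<Rightarrow> (tree \<Rightarrow>\<^sub>0 'k)"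
  assumes "is_p p"
  shows "(\<forall>T \<omega>. wf_tree T \<and> 2 \<le> leaves T \<and> orients \<omega> (edges T) \<longrightarrow>
            p (W_bdry (cell (fully_metric T) \<omega>)) = K_bdry (p (cell (fully_metric T) \<omega>)))
       \<and> (\<forall>n k. \<forall>x\<in>W_chains n k. p (W_bdry x) = K_bdry (p x))
       \<and> dg_operad_morphism W_operad K_operad p"
proof -
  interpret p_morphism p by unfold_locales (rule assms)
  have all: "\<forall>n k. \<forall>x\<in>W_chains n k. p (W_bdry x) = K_bdry (p x)" using p_chain_map by blast
  have "p (W_bdry (cell (fully_metric T) \<omega>)) = K_bdry (p (cell (fully_metric T) \<omega>))"
    if "wf_tree T" "2 \<le> leaves T" for T \<omega>
  proof -
    have "cell (fully_metric T) \<omega> \<in> (W_chains (leaves T) (card (edges T)) :: (mtree \<Rightarrow>\<^sub>0 'k) set)"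
      unfolding cell_def fully_metric_def using that by (intro W_chains_single) auto
    then show ?thesis by (rule p_chain_map)
  qed
  moreover have "dg_operad_morphism W_operad K_operad p"
    using all p_graded by (simp add: dg_operad_morphism_def W_operad_def K_operad_def)
  ultimately show ?thesis using all by blast
qed

end
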